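(* Let $p\in(0,1)$. (i) For $\ell\in\{2,3,\dots\}$ and $\alpha\in(2-\frac1{\ell-1},2-\frac1\ell]$, \[\sup_{x\in\mathbb{R}}(1+|x|)\Big|\mathsf{P}\Big\{\frac{S_n-\mu_1^{\alpha,p}n}{n^{1/\alpha}}\le x\Big\}-\tilde G_{n,\ell-1}^{\alpha,p}(x)\Big|=O\big(n^{-1/\alpha}\big).\] (ii) If either $\ell=2$ and $\alpha\in(1,\frac32)$, or $\ell\in\{3,4,\dots\}$ and $\alpha\in[2-\frac1{\ell-1},2-\frac1\ell)$, and moreover $r^{1/\alpha}\notin\mathbb{N}$, then \[\sup_{x\in\mathbb{R}}(1+|x|)\Big|\mathsf{P}\Big\{\frac{S_n-\mu_1^{\alpha,p}n}{n^{1/\alpha}}\le x\Big\}-\tilde{\tilde G}_{n,\ell-1}^{\alpha,p}(x)\Big|=o\big(n^{-1/\alpha}\big).\] All asymptotics are as $n\to\infty$.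
   Context: Let $p\in(0,1)$, $q=1-p$, $r=1/q$, $\alpha\in(1,2)$. Let $X$ satisfy $\mathsf{P}\{X=r^{k/\alpha}\}=q^{k-1}p$, $k\in\mathbb{N}$; $X_1,X_2,\dots$ i.i.d. copies, $S_n=X_1+\dots+X_n$. For $\beta>0$, $\beta\ne\alpha$, $\mu_\beta^{\alpha,p}=p/(q^{\beta/\alpha}-q)$ (the paper writes the centering as $c_n^{\alpha,p}=\mu_1^{\alpha,p}n$). Let $\gamma_n=n/r^{\lceil\log_r n\rceil}\in(q,1]$. For $\gamma\in(q,1]$, $y_\gamma^{\alpha,p}(t)=\sum_{k\in\mathbb{Z}}(\exp\{\mathrm{i}tr^{k/\alpha}/\gamma^{1/\alpha}\}-1-\mathrm{i}tr^{k/\alpha}/\gamma^{1/\alpha})\frac{p\gamma}{qr^k}$. $G_{\alpha,p,\gamma}$ is the distribution function with characteristic function $e^{y_\gamma^{\alpha,p}}$; for integers $k,j\ge0$, $G^{(k,j)}_{\alpha,p,\gamma}$ is the function of bounded variation with limit $0$ at $-\infty$ and Fourier–Stieltjes transform $(-\mathrm{i}t)^k[y_\gamma^{\alpha,p}(t)]^je^{y_\gamma^{\alpha,p}(t)}$. Define \[\tilde G_{n,\ell-1}^{\alpha,p}=G_{\alpha,p,\gamma_n}+\sum_{j=1}^{\ell-1}\frac{(-1)^j([\mu_1^{\alpha,p}]^2-\mu_2^{\alpha,p})^jG^{(2j,0)}_{\alpha,p,\gamma_n}}{j!\,2^j\,n^{j(2-\alpha)/\alpha}},\qquad \tilde{\tilde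 G}_{n,\ell-1}^{\alpha,p}=\tilde G_{n,\ell-1}^{\alpha,p}+\frac{\mu_1^{\alpha,p}G^{(1,1)}_{\alpha,p,\gamma_n}}{n^{1/\alpha}}.\] *)

theory Defs
  imports "HOL-Probability.Probability"
begin

definition qq :: "real \<Rightarrow> real" where "qq p = 1 - p"
definition rr :: "real \<Rightarrow> real" where "rr p = 1 / (1 - p)"

definition mu :: "real \<Rightarrow> real \<Rightarrow> real \<Rightarrow> real" where
  "mu \<alpha> p \<beta> = p / (qq p powr (\<beta> / \<alpha>) - qq p)"

definition gam :: "real \<Rightarrow> nat \<Rightarrow> real" where
  "gam p n = real n / rr p powr (real_of_int \<lceil>log (rr p) (real n)\<rceil>)"

definition yfun :: "real \<Rightarrow> real \<Rightarrow> real \<Rightarrow> real \<Rightarrow> complex" where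
  "yfun \<alpha> p \<gamma> t = infsum (\<lambda>k::int.
      (exp (\<i> * complex_of_real (t * rr p powr (real_of_int k / \<alpha>) / \<gamma> powr (1 / \<alpha>))) - 1
        - \<i> * complex_of_real (t * rr p powr (real_of_int k / \<alpha>) / \<gamma> powr (1 / \<alpha>)))
      * complex_of_real (p * \<gamma> / (qq p * rr p powr (real_of_int k)))) UNIV"

definition Gdf :: "real \<Rightarrow> real \<Rightarrow> real \<Rightarrow> real \<Rightarrow> real" where
  "Gdf \<alpha> p \<gamma> = (THE F. \<exists>M. real_distribution M \<and>
      (\<forall>t. char M t = exp (yfun \<alpha> p \<gamma> t)) \<and> F = cdf M)"

text \<open>G^{(k,j)}_{alpha,p,gamma}: the (normalized, right-continuous) function of bounded variation
  with limit 0 at -infinity, written as a difference of the distribution functions of two finite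
  Borel measures, whose Fourier--Stieltjes transform (integral of exp(itx) dF(x)) equals
  (-it)^k y(t)^j exp(y(t)).\<close>
definition Gkj :: "nat \<Rightarrow> nat \<Rightarrow> real \<Rightarrow> real \<Rightarrow> real \<Rightarrow> real \<Rightarrow> real" where
  "Gkj k j \<alpha> p \<gamma> = (THE F. \<exists>M1 M2. finite_measure M1 \<and> finite_measure M2 \<and>
      sets M1 = sets borel \<and> sets M2 = sets borel \<and>
      (\<forall>t. char M1 t - char M2 t =
            (- \<i> * complex_of_real t) ^ k * (yfun \<alpha> p \<gamma> t) ^ j * exp (yfun \<alpha> p \<gamma> t)) \<and>
      F = (\<lambda>x. measure M1 {..x} - measure M2 {..x}))"

definition Gtilde :: "real \<Rightarrow> real \<Rightarrow> nat \<Rightarrow> nat \<Rightarrow> real \<Rightarrow> real" where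
  "Gtilde \<alpha> p l n x = Gdf \<alpha> p (gam p n) x +
     (\<Sum>j\<in>{1..l-1}. (-1) ^ j * ((mu \<alpha> p 1)\<^sup>2 - mu \<alpha> p 2) ^ j * Gkj (2*j) 0 \<alpha> p (gam p n) x
        / (fact j * 2 ^ j * real n powr (real j * (2 - \<alpha>) / \<alpha>)))"

definition Gtt :: "real \<Rightarrow> real \<Rightarrow> nat \<Rightarrow> nat \<Rightarrow> real \<Rightarrow> real" where
  "Gtt \<alpha> p l n x = Gtilde \<alpha> p l n x + mu \<alpha> p 1 * Gkj 1 1 \<alpha> p (gam p n) x / real n powr (1 / \<alpha>)"

end

theory Submission
  imports Defs "HOL-Complex_Analysis.Complex_Analysis" "HOL-Real_Asymp.Real_Asymp"
begin

text \<open>Rescaled to \<open>t / n powr (1 / \<alpha>)\<close>, the characteristic function of the normalised sum differs from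
  \<open>exp (Y n t)\<close>, where \<open>Y n\<close> is the exponent of \<open>G\<close>, by the factor
  \<open>exp (A2 n (t / n powr (1 / \<alpha>))\<^sup>2 - \<i> t \<mu> Y n t / n powr (1 / \<alpha>) + \<dots>)\<close>: the quadratic term collects the
  second moment of the small jumps, which the sum does not have, and the square of its mean, and the Taylor
  polynomial of its exponential gives the correction terms.
  Comparing the two transforms together with their first derivatives yields the weight \<open>1 + \<bar>x\<bar>\<close> through a
  weighted form of Esseen's smoothing inequality. For the \<open>o\<close>-statement the smoothing window is widened by an
  arbitrary constant, which is possible because the summands are nonlattice when \<open>r powr (1 / \<alpha>)\<close> is not an integer.
  The functions \<open>G\<^sup>(\<^sup>k\<^sup>,\<^sup>j\<^sup>)\<close> exist since the exponent splits into a compound Poisson part with finite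
  mean (large jumps) and a small-jump part whose exponential is entire and decays exponentially along the real axis.\<close>

section \<open>Fourier inversion on the real line\<close>

lemma integrable_inverse_one_plus_square:
  "integrable lborel (\<lambda>x::real. 1 / (1 + x\<^sup>2))"
  using integrable_inverse_1_plus_square
  by (simp add: set_integrable_def inverse_eq_divide)

lemma integrable_bound_inv_square:
  fixes f :: "real \<Rightarrow> 'a::{banach, second_countable_topology}"
  assumes "f \<in> borel_measurable borel" "\<And>x. norm (f x) \<le> C / (1 + x\<^sup>2)"
  shows "integrable lborel f"
proof (rule Bochner_Integration.integrable_bound)
  show "integrable lborel (\<lambda>x::real. C * (1 / (1 + x\<^sup>2)))"
    using integrable_inverse_one_plus_square by (rule integrable_mult_right)
  show "AE x in lborel. norm (f x) \<le> norm (C * (1 / (1 + x\<^sup>2)))"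
    using order_trans[OF assms(2) abs_ge_self] by (intro AE_I2) simp
qed (use assms in simp)

lemma tendsto_zero_of_inv_square_bound:
  fixes f :: "real \<Rightarrow> 'a::real_normed_vector"
  assumes "\<And>x. norm (f x) \<le> C / (1 + x\<^sup>2)"
  shows "(f \<longlongrightarrow> 0) at_top" "(f \<longlongrightarrow> 0) at_bot"
proof -
  have "((\<lambda>x::real. C / (1 + x\<^sup>2)) \<longlongrightarrow> 0) at_top" by real_asymp
  then show "(f \<longlongrightarrow> 0) at_top"
    by (rule Lim_null_comparison[rotated]) (use assms in auto)
  have "((\<lambda>x::real. C / (1 + x\<^sup>2)) \<longlongrightarrow> 0) at_bot" by real_asymp
  then show "(f \<longlongrightarrow> 0) at_bot"
    by (rule Lim_null_comparison[rotated]) (use assms in auto)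
qed

lemma integral_derivative_eq_zero:
  fixes F f :: "real \<Rightarrow> complex"
  assumes "\<And>t. (F has_vector_derivative f t) (at t)" "continuous_on UNIV f"
    and "\<And>t. norm (F t) \<le> C / (1 + t\<^sup>2)" "integrable lborel f"
  shows "(\<integral>t. f t \<partial>lborel) = 0"
proof -
  have "(LBINT x=-\<infinity>..\<infinity>. f x) = 0 - 0"
  proof (rule interval_integral_FTC_integrable[where F = F])
    show "isCont f x" for x using assms(2) by (simp add: continuous_on_eq_continuous_at)
    show "set_integrable lborel (einterval (- \<infinity>) \<infinity>) f"
      using assms(4) by (simp add: set_integrable_def)
    show "((F \<circ> real_of_ereal) \<longlongrightarrow> 0) (at_right (-\<infinity>))"
      unfolding at_right_MInf filterlim_filtermap
      using tendsto_zero_of_inv_square_bound(2)[OF assms(3)] by (simp add: comp_def)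
    show "((F \<circ> real_of_ereal) \<longlongrightarrow> 0) (at_left \<infinity>)"
      unfolding at_left_PInf filterlim_filtermap
      using tendsto_zero_of_inv_square_bound(1)[OF assms(3)] by (simp add: comp_def)
  qed (use assms in auto)
  then show ?thesis
    by (simp add: interval_lebesgue_integral_def set_lebesgue_integral_def)
qed

definition ift :: "(real \<Rightarrow> complex) \<Rightarrow> real \<Rightarrow> complex" where
  "ift w x = (1 / (2 * pi)) * (\<integral>t. iexp (- (t * x)) * w t \<partial>lborel)"

lemma norm_iexp_mult [simp]: "cmod (iexp x * z) = cmod z"
  by (simp add: norm_mult)

lemma norm_exp_imaginary [simp]:
  "cmod (exp (\<i> * (of_real x * of_real y)) * z) = cmod z"
  "cmod (exp (- (\<i> * (of_real x * of_real y))) * z) = cmod z"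
  by (simp_all add: norm_mult)

lemma ift_integrable:
  assumes "integrable lborel w"
  shows "integrable lborel (\<lambda>t. iexp (- (t * x)) * w t)"
  by (rule Bochner_Integration.integrable_bound[OF assms]) (use assms in \<open>auto intro!: borel_measurable_times\<close>)

lemma norm_ift_le:
  assumes "integrable lborel w"
  shows "cmod (ift w x) \<le> (\<integral>t. cmod (w t) \<partial>lborel)"
proof -
  have "cmod (\<integral>t. iexp (- (t * x)) * w t \<partial>lborel) \<le> (\<integral>t. cmod (iexp (- (t * x)) * w t) \<partial>lborel)"
    by (rule integral_norm_bound)
  then have 1: "cmod (\<integral>t. iexp (- (t * x)) * w t \<partial>lborel) \<le> (\<integral>t. cmod (w t) \<partial>lborel)"
    by simp
  have "cmod (ift w x) = (1 / (2 * pi)) * cmod (\<integral>t. iexp (- (t * x)) * w t \<partial>lborel)"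
    by (simp add: ift_def norm_mult norm_divide)
  also have "\<dots> \<le> 1 * (\<integral>t. cmod (w t) \<partial>lborel)"
    using pi_gt3 by (intro mult_mono 1) (auto simp: field_simps)
  finally show ?thesis by simp
qed

lemma continuous_ift:
  assumes "integrable lborel w"
  shows "continuous_on UNIV (ift w)"
proof -
  have "isCont (\<lambda>x. \<integral>t. iexp (- (t * x)) * w t \<partial>lborel) x" for x
  proof (rule continuous_at_sequentiallyI)
    fix u :: "nat \<Rightarrow> real" assume u: "u \<longlonglongrightarrow> x"
    show "(\<lambda>n. \<integral>t. iexp (- (t * u n)) * w t \<partial>lborel) \<longlonglongrightarrow> (\<integral>t. iexp (- (t * x)) * w t \<partial>lborel)"
    proof (rule integral_dominated_convergence[where w = "\<lambda>t. cmod (w t)"])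
      show "AE t in lborel. (\<lambda>n. iexp (- (t * u n)) * w t) \<longlonglongrightarrow> iexp (- (t * x)) * w t"
        by (intro AE_I2 tendsto_intros u)
    qed (use assms ift_integrable[OF assms] in auto)
  qed
  then show ?thesis unfolding ift_def
    by (auto intro!: continuous_intros simp: continuous_on_eq_continuous_at)
qed

lemma has_vector_derivative_iexp_minus:
  "((\<lambda>t. iexp (- (t * x))) has_vector_derivative (- \<i> * x) * iexp (- (t * x))) (at t within S)"
proof -
  have "((\<lambda>z. exp (\<i> * (- (z * of_real x)))) has_field_derivative (- \<i> * x) * iexp (- (t * x))) (at (of_real t))"
    by (auto intro!: derivative_eq_intros)
  from has_vector_derivative_real_field[OF this] show ?thesis by simp
qed

lemma ift_derivative:
  assumes "\<And>t. (u has_vector_derivative u' t) (at t)" "continuous_on UNIV u'"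
    and "\<And>t. norm (u t) \<le> C / (1 + t\<^sup>2)" "\<And>t. norm (u' t) \<le> C / (1 + t\<^sup>2)"
  shows "ift u' x = \<i> * x * ift u x"
proof -
  have cu: "continuous_on UNIV u"
    using assms(1) has_vector_derivative_continuous by (blast intro: continuous_at_imp_continuous_on)
  have mu: "u \<in> borel_measurable borel" "u' \<in> borel_measurable borel"
    using cu assms(2) by (auto intro: borel_measurable_continuous_onI)
  have iu: "integrable lborel u" "integrable lborel u'"
    using integrable_bound_inv_square assms(3,4) mu by blast+
  let ?f = "\<lambda>t. iexp (- (t * x)) * u' t + (- \<i> * x) * (iexp (- (t * x)) * u t)"
  have "(\<integral>t. ?f t \<partial>lborel) = 0"
  proof (rule integral_derivative_eq_zero[where F = "\<lambda>t. iexp (- (t * x)) * u t"])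
    show "((\<lambda>t. iexp (- (t * x)) * u t) has_vector_derivative ?f t) (at t)" for t
      by (rule has_vector_derivative_eq_rhs[OF has_vector_derivative_mult[OF has_vector_derivative_iexp_minus assms(1)]])
        (simp only: mult_ac add_ac)
    show "continuous_on UNIV ?f" by (intro continuous_intros cu assms(2))
    show "cmod (iexp (- (t * x)) * u t) \<le> C / (1 + t\<^sup>2)" for t using assms(3) by simp
    show "integrable lborel ?f"
      by (intro Bochner_Integration.integrable_add integrable_mult_right ift_integrable iu)
  qed
  moreover have "(\<integral>t. ?f t \<partial>lborel) = (\<integral>t. iexp (- (t * x)) * u' t \<partial>lborel)
      + (\<integral>t. (- \<i> * x) * (iexp (- (t * x)) * u t) \<partial>lborel)"
    by (rule Bochner_Integration.integral_add[OF ift_integrable[OF iu(2)] integrable_mult_right[OF ift_integrable[OF iu(1)]]])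
  moreover have "(\<integral>t. (- \<i> * x) * (iexp (- (t * x)) * u t) \<partial>lborel)
      = (- \<i> * x) * (\<integral>t. iexp (- (t * x)) * u t \<partial>lborel)"
    by (rule integral_mult_right_zero)
  ultimately have "(\<integral>t. iexp (- (t * x)) * u' t \<partial>lborel) + (- \<i> * x) * (\<integral>t. iexp (- (t * x)) * u t \<partial>lborel) = 0"
    by argo
  then show ?thesis by (simp add: ift_def algebra_simps)
qed

lemma integral_iexp_gaussian:
  assumes "\<sigma> > 0"
  shows "integrable lborel (\<lambda>x. iexp (u * x) * of_real (exp (- (\<sigma> * x)\<^sup>2 / 2)))"
    and "(\<integral>x. iexp (u * x) * of_real (exp (- (\<sigma> * x)\<^sup>2 / 2)) \<partial>lborel)
      = of_real (sqrt (2 * pi) / \<sigma> * exp (- (u / \<sigma>)\<^sup>2 / 2))"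
proof -
  interpret N: real_distribution std_normal_distribution by (rule real_dist_normal_dist)
  have "integrable lborel (\<lambda>x. std_normal_density x *\<^sub>R iexp (u / \<sigma> * x))"
  proof -
    have "integrable std_normal_distribution (\<lambda>x. iexp (u / \<sigma> * x))"
      by (rule N.integrable_iexp) auto
    then show ?thesis by (subst (asm) integrable_density) auto
  qed
  then have i0: "integrable lborel (\<lambda>x. of_real (sqrt (2 * pi)) * (std_normal_density x *\<^sub>R iexp (u / \<sigma> * x)))"
    by (rule integrable_mult_right)
  have eq: "of_real (sqrt (2 * pi)) * (std_normal_density x *\<^sub>R iexp (u / \<sigma> * x))
      = iexp (u / \<sigma> * x) * of_real (exp (- x\<^sup>2 / 2))" for x
    by (simp add: std_normal_density_def scaleR_conv_of_real field_simps)
  have i1: "integrable lborel (\<lambda>x. iexp (u / \<sigma> * x) * of_real (exp (- x\<^sup>2 / 2)))"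
    using i0 unfolding eq .
  have "(\<integral>x. of_real (sqrt (2 * pi)) * (std_normal_density x *\<^sub>R iexp (u / \<sigma> * x)) \<partial>lborel)
      = of_real (sqrt (2 * pi)) * char std_normal_distribution (u / \<sigma>)"
    unfolding char_def by (subst integral_mult_right_zero, subst integral_density) auto
  then have e1: "(\<integral>x. iexp (u / \<sigma> * x) * of_real (exp (- x\<^sup>2 / 2)) \<partial>lborel)
      = of_real (sqrt (2 * pi) * exp (- (u / \<sigma>)\<^sup>2 / 2))"
    unfolding eq by (simp add: char_std_normal_distribution)
  have eq2: "iexp (u / \<sigma> * (0 + \<sigma> * x)) * of_real (exp (- (0 + \<sigma> * x)\<^sup>2 / 2))
      = iexp (u * x) * of_real (exp (- (\<sigma> * x)\<^sup>2 / 2))" for x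
    using assms by simp
  show "integrable lborel (\<lambda>x. iexp (u * x) * of_real (exp (- (\<sigma> * x)\<^sup>2 / 2)))"
    using lborel_integrable_real_affine[OF i1, of \<sigma> 0] assms unfolding eq2 by simp
  show "(\<integral>x. iexp (u * x) * of_real (exp (- (\<sigma> * x)\<^sup>2 / 2)) \<partial>lborel)
      = of_real (sqrt (2 * pi) / \<sigma> * exp (- (u / \<sigma>)\<^sup>2 / 2))"
    using lborel_integral_real_affine[of \<sigma> "\<lambda>x. iexp (u / \<sigma> * x) * of_real (exp (- x\<^sup>2 / 2))" 0] assms e1
    unfolding eq2 by (simp add: scaleR_conv_of_real field_simps)
qed

lemma iexp_diff_mult: "iexp ((t - s) * x) = iexp (t * x) * iexp (- (s * x))"
  by (simp add: exp_add[symmetric] algebra_simps)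

lemma fourier_inversion:
  assumes cw: "continuous_on UNIV w" and bw: "\<And>t. cmod (w t) \<le> B"
    and iw: "integrable lborel w" and ig: "integrable lborel (ift w)"
  shows "(\<integral>x. iexp (t * x) * ift w x \<partial>lborel) = w t"
proof -
  define \<sigma> where "\<sigma> n = 1 / real (Suc n)" for n
  have \<sigma>: "\<sigma> n > 0" for n by (simp add: \<sigma>_def)
  have \<sigma>0: "\<sigma> \<longlonglongrightarrow> 0" unfolding \<sigma>_def by (rule LIMSEQ_Suc[OF lim_1_over_n])
  have mw [measurable]: "w \<in> borel_measurable borel" using iw by simp
  have mg [measurable]: "ift w \<in> borel_measurable borel" using ig by simp
  define J where "J n = (\<integral>x. iexp (t * x) * ift w x * of_real (exp (- (\<sigma> n * x)\<^sup>2 / 2)) \<partial>lborel)" for n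
  have lim1: "J \<longlonglongrightarrow> (\<integral>x. iexp (t * x) * ift w x \<partial>lborel)"
    unfolding J_def
  proof (rule integral_dominated_convergence[where w = "\<lambda>x. cmod (ift w x)"])
    show "AE x in lborel. (\<lambda>n. iexp (t * x) * ift w x * of_real (exp (- (\<sigma> n * x)\<^sup>2 / 2))) \<longlonglongrightarrow> iexp (t * x) * ift w x"
    proof (rule AE_I2)
      fix x
      have "(\<lambda>n. iexp (t * x) * ift w x * of_real (exp (- (\<sigma> n * x)\<^sup>2 / 2))) \<longlonglongrightarrow>
         iexp (t * x) * ift w x * of_real (exp (- (0 * x)\<^sup>2 / 2))"
        by (intro tendsto_intros \<sigma>0) auto
      then show "(\<lambda>n. iexp (t * x) * ift w x * of_real (exp (- (\<sigma> n * x)\<^sup>2 / 2))) \<longlonglongrightarrow> iexp (t * x) * ift w x" by simp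
    qed
    show "AE x in lborel. cmod (iexp (t * x) * ift w x * of_real (exp (- (\<sigma> n * x)\<^sup>2 / 2))) \<le> cmod (ift w x)" for n
      by (intro AE_I2) (simp add: norm_mult mult_left_le)
  qed (use ig in auto)
  have J: "J n = (\<integral>v. std_normal_density v *\<^sub>R w (t + \<sigma> n * v) \<partial>lborel)" for n
  proof -
    let ?e = "\<lambda>x. complex_of_real (exp (- (\<sigma> n * x)\<^sup>2 / 2))"
    let ?P = "\<lambda>x s. iexp ((t - s) * x) * ?e x * w s"
    have ie: "integrable lborel (\<lambda>x. exp (- (\<sigma> n * x)\<^sup>2 / 2))"
      using integrable_norm[OF integral_iexp_gaussian(1)[OF \<sigma>[of n], of 0]] by simp
    have intP: "integrable (lborel \<Otimes>\<^sub>M lborel) (case_prod ?P)"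
    proof (rule lborel_pair.Fubini_integrable)
      show "integrable lborel (\<lambda>x. \<integral>y. cmod (case (x, y) of (x, s) \<Rightarrow> ?P x s) \<partial>lborel)"
        using integrable_mult_left[OF ie, of "\<integral>y. cmod (w y) \<partial>lborel"] by (simp add: norm_mult)
      show "AE x in lborel. integrable lborel (\<lambda>y. case (x, y) of (x, s) \<Rightarrow> ?P x s)"
      proof (rule AE_I2, unfold prod.case)
        fix x
        have "integrable lborel (\<lambda>y. iexp (t * x) * ?e x * (iexp (- (y * x)) * w y))"
          by (intro integrable_mult_right ift_integrable iw)
        also have "(\<lambda>y. iexp (t * x) * ?e x * (iexp (- (y * x)) * w y)) = (\<lambda>y. ?P x y)"
          by (rule ext, subst iexp_diff_mult) (simp only: mult_ac)
        finally show "integrable lborel (\<lambda>y. ?P x y)" .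
      qed
    qed measurable
    have "J n = (\<integral>x. (1 / (2 * pi)) * (\<integral>s. ?P x s \<partial>lborel) \<partial>lborel)"
      unfolding J_def
    proof (rule Bochner_Integration.integral_cong[OF refl])
      fix x
      have "(\<integral>s. ?P x s \<partial>lborel) = (\<integral>s. iexp (t * x) * ?e x * (iexp (- (s * x)) * w s) \<partial>lborel)"
        by (rule Bochner_Integration.integral_cong[OF refl])
          (subst iexp_diff_mult, simp only: mult_ac)
      also have "\<dots> = iexp (t * x) * ?e x * (\<integral>s. iexp (- (s * x)) * w s \<partial>lborel)"
        by (rule integral_mult_right_zero)
      finally show "iexp (t * x) * ift w x * ?e x = (1 / (2 * pi)) * (\<integral>s. ?P x s \<partial>lborel)"
        by (simp add: ift_def)
    qed
    also have "\<dots> = (1 / (2 * pi)) * (\<integral>x. (\<integral>s. ?P x s \<partial>lborel) \<partial>lborel)"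
      by (rule integral_mult_right_zero)
    also have "(\<integral>x. (\<integral>s. ?P x s \<partial>lborel) \<partial>lborel) = (\<integral>s. (\<integral>x. ?P x s \<partial>lborel) \<partial>lborel)"
      by (rule lborel_pair.Fubini_integral[OF intP, symmetric])
    also have "\<dots> = (\<integral>s. of_real (sqrt (2 * pi) / \<sigma> n * exp (- ((t - s) / \<sigma> n)\<^sup>2 / 2)) * w s \<partial>lborel)"
      by (simp only: integral_mult_left_zero integral_iexp_gaussian(2)[OF \<sigma>])
    also have "\<dots> = \<sigma> n *\<^sub>R (\<integral>v. of_real (sqrt (2 * pi) / \<sigma> n * exp (- ((t - (t + \<sigma> n * v)) / \<sigma> n)\<^sup>2 / 2)) * w (t + \<sigma> n * v) \<partial>lborel)"
    proof -
      have "\<sigma> n \<noteq> 0" "\<bar>\<sigma> n\<bar> = \<sigma> n" using \<sigma>[of n] by auto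
      then show ?thesis
        using lborel_integral_real_affine[OF \<open>\<sigma> n \<noteq> 0\<close>, where t = t and
            f = "\<lambda>s. of_real (sqrt (2 * pi) / \<sigma> n * exp (- ((t - s) / \<sigma> n)\<^sup>2 / 2)) * w s"]
        by (simp only:)
    qed
    also have "\<dots> = \<sigma> n *\<^sub>R (\<integral>v. of_real (2 * pi / \<sigma> n) * (std_normal_density v *\<^sub>R w (t + \<sigma> n * v)) \<partial>lborel)"
    proof (intro arg_cong2[of _ _ _ _ "(*\<^sub>R)"] refl Bochner_Integration.integral_cong)
      fix v
      have 1: "sqrt (2 * pi) / \<sigma> n * E = 2 * pi / \<sigma> n * (1 / sqrt (2 * pi) * E)" for E
      proof -
        have "sqrt (2 * pi) = 2 * pi / sqrt (2 * pi)" by (rule real_div_sqrt[symmetric]) simp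
        then have "sqrt (2 * pi) / \<sigma> n * E = 2 * pi / sqrt (2 * pi) / \<sigma> n * E" by (simp only:)
        then show ?thesis by simp
      qed
      have 2: "(t - (t + \<sigma> n * v)) / \<sigma> n = - v" using \<sigma>[of n] by simp
      show "of_real (sqrt (2 * pi) / \<sigma> n * exp (- ((t - (t + \<sigma> n * v)) / \<sigma> n)\<^sup>2 / 2)) * w (t + \<sigma> n * v)
         = of_real (2 * pi / \<sigma> n) * (std_normal_density v *\<^sub>R w (t + \<sigma> n * v))"
        unfolding 2 1 std_normal_density_def scaleR_conv_of_real of_real_mult by simp
    qed
    also have "\<dots> = of_real (2 * pi) * (\<integral>v. std_normal_density v *\<^sub>R w (t + \<sigma> n * v) \<partial>lborel)"
      unfolding integral_mult_right_zero using \<sigma>[of n] by (simp add: scaleR_conv_of_real)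
    finally show ?thesis by simp
  qed
  have lim2: "J \<longlonglongrightarrow> (\<integral>v. std_normal_density v *\<^sub>R w (t + 0 * v) \<partial>lborel)"
    unfolding J
  proof (rule integral_dominated_convergence[where w = "\<lambda>v. std_normal_density v * B"])
    have cwt: "isCont w y" for y using cw by (simp add: continuous_on_eq_continuous_at)
    show "AE v in lborel. (\<lambda>n. std_normal_density v *\<^sub>R w (t + \<sigma> n * v)) \<longlonglongrightarrow> std_normal_density v *\<^sub>R w (t + 0 * v)"
      by (intro AE_I2 tendsto_intros isCont_tendsto_compose[OF cwt] \<sigma>0)
    show "AE v in lborel. cmod (std_normal_density v *\<^sub>R w (t + \<sigma> n * v)) \<le> std_normal_density v * B" for n
      using bw by (intro AE_I2) (auto intro!: mult_left_mono)
    show "integrable lborel (\<lambda>v. std_normal_density v * B)"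
      by (intro integrable_mult_left integrable_normal_density) simp
  qed auto
  have "(\<integral>v. std_normal_density v *\<^sub>R w (t + 0 * v) \<partial>lborel) = w t"
    using integral_normal_density[of 1 0] integrable_normal_density[of 1 0]
    by (simp add: integral_scaleR_left)
  with lim1 lim2 show ?thesis using LIMSEQ_unique by metis
qed

section \<open>Signed distribution functions\<close>

lemma finite_measure_eq_scaled_distribution:
  assumes "finite_measure M" and [simp, measurable_cong]: "sets M = sets borel"
  obtains P where "real_distribution P"
    "\<And>f::real \<Rightarrow> complex. f \<in> borel_measurable borel \<Longrightarrow>
      (\<integral>x. f x \<partial>M) = of_real (measure M UNIV) * (\<integral>x. f x \<partial>P)"
proof -
  interpret finite_measure M by fact
  have sp: "space M = UNIV" using sets_eq_imp_space_eq[OF assms(2)] by simp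
  define c where "c = measure M UNIV"
  show thesis
  proof (cases "c = 0")
    case True
    have "emeasure M (space M) = 0" using True by (simp add: c_def sp emeasure_eq_measure)
    then have ae: "AE x in M. False" by (simp add: AE_iff_measurable[OF _ refl] sp emeasure_eq_measure)
    have "real_distribution (return borel (0::real))"
      by (auto simp: real_distribution_def real_distribution_axioms_def intro!: prob_space_return)
    moreover have "(\<integral>x. f x \<partial>M) = 0" for f :: "real \<Rightarrow> complex"
      by (rule integral_eq_zero_AE) (use ae in auto)
    ultimately show thesis using True by (intro that[of "return borel 0"]) (auto simp: c_def)
  next
    case False
    then have c: "c > 0" by (simp add: c_def zero_less_measure_iff)
    let ?P = "density M (\<lambda>_. ennreal (1 / c))"
    have "emeasure ?P UNIV = 1"
      using c by (subst emeasure_density) (auto simp: nn_integral_cmult sp emeasure_eq_measure ennreal_mult[symmetric]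
          sets_eq_imp_space_eq[OF assms(2)] c_def)
    then have "real_distribution ?P"
      by (auto simp: real_distribution_def real_distribution_axioms_def sp intro!: prob_spaceI)
    moreover have "(\<integral>x. f x \<partial>M) = of_real c * (\<integral>x. f x \<partial>?P)" if [measurable]: "f \<in> borel_measurable borel" for f :: "real \<Rightarrow> complex"
      using c by (subst integral_density) (auto simp: scaleR_conv_of_real)
    ultimately show thesis by (intro that[of ?P]) (auto simp: c_def)
  qed
qed

lemma mixture_distribution:
  assumes "real_distribution P1" "real_distribution P2" "0 \<le> \<theta>" "\<theta> \<le> 1"
  obtains Q where "real_distribution Q"
    "\<And>f::real \<Rightarrow> complex. f \<in> borel_measurable borel \<Longrightarrow> (\<And>x. cmod (f x) \<le> 1) \<Longrightarrow>
      (\<integral>x. f x \<partial>Q) = of_real \<theta> * (\<integral>x. f x \<partial>P1) + of_real (1 - \<theta>) * (\<integral>x. f x \<partial>P2)"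
proof -
  interpret P1: real_distribution P1 by fact
  interpret P2: real_distribution P2 by fact
  interpret P12: pair_prob_space P1 P2 ..
  interpret B: prob_space "measure_pmf (bernoulli_pmf \<theta>)" by (rule prob_space_measure_pmf)
  interpret B12: pair_prob_space "measure_pmf (bernoulli_pmf \<theta>)" "P1 \<Otimes>\<^sub>M P2" ..
  let ?N = "measure_pmf (bernoulli_pmf \<theta>) \<Otimes>\<^sub>M (P1 \<Otimes>\<^sub>M P2)"
  let ?U = "\<lambda>(b, x, y). if b then x else (y::real)"
  have U [measurable]: "?U \<in> borel_measurable ?N" by measurable
  show thesis
  proof (rule that[of "distr ?N borel ?U"])
    show "real_distribution (distr ?N borel ?U)"
      by (auto simp: real_distribution_def real_distribution_axioms_def intro!: B12.prob_space_distr)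
    fix f :: "real \<Rightarrow> complex" assume [measurable]: "f \<in> borel_measurable borel" and b: "\<And>x. cmod (f x) \<le> 1"
    have int: "integrable ?N (\<lambda>z. f (?U z))"
      by (rule B12.integrable_const_bound[of _ 1]) (use b in auto)
    have "(\<integral>x. f x \<partial>distr ?N borel ?U) = (\<integral>z. f (?U z) \<partial>?N)"
      by (rule integral_distr) measurable
    also have "\<dots> = (\<integral>b. (\<integral>z. f (?U (b, z)) \<partial>(P1 \<Otimes>\<^sub>M P2)) \<partial>measure_pmf (bernoulli_pmf \<theta>))"
      by (rule B12.integral_fst'[symmetric, OF int])
    also have "\<dots> = \<theta> *\<^sub>R (\<integral>z. f (fst z) \<partial>(P1 \<Otimes>\<^sub>M P2)) + (1 - \<theta>) *\<^sub>R (\<integral>z. f (snd z) \<partial>(P1 \<Otimes>\<^sub>M P2))"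
      using assms by (subst integral_measure_pmf[of UNIV]) (auto simp: case_prod_beta UNIV_bool)
    also have "(\<integral>z. f (fst z) \<partial>(P1 \<Otimes>\<^sub>M P2)) = (\<integral>x. f x \<partial>distr (P1 \<Otimes>\<^sub>M P2) P1 fst)"
      by (rule integral_distr[symmetric]) measurable
    also have "distr (P1 \<Otimes>\<^sub>M P2) P1 fst = P1"
      by (rule P2.distr_pair_fst)
    also have "(\<integral>z. f (snd z) \<partial>(P1 \<Otimes>\<^sub>M P2)) = (\<integral>z. f (fst z) \<partial>(P2 \<Otimes>\<^sub>M P1))"
      by (subst P12.distr_pair_swap, subst integral_distr) (auto simp: case_prod_beta)
    also have "\<dots> = (\<integral>x. f x \<partial>distr (P2 \<Otimes>\<^sub>M P1) P2 fst)"
      by (rule integral_distr[symmetric]) measurable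
    also have "distr (P2 \<Otimes>\<^sub>M P1) P2 fst = P2"
      by (rule P1.distr_pair_fst)
    finally show "(\<integral>x. f x \<partial>distr ?N borel ?U) = of_real \<theta> * (\<integral>x. f x \<partial>P1) + of_real (1 - \<theta>) * (\<integral>x. f x \<partial>P2)"
      by (simp add: scaleR_conv_of_real)
  qed
qed

lemma sum_finite_measures_eq_scaled_distribution:
  assumes "finite_measure M1" "finite_measure M2" "sets M1 = sets borel" "sets M2 = sets borel"
  obtains Q where "real_distribution Q"
    "\<And>f::real \<Rightarrow> complex. f \<in> borel_measurable borel \<Longrightarrow> (\<And>x. cmod (f x) \<le> 1) \<Longrightarrow>
      (\<integral>x. f x \<partial>M1) + (\<integral>x. f x \<partial>M2) = of_real (measure M1 UNIV + measure M2 UNIV) * (\<integral>x. f x \<partial>Q)"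
proof -
  obtain P1 where P1: "real_distribution P1" "\<And>f::real \<Rightarrow> complex. f \<in> borel_measurable borel \<Longrightarrow>
      (\<integral>x. f x \<partial>M1) = of_real (measure M1 UNIV) * (\<integral>x. f x \<partial>P1)"
    using finite_measure_eq_scaled_distribution assms by blast
  obtain P2 where P2: "real_distribution P2" "\<And>f::real \<Rightarrow> complex. f \<in> borel_measurable borel \<Longrightarrow>
      (\<integral>x. f x \<partial>M2) = of_real (measure M2 UNIV) * (\<integral>x. f x \<partial>P2)"
    using finite_measure_eq_scaled_distribution assms by blast
  let ?a = "measure M1 UNIV" let ?b = "measure M2 UNIV"
  show thesis
  proof (cases "?a + ?b = 0")
    case True
    then have "?a = 0" "?b = 0" by (smt (verit) measure_nonneg)+
    then show thesis using P1 P2 by (intro that[of P1]) auto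
  next
    case False
    then have pos: "?a + ?b > 0" by (smt (verit) measure_nonneg)
    then have "0 \<le> ?a / (?a + ?b)" "?a / (?a + ?b) \<le> 1" by (auto simp: field_simps)
    from mixture_distribution[OF P1(1) P2(1) this] obtain Q where Q: "real_distribution Q"
      "\<And>f::real \<Rightarrow> complex. f \<in> borel_measurable borel \<Longrightarrow> (\<And>x. cmod (f x) \<le> 1) \<Longrightarrow>
      (\<integral>x. f x \<partial>Q) = of_real (?a / (?a + ?b)) * (\<integral>x. f x \<partial>P1) + of_real (1 - ?a / (?a + ?b)) * (\<integral>x. f x \<partial>P2)" by blast
    have 1: "(?a + ?b) * (?a / (?a + ?b)) = ?a" "(?a + ?b) * (1 - ?a / (?a + ?b)) = ?b"
      using False by (auto simp: field_simps)
    show thesis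
    proof (rule that[OF Q(1)])
      fix f :: "real \<Rightarrow> complex" assume f: "f \<in> borel_measurable borel" "\<And>x. cmod (f x) \<le> 1"
      have "of_real (?a + ?b) * (\<integral>x. f x \<partial>Q) = of_real ((?a + ?b) * (?a / (?a + ?b))) * (\<integral>x. f x \<partial>P1)
        + of_real ((?a + ?b) * (1 - ?a / (?a + ?b))) * (\<integral>x. f x \<partial>P2)"
        unfolding Q(2)[OF f] of_real_mult by (simp only: distrib_left mult.assoc)
      then show "(\<integral>x. f x \<partial>M1) + (\<integral>x. f x \<partial>M2) = of_real (?a + ?b) * (\<integral>x. f x \<partial>Q)"
        unfolding 1 P1(2)[OF f(1)] P2(2)[OF f(1)] by simp
    qed
  qed
qed

lemma char_at_zero: "char M 0 = of_real (measure M (space M))"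
  by (simp add: char_def scaleR_conv_of_real)

lemma signed_char_unique:
  assumes fin: "finite_measure M1" "finite_measure M2" "finite_measure K1" "finite_measure K2"
    and s: "sets M1 = sets borel" "sets M2 = sets borel" "sets K1 = sets borel" "sets K2 = sets borel"
    and eq: "\<And>t. char M1 t - char M2 t = char K1 t - char K2 t"
    and A: "A \<in> sets borel"
  shows "measure M1 A - measure M2 A = measure K1 A - measure K2 A"
proof -
  have sp: "space M1 = UNIV" "space M2 = UNIV" "space K1 = UNIV" "space K2 = UNIV"
    using s by (auto dest!: sets_eq_imp_space_eq)
  obtain Q where Q: "real_distribution Q"
    "\<And>f::real \<Rightarrow> complex. f \<in> borel_measurable borel \<Longrightarrow> (\<And>x. cmod (f x) \<le> 1) \<Longrightarrow>
      (\<integral>x. f x \<partial>M1) + (\<integral>x. f x \<partial>K2) = of_real (measure M1 UNIV + measure K2 UNIV) * (\<integral>x. f x \<partial>Q)"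
    using sum_finite_measures_eq_scaled_distribution fin s by metis
  obtain R where R: "real_distribution R"
    "\<And>f::real \<Rightarrow> complex. f \<in> borel_measurable borel \<Longrightarrow> (\<And>x. cmod (f x) \<le> 1) \<Longrightarrow>
      (\<integral>x. f x \<partial>K1) + (\<integral>x. f x \<partial>M2) = of_real (measure K1 UNIV + measure M2 UNIV) * (\<integral>x. f x \<partial>R)"
    using sum_finite_measures_eq_scaled_distribution fin s by metis
  have "of_real (measure M1 UNIV - measure M2 UNIV) = (of_real (measure K1 UNIV - measure K2 UNIV) :: complex)"
    using eq[of 0] by (simp add: char_at_zero sp)
  then have "measure M1 UNIV - measure M2 UNIV = measure K1 UNIV - measure K2 UNIV"
    by (simp only: of_real_eq_iff)
  then have tot: "measure M1 UNIV + measure K2 UNIV = measure K1 UNIV + measure M2 UNIV"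
    by linarith
  have mes: "(\<lambda>x. iexp (t * x)) \<in> borel_measurable borel" for t by measurable
  have QR: "of_real (measure M1 UNIV + measure K2 UNIV) * char Q t
      = of_real (measure M1 UNIV + measure K2 UNIV) * char R t" for t
    using Q(2)[OF mes[of t]] R(2)[OF mes[of t]] eq[of t] unfolding char_def tot
    by (simp add: algebra_simps)
  let ?i = "\<lambda>x. complex_of_real (indicator A x)"
  have im: "?i \<in> borel_measurable borel" "\<And>x. cmod (?i x) \<le> 1"
    using A by (auto simp: indicator_def)
  have "of_real (measure M1 UNIV + measure K2 UNIV) * (\<integral>x. ?i x \<partial>Q)
      = of_real (measure M1 UNIV + measure K2 UNIV) * (\<integral>x. ?i x \<partial>R)"
  proof (cases "measure M1 UNIV + measure K2 UNIV = 0")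
    case False
    then have "char Q = char R" using QR
      by (intro ext) (metis mult_cancel_left of_real_eq_0_iff)
    then show ?thesis using Levy_uniqueness[OF Q(1) R(1)] by simp
  qed auto
  then have "(\<integral>x. ?i x \<partial>M1) + (\<integral>x. ?i x \<partial>K2) = (\<integral>x. ?i x \<partial>K1) + (\<integral>x. ?i x \<partial>M2)"
    using Q(2)[OF im] R(2)[OF im] tot by simp
  moreover have "(\<integral>x. ?i x \<partial>N) = of_real (measure N A)" if "sets N = sets borel" "finite_measure N" for N :: "real measure"
    using A that by (simp add: integral_complex_of_real finite_measure.emeasure_finite)
  ultimately have "complex_of_real (measure M1 A + measure K2 A) = of_real (measure K1 A + measure M2 A)"
    using s fin by simp
  then have "measure M1 A + measure K2 A = measure K1 A + measure M2 A" by (simp only: of_real_eq_iff)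
  then show ?thesis by linarith
qed

definition primitive :: "(real \<Rightarrow> real) \<Rightarrow> real \<Rightarrow> real" where
  "primitive g x = (\<integral>u. indicator {..x} u * g u \<partial>lborel)"

lemma density_measure_facts:
  fixes g :: "real \<Rightarrow> real"
  assumes g: "integrable lborel g" "\<And>x. g x \<ge> 0"
  shows "finite_measure (density lborel g)" "sets (density lborel g) = sets borel"
    "char (density lborel g) t = (\<integral>x. iexp (t * x) * g x \<partial>lborel)"
    "A \<in> sets borel \<Longrightarrow> measure (density lborel g) A = (\<integral>u. indicator A u * g u \<partial>lborel)"
proof -
  have [measurable]: "g \<in> borel_measurable borel" using g by simp
  have "(\<integral>\<^sup>+x. g x \<partial>lborel) < \<infinity>"
    using g by (subst nn_integral_eq_integral) auto
  then show "finite_measure (density lborel g)"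
    by (intro finite_measureI) (auto simp: emeasure_density)
  show "sets (density lborel g) = sets borel" by simp
  show "char (density lborel g) t = (\<integral>x. iexp (t * x) * g x \<partial>lborel)"
    unfolding char_def using g by (subst integral_density) (auto simp: scaleR_conv_of_real mult.commute)
  assume A [measurable]: "A \<in> sets borel"
  have "measure (density lborel g) A = (\<integral>u. indicator A u \<partial>density lborel g)" by simp
  also have "\<dots> = (\<integral>u. indicator A u * g u \<partial>lborel)"
    using g by (subst integral_density) (auto simp: mult.commute)
  finally show "measure (density lborel g) A = (\<integral>u. indicator A u * g u \<partial>lborel)" .
qed

lemma density_parts:
  fixes g :: "real \<Rightarrow> real"
  assumes g: "integrable lborel g"
  defines "K1 \<equiv> density lborel (\<lambda>x. max 0 (g x))" and "K2 \<equiv> density lborel (\<lambda>x. max 0 (- g x))"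
  shows "char K1 t - char K2 t = (\<integral>x. iexp (t * x) * of_real (g x) \<partial>lborel)"
    and "measure K1 {..x} - measure K2 {..x} = primitive g x"
proof -
  have [measurable]: "g \<in> borel_measurable borel" using g by simp
  have i: "integrable lborel (\<lambda>x. max 0 (g x))" "integrable lborel (\<lambda>x. max 0 (- g x))"
    using g by auto
  note K1 = density_measure_facts[OF i(1) max.cobounded1, folded K1_def] and K2 = density_measure_facts[OF i(2) max.cobounded1, folded K2_def]
  have int: "integrable lborel (\<lambda>x. iexp (t * x) * complex_of_real (f x))" if "integrable lborel f" for t and f :: "real \<Rightarrow> real"
    by (rule Bochner_Integration.integrable_bound[OF that]) (use that in auto)
  have "char K1 t - char K2 t = (\<integral>x. iexp (t * x) * of_real (max 0 (g x)) - iexp (t * x) * of_real (max 0 (- g x)) \<partial>lborel)"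
    using K1(3) K2(3) int[OF i(1)] int[OF i(2)] by (subst Bochner_Integration.integral_diff) auto
  also have "\<dots> = (\<integral>x. iexp (t * x) * of_real (g x) \<partial>lborel)"
    by (intro Bochner_Integration.integral_cong refl) (auto simp: max_def)
  finally show "char K1 t - char K2 t = (\<integral>x. iexp (t * x) * of_real (g x) \<partial>lborel)" .
  have int2: "integrable lborel (\<lambda>u. indicator {..x} u * f u)" if "integrable lborel f" for f :: "real \<Rightarrow> real"
    using integrable_mult_indicator[OF _ that, of "{..x}"] by simp
  have "measure K1 {..x} - measure K2 {..x} = (\<integral>u. indicator {..x} u * max 0 (g u) - indicator {..x} u * max 0 (- g u) \<partial>lborel)"
    using K1(4)[of "{..x}"] K2(4)[of "{..x}"] int2[OF i(1)] int2[OF i(2)]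
    by (subst Bochner_Integration.integral_diff) auto
  also have "\<dots> = primitive g x" unfolding primitive_def
    by (intro Bochner_Integration.integral_cong refl) (auto simp: max_def indicator_def)
  finally show "measure K1 {..x} - measure K2 {..x} = primitive g x" .
qed

lemma the_signed_cdf:
  assumes g: "integrable lborel g" and h: "\<And>t. (\<integral>x. iexp (t * x) * of_real (g x) \<partial>lborel) = h t"
  shows "(THE F. \<exists>M1 M2. finite_measure M1 \<and> finite_measure M2 \<and>
      sets M1 = sets borel \<and> sets M2 = sets borel \<and> (\<forall>t. char M1 t - char M2 t = h t) \<and>
      F = (\<lambda>x. measure M1 {..x} - measure M2 {..x})) = primitive g"
proof -
  let ?K1 = "density lborel (\<lambda>x. max 0 (g x))" and ?K2 = "density lborel (\<lambda>x. max 0 (- g x))"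
  have i: "integrable lborel (\<lambda>x. max 0 (g x))" "integrable lborel (\<lambda>x. max 0 (- g x))"
    using g by auto
  note K1 = density_measure_facts[OF i(1)] and K2 = density_measure_facts[OF i(2)]
  have ch: "char ?K1 t - char ?K2 t = h t" for t using density_parts(1)[OF g] h by simp
  have ms: "measure ?K1 {..x} - measure ?K2 {..x} = primitive g x" for x by (rule density_parts(2)[OF g])
  show ?thesis
  proof (rule the_equality)
    show "\<exists>M1 M2. finite_measure M1 \<and> finite_measure M2 \<and>
      sets M1 = sets borel \<and> sets M2 = sets borel \<and> (\<forall>t. char M1 t - char M2 t = h t) \<and>
      primitive g = (\<lambda>x. measure M1 {..x} - measure M2 {..x})"
      using K1(1,2) K2(1,2) ch ms by (intro exI[of _ ?K1] exI[of _ ?K2]) auto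
  next
    fix F assume "\<exists>M1 M2. finite_measure M1 \<and> finite_measure M2 \<and>
      sets M1 = sets borel \<and> sets M2 = sets borel \<and> (\<forall>t. char M1 t - char M2 t = h t) \<and>
      F = (\<lambda>x. measure M1 {..x} - measure M2 {..x})"
    then obtain M1 M2 where M: "finite_measure M1" "finite_measure M2"
      "sets M1 = sets borel" "sets M2 = sets borel" "\<And>t. char M1 t - char M2 t = h t"
      "F = (\<lambda>x. measure M1 {..x} - measure M2 {..x})" by blast
    have "measure M1 {..x} - measure M2 {..x} = measure ?K1 {..x} - measure ?K2 {..x}" for x
      using M ch K1(1,2) K2(1,2) by (intro signed_char_unique) auto
    then show "F = primitive g" using M(6) ms by auto
  qed
qed

lemma the_cdf:
  assumes g: "integrable lborel g" "\<And>x. g x \<ge> 0"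
    and h: "\<And>t. (\<integral>x. iexp (t * x) * of_real (g x) \<partial>lborel) = h t" "h 0 = 1"
  shows "(THE F. \<exists>M. real_distribution M \<and> (\<forall>t. char M t = h t) \<and> F = cdf M) = primitive g"
proof -
  let ?K = "density lborel g"
  note K = density_measure_facts[OF g]
  interpret K: finite_measure ?K by (rule K(1))
  have "of_real (measure ?K UNIV) = (of_real 1 :: complex)"
    using K(3)[of 0] h(1)[of 0] h(2) char_at_zero[of ?K] by (simp del: of_real_eq_iff)
  then have m1: "measure ?K UNIV = 1" by (simp only: of_real_eq_iff)
  have rd: "real_distribution ?K"
    by (auto simp: real_distribution_def real_distribution_axioms_def K.emeasure_eq_measure m1 intro!: prob_spaceI)
  have cd: "cdf ?K = primitive g"
    using K(4) by (auto simp: cdf_def primitive_def fun_eq_iff)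
  show ?thesis
  proof (rule the_equality)
    show "\<exists>M. real_distribution M \<and> (\<forall>t. char M t = h t) \<and> primitive g = cdf M"
      using rd cd K(3) h by (intro exI[of _ ?K]) auto
  next
    fix F assume "\<exists>M. real_distribution M \<and> (\<forall>t. char M t = h t) \<and> F = cdf M"
    then obtain M where M: "real_distribution M" "\<And>t. char M t = h t" "F = cdf M" by blast
    have "char M = char ?K" using M K(3) h by auto
    from Levy_uniqueness[OF M(1) rd this] show "F = primitive g" using M cd by simp
  qed
qed

section \<open>Positivity and decay of inverse transforms\<close>

lemma ift_limit_char_nonneg:
  fixes U :: "nat \<Rightarrow> 'b \<Rightarrow> real"
  assumes iw: "integrable lborel w" and N: "\<And>j. prob_space (N j)"
    and U: "\<And>j. U j \<in> borel_measurable (N j)"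
    and lim: "\<And>t. (\<lambda>j. \<integral>\<theta>. iexp (t * U j \<theta>) \<partial>N j) \<longlonglongrightarrow> w t"
  shows "ift w x \<in> \<real>\<^sub>\<ge>\<^sub>0"
proof -
  define c where "c j t = (\<integral>\<theta>. iexp (t * U j \<theta>) \<partial>N j)" for j t
  define e where "e \<sigma> t = complex_of_real (exp (- (\<sigma> * t)\<^sup>2 / 2))" for \<sigma> t
  have [measurable]: "w \<in> borel_measurable borel" using iw by simp
  have [measurable]: "e \<sigma> \<in> borel_measurable borel" for \<sigma> unfolding e_def by measurable
  have ie: "integrable lborel (\<lambda>t. cmod (e \<sigma> t))" if "\<sigma> > 0" for \<sigma>
    using integrable_norm[OF integral_iexp_gaussian(1)[OF that, of 0]] by (simp add: e_def)
  have cmeas [measurable]: "c j \<in> borel_measurable borel" for j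
  proof -
    interpret N: prob_space "N j" by (rule N)
    note [measurable] = U[of j]
    show ?thesis unfolding c_def by measurable
  qed
  have cle: "cmod (c j t) \<le> 1" for j t
  proof -
    interpret N: prob_space "N j" by (rule N)
    note [measurable] = U[of j]
    have "cmod (c j t) \<le> (\<integral>\<theta>. cmod (iexp (t * U j \<theta>)) \<partial>N j)"
      unfolding c_def by (rule integral_norm_bound)
    also have "\<dots> = 1" by (simp add: N.prob_space)
    finally show ?thesis .
  qed
  have step: "(\<integral>t. iexp (- (t * x)) * (e \<sigma> t * c j t) \<partial>lborel) \<in> \<real>\<^sub>\<ge>\<^sub>0" if \<sigma>: "\<sigma> > 0" for \<sigma> j
  proof -
    interpret N: prob_space "N j" by (rule N)
    interpret P: pair_sigma_finite lborel "N j" ..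
    note [measurable] = U[of j]
    let ?P = "\<lambda>t \<theta>. iexp ((U j \<theta> - x) * t) * e \<sigma> t"
    have int: "integrable (lborel \<Otimes>\<^sub>M N j) (case_prod ?P)"
    proof (rule P.Fubini_integrable)
      show "integrable lborel (\<lambda>t. \<integral>\<theta>. cmod (case (t, \<theta>) of (t, \<theta>) \<Rightarrow> ?P t \<theta>) \<partial>N j)"
        using ie[OF \<sigma>] by (simp add: N.prob_space norm_mult)
      show "AE t in lborel. integrable (N j) (\<lambda>\<theta>. case (t, \<theta>) of (t, \<theta>) \<Rightarrow> ?P t \<theta>)"
        unfolding prod.case
        by (intro AE_I2 integrable_mult_left N.integrable_iexp) auto
    qed measurable
    have "(\<integral>t. iexp (- (t * x)) * (e \<sigma> t * c j t) \<partial>lborel) = (\<integral>t. (\<integral>\<theta>. ?P t \<theta> \<partial>N j) \<partial>lborel)"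
    proof (intro Bochner_Integration.integral_cong refl)
      fix t
      have "iexp (- (t * x)) * (e \<sigma> t * c j t) = (\<integral>\<theta>. (iexp (- (t * x)) * e \<sigma> t) * iexp (t * U j \<theta>) \<partial>N j)"
        by (simp only: c_def integral_mult_right_zero mult.assoc)
      also have "\<dots> = (\<integral>\<theta>. ?P t \<theta> \<partial>N j)"
      proof (intro Bochner_Integration.integral_cong refl)
        fix \<theta>
        have "iexp ((U j \<theta> - x) * t) = iexp (U j \<theta> * t) * iexp (- (x * t))" by (rule iexp_diff_mult)
        then show "(iexp (- (t * x)) * e \<sigma> t) * iexp (t * U j \<theta>) = ?P t \<theta>" by (simp only: mult_ac)
      qed
      finally show "iexp (- (t * x)) * (e \<sigma> t * c j t) = (\<integral>\<theta>. ?P t \<theta> \<partial>N j)" .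
    qed
    also have "\<dots> = (\<integral>\<theta>. (\<integral>t. ?P t \<theta> \<partial>lborel) \<partial>N j)"
      by (rule P.Fubini_integral[OF int, symmetric])
    also have "\<dots> = (\<integral>\<theta>. complex_of_real (sqrt (2 * pi) / \<sigma> * exp (- ((U j \<theta> - x) / \<sigma>)\<^sup>2 / 2)) \<partial>N j)"
      unfolding e_def integral_iexp_gaussian(2)[OF \<sigma>] ..
    also have "\<dots> = complex_of_real (\<integral>\<theta>. sqrt (2 * pi) / \<sigma> * exp (- ((U j \<theta> - x) / \<sigma>)\<^sup>2 / 2) \<partial>N j)"
      by (rule integral_complex_of_real)
    also have "\<dots> \<in> \<real>\<^sub>\<ge>\<^sub>0"
      unfolding nonneg_Reals_of_real_iff using \<sigma> by (intro Bochner_Integration.integral_nonneg) auto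
    finally show ?thesis .
  qed
  have step2: "(\<integral>t. iexp (- (t * x)) * (e \<sigma> t * w t) \<partial>lborel) \<in> \<real>\<^sub>\<ge>\<^sub>0" if \<sigma>: "\<sigma> > 0" for \<sigma>
  proof (rule Lim_in_closed_set[OF closed_nonneg_Reals_complex])
    show "(\<lambda>j. \<integral>t. iexp (- (t * x)) * (e \<sigma> t * c j t) \<partial>lborel) \<longlonglongrightarrow> (\<integral>t. iexp (- (t * x)) * (e \<sigma> t * w t) \<partial>lborel)"
    proof (rule integral_dominated_convergence[where w = "\<lambda>t. cmod (e \<sigma> t)"])
      show "AE t in lborel. (\<lambda>j. iexp (- (t * x)) * (e \<sigma> t * c j t)) \<longlonglongrightarrow> iexp (- (t * x)) * (e \<sigma> t * w t)"
        using lim unfolding c_def by (intro AE_I2 tendsto_intros)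
      show "AE t in lborel. cmod (iexp (- (t * x)) * (e \<sigma> t * c j t)) \<le> cmod (e \<sigma> t)" for j
        using cle by (intro AE_I2) (auto simp: norm_mult intro!: mult_left_le)
    qed (use ie[OF \<sigma>] in measurable)
    show "\<forall>\<^sub>F j in sequentially. (\<integral>t. iexp (- (t * x)) * (e \<sigma> t * c j t) \<partial>lborel) \<in> \<real>\<^sub>\<ge>\<^sub>0"
      using step[OF \<sigma>] by simp
  qed simp
  have "(\<integral>t. iexp (- (t * x)) * w t \<partial>lborel) \<in> \<real>\<^sub>\<ge>\<^sub>0"
  proof (rule Lim_in_closed_set[OF closed_nonneg_Reals_complex])
    have l0: "(\<lambda>n. 1 / real (Suc n)) \<longlonglongrightarrow> 0" by (rule LIMSEQ_Suc[OF lim_1_over_n])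
    show "(\<lambda>n. \<integral>t. iexp (- (t * x)) * (e (1 / real (Suc n)) t * w t) \<partial>lborel) \<longlonglongrightarrow> (\<integral>t. iexp (- (t * x)) * w t \<partial>lborel)"
    proof (rule integral_dominated_convergence[where w = "\<lambda>t. cmod (w t)"])
      show "AE t in lborel. (\<lambda>n. iexp (- (t * x)) * (e (1 / real (Suc n)) t * w t)) \<longlonglongrightarrow> iexp (- (t * x)) * w t"
      proof (rule AE_I2)
        fix t
        have "(\<lambda>n. iexp (- (t * x)) * (e (1 / real (Suc n)) t * w t)) \<longlonglongrightarrow> iexp (- (t * x)) * (complex_of_real (exp (- (0 * t)\<^sup>2 / 2)) * w t)"
          unfolding e_def by (intro tendsto_intros l0) auto
        then show "(\<lambda>n. iexp (- (t * x)) * (e (1 / real (Suc n)) t * w t)) \<longlonglongrightarrow> iexp (- (t * x)) * w t" by simp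
      qed
      show "AE t in lborel. cmod (iexp (- (t * x)) * (e (1 / real (Suc n)) t * w t)) \<le> cmod (w t)" for n
        by (intro AE_I2) (auto simp: norm_mult e_def intro!: mult_left_le_one_le)
    qed (use iw in auto)
    show "\<forall>\<^sub>F n in sequentially. (\<integral>t. iexp (- (t * x)) * (e (1 / real (Suc n)) t * w t) \<partial>lborel) \<in> \<real>\<^sub>\<ge>\<^sub>0"
      using step2 by simp
  qed simp
  then have "of_real (1 / (2 * pi)) * (\<integral>t. iexp (- (t * x)) * w t \<partial>lborel) \<in> \<real>\<^sub>\<ge>\<^sub>0"
    by (intro nonneg_Reals_mult_I) auto
  then show ?thesis by (simp add: ift_def)
qed

lemma ift_holomorphic_decay:
  assumes hol: "W holomorphic_on UNIV" and bd: "\<And>z. \<bar>Im z\<bar> \<le> 1 \<Longrightarrow> cmod (W z) \<le> C / (1 + (Re z)\<^sup>2)"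
  obtains C' where "\<And>x. cmod (ift (\<lambda>t. W (of_real t)) x) * (1 + \<bar>x\<bar>) \<le> C' / (1 + x\<^sup>2)"
proof -
  define w where "w k t = (deriv ^^ k) W (complex_of_real t)" for k t
  have C0: "C \<ge> 0" using order_trans[OF norm_ge_zero bd[of 0]] by simp
  have holk: "(deriv ^^ k) W holomorphic_on UNIV" for k
    using hol by (rule holomorphic_higher_deriv) simp
  have wder: "(w k has_vector_derivative w (Suc k) t) (at t)" for k t
  proof -
    have "((deriv ^^ k) W has_field_derivative deriv ((deriv ^^ k) W) (of_real t)) (at (of_real t))"
      using holomorphic_derivI[OF holk[of k] open_UNIV] by simp
    from has_vector_derivative_real_field[OF this] show ?thesis by (simp add: w_def[abs_def])
  qed
  have wcont: "continuous_on UNIV (w k)" for k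
    using wder has_vector_derivative_continuous by (blast intro: continuous_at_imp_continuous_on)
  have wbd: "cmod (w k t) \<le> (fact k * (3 * C)) / (1 + t\<^sup>2)" for k t
  proof -
    have "cmod ((deriv ^^ k) W (of_real t)) \<le> fact k * (3 * C / (1 + t\<^sup>2)) / 1 ^ k"
    proof (rule Cauchy_inequality)
      show "W holomorphic_on ball (of_real t) 1" using hol holomorphic_on_subset by blast
      show "continuous_on (cball (of_real t) 1) W"
        using holomorphic_on_imp_continuous_on[OF hol] continuous_on_subset by blast
      fix z assume z: "cmod (of_real t - z) = 1"
      have im: "\<bar>Im z\<bar> \<le> 1" and re: "\<bar>t - Re z\<bar> \<le> 1"
        using z abs_Im_le_cmod[of "of_real t - z"] abs_Re_le_cmod[of "of_real t - z"] by auto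
      have "(t - Re z)\<^sup>2 \<le> 1" using re by (simp add: abs_square_le_1)
      moreover have "t\<^sup>2 \<le> 2 * (t - Re z)\<^sup>2 + 2 * (Re z)\<^sup>2"
        using zero_le_power2[of "t - 2 * Re z"] by (simp add: power2_eq_square algebra_simps)
      moreover define a where "a = (t - Re z)\<^sup>2"
      moreover define b where "b = (Re z)\<^sup>2"
      moreover have "b \<ge> 0" by (simp add: b_def)
      ultimately have "1 + t\<^sup>2 \<le> 3 * (1 + (Re z)\<^sup>2)"
        unfolding a_def[symmetric] b_def[symmetric] by simp
      then have "C * (1 + t\<^sup>2) \<le> C * (3 * (1 + (Re z)\<^sup>2))" using C0 by (rule mult_left_mono)
      then have "C / (1 + (Re z)\<^sup>2) \<le> 3 * C / (1 + t\<^sup>2)"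
        by (simp add: divide_simps add_pos_nonneg) (simp add: algebra_simps)
      with bd[OF im] show "cmod (W z) \<le> 3 * C / (1 + t\<^sup>2)" by linarith
    qed simp
    then show ?thesis by (simp add: w_def)
  qed
  have wint: "integrable lborel (w k)" for k
    using wbd wcont by (intro integrable_bound_inv_square borel_measurable_continuous_onI)
  have ift_Suc: "ift (w (Suc k)) x = \<i> * x * ift (w k) x" for k x
  proof (rule ift_derivative[OF wder wcont])
    show "cmod (w k t) \<le> fact (Suc k) * (3 * C) / (1 + t\<^sup>2)" for t
      by (rule order_trans[OF wbd], intro divide_right_mono mult_right_mono) (auto simp: C0 fact_mono)
  qed (rule wbd)
  have ift_k: "ift (w k) x = (\<i> * x) ^ k * ift (w 0) x" for k x
    by (induction k) (simp_all add: ift_Suc mult.assoc)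
  define I where "I k = (\<integral>t. cmod (w k t) \<partial>lborel)" for k
  have bk: "\<bar>x\<bar> ^ k * cmod (ift (w 0) x) \<le> I k" for k x
    using norm_ift_le[OF wint[of k], of x] unfolding ift_k[of k x] I_def
    by (simp add: norm_mult norm_power)
  show thesis
  proof (rule that[of "I 0 + I 1 + I 2 + I 3"])
    fix x :: real
    have "(1 + \<bar>x\<bar>) * (1 + x\<^sup>2) = \<bar>x\<bar> ^ 0 + \<bar>x\<bar> ^ 1 + \<bar>x\<bar> ^ 2 + \<bar>x\<bar> ^ 3"
      by (simp add: algebra_simps power2_eq_square power3_eq_cube)
    then have "cmod (ift (w 0) x) * (1 + \<bar>x\<bar>) * (1 + x\<^sup>2) = \<bar>x\<bar> ^ 0 * cmod (ift (w 0) x)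
       + \<bar>x\<bar> ^ 1 * cmod (ift (w 0) x) + \<bar>x\<bar> ^ 2 * cmod (ift (w 0) x) + \<bar>x\<bar> ^ 3 * cmod (ift (w 0) x)"
      by (simp only: mult.assoc) (simp only: algebra_simps)
    also have "\<dots> \<le> I 0 + I 1 + I 2 + I 3" using bk by (intro add_mono)
    finally show "cmod (ift (\<lambda>t. W (of_real t)) x) * (1 + \<bar>x\<bar>) \<le> (I 0 + I 1 + I 2 + I 3) / (1 + x\<^sup>2)"
      by (simp add: w_def[abs_def] pos_le_divide_eq add_pos_nonneg)
  qed
qed

lemma ift_convolution:
  fixes U :: "'b \<Rightarrow> real"
  assumes "prob_space N" and U: "integrable N U"
    and iw: "integrable lborel w" and bd: "\<And>x. cmod (ift w x) * (1 + \<bar>x\<bar>) \<le> C / (1 + x\<^sup>2)"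
  shows "integrable lborel (\<lambda>x. (1 + \<bar>x\<bar>) * cmod (ift (\<lambda>t. w t * (\<integral>\<theta>. iexp (t * U \<theta>) \<partial>N)) x))"
proof -
  interpret N: prob_space N by fact
  interpret P: pair_sigma_finite lborel N ..
  interpret Q: pair_sigma_finite N lborel ..
  have [measurable]: "U \<in> borel_measurable N" using U by simp
  have [measurable]: "w \<in> borel_measurable borel" using iw by simp
  have gm [measurable]: "ift w \<in> borel_measurable borel"
    by (rule borel_measurable_continuous_onI[OF continuous_ift[OF iw]])
  let ?h = "\<lambda>t. w t * (\<integral>\<theta>. iexp (t * U \<theta>) \<partial>N)"
  have conv: "ift ?h x = (\<integral>\<theta>. ift w (x - U \<theta>) \<partial>N)" for x
  proof -
    let ?P = "\<lambda>t \<theta>. iexp (- (t * (x - U \<theta>))) * w t"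
    have int: "integrable (lborel \<Otimes>\<^sub>M N) (case_prod ?P)"
    proof (rule P.Fubini_integrable)
      show "integrable lborel (\<lambda>t. \<integral>\<theta>. cmod (case (t, \<theta>) of (t, \<theta>) \<Rightarrow> ?P t \<theta>) \<partial>N)"
        using integrable_norm[OF iw] by (simp add: N.prob_space norm_mult)
      show "AE t in lborel. integrable N (\<lambda>\<theta>. case (t, \<theta>) of (t, \<theta>) \<Rightarrow> ?P t \<theta>)"
        unfolding prod.case
        by (intro AE_I2 integrable_mult_left N.integrable_iexp) auto
    qed measurable
    have "(\<integral>t. iexp (- (t * x)) * ?h t \<partial>lborel) = (\<integral>t. (\<integral>\<theta>. ?P t \<theta> \<partial>N) \<partial>lborel)"
    proof (intro Bochner_Integration.integral_cong refl)
      fix t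
      have "iexp (- (t * x)) * ?h t = (\<integral>\<theta>. (iexp (- (t * x)) * w t) * iexp (t * U \<theta>) \<partial>N)"
        by (simp only: integral_mult_right_zero mult.assoc)
      also have "\<dots> = (\<integral>\<theta>. ?P t \<theta> \<partial>N)"
      proof (intro Bochner_Integration.integral_cong refl)
        fix \<theta>
        have "iexp ((U \<theta> - x) * t) = iexp (U \<theta> * t) * iexp (- (x * t))" by (rule iexp_diff_mult)
        moreover have "(U \<theta> - x) * t = - (t * (x - U \<theta>))" by (simp add: algebra_simps)
        ultimately show "(iexp (- (t * x)) * w t) * iexp (t * U \<theta>) = ?P t \<theta>" by (simp only: mult_ac)
      qed
      finally show "iexp (- (t * x)) * ?h t = (\<integral>\<theta>. ?P t \<theta> \<partial>N)" .
    qed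
    also have "\<dots> = (\<integral>\<theta>. (\<integral>t. ?P t \<theta> \<partial>lborel) \<partial>N)"
      by (rule P.Fubini_integral[OF int, symmetric])
    finally show ?thesis unfolding ift_def by (simp only: integral_mult_right_zero)
  qed
  have C0: "C \<ge> 0"
    using order_trans[OF _ bd[of 0]] by simp
  have absU: "(\<integral>\<^sup>+\<theta>. ennreal (1 + \<bar>U \<theta>\<bar>) \<partial>N) < \<infinity>"
  proof -
    have "integrable N (\<lambda>\<theta>. 1 + \<bar>U \<theta>\<bar>)" using U by auto
    then show ?thesis by (subst nn_integral_eq_integral) auto
  qed
  have ming: "(\<integral>\<^sup>+x. ennreal ((1 + \<bar>x\<bar>) * cmod (ift w x)) \<partial>lborel) < \<infinity>"
  proof -
    have "integrable lborel (\<lambda>x. (1 + \<bar>x\<bar>) * cmod (ift w x))"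
      by (rule integrable_bound_inv_square[where C = C]) (use bd in \<open>auto simp: mult.commute\<close>)
    then show ?thesis by (subst nn_integral_eq_integral) auto
  qed
  have "(\<integral>\<^sup>+x. ennreal ((1 + \<bar>x\<bar>) * cmod (ift ?h x)) \<partial>lborel)
      \<le> (\<integral>\<^sup>+x. (\<integral>\<^sup>+\<theta>. ennreal ((1 + \<bar>x\<bar>) * cmod (ift w (x - U \<theta>))) \<partial>N) \<partial>lborel)"
  proof (rule nn_integral_mono)
    fix x
    have b: "cmod (ift w (x - U \<theta>)) \<le> C" for \<theta>
    proof -
      have "cmod (ift w (x - U \<theta>)) * 1 \<le> cmod (ift w (x - U \<theta>)) * (1 + \<bar>x - U \<theta>\<bar>)"
        by (intro mult_left_mono) auto
      also have "\<dots> \<le> C / (1 + (x - U \<theta>)\<^sup>2)" by (rule bd)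
      also have "\<dots> \<le> C / 1" using C0 by (intro divide_left_mono) (auto intro: add_pos_nonneg)
      finally show ?thesis by simp
    qed
    have i: "integrable N (\<lambda>\<theta>. cmod (ift w (x - U \<theta>)))"
      by (rule N.integrable_const_bound[of _ C]) (use b in auto)
    have "cmod (ift ?h x) \<le> (\<integral>\<theta>. cmod (ift w (x - U \<theta>)) \<partial>N)"
      unfolding conv by (rule integral_norm_bound)
    then have "(1 + \<bar>x\<bar>) * cmod (ift ?h x) \<le> (\<integral>\<theta>. (1 + \<bar>x\<bar>) * cmod (ift w (x - U \<theta>)) \<partial>N)"
      unfolding integral_mult_right_zero by (intro mult_left_mono) auto
    then show "ennreal ((1 + \<bar>x\<bar>) * cmod (ift ?h x)) \<le> (\<integral>\<^sup>+\<theta>. ennreal ((1 + \<bar>x\<bar>) * cmod (ift w (x - U \<theta>))) \<partial>N)"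
      using i by (subst nn_integral_eq_integral) (auto intro!: ennreal_leI integrable_mult_right)
  qed
  also have "\<dots> = (\<integral>\<^sup>+\<theta>. (\<integral>\<^sup>+x. ennreal ((1 + \<bar>x\<bar>) * cmod (ift w (x - U \<theta>))) \<partial>lborel) \<partial>N)"
    by (rule P.Fubini'[symmetric]) measurable
  also have "\<dots> \<le> (\<integral>\<^sup>+\<theta>. ennreal (1 + \<bar>U \<theta>\<bar>) * (\<integral>\<^sup>+x. ennreal ((1 + \<bar>x\<bar>) * cmod (ift w x)) \<partial>lborel) \<partial>N)"
  proof (rule nn_integral_mono)
    fix \<theta>
    have "(\<integral>\<^sup>+x. ennreal ((1 + \<bar>x\<bar>) * cmod (ift w (x - U \<theta>))) \<partial>lborel)
       = (\<integral>\<^sup>+x. ennreal ((1 + \<bar>U \<theta> + 1 * x\<bar>) * cmod (ift w (U \<theta> + 1 * x - U \<theta>))) \<partial>lborel)"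
      by (subst nn_integral_real_affine[of _ 1 "U \<theta>"]) auto
    also have "\<dots> \<le> (\<integral>\<^sup>+x. ennreal (1 + \<bar>U \<theta>\<bar>) * ennreal ((1 + \<bar>x\<bar>) * cmod (ift w x)) \<partial>lborel)"
    proof (rule nn_integral_mono)
      fix x
      have "(1 + \<bar>U \<theta>\<bar>) * (1 + \<bar>x\<bar>) = 1 + \<bar>U \<theta>\<bar> + \<bar>x\<bar> + \<bar>U \<theta>\<bar> * \<bar>x\<bar>"
        by (simp add: algebra_simps)
      moreover have "0 \<le> \<bar>U \<theta>\<bar> * \<bar>x\<bar>" by simp
      ultimately have "1 + \<bar>U \<theta> + x\<bar> \<le> (1 + \<bar>U \<theta>\<bar>) * (1 + \<bar>x\<bar>)"
        using abs_triangle_ineq[of "U \<theta>" x] by linarith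
      then have "(1 + \<bar>U \<theta> + x\<bar>) * cmod (ift w x) \<le> (1 + \<bar>U \<theta>\<bar>) * (1 + \<bar>x\<bar>) * cmod (ift w x)"
        by (rule mult_right_mono) simp
      then show "ennreal ((1 + \<bar>U \<theta> + 1 * x\<bar>) * cmod (ift w (U \<theta> + 1 * x - U \<theta>)))
          \<le> ennreal (1 + \<bar>U \<theta>\<bar>) * ennreal ((1 + \<bar>x\<bar>) * cmod (ift w x))"
        by (subst ennreal_mult[symmetric]) (auto intro!: ennreal_leI simp: mult.assoc)
    qed
    also have "\<dots> = ennreal (1 + \<bar>U \<theta>\<bar>) * (\<integral>\<^sup>+x. ennreal ((1 + \<bar>x\<bar>) * cmod (ift w x)) \<partial>lborel)"
      by (rule nn_integral_cmult) measurable
    finally show "(\<integral>\<^sup>+x. ennreal ((1 + \<bar>x\<bar>) * cmod (ift w (x - U \<theta>))) \<partial>lborel)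
       \<le> ennreal (1 + \<bar>U \<theta>\<bar>) * (\<integral>\<^sup>+x. ennreal ((1 + \<bar>x\<bar>) * cmod (ift w x)) \<partial>lborel)" .
  qed
  also have "\<dots> = (\<integral>\<^sup>+\<theta>. ennreal (1 + \<bar>U \<theta>\<bar>) \<partial>N) * (\<integral>\<^sup>+x. ennreal ((1 + \<bar>x\<bar>) * cmod (ift w x)) \<partial>lborel)"
    by (rule nn_integral_multc) measurable
  also have "\<dots> < \<infinity>"
    using absU ming by (simp add: ennreal_mult_less_top)
  finally have fin: "(\<integral>\<^sup>+x. ennreal ((1 + \<bar>x\<bar>) * cmod (ift ?h x)) \<partial>lborel) < \<infinity>" .
  have [measurable]: "ift ?h \<in> borel_measurable borel"
    unfolding ift_def by measurable
  have m: "(\<lambda>x. (1 + \<bar>x\<bar>) * cmod (ift ?h x)) \<in> borel_measurable lborel" by measurable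
  have eq: "norm ((1 + \<bar>x\<bar>) * cmod (ift ?h x)) = (1 + \<bar>x\<bar>) * cmod (ift ?h x)" for x
    unfolding real_norm_def by (rule abs_of_nonneg) (intro mult_nonneg_nonneg, auto)
  show ?thesis
    by (rule integrableI_bounded[OF m]) (unfold eq, rule fin)
qed

section \<open>Weighted smoothing inequality\<close>

lemma integral_iexp_interval:
  assumes "a \<le> b" "t \<noteq> 0"
  shows "(\<integral>x. indicator {a..<b} x *\<^sub>R iexp (t * x) \<partial>lborel) = (iexp (t * b) - iexp (t * a)) / (\<i> * t)"
proof -
  have der: "((\<lambda>x. iexp (t * x) / (\<i> * t)) has_vector_derivative iexp (t * x)) (at x within S)" for x S
  proof -
    have "((\<lambda>z. exp (\<i> * (of_real t * z)) / (\<i> * t)) has_field_derivative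
        exp (\<i> * (of_real t * of_real x)) * (\<i> * t) / (\<i> * t)) (at (of_real x))"
      by (rule DERIV_cdivide, rule DERIV_chain2[OF DERIV_exp]) (auto intro!: derivative_eq_intros)
    then have "((\<lambda>z. exp (\<i> * (of_real t * z)) / (\<i> * t)) has_field_derivative iexp (t * x)) (at (of_real x))"
      using assms by simp
    from has_vector_derivative_real_field[OF this] show ?thesis by simp
  qed
  have "(LBINT x=a..b. iexp (t * x)) = iexp (t * b) / (\<i> * t) - iexp (t * a) / (\<i> * t)"
    by (rule interval_integral_FTC_finite, intro continuous_intros, rule der)
  then show ?thesis using assms
    by (subst (asm) interval_integral_Ico) (auto simp: set_lebesgue_integral_def diff_divide_distrib)
qed

lemma integrable_indicator_iexp:
  "integrable lborel (\<lambda>x. indicator {a..<b} x *\<^sub>R iexp (t * x))"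
  by (rule Bochner_Integration.integrable_bound[of _ "indicator {a..b::real} :: real \<Rightarrow> real"])
    (auto simp: indicator_def emeasure_lborel_Icc_eq)

lemma centred_cdf_transform:
  fixes M :: "real measure"
  assumes "finite_measure M" and sets [simp, measurable_cong]: "sets M = sets borel"
    and first: "integrable M (\<lambda>u. u)"
  defines "J \<equiv> \<lambda>x. measure M {..x} - measure M UNIV * indicator {0..} x"
  shows "integrable lborel J"
    and "t \<noteq> 0 \<Longrightarrow> (\<integral>x. iexp (t * x) * of_real (J x) \<partial>lborel) = - (char M t - char M 0) / (\<i> * t)"
    and "(1 + \<bar>x\<bar>) * \<bar>J x\<bar> \<le> measure M UNIV + (\<integral>u. \<bar>u\<bar> \<partial>M)"
proof -
  interpret M: finite_measure M by fact
  interpret Q: pair_sigma_finite M lborel ..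
  have sp: "space M = UNIV" using sets_eq_imp_space_eq[OF sets] by simp
  define K :: "real \<Rightarrow> real \<Rightarrow> real" where "K u x = indicator {u..<0} x - indicator {0..<u} x" for u x
  have Kalt: "K u x = indicator {..x} u - indicator {0..} x" for u x
    by (auto simp: K_def indicator_def)
  have [measurable]: "(\<lambda>z. K (fst z) (snd z)) \<in> borel_measurable (borel \<Otimes>\<^sub>M borel)"
  proof -
    have "(\<lambda>z. K (fst z) (snd z)) = (\<lambda>z. (if fst z \<le> snd z then 1 else 0) - (if 0 \<le> snd z then 1 else 0))"
      by (auto simp: Kalt indicator_def fun_eq_iff)
    then show ?thesis by simp
  qed
  have Kint: "J x = (\<integral>u. K u x \<partial>M)" for x
  proof -
    have "(\<integral>u. K u x \<partial>M) = (\<integral>u. indicator {..x} u \<partial>M) - (\<integral>u. indicator {0..} x \<partial>M)"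
      unfolding Kalt by (rule Bochner_Integration.integral_diff) (auto simp: M.emeasure_finite less_top[symmetric])
    then show ?thesis by (simp add: J_def sp mult.commute)
  qed
  have absK: "\<bar>K u x\<bar> = indicator {min u 0..<max u 0} x" for u x
    by (auto simp: K_def indicator_def)
  have absKint: "(\<integral>x. \<bar>K u x\<bar> \<partial>lborel) = \<bar>u\<bar>" for u
    unfolding absK by (auto simp: min_def max_def)
  have [measurable]: "K u \<in> borel_measurable borel" for u
    unfolding K_def by measurable
  have Ki: "integrable lborel (\<lambda>x. iexp (t * x) * of_real (K u x))" for t u
    by (rule Bochner_Integration.integrable_bound[of _ "indicator {min u 0..<max u 0} :: real \<Rightarrow> real"])
      (auto simp: norm_mult absK)
  have int: "integrable (M \<Otimes>\<^sub>M lborel) (\<lambda>(u, x). iexp (t * x) * of_real (K u x))" for t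
  proof (rule Q.Fubini_integrable)
    show "integrable M (\<lambda>u. \<integral>x. cmod (case (u, x) of (u, x) \<Rightarrow> iexp (t * x) * of_real (K u x)) \<partial>lborel)"
      using first by (simp add: norm_mult absKint)
    show "AE u in M. integrable lborel (\<lambda>x. case (u, x) of (u, x) \<Rightarrow> iexp (t * x) * of_real (K u x))"
      using Ki by simp
  qed measurable
  have Jt: "iexp (t * x) * of_real (J x) = (\<integral>u. iexp (t * x) * of_real (K u x) \<partial>M)" for t x
    unfolding Kint by (simp only: integral_mult_right_zero integral_complex_of_real)
  have "integrable lborel (\<lambda>x. \<integral>u. iexp (0 * x) * complex_of_real (K u x) \<partial>M)"
    by (rule Q.integrable_snd[OF int])
  then have "integrable lborel (\<lambda>x. complex_of_real (J x))"
    unfolding Jt[symmetric] by simp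
  then show "integrable lborel J" by (simp add: complex_of_real_integrable_eq)
  show "(\<integral>x. iexp (t * x) * of_real (J x) \<partial>lborel) = - (char M t - char M 0) / (\<i> * t)" if t: "t \<noteq> 0"
  proof -
    have inner: "(\<integral>x. iexp (t * x) * of_real (K u x) \<partial>lborel) = - (iexp (t * u) - 1) / (\<i> * t)" for u
    proof -
      have "(\<integral>x. iexp (t * x) * of_real (K u x) \<partial>lborel) =
         (\<integral>x. indicator {u..<0} x *\<^sub>R iexp (t * x) - indicator {0..<u} x *\<^sub>R iexp (t * x) \<partial>lborel)"
        by (intro Bochner_Integration.integral_cong refl) (auto simp: K_def indicator_def)
      also have "\<dots> = (\<integral>x. indicator {u..<0} x *\<^sub>R iexp (t * x) \<partial>lborel) - (\<integral>x. indicator {0..<u} x *\<^sub>R iexp (t * x) \<partial>lborel)"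
        by (rule Bochner_Integration.integral_diff[OF integrable_indicator_iexp integrable_indicator_iexp])
      also have "\<dots> = - (iexp (t * u) - 1) / (\<i> * t)"
      proof (cases "u \<le> 0")
        case True
        then have "{0..<u} = {}" by auto
        then show ?thesis using integral_iexp_interval[OF True t] by (simp add: diff_divide_distrib minus_divide_left)
      next
        case False
        then have "{u..<0} = {}" "0 \<le> u" by auto
        then show ?thesis using integral_iexp_interval[OF \<open>0 \<le> u\<close> t] by (simp add: diff_divide_distrib minus_divide_left)
      qed
      finally show ?thesis .
    qed
    have "(\<integral>x. iexp (t * x) * of_real (J x) \<partial>lborel) = (\<integral>x. (\<integral>u. iexp (t * x) * of_real (K u x) \<partial>M) \<partial>lborel)"
      unfolding Jt ..
    also have "\<dots> = (\<integral>u. (\<integral>x. iexp (t * x) * of_real (K u x) \<partial>lborel) \<partial>M)"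
      by (rule Q.Fubini_integral[OF int])
    also have "\<dots> = (\<integral>u. - (iexp (t * u) - 1) / (\<i> * t) \<partial>M)" unfolding inner ..
    also have "\<dots> = (\<integral>u. (- 1 / (\<i> * t)) * (iexp (t * u) - 1) \<partial>M)"
      by (intro Bochner_Integration.integral_cong refl) (simp only: minus_divide_left times_divide_eq_left mult_minus_left mult_1)
    also have "\<dots> = (- 1 / (\<i> * t)) * (\<integral>u. iexp (t * u) - 1 \<partial>M)" by (rule integral_mult_right_zero)
    also have "(\<integral>u. iexp (t * u) - 1 \<partial>M) = char M t - char M 0"
      unfolding char_def
      by (subst Bochner_Integration.integral_diff)
        (auto intro!: M.integrable_const_bound[of _ 1])
    finally show ?thesis by (simp add: diff_divide_distrib)
  qed
  have iabs: "integrable M (\<lambda>u. \<bar>u\<bar>)" using first by auto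
  have pt: "(1 + \<bar>x\<bar>) * \<bar>K u x\<bar> \<le> 1 + \<bar>u\<bar>" for u
    by (auto simp: K_def indicator_def)
  have iK: "integrable M (\<lambda>u. \<bar>K u x\<bar>)"
    by (rule M.integrable_const_bound[of _ 1]) (auto simp: K_def indicator_def)
  have "\<bar>J x\<bar> \<le> (\<integral>u. \<bar>K u x\<bar> \<partial>M)"
    unfolding Kint using integral_norm_bound[of M "\<lambda>u. K u x"] by simp
  then have "(1 + \<bar>x\<bar>) * \<bar>J x\<bar> \<le> (1 + \<bar>x\<bar>) * (\<integral>u. \<bar>K u x\<bar> \<partial>M)"
    by (intro mult_left_mono) auto
  also have "\<dots> = (\<integral>u. (1 + \<bar>x\<bar>) * \<bar>K u x\<bar> \<partial>M)" by (rule integral_mult_right_zero[symmetric])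
  also have "\<dots> \<le> (\<integral>u. 1 + \<bar>u\<bar> \<partial>M)"
    using pt iK iabs by (intro integral_mono integrable_mult_right Bochner_Integration.integrable_add) auto
  also have "\<dots> = measure M UNIV + (\<integral>u. \<bar>u\<bar> \<partial>M)"
    using iabs by (subst Bochner_Integration.integral_add) (auto simp: sp)
  finally show "(1 + \<bar>x\<bar>) * \<bar>J x\<bar> \<le> measure M UNIV + (\<integral>u. \<bar>u\<bar> \<partial>M)" .
qed

lemma ift_convolution_integrable:
  assumes im: "integrable lborel m" and iD: "integrable lborel D"
  shows "(\<integral>y. ift m (x - y) * complex_of_real (D y) \<partial>lborel)
    = ift (\<lambda>t. m t * (\<integral>y. iexp (t * y) * complex_of_real (D y) \<partial>lborel)) x"
proof -
  have [measurable]: "m \<in> borel_measurable borel" "D \<in> borel_measurable borel" using im iD by auto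
  let ?P = "\<lambda>t y. iexp (- (t * (x - y))) * m t * complex_of_real (D y)"
  have int: "integrable (lborel \<Otimes>\<^sub>M lborel) (case_prod ?P)"
  proof (rule lborel_pair.Fubini_integrable)
    show "integrable lborel (\<lambda>t. \<integral>y. cmod (case (t, y) of (t, y) \<Rightarrow> ?P t y) \<partial>lborel)"
      using integrable_norm[OF im] by (simp add: norm_mult)
    show "AE t in lborel. integrable lborel (\<lambda>y. case (t, y) of (t, y) \<Rightarrow> ?P t y)"
    proof (rule AE_I2, unfold prod.case)
      fix t
      show "integrable lborel (\<lambda>y. ?P t y)"
        by (rule Bochner_Integration.integrable_bound[OF integrable_mult_right[OF iD, of "cmod (m t)"]])
          (auto simp: norm_mult)
    qed
  qed measurable
  have "(\<integral>t. iexp (- (t * x)) * (m t * (\<integral>y. iexp (t * y) * complex_of_real (D y) \<partial>lborel)) \<partial>lborel)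
      = (\<integral>t. (\<integral>y. ?P t y \<partial>lborel) \<partial>lborel)"
  proof (intro Bochner_Integration.integral_cong refl)
    fix t
    have "iexp (- (t * x)) * (m t * (\<integral>y. iexp (t * y) * complex_of_real (D y) \<partial>lborel))
        = (\<integral>y. (iexp (- (t * x)) * m t) * (iexp (t * y) * complex_of_real (D y)) \<partial>lborel)"
      by (simp only: integral_mult_right_zero mult.assoc)
    also have "\<dots> = (\<integral>y. ?P t y \<partial>lborel)"
    proof (intro Bochner_Integration.integral_cong refl)
      fix y
      have "iexp ((y - x) * t) = iexp (y * t) * iexp (- (x * t))" by (rule iexp_diff_mult)
      moreover have "(y - x) * t = - (t * (x - y))" by (simp add: algebra_simps)
      ultimately show "(iexp (- (t * x)) * m t) * (iexp (t * y) * complex_of_real (D y)) = ?P t y"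
        by (simp only: mult_ac)
    qed
    finally show "iexp (- (t * x)) * (m t * (\<integral>y. iexp (t * y) * complex_of_real (D y) \<partial>lborel)) = (\<integral>y. ?P t y \<partial>lborel)" .
  qed
  also have "\<dots> = (\<integral>y. (\<integral>t. ?P t y \<partial>lborel) \<partial>lborel)"
    by (rule lborel_pair.Fubini_integral[OF int, symmetric])
  finally have *: "(\<integral>t. iexp (- (t * x)) * (m t * (\<integral>y. iexp (t * y) * complex_of_real (D y) \<partial>lborel)) \<partial>lborel)
      = (\<integral>y. (\<integral>t. iexp (- (t * (x - y))) * m t \<partial>lborel) * complex_of_real (D y) \<partial>lborel)"
    by (simp only: integral_mult_left_zero)
  show ?thesis unfolding ift_def * by (simp only: integral_mult_right_zero mult.assoc)
qed

definition tri :: "real \<Rightarrow> real" where "tri t = max 0 (1 - \<bar>t\<bar>)"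

definition tri' :: "real \<Rightarrow> real" where "tri' t = indicator {-1..<0} t - indicator {0..<1} t"

lemma tri_measurable [measurable]: "tri \<in> borel_measurable borel" "tri' \<in> borel_measurable borel"
  unfolding tri_def tri'_def by measurable

lemma tri_bounds: "0 \<le> tri t" "tri t \<le> indicator {-1..1} t" "\<bar>tri' t\<bar> \<le> indicator {-1..1} t"
  by (auto simp: tri_def tri'_def indicator_def)

lemma integrable_times_bounded_indicator:
  fixes Z :: "real \<Rightarrow> complex"
  assumes c: "continuous_on {-1..1} Z" and m: "m \<in> borel_measurable borel" "\<And>t. \<bar>m t\<bar> \<le> indicator {-1..1} t"
  shows "integrable lborel (\<lambda>t. complex_of_real (m t) * Z t)"
proof -
  have i: "integrable lborel (\<lambda>t. indicator {-1..1::real} t *\<^sub>R Z t)"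
    using borel_integrable_atLeastAtMost'[OF c] by (simp add: set_integrable_def)
  have eq: "complex_of_real (m t) * Z t = complex_of_real (m t) * (indicator {-1..1::real} t *\<^sub>R Z t)" for t
    using m(2)[of t] by (auto simp: indicator_def)
  have le: "cmod (complex_of_real (m t) * Z t) \<le> cmod (indicator {-1..1::real} t *\<^sub>R Z t)" for t
    using m(2)[of t] by (auto simp: indicator_def norm_mult intro!: mult_left_le_one_le)
  have meas: "(\<lambda>t. complex_of_real (m t) * Z t) \<in> borel_measurable borel"
    unfolding eq using m(1) borel_measurable_integrable[OF i] by measurable
  show ?thesis
    by (rule Bochner_Integration.integrable_bound[OF i]) (use meas le in auto)
qed

lemma ift_tri_by_parts:
  fixes Z Z' :: "real \<Rightarrow> complex"
  assumes c: "continuous_on UNIV Z"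
    and d: "\<And>t. t \<noteq> 0 \<Longrightarrow> \<bar>t\<bar> < 1 \<Longrightarrow> (Z has_vector_derivative Z' t) (at t)"
    and i: "integrable lborel (\<lambda>t. complex_of_real (tri t) * Z' t)"
  shows "\<i> * x * ift (\<lambda>t. complex_of_real (tri t) * Z t) x
    = ift (\<lambda>t. complex_of_real (tri' t) * Z t) x + ift (\<lambda>t. complex_of_real (tri t) * Z' t) x"
proof -
  have c1: "continuous_on {-1..1} Z" using c continuous_on_subset by blast
  have b1: "\<bar>tri t\<bar> \<le> indicator {-1..1} t" for t using tri_bounds[of t] by simp
  have i1: "integrable lborel (\<lambda>t. complex_of_real (tri t) * Z t)"
    by (rule integrable_times_bounded_indicator[OF c1]) (use b1 in auto)
  have i2: "integrable lborel (\<lambda>t. complex_of_real (tri' t) * Z t)"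
    by (rule integrable_times_bounded_indicator[OF c1]) (use tri_bounds(3) in auto)
  let ?e = "\<lambda>t. iexp (- (t * x))"
  let ?G = "\<lambda>t. ?e t * (complex_of_real (tri' t) * Z t) + ?e t * (complex_of_real (tri t) * Z' t)
      + (- \<i> * x) * (?e t * (complex_of_real (tri t) * Z t))"
  have iG: "integrable lborel ?G"
    by (intro Bochner_Integration.integrable_add integrable_mult_right ift_integrable i i1 i2)
  have hi: "(?G has_integral (?e 1 * (complex_of_real (tri 1) * Z 1) - ?e (-1) * (complex_of_real (tri (-1)) * Z (-1)))) {-1..1}"
  proof (rule fundamental_theorem_of_calculus_interior_strong[where S = "{0}"])
    show "continuous_on {-1..1} (\<lambda>t. ?e t * (complex_of_real (tri t) * Z t))"
      unfolding tri_def by (intro continuous_intros c1)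
    fix t :: real assume t: "t \<in> {-1<..<1} - {0}"
    have tri_d: "(tri has_real_derivative tri' t) (at t)"
    proof (cases "t > 0")
      case True
      have "((\<lambda>t. 1 - t) has_real_derivative tri' t) (at t)"
        using True t by (auto intro!: derivative_eq_intros simp: tri'_def)
      then show ?thesis
        by (rule DERIV_cong_ev[THEN iffD1, rotated -1, OF _ refl _ refl])
          (use True t in \<open>auto simp: tri_def intro!: eventually_nhds_in_open[of "{0<..<1}", THEN eventually_mono]\<close>)
    next
      case False
      have "((\<lambda>t. 1 + t) has_real_derivative tri' t) (at t)"
        using False t by (auto intro!: derivative_eq_intros simp: tri'_def)
      then show ?thesis
        by (rule DERIV_cong_ev[THEN iffD1, rotated -1, OF _ refl _ refl])
          (use False t in \<open>auto simp: tri_def intro!: eventually_nhds_in_open[of "{-1<..<0}", THEN eventually_mono]\<close>)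
    qed
    have 1: "((\<lambda>t. complex_of_real (tri t)) has_vector_derivative complex_of_real (tri' t)) (at t)"
      using tri_d by (rule has_vector_derivative_of_real[unfolded has_real_derivative_iff_has_vector_derivative[symmetric]])
    have 2: "(Z has_vector_derivative Z' t) (at t)" using d t by auto
    show "((\<lambda>t. ?e t * (complex_of_real (tri t) * Z t)) has_vector_derivative ?G t) (at t)"
      by (rule has_vector_derivative_eq_rhs[OF has_vector_derivative_mult[OF has_vector_derivative_iexp_minus has_vector_derivative_mult[OF 1 2]]])
        (simp only: algebra_simps)
  qed auto
  have sG: "set_integrable lborel {-1..1} ?G"
    unfolding set_integrable_def using integrable_mult_indicator[OF _ iG, of "{-1..1}"] by simp
  have "(\<integral>t. ?G t \<partial>lborel) = (LINT t:{-1..1}|lborel. ?G t)"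
    unfolding set_lebesgue_integral_def
    by (intro Bochner_Integration.integral_cong refl) (auto simp: indicator_def tri_def tri'_def)
  also have "\<dots> = integral {-1..1} ?G" by (rule set_borel_integral_eq_integral[OF sG])
  also have "\<dots> = 0" using integral_unique[OF hi] by (simp add: tri_def)
  finally have G0: "(\<integral>t. ?G t \<partial>lborel) = 0" .
  have G1: "(\<integral>t. ?G t \<partial>lborel) = (\<integral>t. ?e t * (complex_of_real (tri' t) * Z t) \<partial>lborel)
      + (\<integral>t. ?e t * (complex_of_real (tri t) * Z' t) \<partial>lborel)
      + (\<integral>t. (- \<i> * x) * (?e t * (complex_of_real (tri t) * Z t)) \<partial>lborel)"
    by (subst Bochner_Integration.integral_add Bochner_Integration.integral_add,
        (intro Bochner_Integration.integrable_add integrable_mult_right ift_integrable i i1 i2)+)+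
      (rule refl)
  have G2: "(\<integral>t. (- \<i> * x) * (?e t * (complex_of_real (tri t) * Z t)) \<partial>lborel)
      = (- \<i> * x) * (\<integral>t. ?e t * (complex_of_real (tri t) * Z t) \<partial>lborel)"
    by (rule integral_mult_right_zero)
  have alg: "A + B + (- \<i> * y) * C = 0 \<Longrightarrow> \<i> * y * (c * C) = c * A + c * B" for A B C y c :: complex
  proof -
    assume "A + B + (- \<i> * y) * C = 0"
    then have "A + B = \<i> * y * C" by simp
    then have "c * (A + B) = c * (\<i> * y * C)" by (simp only:)
    then show ?thesis by (simp only: distrib_left mult_ac)
  qed
  show ?thesis unfolding ift_def
    by (rule alg) (rule trans[OF _ G0], subst G1, subst G2, rule refl)
qed

definition fejer :: "real \<Rightarrow> real" where
  "fejer u = (if u = 0 then 1 / (2 * pi) else (1 - cos u) / (pi * u\<^sup>2))"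

lemma integrable_tri: "integrable lborel (\<lambda>t. complex_of_real (tri t))" "integrable lborel (\<lambda>t. complex_of_real (tri' t))"
proof -
  have "\<bar>tri t\<bar> \<le> indicator {-1..1} t" for t using tri_bounds[of t] by simp
  then show "integrable lborel (\<lambda>t. complex_of_real (tri t))"
    using integrable_times_bounded_indicator[of "\<lambda>_. 1" tri] by simp
  show "integrable lborel (\<lambda>t. complex_of_real (tri' t))"
    using integrable_times_bounded_indicator[of "\<lambda>_. 1" tri'] tri_bounds(3) by simp
qed

lemma ift_tri_frequency:
  "\<i> * x * ift (\<lambda>t. complex_of_real (tri t)) x = ift (\<lambda>t. complex_of_real (tri' t)) x"
  using ift_tri_by_parts[of "\<lambda>_. 1" "\<lambda>_. 0" x] by (simp add: ift_def)

lemma integral_tri: "(\<integral>t. tri t \<partial>lborel) = 1"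
proof -
  define F :: "real \<Rightarrow> real" where "F t = (if t \<le> 0 then t + t\<^sup>2 / 2 else t - t\<^sup>2 / 2)" for t
  have "(tri has_integral (F 1 - F (-1))) {-1..1}"
  proof (rule fundamental_theorem_of_calculus_interior_strong[where S = "{0}"])
    have "F = (\<lambda>t. t - t * \<bar>t\<bar> / 2)" by (auto simp: F_def fun_eq_iff power2_eq_square)
    then show "continuous_on {-1..1} F" by (auto intro!: continuous_intros)
    fix t :: real assume t: "t \<in> {-1<..<1} - {0}"
    show "(F has_vector_derivative tri t) (at t)"
    proof (cases "t > 0")
      case True
      have "((\<lambda>t. t - t\<^sup>2 / 2) has_real_derivative tri t) (at t)"
        using True t by (auto intro!: derivative_eq_intros simp: tri_def)
      then show ?thesis unfolding has_real_derivative_iff_has_vector_derivative[symmetric]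
        by (rule DERIV_cong_ev[THEN iffD1, rotated -1, OF _ refl _ refl])
          (use True t in \<open>auto simp: F_def intro!: eventually_nhds_in_open[of "{0<..<1}", THEN eventually_mono]\<close>)
    next
      case False
      have "((\<lambda>t. t + t\<^sup>2 / 2) has_real_derivative tri t) (at t)"
        using False t by (auto intro!: derivative_eq_intros simp: tri_def)
      then show ?thesis unfolding has_real_derivative_iff_has_vector_derivative[symmetric]
        by (rule DERIV_cong_ev[THEN iffD1, rotated -1, OF _ refl _ refl])
          (use False t in \<open>auto simp: F_def intro!: eventually_nhds_in_open[of "{-1<..<0}", THEN eventually_mono]\<close>)
    qed
  qed auto
  then have h: "(tri has_integral 1) {-1..1}" by (simp add: F_def)
  have s: "set_integrable lborel {-1..1} tri"
    unfolding set_integrable_def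
    using integrable_tri(1) integrable_mult_indicator[of "{-1..1}" lborel tri]
    by (simp add: complex_of_real_integrable_eq)
  have "(\<integral>t. tri t \<partial>lborel) = (LINT t:{-1..1}|lborel. tri t)"
    unfolding set_lebesgue_integral_def
    by (intro Bochner_Integration.integral_cong refl) (auto simp: indicator_def tri_def)
  also have "\<dots> = 1" using set_borel_integral_eq_integral[OF s] integral_unique[OF h] by simp
  finally show ?thesis .
qed

lemma ift_tri_eq_fejer: "ift (\<lambda>t. complex_of_real (tri t)) u = of_real (fejer u)"
proof (cases "u = 0")
  case True
  have "(\<integral>t. complex_of_real (tri t) \<partial>lborel) = of_real (\<integral>t. tri t \<partial>lborel)"
    by (rule integral_complex_of_real)
  then show ?thesis using True by (simp add: ift_def fejer_def integral_tri)
next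
  case False
  have "(\<integral>t. iexp (- (t * u)) * complex_of_real (tri' t) \<partial>lborel)
      = (\<integral>t. indicator {-1..<0} t *\<^sub>R iexp (- u * t) - indicator {0..<1} t *\<^sub>R iexp (- u * t) \<partial>lborel)"
    by (intro Bochner_Integration.integral_cong refl) (auto simp: tri'_def indicator_def mult.commute)
  also have "\<dots> = (\<integral>t. indicator {-1..<0} t *\<^sub>R iexp (- u * t) \<partial>lborel) - (\<integral>t. indicator {0..<1} t *\<^sub>R iexp (- u * t) \<partial>lborel)"
    by (rule Bochner_Integration.integral_diff[OF integrable_indicator_iexp integrable_indicator_iexp])
  also have "\<dots> = (iexp (- u * 0) - iexp (- u * - 1)) / (\<i> * of_real (- u)) - (iexp (- u * 1) - iexp (- u * 0)) / (\<i> * of_real (- u))"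
    using False by (subst (1 2) integral_iexp_interval) auto
  also have "\<dots> = (2 - (iexp u + iexp (- u))) / (\<i> * of_real (- u))"
    by (simp add: diff_divide_distrib add_divide_distrib)
  also have "iexp u + iexp (- u) = of_real (2 * cos u)"
    by (simp add: exp_Euler exp_minus_Euler cos_of_real)
  finally have *: "(\<integral>t. iexp (- (t * u)) * complex_of_real (tri' t) \<partial>lborel) = (2 - of_real (2 * cos u)) / (\<i> * of_real (- u))" .
  have "\<i> * u * ift (\<lambda>t. complex_of_real (tri t)) u = (1 / (2 * pi)) * ((2 - of_real (2 * cos u)) / (\<i> * of_real (- u)))"
    unfolding ift_tri_frequency by (simp only: ift_def *)
  also have "\<dots> = \<i> * u * of_real ((1 - cos u) / (pi * u\<^sup>2))"
    using False by (simp add: field_simps power2_eq_square)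
  finally have "(\<i> * u) * ift (\<lambda>t. complex_of_real (tri t)) u = (\<i> * u) * of_real ((1 - cos u) / (pi * u\<^sup>2))" .
  then have "ift (\<lambda>t. complex_of_real (tri t)) u = of_real ((1 - cos u) / (pi * u\<^sup>2))"
    by (rule mult_left_cancel[THEN iffD1, rotated]) (use False in simp)
  then show ?thesis using False by (simp add: fejer_def)
qed

lemma fejer_nonneg: "fejer u \<ge> 0"
  by (auto simp: fejer_def)

lemma fejer_le: "fejer u \<le> 4 / (1 + u\<^sup>2)"
proof (cases "\<bar>u\<bar> \<le> 1")
  case True
  have "fejer u \<le> 1"
  proof -
    have "cmod (ift (\<lambda>t. complex_of_real (tri t)) u) \<le> (\<integral>t. cmod (complex_of_real (tri t)) \<partial>lborel)"
      by (rule norm_ift_le[OF integrable_tri(1)])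
    also have "\<dots> = 1" using tri_bounds(1) integral_tri by simp
    finally show ?thesis using fejer_nonneg by (simp add: ift_tri_eq_fejer)
  qed
  also have "1 \<le> 4 / (1 + u\<^sup>2)"
    using True abs_square_le_1[of u] by (simp add: pos_le_divide_eq add_pos_nonneg)
  finally show ?thesis .
next
  case False
  have u2: "u\<^sup>2 \<ge> 1" using one_le_power[of "\<bar>u\<bar>" 2] False by simp
  have "fejer u \<le> 2 / (pi * u\<^sup>2)"
    using False cos_ge_minus_one[of u] by (auto simp: fejer_def intro!: divide_right_mono)
  also have "\<dots> \<le> 2 / (1 * u\<^sup>2)"
    using pi_gt3 u2 by (intro divide_left_mono mult_right_mono) (auto intro!: mult_pos_pos)
  also have "\<dots> \<le> 4 / (1 + u\<^sup>2)"
    using u2 by (simp add: divide_simps add_pos_nonneg)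
  finally show ?thesis .
qed

lemma fejer_measurable [measurable]: "fejer \<in> borel_measurable borel"
  unfolding fejer_def by measurable

lemma integrable_fejer: "integrable lborel fejer"
  by (rule integrable_bound_inv_square[of _ 4]) (use fejer_le fejer_nonneg in auto)

lemma integral_fejer: "(\<integral>u. fejer u \<partial>lborel) = 1"
proof -
  have "(\<integral>x. iexp (0 * x) * ift (\<lambda>t. complex_of_real (tri t)) x \<partial>lborel) = complex_of_real (tri 0)"
  proof (rule fourier_inversion)
    show "continuous_on UNIV (\<lambda>t. complex_of_real (tri t))"
      unfolding tri_def by (intro continuous_intros)
    show "cmod (complex_of_real (tri t)) \<le> 1" for t by (simp add: tri_def)
    show "integrable lborel (ift (\<lambda>t. complex_of_real (tri t)))"
      unfolding ift_tri_eq_fejer[abs_def] complex_of_real_integrable_eq by (rule integrable_fejer)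
  qed (rule integrable_tri(1))
  then have "complex_of_real (\<integral>u. fejer u \<partial>lborel) = of_real 1"
    by (simp add: ift_tri_eq_fejer[abs_def] integral_complex_of_real) (simp add: tri_def)
  then show ?thesis by (simp only: of_real_eq_iff)
qed

lemma fejer_mass:
  obtains A where "A > 0" "\<And>a. a \<ge> A \<Longrightarrow> (\<integral>u. indicator {-a..a} u * fejer u \<partial>lborel) \<ge> 7 / 8"
proof -
  have "((\<lambda>n. \<integral>u. indicator {- real n..real n} u * fejer u \<partial>lborel) \<longlonglongrightarrow> (\<integral>u. fejer u \<partial>lborel))"
  proof (rule integral_dominated_convergence[where w = fejer])
    show "AE u in lborel. (\<lambda>n. indicator {- real n..real n} u * fejer u) \<longlonglongrightarrow> fejer u"
    proof (rule AE_I2)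
      fix u :: real
      have "\<forall>\<^sub>F n in sequentially. \<bar>u\<bar> \<le> real n"
        using eventually_ge_at_top[of "nat \<lceil>\<bar>u\<bar>\<rceil>"] by eventually_elim linarith
      then have "\<forall>\<^sub>F n in sequentially. indicator {- real n..real n} u * fejer u = fejer u"
        by eventually_elim (auto simp: indicator_def)
      then show "(\<lambda>n. indicator {- real n..real n} u * fejer u) \<longlonglongrightarrow> fejer u"
        by (rule tendsto_eventually)
    qed
    show "AE u in lborel. norm (indicator {- real n..real n} u * fejer u) \<le> fejer u" for n
      using fejer_nonneg by (auto simp: indicator_def)
  qed (use integrable_fejer in auto)
  then have "\<forall>\<^sub>F n in sequentially. (\<integral>u. indicator {- real n..real n} u * fejer u \<partial>lborel) > 7 / 8"
    unfolding integral_fejer by (rule order_tendstoD) simp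
  then obtain n where n: "n \<ge> 1" "(\<integral>u. indicator {- real n..real n} u * fejer u \<partial>lborel) > 7 / 8"
    unfolding eventually_sequentially by (metis le_add1 le_add2)
  show thesis
  proof (rule that[of "real n"])
    fix a assume a: "a \<ge> real n"
    have i: "integrable lborel (\<lambda>u. indicator {-b..b} u * fejer u)" for b :: real
      using integrable_mult_indicator[OF _ integrable_fejer, of "{-b..b}"] by simp
    have "(\<integral>u. indicator {- real n..real n} u * fejer u \<partial>lborel) \<le> (\<integral>u. indicator {-a..a} u * fejer u \<partial>lborel)"
      using a fejer_nonneg by (intro integral_mono i) (auto simp: indicator_def)
    then show "(\<integral>u. indicator {-a..a} u * fejer u \<partial>lborel) \<ge> 7 / 8" using n by linarith
  qed (use n in auto)
qed

lemma fejer_smoothing_bound: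
  fixes D :: "real \<Rightarrow> real" and Z Z' :: "real \<Rightarrow> complex"
  assumes D: "integrable lborel D" and bd: "\<And>y. \<bar>y * D y\<bar> \<le> B"
    and Z: "Z = (\<lambda>t. \<integral>y. iexp (t * y) * complex_of_real (D y) \<partial>lborel)"
    and d: "\<And>t. t \<noteq> 0 \<Longrightarrow> \<bar>t\<bar> < 1 \<Longrightarrow> (Z has_vector_derivative Z' t) (at t)"
    and i: "integrable lborel (\<lambda>t. complex_of_real (tri t) * Z' t)"
    and J: "(\<integral>t. cmod (complex_of_real (tri t) * Z' t) \<partial>lborel) \<le> J"
  shows "\<bar>\<integral>y. fejer (x - y) * (y * D y) \<partial>lborel\<bar> \<le> J"
proof -
  have [measurable]: "D \<in> borel_measurable borel" using D by simp
  have cZ: "continuous_on UNIV Z"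
  proof -
    have "isCont Z t" for t
    proof (rule continuous_at_sequentiallyI)
      fix u :: "nat \<Rightarrow> real" assume u: "u \<longlonglongrightarrow> t"
      show "(\<lambda>n. Z (u n)) \<longlonglongrightarrow> Z t" unfolding Z
      proof (rule integral_dominated_convergence[where w = "\<lambda>y. \<bar>D y\<bar>"])
        show "AE y in lborel. (\<lambda>n. iexp (u n * y) * complex_of_real (D y)) \<longlonglongrightarrow> iexp (t * y) * complex_of_real (D y)"
          by (intro AE_I2 tendsto_intros u)
      qed (use D in \<open>auto simp: norm_mult\<close>)
    qed
    then show ?thesis by (simp add: continuous_on_eq_continuous_at)
  qed
  let ?k = "\<lambda>t. complex_of_real (tri t)" and ?k' = "\<lambda>t. complex_of_real (tri' t)"
  have e1: "(\<integral>y. ift ?k (x - y) * complex_of_real (D y) \<partial>lborel) = ift (\<lambda>t. ?k t * Z t) x"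
    using ift_convolution_integrable[OF integrable_tri(1) D] by (simp add: Z)
  have e2: "(\<integral>y. ift ?k' (x - y) * complex_of_real (D y) \<partial>lborel) = ift (\<lambda>t. ?k' t * Z t) x"
    using ift_convolution_integrable[OF integrable_tri(2) D] by (simp add: Z)
  have ib: "integrable lborel (\<lambda>y. ift m (x - y) * complex_of_real (D y))" if m: "integrable lborel m" for m
  proof -
    have [measurable]: "ift m \<in> borel_measurable borel"
      by (rule borel_measurable_continuous_onI[OF continuous_ift[OF m]])
    show ?thesis
      by (rule Bochner_Integration.integrable_bound[OF integrable_mult_right[OF D, of "\<integral>t. cmod (m t) \<partial>lborel"]])
        (auto simp: norm_mult abs_mult intro!: mult_right_mono norm_ift_le m order_trans[OF norm_ift_le abs_ge_self])
  qed
  have "\<i> * (\<integral>y. fejer (x - y) * (y * D y) \<partial>lborel)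
      = (\<integral>y. \<i> * complex_of_real (fejer (x - y) * (y * D y)) \<partial>lborel)"
    by (simp only: integral_mult_right_zero integral_complex_of_real)
  also have "\<dots> = (\<integral>y. \<i> * x * (ift ?k (x - y) * complex_of_real (D y)) - ift ?k' (x - y) * complex_of_real (D y) \<partial>lborel)"
  proof (intro Bochner_Integration.integral_cong refl)
    fix y
    show "\<i> * complex_of_real (fejer (x - y) * (y * D y)) =
      \<i> * x * (ift ?k (x - y) * complex_of_real (D y)) - ift ?k' (x - y) * complex_of_real (D y)"
      unfolding ift_tri_frequency[symmetric] ift_tri_eq_fejer by (simp add: algebra_simps)
  qed
  also have "\<dots> = \<i> * x * ift (\<lambda>t. ?k t * Z t) x - ift (\<lambda>t. ?k' t * Z t) x"
    unfolding e1[symmetric] e2[symmetric]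
    by (subst Bochner_Integration.integral_diff)
      (auto intro!: ib integrable_tri simp del: mult.assoc simp: integral_mult_right_zero)
  also have "\<dots> = ift (\<lambda>t. ?k t * Z' t) x"
    using ift_tri_by_parts[OF cZ d i, of x] by simp
  finally have "\<bar>\<integral>y. fejer (x - y) * (y * D y) \<partial>lborel\<bar> = cmod (ift (\<lambda>t. ?k t * Z' t) x)"
    by (metis norm_ii norm_mult mult_1 norm_of_real)
  also have "\<dots> \<le> J" using norm_ift_le[OF i] J by (rule order_trans)
  finally show ?thesis .
qed

text \<open>The two one-sided Lipschitz conditions pass from a near-extremal point of \<open>E\<close> to a whole interval
  on one side of it, where smoothing with the Fejer kernel still sees most of the extremal value.\<close>
lemma esseen_core:
  obtains C0 :: real where "C0 > 0"
    "\<And>E L J. \<lbrakk>E \<in> borel_measurable borel; \<exists>B. \<forall>x. \<bar>E x\<bar> \<le> B; L > 0; E 0 = 0;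
       \<And>x y. 0 \<le> x \<Longrightarrow> x \<le> y \<Longrightarrow> E y \<ge> E x - L * (y - x);
       \<And>x y. x \<le> y \<Longrightarrow> y \<le> 0 \<Longrightarrow> E y \<le> E x + L * (y - x);
       \<And>x. \<bar>\<integral>y. fejer (x - y) * E y \<partial>lborel\<bar> \<le> J\<rbrakk> \<Longrightarrow> (\<forall>x::real. \<bar>E x\<bar> \<le> C0 * (J + L))"
proof -
  obtain A where A: "A > 0" "\<And>a. a \<ge> A \<Longrightarrow> (\<integral>u. indicator {-a..a} u * fejer u \<partial>lborel) \<ge> 7 / 8"
    using fejer_mass by blast
  show thesis
  proof (rule that[of "4 + 6 * A"])
    fix E :: "real \<Rightarrow> real" and L J :: real
    assume [measurable]: "E \<in> borel_measurable borel" and bdd: "\<exists>B. \<forall>x. \<bar>E x\<bar> \<le> B" and L: "L > 0" and E0: "E 0 = 0"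
      and R: "\<And>x y. 0 \<le> x \<Longrightarrow> x \<le> y \<Longrightarrow> E y \<ge> E x - L * (y - x)"
      and Lf: "\<And>x y. x \<le> y \<Longrightarrow> y \<le> 0 \<Longrightarrow> E y \<le> E x + L * (y - x)"
      and J: "\<And>x. \<bar>\<integral>y. fejer (x - y) * E y \<partial>lborel\<bar> \<le> J"
    define \<Delta> where "\<Delta> = (SUP x. \<bar>E x\<bar>)"
    have bd: "bdd_above (range (\<lambda>x. \<bar>E x\<bar>))" using bdd by auto
    have \<Delta>: "\<bar>E x\<bar> \<le> \<Delta>" for x unfolding \<Delta>_def by (rule cSUP_upper[OF _ bd]) simp
    have J0: "J \<ge> 0" using J[of 0] by linarith
    have "\<Delta> \<le> (4 + 6 * A) * (J + L)"
    proof (cases "\<Delta> > 0")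
      case False
      have "0 \<le> (4 + 6 * A) * (J + L)" using A(1) J0 L by (intro mult_nonneg_nonneg) auto
      with False show ?thesis by linarith
    next
      case \<Delta>0: True
      then have "7/8 * \<Delta> < \<Delta>" by simp
      then obtain x0 where x0: "7/8 * \<Delta> < \<bar>E x0\<bar>"
        using less_cSUP_iff[OF UNIV_not_empty bd, of "7/8 * \<Delta>"] unfolding \<Delta>_def[symmetric] by blast
      define a where "a = 3 * \<Delta> / (16 * L)"
      have a: "a > 0" and aL: "2 * a * L = 3/8 * \<Delta>" using \<Delta>0 L by (auto simp: a_def)
      obtain x1 \<sigma> :: real where \<sigma>: "\<bar>\<sigma>\<bar> = 1" and x1: "\<And>y. \<bar>x1 - y\<bar> \<le> a \<Longrightarrow> \<sigma> * E y \<ge> \<Delta> / 2"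
      proof -
        have step: "L * d \<le> 3/8 * \<Delta>" if "d \<le> 2 * a" for d
        proof -
          have "L * d \<le> L * (2 * a)" using that L by (intro mult_left_mono) auto
          also have "\<dots> = 2 * a * L" by simp
          finally show ?thesis using aL by linarith
        qed
        have far: "2 * a < d" if "7/8 * \<Delta> < L * d" for d
        proof (rule ccontr)
          assume "\<not> 2 * a < d"
          then have "L * d \<le> 3/8 * \<Delta>" by (intro step) simp
          with that \<Delta>0 show False by linarith
        qed
        consider "x0 \<ge> 0" "E x0 \<ge> 0" | "x0 \<ge> 0" "E x0 < 0" | "x0 < 0" "E x0 \<ge> 0" | "x0 < 0" "E x0 < 0" by linarith
        then show thesis
        proof cases
          case 1
          show thesis
          proof (rule that[of 1 "x0 + a"])
            fix y assume "\<bar>x0 + a - y\<bar> \<le> a"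
            then have y: "x0 \<le> y" "y - x0 \<le> 2 * a" by auto
            from R[OF 1(1) y(1)] step[OF y(2)] x0 1 show "\<Delta> / 2 \<le> 1 * E y" by linarith
          qed simp
        next
          case 2
          have "7/8 * \<Delta> < L * x0" using R[of 0 x0] E0 2 x0 by simp
          from far[OF this] have fx: "2 * a < x0" .
          show thesis
          proof (rule that[of "-1" "x0 - a"])
            fix y assume "\<bar>x0 - a - y\<bar> \<le> a"
            then have y: "0 \<le> y" "y \<le> x0" "x0 - y \<le> 2 * a" using fx by auto
            from R[OF y(1,2)] step[OF y(3)] x0 2 show "\<Delta> / 2 \<le> - 1 * E y" by linarith
          qed simp
        next
          case 3
          show thesis
          proof (rule that[of 1 "x0 - a"])
            fix y assume "\<bar>x0 - a - y\<bar> \<le> a"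
            then have y: "y \<le> x0" "x0 - y \<le> 2 * a" by auto
            from Lf[OF y(1)] step[OF y(2)] x0 3 show "\<Delta> / 2 \<le> 1 * E y" by linarith
          qed simp
        next
          case 4
          have "7/8 * \<Delta> < L * (- x0)" using Lf[of x0 0] E0 4 x0 by simp
          from far[OF this] have fx: "2 * a < - x0" .
          show thesis
          proof (rule that[of "-1" "x0 + a"])
            fix y assume "\<bar>x0 + a - y\<bar> \<le> a"
            then have y: "x0 \<le> y" "y \<le> 0" "y - x0 \<le> 2 * a" using fx by auto
            from Lf[OF y(1,2)] step[OF y(3)] x0 4 show "\<Delta> / 2 \<le> - 1 * E y" by linarith
          qed simp
        qed
      qed
      show ?thesis
      proof (cases "a \<ge> A")
        case True
        define P where "P = (\<integral>u. indicator {-a..a} u * fejer u \<partial>lborel)"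
        have P: "P \<ge> 7/8" unfolding P_def by (rule A(2)[OF True])
        have iP: "integrable lborel (\<lambda>u. indicator {-a..a} u * fejer u)"
          using integrable_mult_indicator[OF _ integrable_fejer, of "{-a..a}"] by simp
        have iL: "integrable lborel (\<lambda>u. 3/2 * \<Delta> * (indicator {-a..a} u * fejer u) - \<Delta> * fejer u)"
          by (intro Bochner_Integration.integrable_diff integrable_mult_right iP integrable_fejer)
        have iR: "integrable lborel (\<lambda>u. \<sigma> * (fejer u * E (x1 - u)))"
        proof (rule Bochner_Integration.integrable_bound[OF integrable_mult_right[OF integrable_fejer, of \<Delta>]])
          show "AE u in lborel. norm (\<sigma> * (fejer u * E (x1 - u))) \<le> norm (\<Delta> * fejer u)"
            using \<sigma> fejer_nonneg \<Delta>0 mult_right_mono[OF \<Delta> fejer_nonneg]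
            by (simp add: abs_mult mult.commute)
        qed measurable
        have "3/2 * \<Delta> * P - \<Delta> = (\<integral>u. 3/2 * \<Delta> * (indicator {-a..a} u * fejer u) - \<Delta> * fejer u \<partial>lborel)"
          unfolding P_def
          by (subst Bochner_Integration.integral_diff, intro integrable_mult_right iP, intro integrable_mult_right integrable_fejer)
            (simp only: integral_mult_right_zero integral_fejer mult_1_right)
        also have "\<dots> \<le> (\<integral>u. \<sigma> * (fejer u * E (x1 - u)) \<partial>lborel)"
        proof (rule integral_mono[OF iL iR])
          fix u :: real
          show "3/2 * \<Delta> * (indicator {-a..a} u * fejer u) - \<Delta> * fejer u \<le> \<sigma> * (fejer u * E (x1 - u))"
          proof (cases "\<bar>u\<bar> \<le> a")
            case True
            then have "\<Delta> / 2 \<le> \<sigma> * E (x1 - u)" by (intro x1) simp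
            then have "\<Delta> / 2 * fejer u \<le> \<sigma> * E (x1 - u) * fejer u" by (rule mult_right_mono) (rule fejer_nonneg)
            then show ?thesis using True by (simp add: indicator_def abs_le_iff algebra_simps)
          next
            case False
            have "- \<Delta> \<le> \<sigma> * E (x1 - u)"
            proof -
              have "\<bar>\<sigma> * E (x1 - u)\<bar> \<le> \<Delta>" using \<Delta> \<sigma> by (simp add: abs_mult)
              then show ?thesis by linarith
            qed
            then have "- \<Delta> * fejer u \<le> \<sigma> * E (x1 - u) * fejer u" by (rule mult_right_mono) (rule fejer_nonneg)
            then show ?thesis using False by (auto simp: indicator_def abs_le_iff algebra_simps)
          qed
        qed
        also have "\<dots> = \<sigma> * (\<integral>u. fejer u * E (x1 - u) \<partial>lborel)" by (rule integral_mult_right_zero)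
        also have "(\<integral>u. fejer u * E (x1 - u) \<partial>lborel) = (\<integral>y. fejer (x1 - y) * E y \<partial>lborel)"
          using lborel_integral_real_affine[of "-1" "\<lambda>u. fejer u * E (x1 - u)" x1] by simp
        also have "\<sigma> * (\<integral>y. fejer (x1 - y) * E y \<partial>lborel) \<le> J"
        proof -
          have "\<bar>\<sigma> * (\<integral>y. fejer (x1 - y) * E y \<partial>lborel)\<bar> \<le> J" using J[of x1] \<sigma> by (simp add: abs_mult)
          then show ?thesis by linarith
        qed
        finally have "3/2 * \<Delta> * P - \<Delta> \<le> J" .
        moreover have "3/2 * \<Delta> * (7/8) \<le> 3/2 * \<Delta> * P" using P \<Delta>0 by (intro mult_left_mono) auto
        ultimately have "\<Delta> \<le> 4 * J" using \<Delta>0 by linarith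
        also have "\<dots> \<le> (4 + 6 * A) * (J + L)" using A(1) J0 L by (intro mult_mono) auto
        finally show ?thesis .
      next
        case False
        then have "3 * \<Delta> < 16 * L * A" using L by (simp add: a_def field_simps)
        then have "\<Delta> \<le> 6 * A * L" using mult_pos_pos[OF L A(1)] by (simp add: mult_ac)
        also have "\<dots> \<le> (4 + 6 * A) * (J + L)" using A(1) J0 L by (intro mult_mono) auto
        finally show ?thesis .
      qed
    qed
    then show "\<forall>x. \<bar>E x\<bar> \<le> (4 + 6 * A) * (J + L)" using \<Delta> order_trans by blast
  qed (use A in auto)
qed

lemma weighted_one_sided_lipschitz:
  fixes F H g :: "real \<Rightarrow> real"
  assumes F: "mono F" and H: "\<And>x. (H has_real_derivative g x) (at x)"
    and m: "\<And>x. \<bar>x - c\<bar> * \<bar>g x\<bar> \<le> m" and d: "\<And>x. \<bar>F x - H x\<bar> \<le> \<delta>"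
  shows "c \<le> x \<Longrightarrow> x \<le> y \<Longrightarrow> (y - c) * (F y - H y) \<ge> (x - c) * (F x - H x) - (\<delta> + m) * (y - x)"
    and "x \<le> y \<Longrightarrow> y \<le> c \<Longrightarrow> (y - c) * (F y - H y) \<le> (x - c) * (F x - H x) + (\<delta> + m) * (y - x)"
proof -
  have mvt: "\<exists>z. x \<le> z \<and> z \<le> y \<and> (y - c) * H y - (x - c) * H x = (y - x) * (H z + (z - c) * g z)" if "x \<le> y" for x y
  proof (cases "x = y")
    case False
    with that have "x < y" by simp
    have "\<exists>z>x. z < y \<and> (y - c) * H y - (x - c) * H x = (y - x) * (H z + (z - c) * g z)"
      by (rule MVT2[OF \<open>x < y\<close>]) (auto intro!: derivative_eq_intros H)
    then show ?thesis by (meson less_imp_le)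
  qed auto
  have gb: "\<bar>(z - c) * g z\<bar> \<le> m" for z using m[of z] by (simp add: abs_mult)
  { assume xy: "c \<le> x" "x \<le> y"
    obtain z where z: "x \<le> z" "z \<le> y" "(y - c) * H y - (x - c) * H x = (y - x) * (H z + (z - c) * g z)"
      using mvt[OF xy(2)] by blast
    have "(x - c) * (F y - F x) \<ge> 0" using F xy by (intro mult_nonneg_nonneg) (auto simp: mono_def)
    moreover have "(y - c) * F y - (x - c) * F x = (x - c) * (F y - F x) + (y - x) * F y"
      by (simp add: algebra_simps)
    ultimately have 1: "(y - c) * F y - (x - c) * F x \<ge> (y - x) * F y" by linarith
    have "F z \<le> F y" using F z by (auto simp: mono_def)
    then have "F y - (H z + (z - c) * g z) \<ge> - (\<delta> + m)" using d[of z] gb[of z] by linarith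
    then have "(y - x) * (F y - (H z + (z - c) * g z)) \<ge> (y - x) * (- (\<delta> + m))" using xy by (intro mult_left_mono) auto
    then show "(y - c) * (F y - H y) \<ge> (x - c) * (F x - H x) - (\<delta> + m) * (y - x)"
      using 1 z(3) by (simp add: algebra_simps) }
  { assume xy: "x \<le> y" "y \<le> c"
    obtain z where z: "x \<le> z" "z \<le> y" "(y - c) * H y - (x - c) * H x = (y - x) * (H z + (z - c) * g z)"
      using mvt[OF xy(1)] by blast
    have "(c - y) * (F y - F x) \<ge> 0" using F xy by (intro mult_nonneg_nonneg) (auto simp: mono_def)
    moreover have "(y - c) * F y - (x - c) * F x = - ((c - y) * (F y - F x)) + (y - x) * F x"
      by (simp add: algebra_simps)
    ultimately have 1: "(y - c) * F y - (x - c) * F x \<le> (y - x) * F x" by linarith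
    have "F x \<le> F z" using F z by (auto simp: mono_def)
    then have "F x - (H z + (z - c) * g z) \<le> \<delta> + m" using d[of z] gb[of z] by linarith
    then have "(y - x) * (F x - (H z + (z - c) * g z)) \<le> (y - x) * (\<delta> + m)" using xy by (intro mult_left_mono) auto
    then show "(y - c) * (F y - H y) \<le> (x - c) * (F x - H x) + (\<delta> + m) * (y - x)"
      using 1 z(3) by (simp add: algebra_simps) }
qed

lemma weighted_esseen:
  obtains C0 :: real where "C0 > 0"
    "\<And>F H g D Z Z' \<beta> m J T. \<lbrakk>mono F; \<And>x. (H has_real_derivative g x) (at x); \<And>x. (1 + \<bar>x\<bar>) * \<bar>g x\<bar> \<le> m; m > 0;
      D = (\<lambda>x. F x - H x); \<exists>B. \<forall>x. (1 + \<bar>x\<bar>) * \<bar>D x\<bar> \<le> B; integrable lborel D;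
      Z = (\<lambda>t. \<integral>y. iexp (t * y) * complex_of_real (D y) \<partial>lborel);
      \<And>t. t \<noteq> 0 \<Longrightarrow> \<bar>t\<bar> < T \<Longrightarrow> (Z has_vector_derivative Z' t) (at t);
      Z' \<in> borel_measurable borel; integrable lborel \<beta>; \<And>t. 0 \<le> \<beta> t; (\<integral>t. \<beta> t \<partial>lborel) \<le> J;
      \<And>t. t \<noteq> 0 \<Longrightarrow> \<bar>t\<bar> < T \<Longrightarrow> cmod (Z t) + cmod (Z' t) \<le> \<beta> t; C0 \<le> T\<rbrakk>
      \<Longrightarrow> (\<forall>x::real. (1 + \<bar>x\<bar>) * \<bar>D x\<bar> \<le> C0 * (J + m / T))"
proof -
  obtain K :: real where K: "K > 0" and core:
    "\<And>E L J. \<lbrakk>E \<in> borel_measurable borel; \<exists>B. \<forall>x. \<bar>E x\<bar> \<le> B; L > 0; E 0 = 0;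
       \<And>x y. 0 \<le> x \<Longrightarrow> x \<le> y \<Longrightarrow> E y \<ge> E x - L * (y - x);
       \<And>x y. x \<le> y \<Longrightarrow> y \<le> 0 \<Longrightarrow> E y \<le> E x + L * (y - x);
       \<And>x. \<bar>\<integral>y. fejer (x - y) * E y \<partial>lborel\<bar> \<le> J\<rbrakk> \<Longrightarrow> (\<forall>x::real. \<bar>E x\<bar> \<le> K * (J + L))"
    using esseen_core by blast
  show thesis
  proof (rule that[of "4 * K"])
    fix F H g D :: "real \<Rightarrow> real" and Z Z' :: "real \<Rightarrow> complex" and \<beta> :: "real \<Rightarrow> real" and m J T :: real
    assume F: "mono F" and H: "\<And>x. (H has_real_derivative g x) (at x)" and gm: "\<And>x. (1 + \<bar>x\<bar>) * \<bar>g x\<bar> \<le> m"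
      and m: "m > 0" and D: "D = (\<lambda>x. F x - H x)" and bdd: "\<exists>B. \<forall>x. (1 + \<bar>x\<bar>) * \<bar>D x\<bar> \<le> B"
      and iD: "integrable lborel D" and Z: "Z = (\<lambda>t. \<integral>y. iexp (t * y) * complex_of_real (D y) \<partial>lborel)"
      and d: "\<And>t. t \<noteq> 0 \<Longrightarrow> \<bar>t\<bar> < T \<Longrightarrow> (Z has_vector_derivative Z' t) (at t)"
      and mZ' [measurable]: "Z' \<in> borel_measurable borel" and i\<beta>: "integrable lborel \<beta>" and \<beta>0: "\<And>t. 0 \<le> \<beta> t"
      and \<beta>J: "(\<integral>t. \<beta> t \<partial>lborel) \<le> J"
      and le\<beta>: "\<And>t. t \<noteq> 0 \<Longrightarrow> \<bar>t\<bar> < T \<Longrightarrow> cmod (Z t) + cmod (Z' t) \<le> \<beta> t" and T: "4 * K \<le> T"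
    have T0: "T > 0" using K T by linarith
    have mD [measurable]: "D \<in> borel_measurable borel" using iD by simp
    have mZ [measurable]: "Z \<in> borel_measurable borel" unfolding Z by measurable
    define B where "B = (SUP x. (1 + \<bar>x\<bar>) * \<bar>D x\<bar>)"
    have bd: "bdd_above (range (\<lambda>x. (1 + \<bar>x\<bar>) * \<bar>D x\<bar>))" using bdd by auto
    have B: "(1 + \<bar>x\<bar>) * \<bar>D x\<bar> \<le> B" for x unfolding B_def by (rule cSUP_upper[OF _ bd]) simp
    have DB: "\<bar>D x\<bar> \<le> B" for x
    proof -
      have "1 * \<bar>D x\<bar> \<le> (1 + \<bar>x\<bar>) * \<bar>D x\<bar>" by (intro mult_right_mono) auto
      with B[of x] show ?thesis by linarith
    qed
    have B0: "B \<ge> 0" using DB[of 0] by linarith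
    have main: "T * (\<bar>v - c\<bar> * \<bar>D v\<bar>) \<le> K * (T * J + (B + m))" if c: "\<bar>c\<bar> = 1" for c v
    proof -
      have wc: "\<bar>v - c\<bar> \<le> 1 + \<bar>v\<bar>" for v using c abs_triangle_ineq4[of v c] by linarith
      define E where "E y = y * D (y / T + c)" for y
      have Ev: "E y = T * (((y / T + c) - c) * (F (y / T + c) - H (y / T + c)))" for y
        using T0 by (simp add: E_def D)
      have "\<bar>x - c\<bar> * \<bar>g x\<bar> \<le> m" for x
        using mult_right_mono[OF wc[of x], of "\<bar>g x\<bar>"] gm[of x] by simp
      note lip = weighted_one_sided_lipschitz[OF F H this, of B]
      have DB': "\<bar>F x - H x\<bar> \<le> B" for x using DB by (simp add: D)
      have Tm: "(y / T + c) - (x / T + c) = (y - x) / T" for x y by (simp add: diff_divide_distrib)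
      have iD1: "integrable lborel (\<lambda>y. D (y / T + c))"
        using lborel_integrable_real_affine[OF iD, of "1 / T" c] T0 by (simp add: add.commute)
      have ED: "\<bar>y * D (y / T + c)\<bar> \<le> T * B" for y
      proof -
        have "\<bar>y * D (y / T + c)\<bar> = T * (\<bar>(y / T + c) - c\<bar> * \<bar>D (y / T + c)\<bar>)"
          using T0 by (simp add: abs_mult)
        also have "\<dots> \<le> T * ((1 + \<bar>y / T + c\<bar>) * \<bar>D (y / T + c)\<bar>)"
          using T0 by (intro mult_left_mono mult_right_mono wc) auto
        also have "\<dots> \<le> T * B" using T0 B by (intro mult_left_mono) auto
        finally show ?thesis .
      qed
      define Z1 where "Z1 t = of_real T * (iexp (- (t * (T * c))) * Z (T * t))" for t
      define Z1' where "Z1' t = of_real T * (iexp (- (t * (T * c))) * (T *\<^sub>R Z' (T * t)) + (- \<i> * (T * c)) * iexp (- (t * (T * c))) * Z (T * t))" for t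
      have Z1: "Z1 = (\<lambda>t. \<integral>y. iexp (t * y) * complex_of_real (D (y / T + c)) \<partial>lborel)"
      proof (rule ext)
        fix t
        have "(\<integral>y. iexp (t * y) * complex_of_real (D (y / T + c)) \<partial>lborel)
          = \<bar>T\<bar> *\<^sub>R (\<integral>v. iexp (t * (- (T * c) + T * v)) * complex_of_real (D ((- (T * c) + T * v) / T + c)) \<partial>lborel)"
          using T0 by (intro lborel_integral_real_affine) auto
        also have "(\<integral>v. iexp (t * (- (T * c) + T * v)) * complex_of_real (D ((- (T * c) + T * v) / T + c)) \<partial>lborel)
          = (\<integral>v. iexp (- (t * (T * c))) * (iexp (T * t * v) * complex_of_real (D v)) \<partial>lborel)"
        proof (intro Bochner_Integration.integral_cong refl)
          fix v
          have 1: "(- (T * c) + T * v) / T + c = v" using T0 by (simp add: field_simps)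
          have "iexp (t * (- (T * c) + T * v)) = iexp (- (t * (T * c))) * iexp (T * t * v)"
            by (simp add: exp_add[symmetric] algebra_simps)
          then show "iexp (t * (- (T * c) + T * v)) * complex_of_real (D ((- (T * c) + T * v) / T + c))
             = iexp (- (t * (T * c))) * (iexp (T * t * v) * complex_of_real (D v))"
            unfolding 1 by (simp only: mult.assoc)
        qed
        also have "\<dots> = iexp (- (t * (T * c))) * Z (T * t)" unfolding Z by (rule integral_mult_right_zero)
        finally show "Z1 t = (\<integral>y. iexp (t * y) * complex_of_real (D (y / T + c)) \<partial>lborel)"
          using T0 by (simp add: Z1_def scaleR_conv_of_real)
      qed
      have d1: "(Z1 has_vector_derivative Z1' t) (at t)" if t: "t \<noteq> 0" "\<bar>t\<bar> < 1" for t
      proof -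
        have "\<bar>T * t\<bar> < T" "T * t \<noteq> 0" using t T0 by (auto simp: abs_mult)
        then have "(Z has_vector_derivative Z' (T * t)) (at (T * t))" by (intro d)
        moreover have "((\<lambda>t. T * t) has_vector_derivative T) (at t)"
          by (auto intro!: derivative_eq_intros simp: has_real_derivative_iff_has_vector_derivative[symmetric])
        ultimately have zc: "((\<lambda>t. Z (T * t)) has_vector_derivative T *\<^sub>R Z' (T * t)) (at t)"
          using vector_diff_chain_at[of "\<lambda>t. T * t" T t Z] by (simp add: comp_def)
        show ?thesis unfolding Z1_def[abs_def] Z1'_def
          by (rule has_vector_derivative_mult_right[OF has_vector_derivative_mult[OF has_vector_derivative_iexp_minus zc]])
      qed
      have le1: "cmod (complex_of_real (tri t) * Z1' t) \<le> T\<^sup>2 * \<beta> (0 + T * t)" if "t \<noteq> 0" for t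
      proof (cases "\<bar>t\<bar> < 1")
        case True
        have tt: "\<bar>T * t\<bar> < T" "T * t \<noteq> 0" using that True T0 by (auto simp: abs_mult)
        have "cmod (Z1' t) \<le> T * (cmod (iexp (- (t * (T * c))) * (T *\<^sub>R Z' (T * t))) + cmod ((- \<i> * (T * c)) * iexp (- (t * (T * c))) * Z (T * t)))"
        proof -
          have "cmod (of_real T * (X + Y)) \<le> T * (cmod X + cmod Y)" for X Y :: complex
            unfolding norm_mult using T0 by (auto intro!: mult_left_mono norm_triangle_ineq)
          then show ?thesis unfolding Z1'_def .
        qed
        also have "\<dots> = T * (T * cmod (Z' (T * t)) + T * cmod (Z (T * t)))"
          using T0 c by (simp add: norm_mult abs_mult)
        also have "\<dots> = T\<^sup>2 * (cmod (Z (T * t)) + cmod (Z' (T * t)))" by (simp add: power2_eq_square algebra_simps)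
        also have "\<dots> \<le> T\<^sup>2 * \<beta> (T * t)" using le\<beta>[OF tt(2,1)] by (intro mult_left_mono) auto
        finally have 1: "cmod (Z1' t) \<le> T\<^sup>2 * \<beta> (T * t)" .
        have "\<bar>tri t\<bar> \<le> 1" by (simp add: tri_def)
        then have "cmod (complex_of_real (tri t) * Z1' t) \<le> 1 * cmod (Z1' t)"
          unfolding norm_mult by (intro mult_right_mono) auto
        with 1 show ?thesis by simp
      next
        case False
        then show ?thesis using \<beta>0 by (simp add: tri_def)
      qed
      have i\<beta>1: "integrable lborel (\<lambda>t. T\<^sup>2 * \<beta> (0 + T * t))"
        using lborel_integrable_real_affine[OF i\<beta>, of T 0] T0 by (intro integrable_mult_right) auto
      have ae: "AE t in lborel. cmod (complex_of_real (tri t) * Z1' t) \<le> T\<^sup>2 * \<beta> (0 + T * t)"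
        using AE_lborel_singleton[of 0] by eventually_elim (rule le1)
      have i1: "integrable lborel (\<lambda>t. complex_of_real (tri t) * Z1' t)"
      proof (rule Bochner_Integration.integrable_bound[OF i\<beta>1])
        show "(\<lambda>t. complex_of_real (tri t) * Z1' t) \<in> borel_measurable lborel"
          unfolding Z1'_def by measurable
        show "AE t in lborel. cmod (complex_of_real (tri t) * Z1' t) \<le> norm (T\<^sup>2 * \<beta> (0 + T * t))"
          using ae by eventually_elim (use \<beta>0 in auto)
      qed
      have J1: "(\<integral>t. cmod (complex_of_real (tri t) * Z1' t) \<partial>lborel) \<le> T * J"
      proof -
        have "(\<integral>t. cmod (complex_of_real (tri t) * Z1' t) \<partial>lborel) \<le> (\<integral>t. T\<^sup>2 * \<beta> (0 + T * t) \<partial>lborel)"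
          by (rule integral_mono_AE[OF integrable_norm[OF i1] i\<beta>1 ae])
        also have "\<dots> = T * (\<bar>T\<bar> *\<^sub>R (\<integral>t. \<beta> (0 + T * t) \<partial>lborel))"
          using T0 by (simp add: power2_eq_square mult.assoc)
        also have "\<dots> = T * (\<integral>t. \<beta> t \<partial>lborel)"
          using T0 by (subst lborel_integral_real_affine[of T \<beta> 0, symmetric]) auto
        also have "\<dots> \<le> T * J" using \<beta>J T0 by (intro mult_left_mono) auto
        finally show ?thesis .
      qed
      have "\<forall>x. \<bar>E x\<bar> \<le> K * (T * J + (B + m))"
      proof (rule core)
        show "E \<in> borel_measurable borel" unfolding E_def by measurable
        show "\<exists>B. \<forall>x. \<bar>E x\<bar> \<le> B" using ED unfolding E_def by blast
        show "B + m > 0" using B0 m by linarith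
        show "E 0 = 0" by (simp add: E_def)
        show "E y \<ge> E x - (B + m) * (y - x)" if "0 \<le> x" "x \<le> y" for x y
        proof -
          have "((y / T + c) - c) * (F (y / T + c) - H (y / T + c)) \<ge> ((x / T + c) - c) * (F (x / T + c) - H (x / T + c)) - (B + m) * ((y / T + c) - (x / T + c))"
            using that T0 by (intro lip(1) DB') (auto simp: divide_right_mono)
          then have "E y \<ge> T * (((x / T + c) - c) * (F (x / T + c) - H (x / T + c)) - (B + m) * ((y / T + c) - (x / T + c)))"
            unfolding Ev using T0 by (intro mult_left_mono) auto
          also have "T * (((x / T + c) - c) * (F (x / T + c) - H (x / T + c)) - (B + m) * ((y / T + c) - (x / T + c))) = E x - (B + m) * (y - x)"
            unfolding Ev Tm right_diff_distrib[of T] using T0 by simp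
          finally show ?thesis .
        qed
        show "E y \<le> E x + (B + m) * (y - x)" if "x \<le> y" "y \<le> 0" for x y
        proof -
          have "((y / T + c) - c) * (F (y / T + c) - H (y / T + c)) \<le> ((x / T + c) - c) * (F (x / T + c) - H (x / T + c)) + (B + m) * ((y / T + c) - (x / T + c))"
            using that T0 by (intro lip(2) DB') (auto simp: divide_right_mono divide_nonpos_pos)
          then have "E y \<le> T * (((x / T + c) - c) * (F (x / T + c) - H (x / T + c)) + (B + m) * ((y / T + c) - (x / T + c)))"
            unfolding Ev using T0 by (intro mult_left_mono) auto
          also have "T * (((x / T + c) - c) * (F (x / T + c) - H (x / T + c)) + (B + m) * ((y / T + c) - (x / T + c))) = E x + (B + m) * (y - x)"
            unfolding Ev Tm distrib_left[of T] using T0 by simp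
          finally show ?thesis .
        qed
        show "\<bar>\<integral>y. fejer (x - y) * E y \<partial>lborel\<bar> \<le> T * J" for x
          unfolding E_def by (rule fejer_smoothing_bound[OF iD1 ED Z1 d1 i1 J1])
      qed
      then have "\<bar>E (T * (v - c))\<bar> \<le> K * (T * J + (B + m))" by blast
      then show ?thesis using T0 by (simp add: E_def abs_mult mult.assoc)
    qed
    have pt: "(1 + \<bar>v\<bar>) * \<bar>D v\<bar> \<le> 2 * K * (J + (B + m) / T)" for v
    proof -
      have "(1 + \<bar>v\<bar>) * \<bar>D v\<bar> \<le> (\<bar>v - 1\<bar> + \<bar>v - (-1)\<bar>) * \<bar>D v\<bar>" by (intro mult_right_mono) auto
      then have "T * ((1 + \<bar>v\<bar>) * \<bar>D v\<bar>) \<le> T * ((\<bar>v - 1\<bar> + \<bar>v - (-1)\<bar>) * \<bar>D v\<bar>)" using T0 by (intro mult_left_mono) auto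
      also have "\<dots> = T * (\<bar>v - 1\<bar> * \<bar>D v\<bar>) + T * (\<bar>v - (-1)\<bar> * \<bar>D v\<bar>)" by (simp only: distrib_left distrib_right)
      also have "\<dots> \<le> 2 * (K * (T * J + (B + m)))" using main[of 1 v] main[of "-1" v] by simp
      also have "\<dots> = T * (2 * K * (J + (B + m) / T))" using T0 by (simp add: field_simps)
      finally show ?thesis using T0 by (simp only: mult_le_cancel_left_pos)
    qed
    have "B \<le> 2 * K * (J + (B + m) / T)" unfolding B_def by (rule cSUP_least) (use pt in \<open>auto simp: B_def\<close>)
    also have "\<dots> = 2 * K * (J + m / T) + (2 * K / T) * B" using T0 by (simp add: field_simps)
    also have "(2 * K / T) * B \<le> 1/2 * B" using T T0 B0 by (intro mult_right_mono) (auto simp: field_simps)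
    finally have "B \<le> 4 * K * (J + m / T)" by linarith
    then show "\<forall>x. (1 + \<bar>x\<bar>) * \<bar>D x\<bar> \<le> 4 * K * (J + m / T)" using B order_trans by blast
  qed (use K in auto)
qed

section \<open>The generalised Petersburg law\<close>

lemma vector_derivative_series:
  fixes f f' :: "nat \<Rightarrow> real \<Rightarrow> complex"
  assumes d: "\<And>j x. \<bar>x\<bar> < K \<Longrightarrow> (f j has_vector_derivative f' j x) (at x)"
    and M: "\<And>j x. \<bar>x\<bar> < K \<Longrightarrow> cmod (f' j x) \<le> M j" "summable M" and s0: "summable (\<lambda>j. f j 0)"
    and x: "\<bar>x\<bar> < K"
  shows "((\<lambda>x. \<Sum>j. f j x) has_vector_derivative (\<Sum>j. f' j x)) (at x)"
proof -
  let ?S = "{-K<..<K}"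
  have K: "K > 0" using x by linarith
  have ul: "uniform_limit ?S (\<lambda>n x. \<Sum>i<n. f' i x) (\<lambda>x. \<Sum>i. f' i x) sequentially"
    by (rule Weierstrass_m_test[OF _ M(2)]) (use M(1) in auto)
  have "\<exists>g. \<forall>x\<in>?S. (\<lambda>n. f n x) sums (g x) \<and> (g has_derivative (\<lambda>h. h *\<^sub>R (\<Sum>i. f' i x))) (at x within ?S)"
  proof (rule has_derivative_series)
    show "convex ?S" by simp
    show "(f n has_derivative (\<lambda>h. h *\<^sub>R f' n x)) (at x within ?S)" if "x \<in> ?S" for n x
      using d[of x n] that unfolding has_vector_derivative_def by (auto intro: has_derivative_at_withinI)
    show "\<forall>\<^sub>F n in sequentially. \<forall>x\<in>?S. \<forall>h. cmod ((\<Sum>i<n. h *\<^sub>R f' i x) - h *\<^sub>R (\<Sum>i. f' i x)) \<le> e * norm h" if "e > 0" for e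
      using uniform_limitD[OF ul that]
    proof eventually_elim
      case (elim n)
      show ?case
      proof (intro ballI allI)
        fix x h assume "x \<in> ?S"
        with elim have "cmod ((\<Sum>i<n. f' i x) - (\<Sum>i. f' i x)) \<le> e" by (force simp: dist_norm)
        then have "\<bar>h\<bar> * cmod ((\<Sum>i<n. f' i x) - (\<Sum>i. f' i x)) \<le> \<bar>h\<bar> * e" by (rule mult_left_mono) simp
        then show "cmod ((\<Sum>i<n. h *\<^sub>R f' i x) - h *\<^sub>R (\<Sum>i. f' i x)) \<le> e * norm h"
          by (simp add: scaleR_sum_right[symmetric] scaleR_diff_right[symmetric] mult.commute)
      qed
    qed
    show "0 \<in> ?S" using K by simp
    show "(\<lambda>n. f n 0) sums (\<Sum>n. f n 0)" using s0 by (rule summable_sums)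
  qed
  then obtain g where g: "\<And>x. x \<in> ?S \<Longrightarrow> (\<lambda>n. f n x) sums (g x)"
    "\<And>x. x \<in> ?S \<Longrightarrow> (g has_derivative (\<lambda>h. h *\<^sub>R (\<Sum>i. f' i x))) (at x within ?S)" by blast
  have xS: "x \<in> ?S" using x by auto
  have "(g has_vector_derivative (\<Sum>j. f' j x)) (at x)"
    using g(2)[OF xS] at_within_open[OF xS open_greaterThanLessThan] by (simp add: has_vector_derivative_def)
  moreover have "g y = (\<Sum>j. f j y)" if "y \<in> ?S" for y using g(1)[OF that] by (simp add: sums_iff)
  ultimately show ?thesis
    using has_vector_derivative_transform_within_open[OF _ open_greaterThanLessThan xS] by metis
qed

lemma continuous_on_series:
  fixes f :: "nat \<Rightarrow> 'a::topological_space \<Rightarrow> complex"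
  assumes "\<And>j. continuous_on S (f j)" "\<And>j x. x \<in> S \<Longrightarrow> cmod (f j x) \<le> M j" "summable M"
  shows "continuous_on S (\<lambda>x. \<Sum>j. f j x)"
proof (rule uniform_limit_theorem)
  show "uniform_limit S (\<lambda>n x. \<Sum>i<n. f i x) (\<lambda>x. \<Sum>j. f j x) sequentially"
    by (rule Weierstrass_m_test[OF assms(2,3)])
  show "\<forall>\<^sub>F n in sequentially. continuous_on S (\<lambda>x. \<Sum>i<n. f i x)"
    by (intro always_eventually allI continuous_on_sum assms(1))
qed simp

lemma norm_suminf_le_suminf:
  fixes f :: "nat \<Rightarrow> complex"
  assumes "\<And>j. cmod (f j) \<le> M j" "summable M"
  shows "cmod (\<Sum>j. f j) \<le> (\<Sum>j. M j)"
proof -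
  have s: "summable (\<lambda>j. cmod (f j))" using assms by (intro summable_comparison_test'[OF assms(2), of 0]) auto
  have "cmod (\<Sum>j. f j) \<le> (\<Sum>j. cmod (f j))" by (rule summable_norm[OF s])
  also have "\<dots> \<le> (\<Sum>j. M j)" by (rule suminf_le[OF assms(1) s assms(2)])
  finally show ?thesis .
qed

lemma has_vector_derivative_iexp_linear:
  "((\<lambda>s. iexp (s * c)) has_vector_derivative \<i> * of_real c * iexp (s * c)) (at s within S)"
proof -
  have "((\<lambda>z. exp (\<i> * (z * of_real c))) has_field_derivative \<i> * of_real c * exp (\<i> * (of_real s * of_real c))) (at (of_real s))"
    by (auto intro!: derivative_eq_intros)
  from has_vector_derivative_real_field[OF this] show ?thesis by simp
qed

lemma norm_exp_minus_1_le_Re: "cmod (exp z - 1) \<le> cmod z * exp \<bar>Re z\<bar>" for z :: complex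
proof -
  have "cmod (exp z - exp 0) \<le> exp \<bar>Re z\<bar> * cmod (z - 0)"
  proof (rule field_differentiable_bound[of "closed_segment 0 z"])
    fix w assume "w \<in> closed_segment 0 z"
    then obtain u where "0 \<le> u" "u \<le> 1" "w = of_real u * z" by (auto simp: in_segment scaleR_conv_of_real)
    then have "\<bar>Re w\<bar> \<le> \<bar>Re z\<bar>" by (simp add: abs_mult mult_left_le_one_le)
    then show "cmod (exp w) \<le> exp \<bar>Re z\<bar>" by simp
  qed (auto intro!: derivative_eq_intros)
  then show ?thesis by (simp add: mult.commute)
qed

lemma norm_exp_minus_1_minus_le_Re: "cmod (exp z - 1 - z) \<le> (cmod z)\<^sup>2 * exp \<bar>Re z\<bar>" for z :: complex
proof -
  have "cmod ((exp z - z) - (exp 0 - 0)) \<le> (cmod z * exp \<bar>Re z\<bar>) * cmod (z - 0)"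
  proof (rule field_differentiable_bound[of "closed_segment 0 z"])
    fix w assume "w \<in> closed_segment 0 z"
    then obtain u where u: "0 \<le> u" "u \<le> 1" "w = of_real u * z" by (auto simp: in_segment scaleR_conv_of_real)
    then have 1: "\<bar>Re w\<bar> \<le> \<bar>Re z\<bar>" by (simp add: abs_mult mult_left_le_one_le)
    have 2: "cmod w \<le> cmod z" using u by (simp add: norm_mult mult_left_le_one_le)
    have "cmod w * exp \<bar>Re w\<bar> \<le> cmod z * exp \<bar>Re z\<bar>" using 1 2 by (intro mult_mono) auto
    with norm_exp_minus_1_le_Re[of w] show "cmod (exp w - 1) \<le> cmod z * exp \<bar>Re z\<bar>" by linarith
  qed (auto intro!: derivative_eq_intros)
  moreover have "exp z - z - (exp 0 - 0) = exp z - 1 - z" by simp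
  ultimately have "cmod (exp z - 1 - z) \<le> (cmod z * exp \<bar>Re z\<bar>) * cmod (z - 0)" by (simp only:)
  then show ?thesis by (simp add: power2_eq_square mult_ac)
qed

lemma norm_exp_minus_1_le: "cmod (exp z - 1) \<le> cmod z * exp (cmod z)" for z :: complex
  using norm_exp_minus_1_le_Re[of z] mult_left_mono[of "exp \<bar>Re z\<bar>" "exp (cmod z)" "cmod z"] abs_Re_le_cmod[of z]
  by simp

lemma norm_exp_minus_1_minus_le: "cmod (exp z - 1 - z) \<le> (cmod z)\<^sup>2 * exp (cmod z)" for z :: complex
  using norm_exp_minus_1_minus_le_Re[of z] mult_left_mono[of "exp \<bar>Re z\<bar>" "exp (cmod z)" "(cmod z)\<^sup>2"] abs_Re_le_cmod[of z]
  by simp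

lemma vector_mean_value_bound:
  fixes f f' :: "real \<Rightarrow> complex"
  assumes d: "\<And>t. \<bar>t\<bar> \<le> \<bar>s\<bar> \<Longrightarrow> (f has_vector_derivative f' t) (at t)"
    and B: "\<And>t. \<bar>t\<bar> \<le> \<bar>s\<bar> \<Longrightarrow> cmod (f' t) \<le> B"
  shows "cmod (f s - f 0) \<le> B * \<bar>s\<bar>"
proof -
  have "cmod (f s - f 0) \<le> B * norm (s - 0)"
  proof (rule differentiable_bound[of "{- \<bar>s\<bar>..\<bar>s\<bar>}" f "\<lambda>t h. h *\<^sub>R f' t"])
    fix t assume "t \<in> {- \<bar>s\<bar>..\<bar>s\<bar>}"
    then have t: "\<bar>t\<bar> \<le> \<bar>s\<bar>" by auto
    show "(f has_derivative (\<lambda>h. h *\<^sub>R f' t)) (at t within {- \<bar>s\<bar>..\<bar>s\<bar>})"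
      using d[OF t] unfolding has_vector_derivative_def by (rule has_derivative_at_withinI)
    show "onorm (\<lambda>h. h *\<^sub>R f' t) \<le> B"
    proof (rule onorm_le)
      show "cmod (h *\<^sub>R f' t) \<le> B * norm h" for h
        using mult_right_mono[OF B[OF t], of "\<bar>h\<bar>"] by (simp add: mult.commute)
    qed
  qed auto
  then show ?thesis by simp
qed

definition Alg :: "complex \<Rightarrow> complex" where "Alg w = Ln (1 + w) - w + w\<^sup>2 / 2"

lemma Alg_deriv: "cmod w < 1 \<Longrightarrow> (Alg has_field_derivative w\<^sup>2 / (1 + w)) (at w)"
proof -
  assume w: "cmod w < 1"
  have nz: "1 + w \<noteq> 0" using w by (metis add_eq_0_iff norm_minus_cancel norm_one less_irrefl)
  have "1 + w \<notin> \<real>\<^sub>\<le>\<^sub>0"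
  proof
    assume "1 + w \<in> \<real>\<^sub>\<le>\<^sub>0"
    then have "Re (1 + w) \<le> 0" by (simp add: complex_nonpos_Reals_iff)
    then show False using abs_Re_le_cmod[of w] w by simp
  qed
  then have "((\<lambda>w. Ln (1 + w)) has_field_derivative 1 / (1 + w)) (at w)"
    by (auto intro!: derivative_eq_intros simp: inverse_eq_divide)
  moreover have "((\<lambda>w. w\<^sup>2 / 2) has_field_derivative w) (at w)"
    by (auto intro!: derivative_eq_intros)
  ultimately have "(Alg has_field_derivative 1 / (1 + w) - 1 + w) (at w)"
    unfolding Alg_def[abs_def] by (intro DERIV_add DERIV_diff DERIV_ident)
  moreover have "1 / (1 + w) - 1 + w = w\<^sup>2 / (1 + w)" using nz by (simp add: field_simps power2_eq_square)
  ultimately show ?thesis by simp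
qed

lemma Alg'_bound: "cmod w \<le> 1/2 \<Longrightarrow> cmod (w\<^sup>2 / (1 + w)) \<le> 2 * (cmod w)\<^sup>2"
proof -
  assume w: "cmod w \<le> 1/2"
  have "1 - cmod w \<le> cmod (1 + w)" using norm_triangle_ineq2[of 1 "- w"] by simp
  then have "1/2 \<le> cmod (1 + w)" using w by linarith
  then have "(cmod w)\<^sup>2 / cmod (1 + w) \<le> (cmod w)\<^sup>2 / (1/2)" by (intro divide_left_mono) auto
  then show ?thesis by (simp add: norm_divide norm_power)
qed

lemma Alg_bound: "cmod w \<le> 1/2 \<Longrightarrow> cmod (Alg w) \<le> 2 * (cmod w) ^ 3"
proof -
  assume w: "cmod w \<le> 1/2"
  have "cmod (Alg w - Alg 0) \<le> (2 * (cmod w)\<^sup>2) * cmod (w - 0)"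
  proof (rule field_differentiable_bound[of "cball 0 (cmod w)" Alg "\<lambda>w. w\<^sup>2 / (1 + w)"])
    fix z :: complex assume "z \<in> cball 0 (cmod w)"
    then have z: "cmod z \<le> cmod w" by simp
    show "(Alg has_field_derivative z\<^sup>2 / (1 + z)) (at z within cball 0 (cmod w))"
      using Alg_deriv[of z] z w by (auto intro: has_field_derivative_at_within)
    have "cmod (z\<^sup>2 / (1 + z)) \<le> 2 * (cmod z)\<^sup>2" using z w by (intro Alg'_bound) auto
    also have "\<dots> \<le> 2 * (cmod w)\<^sup>2" using z by (simp add: power_mono)
    finally show "cmod (z\<^sup>2 / (1 + z)) \<le> 2 * (cmod w)\<^sup>2" .
  qed auto
  then show ?thesis by (simp add: Alg_def power2_eq_square power3_eq_cube mult_ac)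
qed

locale petersburg =
  fixes p \<alpha> :: real
  assumes p: "0 < p" "p < 1" and \<alpha>: "1 < \<alpha>" "\<alpha> < 2"
begin

definition "q = 1 - p"
definition "r = 1 / q"
definition "\<rho> = r powr (1 / \<alpha>)"
definition "b = 1 / \<rho>"
definition "\<mu> = mu \<alpha> p 1"
definition "\<mu>2 = mu \<alpha> p 2"

lemma q: "0 < q" "q < 1" using p by (auto simp: q_def)
lemma r: "1 < r" "r * q = 1" using q by (auto simp: r_def)
lemma qq_rr: "qq p = q" "rr p = r" by (simp_all add: qq_def rr_def q_def r_def)
lemma \<rho>: "1 < \<rho>" unfolding \<rho>_def using r \<alpha> by (intro gr_one_powr) auto
lemma b: "0 < b" "b < 1" "b * \<rho> = 1" using \<rho> by (auto simp: b_def)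

lemma \<rho>_powr: "\<rho> powr \<alpha> = r"
  using r \<alpha> by (simp add: \<rho>_def powr_powr)

lemma q\<rho>: "q * \<rho> < 1" "0 < q * \<rho>"
proof -
  have "r powr (1 / \<alpha>) < r powr 1" using r \<alpha> by (intro powr_less_mono) (auto simp: field_simps)
  then have "q * \<rho> < q * r" unfolding \<rho>_def using q r by (intro mult_strict_left_mono) auto
  then show "q * \<rho> < 1" using r by (simp add: mult.commute)
  show "0 < q * \<rho>" using q \<rho> by simp
qed

lemma rb2: "r * b\<^sup>2 < 1" "0 < r * b\<^sup>2"
proof -
  have "\<rho>\<^sup>2 = r powr (2 / \<alpha>)"
    using r \<alpha> \<rho> by (simp add: \<rho>_def power2_eq_square powr_add[symmetric])
  moreover have "r powr 1 < r powr (2 / \<alpha>)" using r \<alpha> by (intro powr_less_mono) (auto simp: field_simps)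
  ultimately have "r < \<rho>\<^sup>2" using r by simp
  then show "r * b\<^sup>2 < 1" using \<rho> by (simp add: b_def power_divide)
  show "0 < r * b\<^sup>2" using r b by simp
qed

lemma sums_\<mu>: "(\<lambda>j. \<rho> ^ (j + 1) * (p * q ^ j)) sums \<mu>"
proof -
  have "(\<lambda>j. (\<rho> * p) * (q * \<rho>) ^ j) sums ((\<rho> * p) * (1 / (1 - q * \<rho>)))"
    using q\<rho> by (intro sums_mult geometric_sums) auto
  moreover have "(\<rho> * p) * (1 / (1 - q * \<rho>)) = \<mu>"
  proof -
    have "q powr (1 / \<alpha>) = b" unfolding b_def \<rho>_def r_def using q by (simp add: powr_divide)
    then have "\<mu> = p / (b - q)" by (simp add: \<mu>_def mu_def qq_rr)
    also have "b - q = (1 - q * \<rho>) / \<rho>" using \<rho> by (simp add: b_def field_simps)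
    finally show ?thesis by simp
  qed
  ultimately show ?thesis by (simp add: power_mult_distrib mult_ac)
qed

lemma sums_\<mu>2: "(\<lambda>j. (b ^ j)\<^sup>2 * (p / q * r ^ j)) sums (- \<mu>2)"
proof -
  have A: "(\<lambda>j. (p / q) * (r * b\<^sup>2) ^ j) sums ((p / q) * (1 / (1 - r * b\<^sup>2)))"
    using rb2 by (intro sums_mult geometric_sums) auto
  have B: "(p / q) * (1 / (1 - r * b\<^sup>2)) = - \<mu>2"
  proof -
    have "q powr (2 / \<alpha>) = (q powr (1 / \<alpha>))\<^sup>2" using q by (simp add: power2_eq_square powr_add[symmetric])
    also have "q powr (1 / \<alpha>) = b" unfolding b_def \<rho>_def r_def using q by (simp add: powr_divide)
    finally have "\<mu>2 = p / (b\<^sup>2 - q)" by (simp add: \<mu>2_def mu_def qq_rr)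
    also have "b\<^sup>2 - q = - (q * (1 - r * b\<^sup>2))" using r by (simp add: algebra_simps)
    finally show ?thesis by simp
  qed
  have C: "(\<lambda>j. (p / q) * (r * b\<^sup>2) ^ j) = (\<lambda>j. (b ^ j)\<^sup>2 * (p / q * r ^ j))"
    by (rule ext) (simp add: power_mult_distrib power_mult[symmetric] mult.commute)
  show ?thesis using A unfolding B C .
qed

definition \<phi> :: "real \<Rightarrow> complex" where
  "\<phi> s = (\<Sum>j. iexp (s * \<rho> ^ (j + 1)) * of_real (p * q ^ j))"
definition \<phi>' :: "real \<Rightarrow> complex" where
  "\<phi>' s = (\<Sum>j. \<i> * of_real (\<rho> ^ (j + 1)) * iexp (s * \<rho> ^ (j + 1)) * of_real (p * q ^ j))"
text \<open>The Levy exponent \<open>y1\<close> of the limit law for \<open>\<gamma> = 1\<close> splits into the jumps \<open>\<rho> ^ k\<close> with \<open>k \<ge> 1\<close>, which form the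
  compound Poisson exponent \<open>\<phi> s - 1 - \<i> s \<mu>\<close>, and the small jumps \<open>b ^ j = \<rho> powr (- j)\<close>, whose exponent \<open>ys\<close> is entire.\<close>
definition ys :: "complex \<Rightarrow> complex" where
  "ys z = (\<Sum>j. (exp (\<i> * z * of_real (b ^ j)) - 1 - \<i> * z * of_real (b ^ j)) * of_real (p / q * r ^ j))"
definition ys' :: "complex \<Rightarrow> complex" where
  "ys' z = (\<Sum>j. \<i> * of_real (b ^ j) * (exp (\<i> * z * of_real (b ^ j)) - 1) * of_real (p / q * r ^ j))"
definition y1 :: "real \<Rightarrow> complex" where "y1 s = \<phi> s - 1 - \<i> * s * \<mu> + ys s"
definition y1' :: "real \<Rightarrow> complex" where "y1' s = \<phi>' s - \<i> * \<mu> + ys' s"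

lemma sums_weights: "(\<lambda>j. p * q ^ j) sums 1"
proof -
  have "(\<lambda>j. p * q ^ j) sums (p * (1 / (1 - q)))" using q by (intro sums_mult geometric_sums) auto
  then show ?thesis using p by (simp add: q_def)
qed

lemma \<phi>_series:
  "summable (\<lambda>j. iexp (s * \<rho> ^ (j + 1)) * of_real (p * q ^ j))"
  "(\<phi> has_vector_derivative \<phi>' s) (at s)"
  "continuous_on UNIV \<phi>'" "cmod (\<phi>' s) \<le> \<mu>" "cmod (\<phi> s) \<le> 1" "\<phi> 0 = 1" "\<phi>' 0 = \<i> * \<mu>"
proof -
  let ?f = "\<lambda>j s. iexp (s * \<rho> ^ (j + 1)) * of_real (p * q ^ j)"
  let ?f' = "\<lambda>j s. \<i> * of_real (\<rho> ^ (j + 1)) * iexp (s * \<rho> ^ (j + 1)) * of_real (p * q ^ j)"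
  have M: "summable (\<lambda>j. \<rho> ^ (j + 1) * (p * q ^ j))" by (rule sums_summable[OF sums_\<mu>])
  have nf': "cmod (?f' j s) \<le> \<rho> ^ (j + 1) * (p * q ^ j)" for j s
    using \<rho> p q by (simp add: norm_mult norm_power)
  have nf: "cmod (?f j s) \<le> p * q ^ j" for j s using p q by (simp add: norm_mult norm_power)
  have sf: "summable (\<lambda>j. ?f j s)" for s
    by (rule summable_comparison_test'[OF sums_summable[OF sums_weights], of 0]) (rule nf)
  then show "summable (\<lambda>j. ?f j s)" .
  have d: "(?f j has_vector_derivative ?f' j x) (at x)" for j x
    by (rule has_vector_derivative_mult_left[OF has_vector_derivative_iexp_linear])
  show "(\<phi> has_vector_derivative \<phi>' s) (at s)"
    unfolding \<phi>_def[abs_def] \<phi>'_def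
    by (rule vector_derivative_series[where K = "\<bar>s\<bar> + 1", OF d nf' M sf]) simp
  show "continuous_on UNIV \<phi>'" unfolding \<phi>'_def[abs_def]
    by (rule continuous_on_series[OF _ nf' M]) (intro continuous_intros)
  show "cmod (\<phi>' s) \<le> \<mu>" unfolding \<phi>'_def sums_unique[OF sums_\<mu>] by (rule norm_suminf_le_suminf[OF nf' M])
  have "cmod (\<phi> s) \<le> (\<Sum>j. p * q ^ j)" unfolding \<phi>_def
    by (rule norm_suminf_le_suminf[OF nf sums_summable[OF sums_weights]])
  also have "\<dots> = 1" by (rule sums_unique[OF sums_weights, symmetric])
  finally show "cmod (\<phi> s) \<le> 1" .
  show "\<phi> 0 = 1"
  proof -
    have "\<phi> 0 = (\<Sum>j. complex_of_real (p * q ^ j))" unfolding \<phi>_def by simp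
    also have "\<dots> = of_real 1" by (rule sums_unique[OF sums_of_real[OF sums_weights], symmetric])
    finally show ?thesis by simp
  qed
  have "(\<lambda>j. \<i> * of_real (\<rho> ^ (j + 1) * (p * q ^ j))) sums (\<i> * of_real \<mu>)"
    by (intro sums_mult sums_of_real sums_\<mu>)
  from sums_unique[OF this] show "\<phi>' 0 = \<i> * \<mu>" unfolding \<phi>'_def by (simp only: of_real_mult mult.assoc) simp
qed

lemma bj: "0 < b ^ j" "b ^ j \<le> 1" using b by (auto simp: power_le_one)

lemma small_jump_terms:
  assumes "cmod z \<le> K"
  shows "cmod ((exp (\<i> * z * of_real (b ^ j)) - 1 - \<i> * z * of_real (b ^ j)) * of_real (p / q * r ^ j))
      \<le> (cmod z)\<^sup>2 * exp K * ((b ^ j)\<^sup>2 * (p / q * r ^ j))" (is ?A)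
    and "cmod (\<i> * of_real (b ^ j) * (exp (\<i> * z * of_real (b ^ j)) - 1) * of_real (p / q * r ^ j))
      \<le> cmod z * exp K * ((b ^ j)\<^sup>2 * (p / q * r ^ j))" (is ?B)
proof -
  let ?w = "\<i> * z * of_real (b ^ j)"
  have nw: "cmod ?w = cmod z * b ^ j" using b by (simp add: norm_mult norm_power)
  have "cmod z * b ^ j \<le> cmod z * 1" using bj(2)[of j] by (intro mult_left_mono) auto
  then have ew: "exp (cmod ?w) \<le> exp K" unfolding nw using assms by simp
  have w: "0 \<le> p / q * r ^ j" using p q r by simp
  have "cmod (exp ?w - 1 - ?w) \<le> (cmod ?w)\<^sup>2 * exp (cmod ?w)" by (rule norm_exp_minus_1_minus_le)
  also have "\<dots> \<le> (cmod ?w)\<^sup>2 * exp K" using ew by (intro mult_left_mono) auto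
  finally have 1: "cmod (exp ?w - 1 - ?w) \<le> (cmod z)\<^sup>2 * exp K * (b ^ j)\<^sup>2"
    unfolding nw by (simp add: power_mult_distrib mult_ac)
  have "cmod ((exp ?w - 1 - ?w) * of_real (p / q * r ^ j)) = cmod (exp ?w - 1 - ?w) * (p / q * r ^ j)"
    unfolding norm_mult[of _ "complex_of_real (p / q * r ^ j)"] norm_of_real abs_of_nonneg[OF w] ..
  also have "\<dots> \<le> (cmod z)\<^sup>2 * exp K * (b ^ j)\<^sup>2 * (p / q * r ^ j)" by (rule mult_right_mono[OF 1 w])
  finally show ?A by (simp only: mult.assoc)
  have "cmod (exp ?w - 1) \<le> cmod ?w * exp (cmod ?w)" by (rule norm_exp_minus_1_le)
  also have "\<dots> \<le> cmod ?w * exp K" using ew by (intro mult_left_mono) auto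
  finally have 2: "cmod (exp ?w - 1) \<le> cmod z * b ^ j * exp K" unfolding nw .
  have "cmod (\<i> * of_real (b ^ j) * (exp ?w - 1) * of_real (p / q * r ^ j)) = b ^ j * cmod (exp ?w - 1) * (p / q * r ^ j)"
    unfolding norm_mult norm_of_real abs_of_nonneg[OF w] abs_of_pos[OF bj(1)] by simp
  also have "\<dots> \<le> b ^ j * (cmod z * b ^ j * exp K) * (p / q * r ^ j)"
    using bj(1)[of j] by (intro mult_right_mono[OF mult_left_mono[OF 2] w]) simp
  finally show ?B by (simp add: power2_eq_square mult_ac)
qed

lemma summable_small: "summable (\<lambda>j. c * ((b ^ j)\<^sup>2 * (p / q * r ^ j)))"
  by (intro summable_mult sums_summable[OF sums_\<mu>2])

lemma ys_series:
  "summable (\<lambda>j. cmod ((exp (\<i> * z * of_real (b ^ j)) - 1 - \<i> * z * of_real (b ^ j)) * of_real (p / q * r ^ j)))"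
  "(ys has_field_derivative ys' z) (at z)" "continuous_on UNIV ys'"
  "cmod z \<le> 1 \<Longrightarrow> cmod (ys z) \<le> exp 1 * (- \<mu>2) * (cmod z)\<^sup>2"
proof -
  let ?f = "\<lambda>j z. (exp (\<i> * z * of_real (b ^ j)) - 1 - \<i> * z * of_real (b ^ j)) * complex_of_real (p / q * r ^ j)"
  let ?f' = "\<lambda>j z. \<i> * of_real (b ^ j) * (exp (\<i> * z * of_real (b ^ j)) - 1) * complex_of_real (p / q * r ^ j)"
  show s: "summable (\<lambda>j. cmod (?f j z))"
    by (rule summable_comparison_test'[OF summable_small[of "(cmod z)\<^sup>2 * exp (cmod z)"], of 0])
      (use small_jump_terms(1)[OF order_refl[of "cmod z"]] in simp)
  have nf': "cmod (?f' j z) \<le> K * exp K * ((b ^ j)\<^sup>2 * (p / q * r ^ j))" if "z \<in> ball 0 K" for j z K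
  proof -
    from that have "cmod z \<le> K" by simp
    from small_jump_terms(2)[OF this, of j]
    have "cmod (?f' j z) \<le> cmod z * exp K * ((b ^ j)\<^sup>2 * (p / q * r ^ j))" .
    also have "\<dots> \<le> K * exp K * ((b ^ j)\<^sup>2 * (p / q * r ^ j))"
      using \<open>cmod z \<le> K\<close> p q r by (intro mult_right_mono) auto
    finally show ?thesis .
  qed
  have "((\<lambda>z. \<Sum>j. ?f j z) has_field_derivative (\<Sum>j. ?f' j z)) (at z)"
  proof (rule has_field_derivative_series'(2)[of "ball 0 (cmod z + 1)" ?f ?f' 0])
    show "uniformly_convergent_on (ball 0 (cmod z + 1)) (\<lambda>n x. \<Sum>i<n. ?f' i x)"
      by (rule Weierstrass_m_test'[OF nf' summable_small])
    show "(?f n has_field_derivative ?f' n x) (at x within ball 0 (cmod z + 1))" for n x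
      using q by (auto intro!: derivative_eq_intros simp: algebra_simps)
    show "summable (\<lambda>n. ?f n 0)" by simp
  qed (auto simp: interior_open add_nonneg_pos)
  then show "(ys has_field_derivative ys' z) (at z)" by (simp add: ys_def[abs_def] ys'_def)
  have "continuous_on (ball 0 K) ys'" for K unfolding ys'_def[abs_def]
    by (rule continuous_on_series[OF _ nf' summable_small]) (intro continuous_intros)
  then have "isCont ys' z" for z
    using continuous_on_interior[of "ball 0 (cmod z + 1)" ys' z] by (simp add: interior_open)
  then show "continuous_on UNIV ys'" by (simp add: continuous_on_eq_continuous_at)
  assume "cmod z \<le> 1"
  then have "cmod (ys z) \<le> (\<Sum>j. (cmod z)\<^sup>2 * exp 1 * ((b ^ j)\<^sup>2 * (p / q * r ^ j)))"
    unfolding ys_def by (intro norm_suminf_le_suminf[OF small_jump_terms(1) summable_small])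
  also have "\<dots> = (cmod z)\<^sup>2 * exp 1 * (- \<mu>2)"
    by (rule sums_unique[OF sums_mult[OF sums_\<mu>2], symmetric])
  finally show "cmod (ys z) \<le> exp 1 * (- \<mu>2) * (cmod z)\<^sup>2" by (simp add: mult_ac)
qed

lemma y1_deriv: "(y1 has_vector_derivative y1' s) (at s)" "continuous_on UNIV y1'" "continuous_on UNIV y1"
proof -
  have ysr: "((\<lambda>s. ys (of_real s)) has_vector_derivative ys' (of_real s)) (at s)" for s
    by (rule has_vector_derivative_real_field[OF ys_series(2)])
  have lin: "((\<lambda>s. \<i> * complex_of_real s * of_real \<mu>) has_vector_derivative \<i> * of_real \<mu>) (at s)" for s
  proof -
    have "((\<lambda>z. \<i> * z * of_real \<mu>) has_field_derivative \<i> * of_real \<mu>) (at (of_real s))"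
      by (auto intro!: derivative_eq_intros)
    from has_vector_derivative_real_field[OF this] show ?thesis .
  qed
  show d: "(y1 has_vector_derivative y1' s) (at s)" for s
  proof -
    have "((\<lambda>s. \<phi> s - 1 - \<i> * complex_of_real s * of_real \<mu> + ys (of_real s)) has_vector_derivative
        (\<phi>' s - 0 - \<i> * of_real \<mu> + ys' (of_real s))) (at s)"
      by (intro has_vector_derivative_add has_vector_derivative_diff has_vector_derivative_const \<phi>_series(2) lin ysr)
    then show ?thesis by (simp only: y1_def[abs_def] y1'_def diff_0_right)
  qed
  have c: "continuous_on UNIV (\<lambda>s. ys' (of_real s))"
    by (rule continuous_on_compose2[OF ys_series(3)]) (auto intro!: continuous_intros)
  show "continuous_on UNIV y1'" unfolding y1'_def[abs_def]
    by (rule continuous_on_add[OF continuous_on_diff[OF \<phi>_series(3) continuous_on_const] c])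
  show "continuous_on UNIV y1"
    by (rule continuous_at_imp_continuous_on) (use has_vector_derivative_continuous[OF d] in simp)
qed

definition jump :: "int \<Rightarrow> real \<Rightarrow> complex" where
  "jump k s = (exp (\<i> * of_real (s * r powr (real_of_int k / \<alpha>))) - 1 - \<i> * of_real (s * r powr (real_of_int k / \<alpha>)))
     * of_real (p / (q * r powr real_of_int k))"

lemma r_powr_root: "r powr (real k / \<alpha>) = \<rho> ^ k" "r powr (- real k / \<alpha>) = b ^ k"
proof -
  show 1: "r powr (real k / \<alpha>) = \<rho> ^ k"
    using \<rho> r by (simp add: \<rho>_def powr_powr powr_realpow[symmetric])
  have "r powr (- real k / \<alpha>) = 1 / r powr (real k / \<alpha>)" by (simp add: powr_minus_divide)
  then show "r powr (- real k / \<alpha>) = b ^ k" unfolding 1 by (simp add: b_def power_one_over)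
qed

lemma jump_nat: "jump (int (j + 1)) s = (iexp (s * \<rho> ^ (j + 1)) - 1 - \<i> * of_real (s * \<rho> ^ (j + 1))) * of_real (p * q ^ j)"
proof -
  have "p / (q * r powr real (j + 1)) = p * q ^ j"
    using r q by (simp add: powr_realpow r_def power_divide field_simps powr_add)
  then show ?thesis unfolding jump_def r_powr_root(1)[of "j + 1", symmetric] by simp
qed

lemma jump_neg: "jump (- int j) s = (exp (\<i> * of_real s * of_real (b ^ j)) - 1 - \<i> * of_real s * of_real (b ^ j)) * of_real (p / q * r ^ j)"
proof -
  have 1: "r powr (- real j) = 1 / r ^ j" using r by (simp add: powr_minus_divide powr_realpow)
  have "p / (q * r powr (- real j)) = p / q * r ^ j" unfolding 1 using r by simp
  moreover have "\<i> * complex_of_real (s * b ^ j) = \<i> * of_real s * of_real (b ^ j)" by simp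
  moreover have "real_of_int (- int j) = - real j" by simp
  ultimately show ?thesis unfolding jump_def by (simp only: r_powr_root(2))
qed

lemma jump_has_sum: "((\<lambda>k. jump k s) has_sum y1 s) UNIV"
proof -
  have s1: "(\<lambda>j. jump (int (j + 1)) s) sums (\<phi> s - 1 - \<i> * s * \<mu>)"
  proof -
    have a: "(\<lambda>j. iexp (s * \<rho> ^ (j + 1)) * of_real (p * q ^ j)) sums \<phi> s"
      unfolding \<phi>_def by (rule summable_sums[OF \<phi>_series(1)])
    have b: "(\<lambda>j. complex_of_real (p * q ^ j)) sums of_real 1" by (rule sums_of_real[OF sums_weights])
    have c: "(\<lambda>j. \<i> * s * of_real (\<rho> ^ (j + 1) * (p * q ^ j))) sums (\<i> * s * of_real \<mu>)"
      by (rule sums_mult[OF sums_of_real[OF sums_\<mu>]])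
    have eq: "(\<lambda>j. jump (int (j + 1)) s) = (\<lambda>j. iexp (s * \<rho> ^ (j + 1)) * of_real (p * q ^ j) - of_real (p * q ^ j) - \<i> * s * of_real (\<rho> ^ (j + 1) * (p * q ^ j)))"
      unfolding jump_nat by (rule ext) (simp add: algebra_simps)
    show ?thesis unfolding eq using sums_diff[OF sums_diff[OF a b] c] by simp
  qed
  have n1: "summable (\<lambda>j. cmod (jump (int (j + 1)) s))"
  proof (rule summable_comparison_test'[of _ 0])
    show "summable (\<lambda>j. 2 * \<bar>s\<bar> * (\<rho> ^ (j + 1) * (p * q ^ j)))"
      by (intro summable_mult sums_summable[OF sums_\<mu>])
    fix j :: nat
    have w: "0 \<le> p * q ^ j" using p q by simp
    have "cmod (iexp (s * \<rho> ^ (j + 1)) - 1 - \<i> * of_real (s * \<rho> ^ (j + 1))) \<le> 2 * \<bar>s * \<rho> ^ (j + 1)\<bar>"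
      using iexp_approx2[of "s * \<rho> ^ (j + 1)" 1] by (simp add: diff_diff_eq)
    also have "\<dots> = 2 * \<bar>s\<bar> * \<rho> ^ (j + 1)" using \<rho> by (simp add: abs_mult)
    finally have "cmod (iexp (s * \<rho> ^ (j + 1)) - 1 - \<i> * of_real (s * \<rho> ^ (j + 1))) * (p * q ^ j) \<le> 2 * \<bar>s\<bar> * \<rho> ^ (j + 1) * (p * q ^ j)"
      using w by (rule mult_right_mono)
    moreover have "cmod (jump (int (j + 1)) s) = cmod (iexp (s * \<rho> ^ (j + 1)) - 1 - \<i> * of_real (s * \<rho> ^ (j + 1))) * (p * q ^ j)"
      unfolding jump_nat norm_mult[of _ "complex_of_real (p * q ^ j)"] norm_of_real abs_of_nonneg[OF w] ..
    ultimately have "cmod (jump (int (j + 1)) s) \<le> 2 * \<bar>s\<bar> * (\<rho> ^ (j + 1) * (p * q ^ j))"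
      by (simp only: mult.assoc)
    then show "norm (cmod (jump (int (j + 1)) s)) \<le> 2 * \<bar>s\<bar> * (\<rho> ^ (j + 1) * (p * q ^ j))"
      by (simp only: real_norm_def abs_norm_cancel)
  qed
  have s2: "(\<lambda>j. jump (- int j) s) sums ys s"
    unfolding jump_neg ys_def by (rule summable_sums[OF summable_norm_cancel[OF ys_series(1)]])
  have n2: "summable (\<lambda>j. cmod (jump (- int j) s))" unfolding jump_neg by (rule ys_series(1))
  have b1: "bij_betw (\<lambda>j. int (j + 1)) UNIV {1..}"
    by (rule bij_betwI[where g = "\<lambda>k. nat (k - 1)"]) auto
  have b2: "bij_betw (\<lambda>j. - int j) UNIV {..0}"
    by (rule bij_betwI[where g = "\<lambda>k. nat (- k)"]) auto
  have h1: "((\<lambda>k. jump k s) has_sum (\<phi> s - 1 - \<i> * s * \<mu>)) {1..}"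
    using norm_summable_imp_has_sum[OF n1 s1] has_sum_reindex_bij_betw[OF b1, of "\<lambda>k. jump k s"] by simp
  have h2: "((\<lambda>k. jump k s) has_sum ys s) {..0}"
    using norm_summable_imp_has_sum[OF n2 s2] has_sum_reindex_bij_betw[OF b2, of "\<lambda>k. jump k s"] by simp
  have "((\<lambda>k. jump k s) has_sum (\<phi> s - 1 - \<i> * s * \<mu> + ys s)) ({1..} \<union> {..0})"
    by (rule has_sum_Un_disjoint[OF h1 h2]) auto
  moreover have "{1..} \<union> {..0} = (UNIV :: int set)" by auto
  ultimately show ?thesis by (simp add: y1_def)
qed

lemma infsum_jump: "infsum (\<lambda>k. jump k s) UNIV = y1 s"
  by (rule infsumI[OF jump_has_sum])

lemma jump_shift: "jump (k + m) s * of_real (r powr real_of_int m) = jump k (r powr (real_of_int m / \<alpha>) * s)"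
proof -
  have 1: "s * r powr (real_of_int (k + m) / \<alpha>) = r powr (real_of_int m / \<alpha>) * s * r powr (real_of_int k / \<alpha>)"
    by (simp add: add_divide_distrib powr_add)
  have "p / (q * r powr real_of_int (k + m)) * r powr real_of_int m = p / (q * r powr real_of_int k)"
    using r by (simp add: powr_add)
  then have 2: "complex_of_real (p / (q * r powr real_of_int (k + m))) * of_real (r powr real_of_int m) = of_real (p / (q * r powr real_of_int k))"
    by (simp only: of_real_mult[symmetric])
  show ?thesis unfolding jump_def 1 mult.assoc 2 ..
qed

lemma y1_scale: "y1 (r powr (real_of_int m / \<alpha>) * s) = of_real (r powr real_of_int m) * y1 s"
proof -
  have "y1 (r powr (real_of_int m / \<alpha>) * s) = infsum (\<lambda>k. jump k (r powr (real_of_int m / \<alpha>) * s)) UNIV"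
    by (rule infsum_jump[symmetric])
  also have "\<dots> = infsum (\<lambda>k. of_real (r powr real_of_int m) * jump (k + m) s) UNIV"
    unfolding jump_shift[symmetric] by (simp only: mult.commute)
  also have "\<dots> = of_real (r powr real_of_int m) * infsum (\<lambda>k. jump (k + m) s) UNIV"
    by (rule infsum_cmult_right')
  also have "infsum (\<lambda>k. jump (k + m) s) UNIV = infsum (\<lambda>k. jump k s) UNIV"
    by (rule infsum_reindex_bij_betw[of "\<lambda>k. k + m"]) (rule bij_betwI[where g = "\<lambda>k. k - m"], auto)
  finally show ?thesis unfolding infsum_jump .
qed

lemma yfun_gam:
  assumes n: "n \<ge> 1"
  shows "yfun \<alpha> p (gam p n) t = of_nat n * y1 (t / real n powr (1 / \<alpha>))"
proof -
  define m where "m = \<lceil>log r (real n)\<rceil>"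
  define s where "s = t / real n powr (1 / \<alpha>)"
  have g: "gam p n = real n / r powr real_of_int m" by (simp add: gam_def qq_rr m_def)
  have g1: "gam p n powr (1 / \<alpha>) = real n powr (1 / \<alpha>) / r powr (real_of_int m / \<alpha>)"
    unfolding g using n r by (simp add: powr_divide powr_powr)
  have 1: "t * rr p powr (real_of_int k / \<alpha>) / gam p n powr (1 / \<alpha>) = s * r powr (real_of_int (k + m) / \<alpha>)" for k
    unfolding g1 qq_rr s_def by (simp add: add_divide_distrib powr_add)
  have 2: "p * gam p n / (qq p * rr p powr real_of_int k) = real n * (p / (q * r powr real_of_int (k + m)))" for k
    unfolding g qq_rr by (simp add: powr_add mult_ac)
  have "yfun \<alpha> p (gam p n) t = infsum (\<lambda>k. of_nat n * jump (k + m) s) UNIV"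
    unfolding yfun_def 1 2 jump_def by (rule infsum_cong) simp
  also have "\<dots> = of_nat n * infsum (\<lambda>k. jump (k + m) s) UNIV"
    by (rule infsum_cmult_right')
  also have "infsum (\<lambda>k. jump (k + m) s) UNIV = infsum (\<lambda>k. jump k s) UNIV"
    by (rule infsum_reindex_bij_betw[of "\<lambda>k. k + m"]) (rule bij_betwI[where g = "\<lambda>k. k - m"], auto)
  finally show ?thesis unfolding infsum_jump s_def .
qed

lemma Re_small_jump:
  "Re ((exp (\<i> * z * of_real (b ^ j)) - 1 - \<i> * z * of_real (b ^ j)) * of_real (p / q * r ^ j))
    = (exp (- (Im z * b ^ j)) * cos (Re z * b ^ j) - 1 + Im z * b ^ j) * (p / q * r ^ j)"
proof -
  have "Re (\<i> * z * of_real (b ^ j)) = - (Im z * b ^ j)" "Im (\<i> * z * of_real (b ^ j)) = Re z * b ^ j"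
    by (simp_all del: of_real_power)
  then have "Re (exp (\<i> * z * of_real (b ^ j)) - 1 - \<i> * z * of_real (b ^ j)) = exp (- (Im z * b ^ j)) * cos (Re z * b ^ j) - 1 + Im z * b ^ j"
    unfolding minus_complex.simps Re_exp by simp
  then show ?thesis unfolding Re_complex_of_real[symmetric] by (simp only: times_complex.simps Im_complex_of_real Re_complex_of_real mult_zero_right diff_0_right)
qed

lemma Re_ys_sums: "(\<lambda>j. (exp (- (Im z * b ^ j)) * cos (Re z * b ^ j) - 1 + Im z * b ^ j) * (p / q * r ^ j)) sums Re (ys z)"
proof -
  have "(\<lambda>j. (exp (\<i> * z * of_real (b ^ j)) - 1 - \<i> * z * of_real (b ^ j)) * of_real (p / q * r ^ j)) sums ys z"
    unfolding ys_def by (rule summable_sums[OF summable_norm_cancel[OF ys_series(1)]])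
  from sums_Re[OF this] show ?thesis unfolding Re_small_jump .
qed

definition "cy = (1 - cos b) * (p / q)"

lemma cy: "cy > 0"
proof -
  have "cos b < cos 0" using b pi_gt3 by (intro cos_monotone_0_pi) auto
  then show ?thesis using p q by (simp add: cy_def)
qed

lemma Re_ys_real_le:
  fixes s :: real
  shows "Re (ys s) \<le> 0" "1 \<le> \<bar>s\<bar> \<Longrightarrow> Re (ys s) \<le> - cy * \<bar>s\<bar> powr \<alpha>"
proof -
  have S: "(\<lambda>j. (1 - cos (s * b ^ j)) * (p / q * r ^ j)) sums (- Re (ys s))"
    using sums_minus[OF Re_ys_sums[of "of_real s"]] by (simp add: algebra_simps)
  have nn: "0 \<le> (1 - cos (s * b ^ j)) * (p / q * r ^ j)" for j using p q r by simp
  have "0 \<le> - Re (ys s)" using suminf_nonneg[OF sums_summable[OF S] nn] sums_unique[OF S] by simp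
  then show "Re (ys s) \<le> 0" by simp
  assume s: "1 \<le> \<bar>s\<bar>"
  define j where "j = nat \<lceil>log \<rho> \<bar>s\<bar>\<rceil>"
  have l0: "log \<rho> \<bar>s\<bar> \<ge> 0" using s \<rho> by simp
  then have jl: "log \<rho> \<bar>s\<bar> \<le> real j" "real j < log \<rho> \<bar>s\<bar> + 1" unfolding j_def by linarith+
  have "\<bar>s\<bar> \<le> \<rho> powr real j" using jl(1) \<rho> s by (simp add: log_le_iff)
  then have sj: "\<bar>s\<bar> \<le> \<rho> ^ j" using \<rho> by (simp add: powr_realpow)
  have "\<rho> powr real j \<le> \<rho> powr (log \<rho> \<bar>s\<bar> + 1)" using jl(2) \<rho> by (intro powr_mono) auto
  also have "\<dots> = \<bar>s\<bar> * \<rho>" using \<rho> s by (simp add: powr_add)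
  finally have sj2: "\<rho> ^ j \<le> \<bar>s\<bar> * \<rho>" using \<rho> by (simp add: powr_realpow)
  have bj1: "b ^ j * \<rho> ^ j = 1" using b by (simp add: power_mult_distrib[symmetric])
  have "\<bar>s\<bar> * b ^ j \<le> \<rho> ^ j * b ^ j" using sj bj(1)[of j] by (intro mult_right_mono) auto
  moreover have "\<bar>s * b ^ j\<bar> = \<bar>s\<bar> * b ^ j" using b by (simp add: abs_mult)
  moreover have "\<rho> ^ j * b ^ j = 1" using bj1 by (simp only: mult.commute)
  ultimately have u1: "\<bar>s * b ^ j\<bar> \<le> 1" by linarith
  have "b * (b ^ j * \<rho> ^ j) \<le> b * (b ^ j * (\<bar>s\<bar> * \<rho>))" using sj2 bj(1)[of j] b by (intro mult_left_mono) auto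
  moreover have "b * (b ^ j * (\<bar>s\<bar> * \<rho>)) = (b * \<rho>) * (\<bar>s\<bar> * b ^ j)" by (simp only: mult_ac)
  moreover have "\<bar>s * b ^ j\<bar> = \<bar>s\<bar> * b ^ j" using b by (simp add: abs_mult)
  ultimately have u2: "b \<le> \<bar>s * b ^ j\<bar>" using bj1 b(3) by simp
  have "cos \<bar>s * b ^ j\<bar> \<le> cos b" using u1 u2 b pi_gt3 by (intro cos_monotone_0_pi_le) auto
  then have "1 - cos b \<le> 1 - cos (s * b ^ j)" by simp
  then have "(1 - cos b) * (p / q * r ^ j) \<le> (1 - cos (s * b ^ j)) * (p / q * r ^ j)"
    using p q r by (intro mult_right_mono) auto
  also have "\<dots> \<le> - Re (ys s)"
    using sum_le_suminf[OF sums_summable[OF S], of "{j}"] nn sums_unique[OF S] by simp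
  finally have 1: "cy * r ^ j \<le> - Re (ys s)" by (simp add: cy_def)
  have "\<bar>s\<bar> powr \<alpha> \<le> (\<rho> ^ j) powr \<alpha>" using sj \<alpha> by (intro powr_mono2) auto
  also have "\<dots> = (\<rho> powr \<alpha>) ^ j" using \<rho> by (simp add: powr_realpow[symmetric] powr_powr mult.commute)
  also have "\<dots> = r ^ j" by (simp add: \<rho>_powr)
  finally have "cy * \<bar>s\<bar> powr \<alpha> \<le> cy * r ^ j" using cy by (intro mult_left_mono) auto
  with 1 show "Re (ys s) \<le> - cy * \<bar>s\<bar> powr \<alpha>" by simp
qed

lemma Re_ys_strip_le:
  assumes "\<bar>Im z\<bar> \<le> 1"
  shows "Re (ys z) \<le> exp (-1) * Re (ys (of_real (Re z))) + exp 1 * (- \<mu>2)"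
proof -
  have S1: "(\<lambda>j. exp (-1) * ((cos (Re z * b ^ j) - 1) * (p / q * r ^ j)) + exp 1 * ((b ^ j)\<^sup>2 * (p / q * r ^ j)))
      sums (exp (-1) * Re (ys (of_real (Re z))) + exp 1 * (- \<mu>2))"
    using Re_ys_sums[of "of_real (Re z)"] by (intro sums_add sums_mult sums_\<mu>2) simp
  show ?thesis
  proof (rule sums_le[OF _ Re_ys_sums S1])
    fix j :: nat
    have w: "0 \<le> p / q * r ^ j" using p q r by simp
    let ?v = "Im z * b ^ j" let ?c = "cos (Re z * b ^ j)"
    have va: "\<bar>?v\<bar> \<le> b ^ j" using mult_right_mono[OF assms, of "b ^ j"] bj[of j] by (simp add: abs_mult)
    have v1: "\<bar>?v\<bar> \<le> 1" using va bj[of j] by linarith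
    have "cmod (exp (of_real (- ?v)) - 1 - of_real (- ?v)) \<le> (cmod (of_real (- ?v)))\<^sup>2 * exp (cmod (of_real (- ?v)))"
      by (rule norm_exp_minus_1_minus_le)
    moreover have "exp (of_real (- ?v)) - 1 - of_real (- ?v) = complex_of_real (exp (- ?v) - 1 + ?v)"
      by (simp add: exp_of_real[symmetric] del: of_real_mult of_real_power)
    ultimately have "\<bar>exp (- ?v) - 1 + ?v\<bar> \<le> \<bar>?v\<bar>\<^sup>2 * exp \<bar>?v\<bar>"
      by (simp only: norm_of_real abs_minus_cancel)
    also have "\<dots> \<le> (b ^ j)\<^sup>2 * exp 1" using va v1 by (intro mult_mono power_mono) auto
    finally have 1: "exp (- ?v) - 1 + ?v \<le> exp 1 * (b ^ j)\<^sup>2" by (simp add: mult.commute)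
    have "exp (- ?v) \<ge> exp (-1)" using v1 by simp
    then have "exp (- ?v) * (1 - ?c) \<ge> exp (-1) * (1 - ?c)" by (rule mult_right_mono) simp
    then have "exp (- ?v) * ?c - 1 + ?v \<le> exp (-1) * (?c - 1) + exp 1 * (b ^ j)\<^sup>2"
      using 1 by (simp add: algebra_simps)
    then have "(exp (- ?v) * ?c - 1 + ?v) * (p / q * r ^ j) \<le> (exp (-1) * (?c - 1) + exp 1 * (b ^ j)\<^sup>2) * (p / q * r ^ j)"
      using w by (rule mult_right_mono)
    then show "(exp (- ?v) * ?c - 1 + ?v) * (p / q * r ^ j)
      \<le> exp (-1) * ((?c - 1) * (p / q * r ^ j)) + exp 1 * ((b ^ j)\<^sup>2 * (p / q * r ^ j))"
      by (simp only: distrib_right mult.assoc)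
  qed
qed

lemma Re_y1_le_ys: "Re (y1 s) \<le> Re (ys s)"
  using \<phi>_series(5)[of s] complex_Re_le_cmod[of "\<phi> s"] by (simp add: y1_def)

lemma scale_to_fundamental:
  assumes "s \<noteq> 0"
  obtains m :: int and s0 where "1 \<le> \<bar>s0\<bar>" "\<bar>s0\<bar> \<le> \<rho>" "s = r powr (real_of_int m / \<alpha>) * s0"
    "r powr real_of_int m = (r powr (real_of_int m / \<alpha>)) powr \<alpha>" "0 < r powr (real_of_int m / \<alpha>)"
    "r powr (real_of_int m / \<alpha>) \<le> \<bar>s\<bar>" "\<bar>s\<bar> \<le> \<rho> * r powr (real_of_int m / \<alpha>)"
proof -
  define m where "m = \<lfloor>log \<rho> \<bar>s\<bar>\<rfloor>"
  define R where "R = r powr (real_of_int m / \<alpha>)"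
  have R: "R = \<rho> powr real_of_int m" unfolding R_def \<rho>_def using r by (simp add: powr_powr)
  have R0: "R > 0" unfolding R_def using r by simp
  have m: "real_of_int m \<le> log \<rho> \<bar>s\<bar>" "log \<rho> \<bar>s\<bar> \<le> real_of_int m + 1" unfolding m_def by linarith+
  have 1: "R \<le> \<bar>s\<bar>"
    using powr_mono[OF m(1), of \<rho>] \<rho> assms unfolding R by simp
  have 2: "\<bar>s\<bar> \<le> \<rho> * R"
    using powr_mono[OF m(2), of \<rho>] \<rho> assms unfolding R by (simp add: powr_add mult.commute)
  show thesis
  proof (rule that[of "s / R" m, folded R_def])
    show "1 \<le> \<bar>s / R\<bar>" "\<bar>s / R\<bar> \<le> \<rho>" using 1 2 R0 by (simp_all add: field_simps)
    show "s = R * (s / R)" using R0 by simp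
    show "r powr real_of_int m = R powr \<alpha>" unfolding R_def using \<alpha> by (simp add: powr_powr)
  qed (use 1 2 R0 in auto)
qed

lemma y1'_scale: "of_real (r powr (real_of_int m / \<alpha>)) * y1' (r powr (real_of_int m / \<alpha>) * s) = of_real (r powr real_of_int m) * y1' s"
proof -
  let ?R = "r powr (real_of_int m / \<alpha>)"
  have "((\<lambda>s. y1 (?R * s)) has_vector_derivative ?R *\<^sub>R y1' (?R * s)) (at s)"
  proof -
    have "((\<lambda>s. ?R * s) has_vector_derivative ?R) (at s)"
      by (auto intro!: derivative_eq_intros simp: has_real_derivative_iff_has_vector_derivative[symmetric])
    from vector_diff_chain_at[OF this y1_deriv(1)] show ?thesis by (simp add: comp_def)
  qed
  moreover have "((\<lambda>s. of_real (r powr real_of_int m) * y1 s) has_vector_derivative of_real (r powr real_of_int m) * y1' s) (at s)"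
    by (rule has_vector_derivative_mult_right[OF y1_deriv(1)])
  ultimately show ?thesis unfolding y1_scale scaleR_conv_of_real
    using vector_derivative_unique_at by blast
qed

lemma y1_bounds:
  obtains C where "C > 0" "\<And>s. cmod (y1 s) \<le> C * \<bar>s\<bar> powr \<alpha>" "\<And>s. cmod (y1' s) \<le> C * \<bar>s\<bar> powr (\<alpha> - 1)"
    "\<And>s. Re (y1 s) \<le> - (cy / r) * \<bar>s\<bar> powr \<alpha>"
proof -
  let ?S = "{s. 1 \<le> \<bar>s\<bar> \<and> \<bar>s\<bar> \<le> \<rho>}"
  have "bounded (y1 ` {-\<rho>..\<rho>})"
    using y1_deriv(3) by (intro compact_imp_bounded compact_continuous_image) (auto intro: continuous_on_subset)
  then obtain C1 where "\<forall>z\<in>y1 ` {-\<rho>..\<rho>}. cmod z \<le> C1" unfolding bounded_iff by blast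
  moreover have "s \<in> {-\<rho>..\<rho>}" if "\<bar>s\<bar> \<le> \<rho>" for s using that by auto
  ultimately have C1: "cmod (y1 s) \<le> C1" if "\<bar>s\<bar> \<le> \<rho>" for s using that by blast
  have "bounded (y1' ` {-\<rho>..\<rho>})"
    using y1_deriv(2) by (intro compact_imp_bounded compact_continuous_image) (auto intro: continuous_on_subset)
  then obtain C2 where "\<forall>z\<in>y1' ` {-\<rho>..\<rho>}. cmod z \<le> C2" unfolding bounded_iff by blast
  moreover have "s \<in> {-\<rho>..\<rho>}" if "\<bar>s\<bar> \<le> \<rho>" for s using that by auto
  ultimately have C2: "cmod (y1' s) \<le> C2" if "\<bar>s\<bar> \<le> \<rho>" for s using that by blast
  define C where "C = max 1 (max C1 C2)"
  have C: "C > 0" "C1 \<le> C" "C2 \<le> C" by (auto simp: C_def)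
  have z1: "y1 0 = 0" by (simp add: y1_def \<phi>_series(6) ys_def)
  have z2: "y1' 0 = 0" by (simp add: y1'_def \<phi>_series(7) ys'_def)
  have ex: "cmod (y1 s) \<le> C * \<bar>s\<bar> powr \<alpha> \<and> cmod (y1' s) \<le> C * \<bar>s\<bar> powr (\<alpha> - 1) \<and> Re (y1 s) \<le> - (cy / r) * \<bar>s\<bar> powr \<alpha>" for s
  proof (cases "s = 0")
    case True
    then show ?thesis using z1 z2 by simp
  next
    case False
    then obtain m s0 where s0: "1 \<le> \<bar>s0\<bar>" "\<bar>s0\<bar> \<le> \<rho>" "s = r powr (real_of_int m / \<alpha>) * s0"
      and R: "r powr real_of_int m = (r powr (real_of_int m / \<alpha>)) powr \<alpha>" "0 < r powr (real_of_int m / \<alpha>)"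
      "r powr (real_of_int m / \<alpha>) \<le> \<bar>s\<bar>" "\<bar>s\<bar> \<le> \<rho> * r powr (real_of_int m / \<alpha>)"
      by (rule scale_to_fundamental)
    define Q where "Q = r powr (real_of_int m / \<alpha>)"
    note R = R[folded Q_def] and s0 = s0[folded Q_def]
    have Qs: "Q powr \<alpha> \<le> \<bar>s\<bar> powr \<alpha>" using R \<alpha> by (intro powr_mono2) auto
    have Qs1: "Q powr (\<alpha> - 1) \<le> \<bar>s\<bar> powr (\<alpha> - 1)" using R \<alpha> by (intro powr_mono2) auto
    have y: "y1 s = of_real (Q powr \<alpha>) * y1 s0" unfolding s0(3) R(1)[symmetric] unfolding Q_def by (rule y1_scale)
    have "cmod (y1 s) = Q powr \<alpha> * cmod (y1 s0)" unfolding y norm_mult norm_of_real by simp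
    also have "\<dots> \<le> \<bar>s\<bar> powr \<alpha> * C" using Qs C1[OF s0(2)] C by (intro mult_mono) auto
    finally have A: "cmod (y1 s) \<le> C * \<bar>s\<bar> powr \<alpha>" by (simp add: mult.commute)
    have "of_real Q * y1' s = of_real (Q powr \<alpha>) * y1' s0"
      unfolding s0(3) R(1)[symmetric] unfolding Q_def by (rule y1'_scale)
    then have "Q * cmod (y1' s) = Q powr \<alpha> * cmod (y1' s0)"
    proof -
      assume eq: "of_real Q * y1' s = of_real (Q powr \<alpha>) * y1' s0"
      have "cmod (of_real Q * y1' s) = cmod (of_real (Q powr \<alpha>) * y1' s0)" unfolding eq ..
      then show ?thesis unfolding norm_mult norm_of_real abs_of_pos[OF R(2)] by simp
    qed
    also have "Q powr \<alpha> = Q * Q powr (\<alpha> - 1)" using R(2) by (simp add: powr_diff)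
    finally have "cmod (y1' s) = Q powr (\<alpha> - 1) * cmod (y1' s0)" using R(2) by simp
    also have "\<dots> \<le> \<bar>s\<bar> powr (\<alpha> - 1) * C" using Qs1 C2[OF s0(2)] C by (intro mult_mono) auto
    finally have B: "cmod (y1' s) \<le> C * \<bar>s\<bar> powr (\<alpha> - 1)" by (simp add: mult.commute)
    have "Re (y1 s0) \<le> - cy * \<bar>s0\<bar> powr \<alpha>" using Re_y1_le_ys[of s0] Re_ys_real_le(2)[OF s0(1)] by linarith
    also have "\<dots> \<le> - cy * 1" using cy s0(1) \<alpha> by (simp add: ge_one_powr_ge_zero)
    finally have "Q powr \<alpha> * Re (y1 s0) \<le> Q powr \<alpha> * (- cy)" by (intro mult_left_mono) auto
    moreover have "Re (y1 s) = Q powr \<alpha> * Re (y1 s0)" unfolding y by simp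
    moreover have "\<bar>s\<bar> powr \<alpha> \<le> r * Q powr \<alpha>"
    proof -
      have "\<bar>s\<bar> powr \<alpha> \<le> (\<rho> * Q) powr \<alpha>" using R \<alpha> by (intro powr_mono2) auto
      also have "\<dots> = r * Q powr \<alpha>" using R \<rho> by (simp add: powr_mult \<rho>_powr)
      finally show ?thesis .
    qed
    then have "(cy / r) * \<bar>s\<bar> powr \<alpha> \<le> (cy / r) * (r * Q powr \<alpha>)" using cy r by (intro mult_left_mono) auto
    moreover have "(cy / r) * (r * Q powr \<alpha>) = Q powr \<alpha> * cy" using r by simp
    ultimately have "Re (y1 s) \<le> - (cy / r) * \<bar>s\<bar> powr \<alpha>" by linarith
    with A B show ?thesis by blast
  qed
  show thesis by (rule that[of C]) (use C ex in auto)
qed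

definition Rs :: "real \<Rightarrow> complex" where "Rs s = ys s - of_real (\<mu>2 * s\<^sup>2 / 2)"
definition Rs' :: "real \<Rightarrow> complex" where "Rs' s = ys' s - of_real (\<mu>2 * s)"

lemma Rs_deriv: "(Rs has_vector_derivative Rs' s) (at s)"
proof -
  have 1: "((\<lambda>s. ys (of_real s)) has_vector_derivative ys' (of_real s)) (at s)"
    by (rule has_vector_derivative_real_field[OF ys_series(2)])
  have "((\<lambda>s. \<mu>2 * s\<^sup>2 / 2) has_real_derivative \<mu>2 * s) (at s)"
    by (auto intro!: derivative_eq_intros)
  then have 2: "((\<lambda>s. complex_of_real (\<mu>2 * s\<^sup>2 / 2)) has_vector_derivative of_real (\<mu>2 * s)) (at s)"
    by (rule has_vector_derivative_of_real[unfolded has_real_derivative_iff_has_vector_derivative[symmetric]])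
  show ?thesis unfolding Rs_def[abs_def] Rs'_def by (rule has_vector_derivative_diff[OF 1 2])
qed

lemma Rs'_bound: "\<bar>s\<bar> \<le> 1 \<Longrightarrow> cmod (Rs' s) \<le> exp 1 * (- \<mu>2) * s\<^sup>2"
proof -
  assume s: "\<bar>s\<bar> \<le> 1"
  let ?t = "\<lambda>j. \<i> * of_real (b ^ j) * (exp (\<i> * of_real s * of_real (b ^ j)) - 1) * complex_of_real (p / q * r ^ j)"
  have alg: "\<i> * X * (E - 1) * (V * W) + S * (X * X * (V * W)) = \<i> * X * (E - 1 - \<i> * S * X) * (V * W)" for X E V W S :: complex
    by (simp add: algebra_simps)
  have n: "summable (\<lambda>j. cmod (?t j))"
    by (rule summable_comparison_test'[OF summable_small[of "cmod (of_real s) * exp (cmod (of_real s))"], of 0])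
      (use small_jump_terms(2)[OF order_refl[of "cmod (of_real s)"]] in simp)
  have "(\<lambda>j. ?t j) sums ys' s" unfolding ys'_def by (rule summable_sums[OF summable_norm_cancel[OF n]])
  moreover have "(\<lambda>j. of_real s * complex_of_real ((b ^ j)\<^sup>2 * (p / q * r ^ j))) sums (of_real s * of_real (- \<mu>2))"
    by (rule sums_mult[OF sums_of_real[OF sums_\<mu>2]])
  ultimately have S: "(\<lambda>j. ?t j + of_real s * complex_of_real ((b ^ j)\<^sup>2 * (p / q * r ^ j))) sums (ys' s + of_real s * of_real (- \<mu>2))"
    by (rule sums_add)
  have "cmod (\<Sum>j. ?t j + of_real s * complex_of_real ((b ^ j)\<^sup>2 * (p / q * r ^ j))) \<le> (\<Sum>j. s\<^sup>2 * exp 1 * ((b ^ j)\<^sup>2 * (p / q * r ^ j)))"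
  proof (rule norm_suminf_le_suminf[OF _ summable_small])
    fix j
    have w: "0 \<le> p / q * r ^ j" using p q r by simp
    let ?w = "\<i> * complex_of_real s * of_real (b ^ j)"
    have nw: "cmod ?w = \<bar>s\<bar> * b ^ j" using b by (simp add: norm_mult norm_power)
    have "\<bar>s\<bar> * b ^ j \<le> 1 * 1" using s bj[of j] by (intro mult_mono) auto
    then have e: "exp (cmod ?w) \<le> exp 1" unfolding nw by simp
    have "cmod (exp ?w - 1 - ?w) \<le> (cmod ?w)\<^sup>2 * exp (cmod ?w)" by (rule norm_exp_minus_1_minus_le)
    also have "\<dots> \<le> (cmod ?w)\<^sup>2 * exp 1" using e by (intro mult_left_mono) auto
    finally have 1: "cmod (exp ?w - 1 - ?w) \<le> s\<^sup>2 * exp 1 * (b ^ j)\<^sup>2"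
      unfolding nw by (simp add: power_mult_distrib mult_ac)
    have "?t j + of_real s * complex_of_real ((b ^ j)\<^sup>2 * (p / q * r ^ j))
        = \<i> * of_real (b ^ j) * (exp ?w - 1 - ?w) * of_real (p / q * r ^ j)"
      unfolding power2_eq_square of_real_mult by (rule alg)
    also have "cmod \<dots> = b ^ j * cmod (exp ?w - 1 - ?w) * (p / q * r ^ j)"
      unfolding norm_mult norm_of_real abs_of_nonneg[OF w] abs_of_pos[OF bj(1)] by simp
    also have "\<dots> \<le> 1 * (s\<^sup>2 * exp 1 * (b ^ j)\<^sup>2) * (p / q * r ^ j)"
      using bj[of j] 1 by (intro mult_right_mono[OF _ w] mult_mono) auto
    finally show "cmod (?t j + of_real s * complex_of_real ((b ^ j)\<^sup>2 * (p / q * r ^ j))) \<le> s\<^sup>2 * exp 1 * ((b ^ j)\<^sup>2 * (p / q * r ^ j))"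
      by (simp only: mult.assoc mult_1)
  qed
  also have "(\<Sum>j. s\<^sup>2 * exp 1 * ((b ^ j)\<^sup>2 * (p / q * r ^ j))) = s\<^sup>2 * exp 1 * (- \<mu>2)"
    by (rule sums_unique[OF sums_mult[OF sums_\<mu>2], symmetric])
  also have "(\<Sum>j. ?t j + of_real s * complex_of_real ((b ^ j)\<^sup>2 * (p / q * r ^ j))) = Rs' s"
    unfolding sums_unique[OF S, symmetric] by (simp add: Rs'_def mult.commute)
  finally show ?thesis by (simp only: mult_ac)
qed

lemma \<mu>2_nonpos: "0 \<le> - \<mu>2"
  by (rule sums_le[OF _ sums_zero sums_\<mu>2]) (use p q r in simp)

lemma Rs_bound: "\<bar>s\<bar> \<le> 1 \<Longrightarrow> cmod (Rs s) \<le> exp 1 * (- \<mu>2) * \<bar>s\<bar> ^ 3"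
proof -
  assume s: "\<bar>s\<bar> \<le> 1"
  note m = \<mu>2_nonpos
  have "cmod (Rs s - Rs 0) \<le> (exp 1 * (- \<mu>2) * s\<^sup>2) * \<bar>s\<bar>"
  proof (rule vector_mean_value_bound[OF Rs_deriv])
    fix t assume t: "\<bar>t\<bar> \<le> \<bar>s\<bar>"
    have "cmod (Rs' t) \<le> exp 1 * (- \<mu>2) * t\<^sup>2" using t s by (intro Rs'_bound) auto
    also have "\<dots> \<le> exp 1 * (- \<mu>2) * s\<^sup>2" using t m
      by (intro mult_left_mono mult_nonneg_nonneg) (auto simp: abs_le_square_iff)
    finally show "cmod (Rs' t) \<le> exp 1 * (- \<mu>2) * s\<^sup>2" .
  qed
  moreover have "Rs 0 = 0" by (simp add: Rs_def ys_def)
  moreover have "\<bar>s\<bar> ^ 3 = \<bar>s\<bar>\<^sup>2 * \<bar>s\<bar>" by (simp only: power3_eq_cube power2_eq_square)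
  ultimately show ?thesis by (simp only: power2_abs mult.assoc diff_0_right)
qed

definition "\<kappa> = min 3 (2 * \<alpha>)"
definition "A2 = (\<mu>\<^sup>2 - \<mu>2) / 2"

lemma \<kappa>: "1 + \<alpha> < \<kappa>" "2 \<le> \<kappa>" "\<kappa> \<le> 3" "\<kappa> \<le> 2 * \<alpha>"
  using \<alpha> by (auto simp: \<kappa>_def)

text \<open>The remainder in \<open>\<phi> s = exp (\<i> s \<mu> + y1 s + A2 s\<^sup>2 - \<i> s \<mu> y1 s + RR s)\<close>.\<close>
definition RR :: "real \<Rightarrow> complex" where
  "RR s = - Rs s + \<i> * s * \<mu> * ys s - (y1 s - ys s)\<^sup>2 / 2 + Alg (\<phi> s - 1)"
definition RR' :: "real \<Rightarrow> complex" where
  "RR' s = - Rs' s + (\<i> * \<mu> * ys s + \<i> * s * \<mu> * ys' s) - (y1 s - ys s) * (y1' s - ys' s) + \<phi>' s * ((\<phi> s - 1)\<^sup>2 / \<phi> s)"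

lemma \<phi>_minus_1_bound: "cmod (\<phi> s - 1) \<le> \<mu> * \<bar>s\<bar>"
  using vector_mean_value_bound[OF \<phi>_series(2) \<phi>_series(4), of s] by (simp add: \<phi>_series(6))

lemma \<mu>_pos: "\<mu> > 0"
proof -
  have "0 \<le> \<rho> ^ (j + 1) * (p * q ^ j)" for j using p q \<rho> by simp
  then have "\<rho> ^ (0 + 1) * (p * q ^ 0) \<le> \<mu>"
    using sum_le_suminf[OF sums_summable[OF sums_\<mu>], of "{0}"] sums_unique[OF sums_\<mu>] by simp
  moreover have "0 < \<rho> * p" using p \<rho> by (intro mult_pos_pos) auto
  ultimately show ?thesis by simp
qed

lemma \<phi>_expansion:
  assumes "\<bar>s\<bar> * \<mu> \<le> 1/2"
  shows "\<phi> s = exp (\<i> * s * \<mu> + (y1 s + of_real (A2 * s\<^sup>2) - \<i> * \<mu> * s * y1 s + RR s))"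
    and "(RR has_vector_derivative RR' s) (at s)"
proof -
  let ?w = "\<phi> s - 1"
  have w: "cmod ?w \<le> 1/2" using \<phi>_minus_1_bound[of s] assms by (simp add: mult.commute)
  have nz: "\<phi> s \<noteq> 0" using w by auto
  have wy: "?w = \<i> * s * \<mu> + (y1 s - ys s)" by (simp add: y1_def)
  have "Ln (\<phi> s) = ?w - ?w\<^sup>2 / 2 + Alg ?w" by (simp add: Alg_def)
  also have "\<dots> = \<i> * s * \<mu> + (y1 s + of_real (A2 * s\<^sup>2) - \<i> * \<mu> * s * y1 s + RR s)"
    unfolding RR_def Rs_def A2_def
    apply (simp only: wy)
    apply (simp add: power2_eq_square field_simps)
    done
  finally have "Ln (\<phi> s) = \<i> * s * \<mu> + (y1 s + of_real (A2 * s\<^sup>2) - \<i> * \<mu> * s * y1 s + RR s)" .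
  then show "\<phi> s = exp (\<i> * s * \<mu> + (y1 s + of_real (A2 * s\<^sup>2) - \<i> * \<mu> * s * y1 s + RR s))"
    using exp_Ln[OF nz] by simp
  have dys: "((\<lambda>s. ys (of_real s)) has_vector_derivative ys' (of_real s)) (at s)"
    by (rule has_vector_derivative_real_field[OF ys_series(2)])
  have dl: "((\<lambda>s. \<i> * complex_of_real s * of_real \<mu>) has_vector_derivative \<i> * of_real \<mu>) (at s)"
  proof -
    have "((\<lambda>z. \<i> * z * of_real \<mu>) has_field_derivative \<i> * of_real \<mu>) (at (of_real s))"
      by (auto intro!: derivative_eq_intros)
    from has_vector_derivative_real_field[OF this] show ?thesis .
  qed
  have dA: "((\<lambda>s. Alg (\<phi> s - 1)) has_vector_derivative \<phi>' s * ((\<phi> s - 1)\<^sup>2 / \<phi> s)) (at s)"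
  proof -
    have "((\<lambda>s. \<phi> s - 1) has_vector_derivative \<phi>' s - 0) (at s)"
      by (rule has_vector_derivative_diff[OF \<phi>_series(2) has_vector_derivative_const])
    then have 1: "((\<lambda>s. \<phi> s - 1) has_vector_derivative \<phi>' s) (at s)" by simp
    have "(Alg has_field_derivative ?w\<^sup>2 / (1 + ?w)) (at ?w)" using w by (intro Alg_deriv) auto
    from field_vector_diff_chain_at[OF 1 this] show ?thesis by (simp add: comp_def)
  qed
  have dd: "((\<lambda>s. y1 s - ys s) has_vector_derivative y1' s - ys' s) (at s)"
    by (rule has_vector_derivative_diff[OF y1_deriv(1) dys])
  have dsq: "((\<lambda>s. (y1 s - ys s)\<^sup>2 / 2) has_vector_derivative (y1 s - ys s) * (y1' s - ys' s)) (at s)"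
  proof -
    have "((\<lambda>s. (y1 s - ys s) * (y1 s - ys s) * (1/2)) has_vector_derivative
      ((y1 s - ys s) * (y1' s - ys' s) + (y1' s - ys' s) * (y1 s - ys s)) * (1/2)) (at s)"
      by (rule has_vector_derivative_mult_left[OF has_vector_derivative_mult[OF dd dd]])
    moreover have "(\<lambda>s. (y1 s - ys s) * (y1 s - ys s) * (1/2)) = (\<lambda>s. (y1 s - ys s)\<^sup>2 / 2)"
      by (simp add: power2_eq_square)
    moreover have "(c * d + d * c) * (1/2) = c * d" for c d :: complex by (simp add: mult.commute)
    ultimately show ?thesis by (simp only:)
  qed
  have dm: "((\<lambda>s. \<i> * complex_of_real s * of_real \<mu> * ys s) has_vector_derivative \<i> * \<mu> * ys s + \<i> * s * \<mu> * ys' s) (at s)"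
    by (rule has_vector_derivative_eq_rhs[OF has_vector_derivative_mult[OF dl dys]]) (simp only: add.commute)
  show "(RR has_vector_derivative RR' s) (at s)"
    unfolding RR_def[abs_def] RR'_def
    by (rule has_vector_derivative_add[OF has_vector_derivative_diff[OF has_vector_derivative_add[OF has_vector_derivative_minus[OF Rs_deriv] dm] dsq] dA])
qed

lemma RR_bounds:
  obtains \<delta> C where "0 < \<delta>" "\<delta> \<le> 1" "\<delta> * \<mu> \<le> 1/2" "C > 0"
    "\<And>s. \<bar>s\<bar> \<le> \<delta> \<Longrightarrow> cmod (RR s) \<le> C * \<bar>s\<bar> powr \<kappa>" "\<And>s. \<bar>s\<bar> \<le> \<delta> \<Longrightarrow> cmod (RR' s) \<le> C * \<bar>s\<bar> powr (\<kappa> - 1)"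
proof -
  obtain Cy where Cy: "Cy > 0" "\<And>s. cmod (y1 s) \<le> Cy * \<bar>s\<bar> powr \<alpha>" "\<And>s. cmod (y1' s) \<le> Cy * \<bar>s\<bar> powr (\<alpha> - 1)"
      "\<And>s. Re (y1 s) \<le> - (cy / r) * \<bar>s\<bar> powr \<alpha>"
    by (rule y1_bounds, rule that, assumption+)
  define \<delta> where "\<delta> = min 1 (1 / (2 * \<mu>))"
  have \<delta>: "0 < \<delta>" "\<delta> \<le> 1" "\<delta> * \<mu> \<le> 1/2"
    using \<mu>_pos by (auto simp: \<delta>_def min_def field_simps)
  define M where "M = exp 1 * (- \<mu>2)"
  have M0: "M \<ge> 0" unfolding M_def using \<mu>2_nonpos by (intro mult_nonneg_nonneg) auto
  define P where "P = Cy + 2 * M + \<bar>\<mu>2\<bar>"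
  have P0: "P \<ge> 0" using M0 Cy by (simp add: P_def)
  define C where "C = 2 * M + 2 * \<mu> * P + P * P + 8 * \<mu> ^ 3 + 1"
  have C0: "C > 0" unfolding C_def using M0 \<mu>_pos P0 by (intro add_nonneg_pos add_nonneg_nonneg mult_nonneg_nonneg) auto
  have both: "cmod (RR s) \<le> C * \<bar>s\<bar> powr \<kappa> \<and> cmod (RR' s) \<le> C * \<bar>s\<bar> powr (\<kappa> - 1)" if s: "\<bar>s\<bar> \<le> \<delta>" for s
  proof (cases "s = 0")
    case True
    then show ?thesis by (simp add: RR_def RR'_def Rs_def Rs'_def ys_def ys'_def y1_def \<phi>_series Alg_def)
  next
    case False
    define x where "x = \<bar>s\<bar>"
    have x: "0 < x" "x \<le> 1" using False s \<delta> by (auto simp: x_def)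
    have "x * \<mu> \<le> \<delta> * \<mu>" using s \<mu>_pos by (intro mult_right_mono) (auto simp: x_def)
    then have x\<mu>: "x * \<mu> \<le> 1/2" using \<delta>(3) by linarith
    have pw: "x powr a \<le> x powr c" if "c \<le> a" for a c
      using that x by (intro powr_mono') auto
    have x2: "x\<^sup>2 = x powr 2" and x3: "x ^ 3 = x powr 3" and x1: "x = x powr 1"
      using x by (simp_all flip: powr_numeral)
    have Rsb: "cmod (Rs s) \<le> M * x powr 3" 
      unfolding x3[symmetric] using Rs_bound[of s] x(2) by (simp add: M_def x_def)
    have Rsb': "cmod (Rs' s) \<le> M * x powr 2" 
    proof -
      have "s\<^sup>2 = x powr 2" unfolding x2[symmetric] by (simp add: x_def)
      then show ?thesis using Rs'_bound[of s] x(2) by (simp add: M_def x_def)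
    qed
    have ysb: "cmod (ys s) \<le> M * x powr 2" 
      unfolding x2[symmetric] using ys_series(4)[of "of_real s"] x(2) by (simp add: M_def x_def)
    have ysb': "cmod (ys' s) \<le> (M + \<bar>\<mu>2\<bar>) * x powr 1"
    proof -
      have "cmod (ys' s) = cmod (Rs' s + of_real (\<mu>2 * s))" by (simp add: Rs'_def)
      also have "\<dots> \<le> M * x powr 2 + \<bar>\<mu>2\<bar> * x"
        by (rule order_trans[OF norm_triangle_ineq add_mono[OF Rsb']]) (simp add: abs_mult x_def norm_mult)
      also have "M * x powr 2 \<le> M * x powr 1" using M0 by (intro mult_left_mono pw) auto
      finally show ?thesis using x by (simp add: distrib_right)
    qed
    have db: "cmod (y1 s - ys s) \<le> P * x powr \<alpha>"
    proof -
      have "cmod (y1 s - ys s) \<le> Cy * x powr \<alpha> + M * x powr 2"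
        by (rule order_trans[OF norm_triangle_ineq4 add_mono]) (use Cy ysb in \<open>auto simp: x_def\<close>)
      also have "M * x powr 2 \<le> M * x powr \<alpha>" using M0 \<alpha> by (intro mult_left_mono pw) auto
      also have "Cy * x powr \<alpha> + M * x powr \<alpha> = (Cy + M) * x powr \<alpha>" by (simp add: distrib_right)
      also have "\<dots> \<le> P * x powr \<alpha>" using M0 by (intro mult_right_mono) (auto simp: P_def)
      finally show ?thesis by simp
    qed
    have db': "cmod (y1' s - ys' s) \<le> P * x powr (\<alpha> - 1)"
    proof -
      have "cmod (y1' s - ys' s) \<le> Cy * x powr (\<alpha> - 1) + (M + \<bar>\<mu>2\<bar>) * x powr 1"
        by (rule order_trans[OF norm_triangle_ineq4 add_mono]) (use Cy ysb' in \<open>auto simp: x_def\<close>)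
      also have "(M + \<bar>\<mu>2\<bar>) * x powr 1 \<le> (M + \<bar>\<mu>2\<bar>) * x powr (\<alpha> - 1)" using M0 \<alpha> by (intro mult_left_mono pw) auto
      also have "Cy * x powr (\<alpha> - 1) + (M + \<bar>\<mu>2\<bar>) * x powr (\<alpha> - 1) = (Cy + (M + \<bar>\<mu>2\<bar>)) * x powr (\<alpha> - 1)" by (simp add: distrib_right)
      also have "\<dots> \<le> P * x powr (\<alpha> - 1)" using M0 by (intro mult_right_mono) (auto simp: P_def)
      finally show ?thesis by simp
    qed
    have wb: "cmod (\<phi> s - 1) \<le> \<mu> * x" using \<phi>_minus_1_bound[of s] by (simp add: x_def)
    then have w2: "cmod (\<phi> s - 1) \<le> 1/2" using x\<mu> by (simp add: mult.commute)
    have MP: "M \<le> P" "M + \<bar>\<mu>2\<bar> \<le> P" using M0 Cy by (auto simp: P_def)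
    have 1: "cmod (- Rs s) \<le> M * x powr \<kappa>"
    proof -
      have "M * x powr 3 \<le> M * x powr \<kappa>" using M0 \<kappa> by (intro mult_left_mono pw) auto
      with Rsb show ?thesis by simp
    qed
    have 2: "cmod (\<i> * s * \<mu> * ys s) \<le> \<mu> * P * x powr \<kappa>"
    proof -
      have "cmod (\<i> * s * \<mu> * ys s) = x * \<mu> * cmod (ys s)" using \<mu>_pos by (simp add: norm_mult x_def)
      also have "\<dots> \<le> x * \<mu> * (P * x powr 2)"
        using ysb MP \<mu>_pos x by (intro mult_left_mono order_trans[OF ysb] mult_right_mono) auto
      also have "\<dots> = \<mu> * P * x powr 3" using x by (simp add: power2_eq_square power3_eq_cube)
      also have "\<dots> \<le> \<mu> * P * x powr \<kappa>" using \<mu>_pos P0 \<kappa> by (intro mult_left_mono pw) auto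
      finally show ?thesis .
    qed
    have 3: "cmod ((y1 s - ys s)\<^sup>2 / 2) \<le> P * P * x powr \<kappa>"
    proof -
      have "cmod ((y1 s - ys s)\<^sup>2 / 2) \<le> cmod (y1 s - ys s) * cmod (y1 s - ys s)"
        by (simp add: norm_divide norm_mult power2_eq_square)
      also have "\<dots> \<le> (P * x powr \<alpha>) * (P * x powr \<alpha>)" using db P0 by (intro mult_mono) auto
      also have "\<dots> = P * P * x powr (2 * \<alpha>)" using x by (simp add: powr_add[symmetric])
      also have "\<dots> \<le> P * P * x powr \<kappa>" using P0 \<kappa> by (intro mult_left_mono pw) auto
      finally show ?thesis .
    qed
    have 4: "cmod (Alg (\<phi> s - 1)) \<le> 2 * \<mu> ^ 3 * x powr \<kappa>"
    proof -
      have "cmod (Alg (\<phi> s - 1)) \<le> 2 * (cmod (\<phi> s - 1)) ^ 3" by (rule Alg_bound[OF w2])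
      also have "\<dots> \<le> 2 * (\<mu> * x) ^ 3" using wb by (intro mult_left_mono power_mono) auto
      also have "\<dots> = 2 * \<mu> ^ 3 * x powr 3" using x by (simp add: power_mult_distrib)
      also have "\<dots> \<le> 2 * \<mu> ^ 3 * x powr \<kappa>" using \<mu>_pos \<kappa> by (intro mult_left_mono pw) auto
      finally show ?thesis .
    qed
    have "cmod (RR s) \<le> M * x powr \<kappa> + \<mu> * P * x powr \<kappa> + P * P * x powr \<kappa> + 2 * \<mu> ^ 3 * x powr \<kappa>"
      unfolding RR_def
      by (rule norm_triangle_le[OF add_mono[OF norm_triangle_le_diff[OF add_mono[OF norm_triangle_le[OF add_mono[OF 1 2]] 3]] 4]])
    also have "\<dots> = (M + \<mu> * P + P * P + 2 * \<mu> ^ 3) * x powr \<kappa>" by (simp add: distrib_right)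
    also have "\<dots> \<le> C * x powr \<kappa>"
      using M0 \<mu>_pos P0 mult_nonneg_nonneg[of \<mu> P] by (intro mult_right_mono) (auto simp: C_def)
    finally have RRb: "cmod (RR s) \<le> C * x powr \<kappa>" .
    have 1: "cmod (- Rs' s) \<le> M * x powr (\<kappa> - 1)"
    proof -
      have "M * x powr 2 \<le> M * x powr (\<kappa> - 1)" using M0 \<kappa> by (intro mult_left_mono pw) auto
      with Rsb' show ?thesis by simp
    qed
    have 2: "cmod (\<i> * \<mu> * ys s + \<i> * s * \<mu> * ys' s) \<le> 2 * \<mu> * P * x powr (\<kappa> - 1)"
    proof -
      have "cmod (\<i> * \<mu> * ys s + \<i> * s * \<mu> * ys' s) \<le> \<mu> * cmod (ys s) + x * \<mu> * cmod (ys' s)"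
        by (rule order_trans[OF norm_triangle_ineq]) (use \<mu>_pos in \<open>simp add: norm_mult x_def\<close>)
      also have "\<dots> \<le> \<mu> * (P * x powr 2) + x * \<mu> * (P * x powr 1)"
        using MP \<mu>_pos x by (intro add_mono mult_left_mono order_trans[OF ysb] order_trans[OF ysb'] mult_right_mono) auto
      also have "\<dots> = 2 * \<mu> * P * x powr 2" using x by (simp add: power2_eq_square)
      also have "\<dots> \<le> 2 * \<mu> * P * x powr (\<kappa> - 1)" using \<mu>_pos P0 \<kappa> by (intro mult_left_mono pw) auto
      finally show ?thesis .
    qed
    have 3: "cmod ((y1 s - ys s) * (y1' s - ys' s)) \<le> P * P * x powr (\<kappa> - 1)"
    proof -
      have "cmod ((y1 s - ys s) * (y1' s - ys' s)) \<le> (P * x powr \<alpha>) * (P * x powr (\<alpha> - 1))"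
        unfolding norm_mult using db db' P0 by (intro mult_mono) auto
      also have "\<dots> = P * P * x powr (2 * \<alpha> - 1)" using x by (simp add: powr_add[symmetric])
      also have "\<dots> \<le> P * P * x powr (\<kappa> - 1)" using P0 \<kappa> by (intro mult_left_mono pw) auto
      finally show ?thesis .
    qed
    have 4: "cmod (\<phi>' s * ((\<phi> s - 1)\<^sup>2 / \<phi> s)) \<le> 2 * \<mu> ^ 3 * x powr (\<kappa> - 1)"
    proof -
      have "cmod (\<phi>' s * ((\<phi> s - 1)\<^sup>2 / \<phi> s)) = cmod (\<phi>' s) * cmod ((\<phi> s - 1)\<^sup>2 / (1 + (\<phi> s - 1)))"
        by (simp add: norm_mult norm_divide)
      also have "\<dots> \<le> \<mu> * (2 * (cmod (\<phi> s - 1))\<^sup>2)"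
        using \<mu>_pos by (intro mult_mono Alg'_bound w2 \<phi>_series(4)) auto
      also have "\<dots> \<le> \<mu> * (2 * (\<mu> * x)\<^sup>2)" using wb \<mu>_pos by (intro mult_left_mono power_mono) auto
      also have "\<dots> = 2 * \<mu> ^ 3 * x powr 2" using x by (simp add: power_mult_distrib power2_eq_square power3_eq_cube)
      also have "\<dots> \<le> 2 * \<mu> ^ 3 * x powr (\<kappa> - 1)" using \<mu>_pos \<kappa> by (intro mult_left_mono pw) auto
      finally show ?thesis .
    qed
    have "cmod (RR' s) \<le> M * x powr (\<kappa> - 1) + 2 * \<mu> * P * x powr (\<kappa> - 1) + P * P * x powr (\<kappa> - 1) + 2 * \<mu> ^ 3 * x powr (\<kappa> - 1)"
      unfolding RR'_def
      by (rule norm_triangle_le[OF add_mono[OF norm_triangle_le_diff[OF add_mono[OF norm_triangle_le[OF add_mono[OF 1 2]] 3]] 4]])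
    also have "\<dots> = (M + 2 * \<mu> * P + P * P + 2 * \<mu> ^ 3) * x powr (\<kappa> - 1)" by (simp add: distrib_right)
    also have "\<dots> \<le> C * x powr (\<kappa> - 1)"
      using M0 \<mu>_pos P0 by (intro mult_right_mono) (auto simp: C_def)
    finally show ?thesis using RRb by (simp add: x_def)
  qed
  show thesis by (rule that[of \<delta> C]) (use \<delta> C0 both in auto)
qed

end

section \<open>Samples and compound Poisson laws\<close>

locale petersburg_sample = petersburg + M: prob_space M
  for M :: "'a measure" +
  fixes X :: "nat \<Rightarrow> 'a \<Rightarrow> real"
  assumes rv [measurable]: "\<And>i. X i \<in> borel_measurable M"
    and indep: "M.indep_vars (\<lambda>_. borel) X UNIV"
    and law: "\<And>i k. k \<ge> 1 \<Longrightarrow>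
        measure M {\<omega> \<in> space M. X i \<omega> = rr p powr (real k / \<alpha>)} = qq p ^ (k - 1) * p"
begin

lemma law_atom: "measure M {\<omega> \<in> space M. X i \<omega> = \<rho> ^ (j + 1)} = p * q ^ j"
  using law[of "j + 1" i] by (simp add: qq_rr r_powr_root(1)[of "j + 1", simplified] mult.commute)

lemma AE_atoms: "AE \<omega> in M. \<exists>j. X i \<omega> = \<rho> ^ (j + 1)"
proof -
  let ?A = "\<lambda>j. {\<omega> \<in> space M. X i \<omega> = \<rho> ^ (j + 1)}"
  have "disjoint_family ?A"
    unfolding disjoint_family_on_def using \<rho> by (auto simp: power_inject_exp)
  then have "(\<lambda>j. measure M (?A j)) sums measure M (\<Union>j. ?A j)"
    by (intro M.finite_measure_UNION) auto
  then have "(\<lambda>j. p * q ^ j) sums measure M (\<Union>j. ?A j)" unfolding law_atom .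
  then have "measure M (\<Union>j. ?A j) = 1" using sums_weights sums_unique2 by blast
  then have "AE \<omega> in M. \<omega> \<in> (\<Union>j. ?A j)" by (rule M.AE_prob_1)
  then show ?thesis by eventually_elim auto
qed

lemma expectation_atoms:
  fixes f :: "real \<Rightarrow> 'b::{banach, second_countable_topology}"
  assumes s: "summable (\<lambda>j. (p * q ^ j) * norm (f (\<rho> ^ (j + 1))))" and f [measurable]: "f \<in> borel_measurable borel"
  shows "integrable M (\<lambda>\<omega>. f (X i \<omega>))" "(\<integral>\<omega>. f (X i \<omega>) \<partial>M) = (\<Sum>j. (p * q ^ j) *\<^sub>R f (\<rho> ^ (j + 1)))"
proof -
  let ?A = "\<lambda>j. {\<omega> \<in> space M. X i \<omega> = \<rho> ^ (j + 1)}"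
  let ?g = "\<lambda>j \<omega>. indicator (?A j) \<omega> *\<^sub>R f (\<rho> ^ (j + 1))"
  have single: "\<exists>j0. \<forall>j. j \<noteq> j0 \<longrightarrow> ?g j \<omega> = 0" for \<omega>
  proof (cases "\<exists>j. X i \<omega> = \<rho> ^ (j + 1)")
    case True
    then obtain j0 where j0: "X i \<omega> = \<rho> ^ (j0 + 1)" by blast
    have "?g j \<omega> = 0" if "j \<noteq> j0" for j
      using that j0 \<rho> by (auto simp: indicator_def power_inject_exp)
    then show ?thesis by blast
  qed (auto simp: indicator_def)
  have int: "integrable M (?g j)" for j by (intro integrable_scaleR_left integrable_real_indicator) (auto simp: M.emeasure_eq_measure)
  have val: "(\<integral>\<omega>. ?g j \<omega> \<partial>M) = (p * q ^ j) *\<^sub>R f (\<rho> ^ (j + 1))" for j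
    using law_atom[of i j] by (simp add: integral_scaleR_left integrable_indicator M.emeasure_eq_measure Int_absorb2 subset_eq)
  have valn: "(\<integral>\<omega>. norm (?g j \<omega>) \<partial>M) = (p * q ^ j) * norm (f (\<rho> ^ (j + 1)))" for j
    using law_atom[of i j] by (simp add: M.emeasure_eq_measure Int_absorb2 subset_eq)
  have sn: "AE \<omega> in M. summable (\<lambda>j. norm (?g j \<omega>))"
  proof (rule AE_I2)
    fix \<omega>
    obtain j0 where "\<forall>j. j \<noteq> j0 \<longrightarrow> ?g j \<omega> = 0" using single by blast
    then show "summable (\<lambda>j. norm (?g j \<omega>))" by (intro summable_finite[of "{j0}"]) auto
  qed
  have sv: "summable (\<lambda>j. \<integral>\<omega>. norm (?g j \<omega>) \<partial>M)" unfolding valn by (rule s)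
  have eq: "AE \<omega> in M. (\<Sum>j. ?g j \<omega>) = f (X i \<omega>)"
    using AE_atoms[of i] AE_space
  proof eventually_elim
    case (elim \<omega>)
    then obtain j0 where j0: "X i \<omega> = \<rho> ^ (j0 + 1)" by blast
    have "?g j \<omega> = 0" if "j \<noteq> j0" for j
      using that j0 \<rho> by (auto simp: indicator_def power_inject_exp)
    then have "(\<Sum>j. ?g j \<omega>) = (\<Sum>j\<in>{j0}. ?g j \<omega>)" by (intro suminf_finite) auto
    then show ?case using j0 elim by (simp add: indicator_def)
  qed
  have i: "integrable M (\<lambda>\<omega>. \<Sum>j. ?g j \<omega>)" by (rule integrable_suminf[OF int sn sv])
  then show "integrable M (\<lambda>\<omega>. f (X i \<omega>))"
    by (subst integrable_cong_AE[OF _ _ eq, symmetric]) auto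
  have "(\<integral>\<omega>. f (X i \<omega>) \<partial>M) = (\<integral>\<omega>. (\<Sum>j. ?g j \<omega>) \<partial>M)"
    by (rule integral_cong_AE) (use eq borel_measurable_integrable[OF i] in auto)
  also have "\<dots> = (\<Sum>j. \<integral>\<omega>. ?g j \<omega> \<partial>M)" by (rule integral_suminf[OF int sn sv])
  finally show "(\<integral>\<omega>. f (X i \<omega>) \<partial>M) = (\<Sum>j. (p * q ^ j) *\<^sub>R f (\<rho> ^ (j + 1)))" unfolding val .
qed

lemma integrable_X: "integrable M (X i)"
proof -
  have "(\<lambda>j. (p * q ^ j) * norm (\<rho> ^ (j + 1))) = (\<lambda>j. \<rho> ^ (j + 1) * (p * q ^ j))" using \<rho> by auto
  then show ?thesis using expectation_atoms(1)[of "\<lambda>x. x"] sums_summable[OF sums_\<mu>] by simp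
qed

lemma expectation_abs_X: "(\<integral>\<omega>. \<bar>X i \<omega>\<bar> \<partial>M) = \<mu>"
proof -
  have eq: "(\<lambda>j. (p * q ^ j) * norm \<bar>\<rho> ^ (j + 1)\<bar>) = (\<lambda>j. \<rho> ^ (j + 1) * (p * q ^ j))" "(\<lambda>j. (p * q ^ j) *\<^sub>R \<bar>\<rho> ^ (j + 1)\<bar>) = (\<lambda>j. \<rho> ^ (j + 1) * (p * q ^ j))" using \<rho> by auto
  have s: "summable (\<lambda>j. (p * q ^ j) * norm \<bar>\<rho> ^ (j + 1)\<bar>)" unfolding eq by (rule sums_summable[OF sums_\<mu>])
  show ?thesis using expectation_atoms(2)[OF s, of i] unfolding eq sums_unique[OF sums_\<mu>, symmetric] by simp
qed

lemma char_X: "char (distr M borel (X i)) t = \<phi> t"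
proof -
  have s: "summable (\<lambda>j. (p * q ^ j) * norm (iexp (t * \<rho> ^ (j + 1))))"
    using sums_summable[OF sums_weights] by simp
  have m: "(\<lambda>x. iexp (t * x)) \<in> borel_measurable borel" by measurable
  have "char (distr M borel (X i)) t = (\<integral>\<omega>. iexp (t * X i \<omega>) \<partial>M)"
    unfolding char_def by (rule integral_distr) measurable
  also have "\<dots> = (\<Sum>j. (p * q ^ j) *\<^sub>R iexp (t * \<rho> ^ (j + 1)))"
    by (rule expectation_atoms(2)[OF s m])
  also have "\<dots> = \<phi> t" unfolding \<phi>_def by (simp only: scaleR_conv_of_real mult.commute)
  finally show ?thesis .
qed

definition S :: "nat \<Rightarrow> 'a \<Rightarrow> real" where "S k \<omega> = (\<Sum>i<k. X i \<omega>)"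

lemma S_measurable [measurable]: "S k \<in> borel_measurable M"
  unfolding S_def by measurable

lemma char_S: "(\<integral>\<omega>. iexp (t * S k \<omega>) \<partial>M) = \<phi> t ^ k"
proof -
  have "(\<integral>\<omega>. iexp (t * S k \<omega>) \<partial>M) = char (distr M borel (\<lambda>\<omega>. \<Sum>i<k. X i \<omega>)) t"
    unfolding char_def S_def by (rule integral_distr[symmetric]) measurable
  also have "\<dots> = (\<Prod>i<k. char (distr M borel (X i)) t)"
    by (rule M.char_distr_sum) (rule M.indep_vars_subset[OF indep], simp)
  finally show ?thesis by (simp add: char_X)
qed

lemma integrable_S: "integrable M (S k)" "(\<integral>\<omega>. \<bar>S k \<omega>\<bar> \<partial>M) \<le> real k * \<mu>"
proof -
  show i: "integrable M (S k)" unfolding S_def by (intro Bochner_Integration.integrable_sum integrable_X)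
  have "(\<integral>\<omega>. \<bar>S k \<omega>\<bar> \<partial>M) \<le> (\<integral>\<omega>. (\<Sum>i<k. \<bar>X i \<omega>\<bar>) \<partial>M)"
    using i integrable_X by (intro integral_mono) (auto simp: S_def sum_abs)
  also have "\<dots> = (\<Sum>i<k. \<integral>\<omega>. \<bar>X i \<omega>\<bar> \<partial>M)"
    using integrable_X by (intro Bochner_Integration.integral_sum) auto
  finally show "(\<integral>\<omega>. \<bar>S k \<omega>\<bar> \<partial>M) \<le> real k * \<mu>" by (simp add: expectation_abs_X)
qed

lemma poisson_expectation:
  fixes f :: "nat \<Rightarrow> 'b::{banach, second_countable_topology}"
  assumes \<nu>: "0 < \<nu>" and s: "summable (\<lambda>k. (\<nu> ^ k / fact k * exp (- \<nu>)) * norm (f k))"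
  shows "integrable (measure_pmf (poisson_pmf \<nu>)) f"
    "(\<integral>k. f k \<partial>measure_pmf (poisson_pmf \<nu>)) = (\<Sum>k. (\<nu> ^ k / fact k * exp (- \<nu>)) *\<^sub>R f k)"
proof -
  have w: "0 \<le> \<nu> ^ k / fact k * exp (- \<nu>)" for k using \<nu> by simp
  have i: "integrable (count_space UNIV) (\<lambda>k. (\<nu> ^ k / fact k * exp (- \<nu>)) *\<^sub>R f k)"
    unfolding integrable_count_space_nat_iff norm_scaleR abs_of_nonneg[OF w] by (rule s)
  show "integrable (measure_pmf (poisson_pmf \<nu>)) f"
    using i w unfolding measure_pmf_eq_density by (subst integrable_density) (auto simp: pmf_poisson[OF \<nu>])
  show "(\<integral>k. f k \<partial>measure_pmf (poisson_pmf \<nu>)) = (\<Sum>k. (\<nu> ^ k / fact k * exp (- \<nu>)) *\<^sub>R f k)"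
    using i w unfolding measure_pmf_eq_density
    by (subst integral_density) (auto simp: pmf_poisson[OF \<nu>] integral_count_space_nat[OF i, simplified])
qed

text \<open>\<open>cp \<nu> \<epsilon> i\<close> is a centred compound Poisson variable plus \<open>i\<close> further independent summands: the summand
  number is the Poisson variable \<open>fst z\<close>. The \<open>i\<close> extra summands produce the powers of \<open>\<phi>\<close> in the transform of \<open>G\<^sup>(\<^sup>1\<^sup>,\<^sup>1\<^sup>)\<close>.\<close>
definition CP :: "real \<Rightarrow> (nat \<times> 'a) measure" where
  "CP \<nu> = measure_pmf (poisson_pmf \<nu>) \<Otimes>\<^sub>M M"

definition cp :: "real \<Rightarrow> real \<Rightarrow> nat \<Rightarrow> nat \<times> 'a \<Rightarrow> real" where
  "cp \<nu> \<epsilon> i z = \<epsilon> * (S (fst z + i) (snd z) - \<nu> * \<mu>)"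

lemma cp_measurable [measurable]: "cp \<nu> \<epsilon> i \<in> borel_measurable (CP \<nu>)"
proof -
  have "cp \<nu> \<epsilon> i \<in> borel_measurable (count_space UNIV \<Otimes>\<^sub>M M)"
    by (rule measurable_pair_measure_countable1) (auto simp: cp_def)
  moreover have "sets (CP \<nu>) = sets (count_space UNIV \<Otimes>\<^sub>M M)"
    unfolding CP_def by (intro sets_pair_measure_cong) auto
  ultimately show ?thesis by (simp cong: measurable_cong_sets)
qed

lemma prob_space_CP: "prob_space (CP \<nu>)"
proof -
  interpret P: pair_prob_space "measure_pmf (poisson_pmf \<nu>)" M ..
  show ?thesis unfolding CP_def by (rule P.prob_space_axioms)
qed

lemma char_cp:
  assumes \<nu>: "0 < \<nu>"
  shows "(\<integral>z. iexp (t * cp \<nu> \<epsilon> i z) \<partial>CP \<nu>) = \<phi> (\<epsilon> * t) ^ i * exp (\<nu> * (\<phi> (\<epsilon> * t) - 1 - \<i> * (\<epsilon> * t) * \<mu>))"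
proof -
  interpret P: pair_prob_space "measure_pmf (poisson_pmf \<nu>)" M ..
  interpret C: prob_space "CP \<nu>" by (rule prob_space_CP)
  define u where "u = \<epsilon> * t"
  define c where "c = iexp (- (u * (\<nu> * \<mu>)))"
  have int: "integrable (measure_pmf (poisson_pmf \<nu>) \<Otimes>\<^sub>M M) (\<lambda>z. iexp (t * cp \<nu> \<epsilon> i z))"
    unfolding CP_def[symmetric] by (rule C.integrable_iexp) auto
  have "(\<integral>z. iexp (t * cp \<nu> \<epsilon> i z) \<partial>CP \<nu>) = (\<integral>k. (\<integral>\<omega>. iexp (t * cp \<nu> \<epsilon> i (k, \<omega>)) \<partial>M) \<partial>measure_pmf (poisson_pmf \<nu>))"
    unfolding CP_def by (rule P.integral_fst'[symmetric, OF int])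
  also have "\<dots> = (\<integral>k. c * \<phi> u ^ (k + i) \<partial>measure_pmf (poisson_pmf \<nu>))"
  proof (intro Bochner_Integration.integral_cong refl)
    fix k
    have "iexp (t * cp \<nu> \<epsilon> i (k, \<omega>)) = c * iexp (u * S (k + i) \<omega>)" for \<omega>
      by (simp add: cp_def c_def u_def exp_add[symmetric] algebra_simps)
    then show "(\<integral>\<omega>. iexp (t * cp \<nu> \<epsilon> i (k, \<omega>)) \<partial>M) = c * \<phi> u ^ (k + i)"
      by (simp only: integral_mult_right_zero char_S)
  qed
  also have "\<dots> = (\<Sum>k. (\<nu> ^ k / fact k * exp (- \<nu>)) *\<^sub>R (c * \<phi> u ^ (k + i)))"
  proof (rule poisson_expectation(2)[OF \<nu>], rule summable_comparison_test'[of _ 0])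
    show "summable (\<lambda>k. exp (- \<nu>) * (\<nu> ^ k / fact k))"
      using summable_exp[of \<nu>] by (intro summable_mult) (simp add: divide_inverse mult.commute)
    fix k
    have "cmod c = 1" unfolding c_def by (rule norm_exp_i_times)
    then have "cmod (c * \<phi> u ^ (k + i)) \<le> 1" using \<phi>_series(5)[of u] by (simp add: norm_mult norm_power power_le_one)
    then have "(\<nu> ^ k / fact k * exp (- \<nu>)) * cmod (c * \<phi> u ^ (k + i)) \<le> (\<nu> ^ k / fact k * exp (- \<nu>)) * 1"
      using \<nu> by (intro mult_left_mono) auto
    then show "norm ((\<nu> ^ k / fact k * exp (- \<nu>)) * cmod (c * \<phi> u ^ (k + i))) \<le> exp (- \<nu>) * (\<nu> ^ k / fact k)"
      using \<nu> by (simp add: mult.commute)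
  qed
  also have "\<dots> = (\<Sum>k. (of_real (exp (- \<nu>)) * c * \<phi> u ^ i) * ((of_real \<nu> * \<phi> u) ^ k /\<^sub>R fact k))"
    by (intro suminf_cong) (simp add: scaleR_conv_of_real power_add power_mult_distrib divide_inverse mult_ac)
  also have "\<dots> = (of_real (exp (- \<nu>)) * c * \<phi> u ^ i) * exp (of_real \<nu> * \<phi> u)"
    unfolding exp_def by (rule suminf_mult[OF summable_exp_generic])
  also have "\<dots> = \<phi> u ^ i * exp (of_real (- \<nu>) + \<i> * of_real (- (u * (\<nu> * \<mu>))) + of_real \<nu> * \<phi> u)"
    unfolding c_def by (simp only: exp_add exp_of_real mult_ac)
  also have "of_real (- \<nu>) + \<i> * of_real (- (u * (\<nu> * \<mu>))) + of_real \<nu> * \<phi> u = \<nu> * (\<phi> u - 1 - \<i> * u * \<mu>)"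
    by (simp add: algebra_simps)
  finally show ?thesis by (simp add: u_def)
qed

lemma integrable_cp:
  assumes \<nu>: "0 < \<nu>"
  shows "integrable (CP \<nu>) (cp \<nu> \<epsilon> i)"
proof -
  interpret P: pair_prob_space "measure_pmf (poisson_pmf \<nu>)" M ..
  have iS: "integrable M (\<lambda>\<omega>. \<epsilon> * (S (k + i) \<omega> - \<nu> * \<mu>))" for k using integrable_S(1) by simp
  have i1: "integrable (measure_pmf (poisson_pmf \<nu>)) (\<lambda>k. \<bar>\<epsilon>\<bar> * ((real k + real i) * \<mu> + \<nu> * \<mu>))"
  proof (intro integrable_mult_right Bochner_Integration.integrable_add integrable_mult_left)
    show "integrable (measure_pmf (poisson_pmf \<nu>)) real"
    proof (rule poisson_expectation(1)[OF \<nu>], rule summable_comparison_test'[of _ 0])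
      show "summable (\<lambda>k. exp (- \<nu>) * ((2 * \<nu>) ^ k / fact k))"
        using summable_exp[of "2 * \<nu>"] by (intro summable_mult) (simp add: divide_inverse mult.commute)
      fix k
      have "real k \<le> 2 ^ k" using of_nat_less_two_power[of k, where 'a = real] by simp
      then have "\<nu> ^ k / fact k * exp (- \<nu>) * real k \<le> \<nu> ^ k / fact k * exp (- \<nu>) * 2 ^ k"
        using \<nu> by (intro mult_left_mono) auto
      then show "norm (\<nu> ^ k / fact k * exp (- \<nu>) * norm (real k)) \<le> exp (- \<nu>) * ((2 * \<nu>) ^ k / fact k)"
        using \<nu> by (simp add: power_mult_distrib mult_ac)
    qed
  qed auto
  have m: "cp \<nu> \<epsilon> i \<in> borel_measurable (measure_pmf (poisson_pmf \<nu>) \<Otimes>\<^sub>M M)"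
    using cp_measurable[of \<nu> \<epsilon> i] unfolding CP_def .
  have "integrable (measure_pmf (poisson_pmf \<nu>) \<Otimes>\<^sub>M M) (cp \<nu> \<epsilon> i)"
  proof (rule P.Fubini_integrable[OF m])
    show "AE k in measure_pmf (poisson_pmf \<nu>). integrable M (\<lambda>\<omega>. cp \<nu> \<epsilon> i (k, \<omega>))"
      using iS by (simp add: cp_def)
    show "integrable (measure_pmf (poisson_pmf \<nu>)) (\<lambda>k. \<integral>\<omega>. norm (cp \<nu> \<epsilon> i (k, \<omega>)) \<partial>M)"
    proof (rule Bochner_Integration.integrable_bound[OF i1])
      have "norm (\<integral>\<omega>. norm (cp \<nu> \<epsilon> i (k, \<omega>)) \<partial>M) \<le> norm (\<bar>\<epsilon>\<bar> * ((real k + real i) * \<mu> + \<nu> * \<mu>))" for k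
      proof -
        have "(\<integral>\<omega>. \<bar>\<epsilon> * (S (k + i) \<omega> - \<nu> * \<mu>)\<bar> \<partial>M) \<le> (\<integral>\<omega>. \<bar>\<epsilon>\<bar> * (\<bar>S (k + i) \<omega>\<bar> + \<nu> * \<mu>) \<partial>M)"
        proof (rule integral_mono)
          show "integrable M (\<lambda>\<omega>. \<bar>\<epsilon> * (S (k + i) \<omega> - \<nu> * \<mu>)\<bar>)" using iS[of k] by (rule integrable_abs)
          show "integrable M (\<lambda>\<omega>. \<bar>\<epsilon>\<bar> * (\<bar>S (k + i) \<omega>\<bar> + \<nu> * \<mu>))" using integrable_S(1)[of "k + i"] by auto
          show "\<bar>\<epsilon> * (S (k + i) \<omega> - \<nu> * \<mu>)\<bar> \<le> \<bar>\<epsilon>\<bar> * (\<bar>S (k + i) \<omega>\<bar> + \<nu> * \<mu>)" for \<omega>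
            using mult_nonneg_nonneg[OF less_imp_le[OF \<nu>] less_imp_le[OF \<mu>_pos]] unfolding abs_mult by (intro mult_left_mono) auto
        qed
        also have "\<dots> = \<bar>\<epsilon>\<bar> * ((\<integral>\<omega>. \<bar>S (k + i) \<omega>\<bar> \<partial>M) + \<nu> * \<mu>)"
          using integrable_S(1)[of "k + i"] by (simp add: M.prob_space)
        also have "\<dots> \<le> \<bar>\<epsilon>\<bar> * (real (k + i) * \<mu> + \<nu> * \<mu>)"
          by (intro mult_left_mono add_right_mono integrable_S(2)) auto
        finally have "(\<integral>\<omega>. norm (cp \<nu> \<epsilon> i (k, \<omega>)) \<partial>M) \<le> \<bar>\<epsilon>\<bar> * ((real k + real i) * \<mu> + \<nu> * \<mu>)"
          by (simp add: cp_def)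
        moreover have "0 \<le> (\<integral>\<omega>. norm (cp \<nu> \<epsilon> i (k, \<omega>)) \<partial>M)" by simp
        ultimately show ?thesis by simp
      qed
      then show "AE k in measure_pmf (poisson_pmf \<nu>). norm (\<integral>\<omega>. norm (cp \<nu> \<epsilon> i (k, \<omega>)) \<partial>M) \<le> norm (\<bar>\<epsilon>\<bar> * ((real k + real i) * \<mu> + \<nu> * \<mu>))"
        by simp
    qed simp
  qed
  then show ?thesis unfolding CP_def .
qed

end

section \<open>Densities of the approximating functions\<close>

lemma polynomial_exp_bounded:
  assumes c: "c > 0"
  obtains C :: real where "C > 0" "\<And>x. x \<ge> 0 \<Longrightarrow> (1 + x) ^ m * exp (- c * x) \<le> C"
proof (rule that[of "fact m * exp c / c ^ m"])
  show "0 < fact m * exp c / c ^ m" using c by simp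
  fix x :: real assume x: "x \<ge> 0"
  define y where "y = c * (1 + x)"
  have y: "y \<ge> 0" using c x by (simp add: y_def)
  have "(\<Sum>k\<in>{m}. y ^ k /\<^sub>R fact k) \<le> (\<Sum>k. y ^ k /\<^sub>R fact k)"
    by (rule sum_le_suminf[OF summable_exp_generic]) (use y in auto)
  then have "y ^ m / fact m \<le> exp y" by (simp add: exp_def divide_inverse mult.commute)
  then have "y ^ m \<le> fact m * exp y" by (simp add: field_simps)
  moreover have "y ^ m = c ^ m * (1 + x) ^ m" by (simp only: y_def power_mult_distrib)
  moreover have "exp y = exp c * exp (c * x)" by (simp add: y_def distrib_left exp_add)
  ultimately have "c ^ m * (1 + x) ^ m \<le> fact m * (exp c * exp (c * x))" by simp
  then have "c ^ m * (1 + x) ^ m * exp (- c * x) \<le> fact m * (exp c * exp (c * x)) * exp (- c * x)"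
    by (rule mult_right_mono) simp
  also have "\<dots> = fact m * exp c" by (simp add: mult.assoc exp_minus_inverse exp_add[symmetric])
  finally show "(1 + x) ^ m * exp (- c * x) \<le> fact m * exp c / c ^ m"
    using c by (simp add: field_simps)
qed

lemma polynomial_exp_le_exp:
  assumes c: "c > 0"
  obtains C :: real where "C > 0" "\<And>x. x \<ge> 0 \<Longrightarrow> (1 + x) ^ m * exp (- c * x) \<le> C * exp (- (c / 2) * x)"
proof -
  obtain C :: real where C: "C > 0" "\<And>x. x \<ge> 0 \<Longrightarrow> (1 + x) ^ m * exp (- (c / 2) * x) \<le> C"
    using polynomial_exp_bounded[of "c / 2" m] c by auto
  show thesis
  proof (rule that[OF C(1)])
    fix x :: real assume x: "x \<ge> 0"
    have "(1 + x) ^ m * exp (- c * x) = (1 + x) ^ m * exp (- (c / 2) * x) * exp (- (c / 2) * x)"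
      by (simp add: mult.assoc exp_add[symmetric])
    also have "\<dots> \<le> C * exp (- (c / 2) * x)" by (rule mult_right_mono[OF C(2)[OF x]]) simp
    finally show "(1 + x) ^ m * exp (- c * x) \<le> C * exp (- (c / 2) * x)" .
  qed
qed

lemma exp_le_inv_square:
  assumes c: "c > 0"
  obtains C :: real where "C > 0" "\<And>x. exp (- c * \<bar>x\<bar>) \<le> C / (1 + x\<^sup>2)"
proof -
  obtain C :: real where C: "C > 0" "\<And>x. x \<ge> 0 \<Longrightarrow> (1 + x) ^ 2 * exp (- c * x) \<le> C"
    using polynomial_exp_bounded[OF c, of 2] by auto
  show thesis
  proof (rule that[OF C(1)])
    fix x :: real
    have "1 + x\<^sup>2 \<le> (1 + \<bar>x\<bar>)\<^sup>2" by (simp add: power2_eq_square algebra_simps)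
    then have "(1 + x\<^sup>2) * exp (- c * \<bar>x\<bar>) \<le> (1 + \<bar>x\<bar>)\<^sup>2 * exp (- c * \<bar>x\<bar>)" by (rule mult_right_mono) simp
    also have "\<dots> \<le> C" by (rule C(2)) simp
    finally show "exp (- c * \<bar>x\<bar>) \<le> C / (1 + x\<^sup>2)" by (simp add: pos_le_divide_eq add_pos_nonneg mult.commute)
  qed
qed

text \<open>Transforms of real \<open>L1\<close> densities with finite first absolute moment.\<close>
definition regular_transform :: "(real \<Rightarrow> complex) \<Rightarrow> bool" where
  "regular_transform w \<longleftrightarrow> continuous_on UNIV w \<and> (\<exists>C. \<forall>t. cmod (w t) \<le> C / (1 + t\<^sup>2)) \<and> (\<forall>t. w (- t) = cnj (w t)) \<and>
     integrable lborel (\<lambda>x. (1 + \<bar>x\<bar>) * cmod (ift w x))"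

lemma integrable_bounded_transform:
  assumes "continuous_on UNIV w" "\<And>t. cmod (w t) \<le> C / (1 + t\<^sup>2)"
  shows "integrable lborel w"
  using assms by (intro integrable_bound_inv_square[where C = C] borel_measurable_continuous_onI)

lemma regular_transform_integrable: "regular_transform w \<Longrightarrow> integrable lborel w"
  unfolding regular_transform_def using integrable_bounded_transform by blast

lemma ift_add:
  assumes "integrable lborel v" "integrable lborel w"
  shows "ift (\<lambda>t. v t + w t) x = ift v x + ift w x"
proof -
  have "(\<integral>t. iexp (- (t * x)) * (v t + w t) \<partial>lborel) = (\<integral>t. iexp (- (t * x)) * v t + iexp (- (t * x)) * w t \<partial>lborel)"
    by (simp only: distrib_left)
  also have "\<dots> = (\<integral>t. iexp (- (t * x)) * v t \<partial>lborel) + (\<integral>t. iexp (- (t * x)) * w t \<partial>lborel)"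
    by (rule Bochner_Integration.integral_add[OF ift_integrable[OF assms(1)] ift_integrable[OF assms(2)]])
  finally show ?thesis unfolding ift_def by (simp only: distrib_left)
qed

lemma ift_cmult: "ift (\<lambda>t. c * w t) x = c * ift w x"
proof -
  have "(\<integral>t. iexp (- (t * x)) * (c * w t) \<partial>lborel) = (\<integral>t. c * (iexp (- (t * x)) * w t) \<partial>lborel)"
    by (simp only: mult.left_commute)
  also have "\<dots> = c * (\<integral>t. iexp (- (t * x)) * w t \<partial>lborel)" by (rule integral_mult_right_zero)
  finally show ?thesis unfolding ift_def by (simp only: mult.left_commute)
qed

lemma weighted_norm_bound_integrable:
  assumes "integrable lborel w" "integrable lborel (\<lambda>x. B x)" "\<And>x. (1 + \<bar>x\<bar>) * cmod (ift w x) \<le> B x"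
  shows "integrable lborel (\<lambda>x. (1 + \<bar>x\<bar>) * cmod (ift w x))"
proof (rule Bochner_Integration.integrable_bound[OF assms(2)])
  have [measurable]: "ift w \<in> borel_measurable borel"
    by (rule borel_measurable_continuous_onI[OF continuous_ift[OF assms(1)]])
  show "(\<lambda>x. (1 + \<bar>x\<bar>) * cmod (ift w x)) \<in> borel_measurable lborel" by measurable
  show "AE x in lborel. norm ((1 + \<bar>x\<bar>) * cmod (ift w x)) \<le> norm (B x)"
  proof (rule AE_I2)
    fix x
    have "0 \<le> (1 + \<bar>x\<bar>) * cmod (ift w x)" by simp
    then show "norm ((1 + \<bar>x\<bar>) * cmod (ift w x)) \<le> norm (B x)" using assms(3)[of x] by simp
  qed
qed

lemma regular_transform_add:
  assumes "regular_transform v" "regular_transform w"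
  shows "regular_transform (\<lambda>t. v t + w t)"
proof -
  obtain C1 C2 where C: "\<And>t. cmod (v t) \<le> C1 / (1 + t\<^sup>2)" "\<And>t. cmod (w t) \<le> C2 / (1 + t\<^sup>2)"
    using assms unfolding regular_transform_def by blast
  have b: "cmod (v t + w t) \<le> (C1 + C2) / (1 + t\<^sup>2)" for t
    using norm_triangle_ineq[of "v t" "w t"] C[of t] by (simp add: add_divide_distrib)
  have c: "continuous_on UNIV (\<lambda>t. v t + w t)" using assms by (auto simp: regular_transform_def intro: continuous_on_add)
  have i: "integrable lborel (\<lambda>x. (1 + \<bar>x\<bar>) * cmod (ift v x) + (1 + \<bar>x\<bar>) * cmod (ift w x))"
    using assms by (intro Bochner_Integration.integrable_add) (auto simp: regular_transform_def)
  have "(1 + \<bar>x\<bar>) * cmod (ift (\<lambda>t. v t + w t) x) \<le> (1 + \<bar>x\<bar>) * cmod (ift v x) + (1 + \<bar>x\<bar>) * cmod (ift w x)" for x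
    unfolding ift_add[OF assms[THEN regular_transform_integrable]] distrib_left[symmetric]
    by (intro mult_left_mono norm_triangle_ineq) auto
  from weighted_norm_bound_integrable[OF integrable_bounded_transform[OF c b] i this]
  show ?thesis using c b assms unfolding regular_transform_def by auto
qed

lemma regular_transform_cmult:
  assumes "regular_transform w"
  shows "regular_transform (\<lambda>t. of_real c * w t)"
proof -
  obtain C where C: "\<And>t. cmod (w t) \<le> C / (1 + t\<^sup>2)" using assms unfolding regular_transform_def by blast
  have b: "cmod (of_real c * w t) \<le> (\<bar>c\<bar> * C) / (1 + t\<^sup>2)" for t
    using mult_left_mono[OF C[of t], of "\<bar>c\<bar>"] by (simp add: norm_mult)
  have ct: "continuous_on UNIV (\<lambda>t. of_real c * w t)" using assms by (auto simp: regular_transform_def intro: continuous_on_mult_left)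
  have i: "integrable lborel (\<lambda>x. \<bar>c\<bar> * ((1 + \<bar>x\<bar>) * cmod (ift w x)))"
    using assms by (intro integrable_mult_right) (auto simp: regular_transform_def)
  have "(1 + \<bar>x\<bar>) * cmod (ift (\<lambda>t. of_real c * w t) x) \<le> \<bar>c\<bar> * ((1 + \<bar>x\<bar>) * cmod (ift w x))" for x
    unfolding ift_cmult by (simp add: norm_mult)
  from weighted_norm_bound_integrable[OF integrable_bounded_transform[OF ct b] i this]
  show ?thesis using ct b assms unfolding regular_transform_def by auto
qed

lemma ift_real:
  assumes w: "integrable lborel w" and sym: "\<And>t. w (- t) = cnj (w t)"
  shows "ift w x = of_real (Re (ift w x))"
proof -
  have "cnj (\<integral>t. iexp (- (t * x)) * w t \<partial>lborel) = (\<integral>t. cnj (iexp (- (t * x)) * w t) \<partial>lborel)"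
    by (rule Bochner_Integration.integral_cnj[symmetric])
  also have "\<dots> = (\<integral>t. iexp (- (- t * x)) * w (- t) \<partial>lborel)"
    unfolding sym by (intro Bochner_Integration.integral_cong refl) (simp add: exp_cnj)
  also have "\<dots> = (\<integral>t. iexp (- (t * x)) * w t \<partial>lborel)"
    using lborel_integral_real_affine[of "-1" "\<lambda>t. iexp (- (t * x)) * w t" 0] by simp
  finally have "cnj (ift w x) = ift w x" by (simp add: ift_def)
  then show ?thesis by (simp add: complex_eq_iff)
qed

lemma regular_transform_density:
  assumes w: "regular_transform w"
  defines "g \<equiv> \<lambda>x. Re (ift w x)"
  shows "continuous_on UNIV g" "integrable lborel (\<lambda>x. (1 + \<bar>x\<bar>) * \<bar>g x\<bar>)" "integrable lborel g"
    "(\<integral>x. iexp (t * x) * of_real (g x) \<partial>lborel) = w t"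
proof -
  have iw: "integrable lborel w" by (rule regular_transform_integrable[OF w])
  obtain C where C: "\<And>t. cmod (w t) \<le> C / (1 + t\<^sup>2)" using w unfolding regular_transform_def by blast
  have r: "ift w x = of_real (g x)" for x
    unfolding g_def by (rule ift_real[OF iw]) (use w in \<open>auto simp: regular_transform_def\<close>)
  have cg: "cmod (ift w x) = \<bar>g x\<bar>" for x unfolding r by simp
  show c: "continuous_on UNIV g" unfolding g_def by (intro continuous_intros continuous_ift iw)
  show i: "integrable lborel (\<lambda>x. (1 + \<bar>x\<bar>) * \<bar>g x\<bar>)"
    using w unfolding regular_transform_def cg by blast
  have [measurable]: "g \<in> borel_measurable borel" by (rule borel_measurable_continuous_onI[OF c])
  show ig: "integrable lborel g"
  proof (rule Bochner_Integration.integrable_bound[OF i])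
    have "norm (g x) \<le> norm ((1 + \<bar>x\<bar>) * \<bar>g x\<bar>)" for x
      using mult_right_mono[of 1 "1 + \<bar>x\<bar>" "\<bar>g x\<bar>"] by (simp add: abs_mult)
    then show "AE x in lborel. norm (g x) \<le> norm ((1 + \<bar>x\<bar>) * \<bar>g x\<bar>)" by simp
  qed simp
  have C0: "C \<ge> 0" using order_trans[OF norm_ge_zero C[of 0]] by simp
  have "cmod (w t) \<le> C" for t
  proof -
    have "C / (1 + t\<^sup>2) \<le> C / 1" using C0 by (intro divide_left_mono) (auto intro: add_pos_nonneg)
    with C[of t] show ?thesis by simp
  qed
  moreover have "integrable lborel (ift w)"
    unfolding r[abs_def] complex_of_real_integrable_eq by (rule ig)
  ultimately have "(\<integral>x. iexp (t * x) * ift w x \<partial>lborel) = w t"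
    using w iw unfolding regular_transform_def by (intro fourier_inversion) auto
  then show "(\<integral>x. iexp (t * x) * of_real (g x) \<partial>lborel) = w t" unfolding r .
qed

context petersburg
begin

lemma \<phi>_minus: "\<phi> (- s) = cnj (\<phi> s)"
proof -
  have "(\<lambda>j. iexp (s * \<rho> ^ (j + 1)) * of_real (p * q ^ j)) sums \<phi> s"
    unfolding \<phi>_def by (rule summable_sums[OF \<phi>_series(1)])
  then have "(\<lambda>j. cnj (iexp (s * \<rho> ^ (j + 1)) * of_real (p * q ^ j))) sums cnj (\<phi> s)"
    by (simp only: sums_cnj)
  moreover have "cnj (iexp (s * \<rho> ^ (j + 1)) * of_real (p * q ^ j)) = iexp (- s * \<rho> ^ (j + 1)) * of_real (p * q ^ j)" for j
    by (simp add: exp_cnj)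
  ultimately show ?thesis unfolding \<phi>_def by (simp only: sums_unique[symmetric])
qed

lemma ys_minus: "ys (- of_real s) = cnj (ys (of_real s))"
proof -
  have "(\<lambda>j. (exp (\<i> * of_real s * of_real (b ^ j)) - 1 - \<i> * of_real s * of_real (b ^ j)) * of_real (p / q * r ^ j)) sums ys (of_real s)"
    unfolding ys_def by (rule summable_sums[OF summable_norm_cancel[OF ys_series(1)]])
  then have "(\<lambda>j. cnj ((exp (\<i> * of_real s * of_real (b ^ j)) - 1 - \<i> * of_real s * of_real (b ^ j)) * of_real (p / q * r ^ j))) sums cnj (ys (of_real s))"
    by (simp only: sums_cnj)
  moreover have "cnj ((exp (\<i> * of_real s * of_real (b ^ j)) - 1 - \<i> * of_real s * of_real (b ^ j)) * of_real (p / q * r ^ j))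
      = (exp (\<i> * - of_real s * of_real (b ^ j)) - 1 - \<i> * - of_real s * of_real (b ^ j)) * of_real (p / q * r ^ j)" for j
    by (simp add: exp_cnj)
  ultimately show ?thesis unfolding ys_def by (simp only: sums_unique[symmetric])
qed

lemma y1_minus: "y1 (- s) = cnj (y1 s)"
  unfolding y1_def using \<phi>_minus[of s] ys_minus[of s] by simp

lemma ys_strip_bound:
  assumes z: "\<bar>Im z\<bar> \<le> 1"
  shows "cmod (ys z) \<le> exp 1 * (- \<mu>2) * (cmod z)\<^sup>2"
proof -
  have "cmod (ys z) \<le> (\<Sum>j. (cmod z)\<^sup>2 * exp 1 * ((b ^ j)\<^sup>2 * (p / q * r ^ j)))"
    unfolding ys_def
  proof (rule norm_suminf_le_suminf[OF _ summable_small])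
    fix j
    have w: "0 \<le> p / q * r ^ j" using p q r by simp
    let ?w = "\<i> * z * of_real (b ^ j)"
    have nw: "cmod ?w = cmod z * b ^ j" using b by (simp add: norm_mult norm_power)
    have re: "\<bar>Re ?w\<bar> = \<bar>Im z\<bar> * b ^ j" using b by (simp add: abs_mult del: of_real_power)
    have "\<bar>Im z\<bar> * b ^ j \<le> 1 * 1" using z bj[of j] by (intro mult_mono) auto
    then have e: "exp \<bar>Re ?w\<bar> \<le> exp 1" unfolding re by simp
    have "cmod (exp ?w - 1 - ?w) \<le> (cmod ?w)\<^sup>2 * exp \<bar>Re ?w\<bar>" by (rule norm_exp_minus_1_minus_le_Re)
    also have "\<dots> \<le> (cmod ?w)\<^sup>2 * exp 1" using e by (intro mult_left_mono) auto
    finally have 1: "cmod (exp ?w - 1 - ?w) \<le> (cmod z)\<^sup>2 * exp 1 * (b ^ j)\<^sup>2"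
      unfolding nw by (simp add: power_mult_distrib mult_ac)
    have "cmod ((exp ?w - 1 - ?w) * of_real (p / q * r ^ j)) = cmod (exp ?w - 1 - ?w) * (p / q * r ^ j)"
      unfolding norm_mult[of _ "complex_of_real (p / q * r ^ j)"] norm_of_real abs_of_nonneg[OF w] ..
    also have "\<dots> \<le> (cmod z)\<^sup>2 * exp 1 * (b ^ j)\<^sup>2 * (p / q * r ^ j)" by (rule mult_right_mono[OF 1 w])
    finally show "cmod ((exp ?w - 1 - ?w) * of_real (p / q * r ^ j)) \<le> (cmod z)\<^sup>2 * exp 1 * ((b ^ j)\<^sup>2 * (p / q * r ^ j))"
      by (simp only: mult.assoc)
  qed
  also have "\<dots> = (cmod z)\<^sup>2 * exp 1 * (- \<mu>2)"
    by (rule sums_unique[OF sums_mult[OF sums_\<mu>2], symmetric])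
  finally show ?thesis by (simp only: mult_ac)
qed

lemma Re_ys_real_le_linear: "Re (ys (of_real s)) \<le> 2 * cy - cy * \<bar>s\<bar>"
proof (cases "1 \<le> \<bar>s\<bar>")
  case True
  have "\<bar>s\<bar> powr 1 \<le> \<bar>s\<bar> powr \<alpha>" using True \<alpha> by (intro powr_mono) auto
  then have "cy * \<bar>s\<bar> \<le> cy * \<bar>s\<bar> powr \<alpha>" using cy True by (intro mult_left_mono) auto
  with Re_ys_real_le(2)[OF True] cy show ?thesis by linarith
next
  case False
  then have "cy * \<bar>s\<bar> \<le> cy * 1" using cy by (intro mult_left_mono) auto
  with Re_ys_real_le(1)[of s] cy show ?thesis by linarith
qed

lemma smooth_factor_decay:
  assumes P: "P holomorphic_on UNIV" and Pb: "\<And>z. \<bar>Im z\<bar> \<le> 1 \<Longrightarrow> cmod (P z) \<le> C * (1 + \<bar>Re z\<bar>) ^ m"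
    and n: "n > 0" and \<epsilon>: "0 < \<epsilon>" "\<epsilon> \<le> 1"
  defines "W \<equiv> \<lambda>z. P z * exp (of_real n * ys (of_real \<epsilon> * z))"
  obtains K where "W holomorphic_on UNIV" "\<And>z. \<bar>Im z\<bar> \<le> 1 \<Longrightarrow> cmod (W z) \<le> K / (1 + (Re z)\<^sup>2)"
proof -
  define c where "c = n * exp (-1) * cy * \<epsilon>"
  have c: "c > 0" using n cy \<epsilon> by (simp add: c_def)
  define D where "D = n * (exp (-1) * (2 * cy) + exp 1 * (- \<mu>2))"
  have C0: "0 \<le> C" using order_trans[OF norm_ge_zero Pb[of 0]] by simp
  obtain K1 :: real where K1: "K1 > 0" "\<And>x. x \<ge> 0 \<Longrightarrow> (1 + x) ^ m * exp (- c * x) \<le> K1 * exp (- (c / 2) * x)"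
    using polynomial_exp_le_exp[OF c, of m] by auto
  obtain K2 :: real where K2: "K2 > 0" "\<And>x. exp (- (c / 2) * \<bar>x\<bar>) \<le> K2 / (1 + x\<^sup>2)"
    using exp_le_inv_square[of "c / 2"] c by auto
  have hol: "W holomorphic_on UNIV"
  proof -
    have "ys holomorphic_on UNIV" using ys_series(2) by (auto simp: holomorphic_on_open)
    then have "(ys \<circ> (\<lambda>z. of_real \<epsilon> * z)) holomorphic_on UNIV"
      by (intro holomorphic_on_compose_gen[of _ UNIV ys UNIV] holomorphic_intros) auto
    then show ?thesis unfolding W_def by (intro holomorphic_intros P) (simp add: comp_def)
  qed
  have "cmod (W z) \<le> (C * exp D * K1 * K2) / (1 + (Re z)\<^sup>2)" if z: "\<bar>Im z\<bar> \<le> 1" for z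
  proof -
    let ?x = "\<bar>Re z\<bar>"
    have "\<bar>Im (of_real \<epsilon> * z)\<bar> \<le> 1"
      using mult_mono[of \<epsilon> 1 "\<bar>Im z\<bar>" 1] z \<epsilon> by (simp add: abs_mult)
    from Re_ys_strip_le[OF this] have "Re (ys (of_real \<epsilon> * z)) \<le> exp (-1) * Re (ys (of_real (\<epsilon> * Re z))) + exp 1 * (- \<mu>2)"
      by simp
    also have "\<dots> \<le> exp (-1) * (2 * cy - cy * \<bar>\<epsilon> * Re z\<bar>) + exp 1 * (- \<mu>2)"
      by (intro add_right_mono mult_left_mono Re_ys_real_le_linear) auto
    finally have "n * Re (ys (of_real \<epsilon> * z)) \<le> n * (exp (-1) * (2 * cy - cy * \<bar>\<epsilon> * Re z\<bar>) + exp 1 * (- \<mu>2))"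
      using n by (intro mult_left_mono) auto
    also have "\<dots> = D + - c * ?x" using \<epsilon> by (simp add: D_def c_def abs_mult algebra_simps)
    finally have "cmod (exp (of_real n * ys (of_real \<epsilon> * z))) \<le> exp D * exp (- c * ?x)"
      by (simp add: exp_add[symmetric])
    then have "cmod (W z) \<le> (C * (1 + ?x) ^ m) * (exp D * exp (- c * ?x))"
      unfolding W_def norm_mult using Pb[OF z] C0 by (intro mult_mono) auto
    also have "\<dots> = C * exp D * ((1 + ?x) ^ m * exp (- c * ?x))" by (simp only: mult_ac)
    also have "\<dots> \<le> C * exp D * (K1 * exp (- (c / 2) * ?x))" using C0 by (intro mult_left_mono K1(2)) auto
    also have "\<dots> \<le> C * exp D * (K1 * (K2 / (1 + (Re z)\<^sup>2)))"
      using C0 K1(1) K2(2)[of "Re z"] by (intro mult_left_mono) auto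
    finally show ?thesis by simp
  qed
  with hol show thesis by (rule that)
qed

end

context petersburg_sample
begin

lemma regular_product:
  assumes P: "P holomorphic_on UNIV" and Pb: "\<And>z. \<bar>Im z\<bar> \<le> 1 \<Longrightarrow> cmod (P z) \<le> C * (1 + \<bar>Re z\<bar>) ^ m"
    and Ps: "\<And>t. P (of_real (- t)) = cnj (P (of_real t))"
    and n: "n > 0" and \<epsilon>: "0 < \<epsilon>" "\<epsilon> \<le> 1"
  shows "regular_transform (\<lambda>t. P (of_real t) * \<phi> (\<epsilon> * t) ^ i * exp (of_real n * y1 (\<epsilon> * t)))"
proof -
  let ?W = "\<lambda>z. P z * exp (of_real n * ys (of_real \<epsilon> * z))"
  have "\<exists>K. ?W holomorphic_on UNIV \<and> (\<forall>z. \<bar>Im z\<bar> \<le> 1 \<longrightarrow> cmod (?W z) \<le> K / (1 + (Re z)\<^sup>2))"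
    by (rule smooth_factor_decay[OF P Pb n \<epsilon>]) blast+
  then obtain K where K: "?W holomorphic_on UNIV" "\<And>z. \<bar>Im z\<bar> \<le> 1 \<Longrightarrow> cmod (?W z) \<le> K / (1 + (Re z)\<^sup>2)"
    by blast
  let ?ws = "\<lambda>t. ?W (complex_of_real t)"
  let ?c = "\<lambda>t. \<integral>z. iexp (t * cp n \<epsilon> i z) \<partial>CP n"
  note n0 = n
  have "\<exists>C'. \<forall>x. cmod (ift ?ws x) * (1 + \<bar>x\<bar>) \<le> C' / (1 + x\<^sup>2)"
    by (rule ift_holomorphic_decay[OF K]) blast+
  then obtain C' where C': "\<And>x. cmod (ift ?ws x) * (1 + \<bar>x\<bar>) \<le> C' / (1 + x\<^sup>2)"
    by blast
  have cws: "continuous_on UNIV ?ws"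
    by (rule continuous_on_compose2[OF holomorphic_on_imp_continuous_on[OF K(1)]]) (auto intro!: continuous_intros)
  have bws: "cmod (?ws t) \<le> K / (1 + t\<^sup>2)" for t using K(2)[of "of_real t"] by simp
  have iws: "integrable lborel ?ws" by (rule integrable_bounded_transform[OF cws bws])
  have eq: "?ws t * ?c t = P (of_real t) * \<phi> (\<epsilon> * t) ^ i * exp (of_real n * y1 (\<epsilon> * t))" for t
  proof -
    have "exp (of_real n * ys (of_real \<epsilon> * of_real t)) * exp (of_real n * (\<phi> (\<epsilon> * t) - 1 - \<i> * (of_real \<epsilon> * of_real t) * of_real \<mu>)) = exp (of_real n * y1 (\<epsilon> * t))"
      by (simp add: exp_add[symmetric] y1_def algebra_simps)
    then show ?thesis unfolding char_cp[OF n0] by (simp only: mult_ac)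
  qed
  have W: "integrable lborel (\<lambda>x. (1 + \<bar>x\<bar>) * cmod (ift (\<lambda>t. ?ws t * ?c t) x))"
    by (rule ift_convolution[OF prob_space_CP integrable_cp[OF n0] iws C'])
  have c1: "cmod (?c t) \<le> 1" for t
  proof -
    interpret C: prob_space "CP n" by (rule prob_space_CP)
    have "cmod (?c t) \<le> (\<integral>z. cmod (iexp (t * cp n \<epsilon> i z)) \<partial>CP n)" by (rule integral_norm_bound)
    also have "\<dots> = 1" by (simp add: C.prob_space)
    finally show ?thesis .
  qed
  have b: "cmod (?ws t * ?c t) \<le> K / (1 + t\<^sup>2)" for t
  proof -
    have "cmod (?ws t * ?c t) \<le> cmod (?ws t) * 1" unfolding norm_mult[of "?ws t"] by (rule mult_left_mono[OF c1]) simp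
    with bws[of t] show ?thesis by simp
  qed
  have cphi: "continuous_on UNIV \<phi>"
    by (rule continuous_at_imp_continuous_on) (use has_vector_derivative_continuous[OF \<phi>_series(2)] in simp)
  have cont: "continuous_on UNIV (\<lambda>t. P (of_real t) * \<phi> (\<epsilon> * t) ^ i * exp (of_real n * y1 (\<epsilon> * t)))"
  proof -
    have 1: "continuous_on UNIV (\<lambda>t. P (complex_of_real t))"
      by (rule continuous_on_compose2[OF holomorphic_on_imp_continuous_on[OF P]]) (auto intro!: continuous_intros)
    have 2: "continuous_on UNIV (\<lambda>t. \<phi> (\<epsilon> * t))" by (rule continuous_on_compose2[OF cphi]) (auto intro!: continuous_intros)
    have 3: "continuous_on UNIV (\<lambda>t. y1 (\<epsilon> * t))" by (rule continuous_on_compose2[OF y1_deriv(3)]) (auto intro!: continuous_intros)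
    show ?thesis by (intro continuous_on_mult continuous_on_power continuous_on_exp continuous_on_const 1 2 3)
  qed
  have sym: "P (of_real (- t)) * \<phi> (\<epsilon> * - t) ^ i * exp (of_real n * y1 (\<epsilon> * - t))
     = cnj (P (of_real t) * \<phi> (\<epsilon> * t) ^ i * exp (of_real n * y1 (\<epsilon> * t)))" for t
  proof -
    have "\<epsilon> * - t = - (\<epsilon> * t)" by simp
    then show ?thesis by (simp only: \<phi>_minus y1_minus Ps complex_cnj_mult complex_cnj_power exp_cnj complex_cnj_complex_of_real)
  qed
  show ?thesis unfolding regular_transform_def
    using cont b[unfolded eq] sym W[unfolded eq] by blast
qed

end

definition dens :: "(real \<Rightarrow> complex) \<Rightarrow> real \<Rightarrow> real" where "dens w x = Re (ift w x)"

lemma dens_facts: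
  assumes "regular_transform w"
  shows "continuous_on UNIV (dens w)" "integrable lborel (\<lambda>x. (1 + \<bar>x\<bar>) * \<bar>dens w x\<bar>)" "integrable lborel (dens w)"
    "(\<integral>x. iexp (t * x) * of_real (dens w x) \<partial>lborel) = w t"
  unfolding dens_def[abs_def] by (rule regular_transform_density[OF assms])+

lemma primitive_dens_add:
  assumes "regular_transform v" "regular_transform w"
  shows "primitive (dens (\<lambda>t. v t + w t)) x = primitive (dens v) x + primitive (dens w) x"
proof -
  note i = assms[THEN regular_transform_integrable]
  have "dens (\<lambda>t. v t + w t) u = dens v u + dens w u" for u by (simp add: dens_def ift_add[OF i])
  moreover have "integrable lborel (\<lambda>u. indicator {..x} u * dens w u)" if "regular_transform w" for w
    using integrable_mult_indicator[OF _ regular_transform_density(3)[OF that], of "{..x}"] by (simp add: dens_def)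
  ultimately show ?thesis using assms by (simp add: primitive_def distrib_left)
qed

lemma primitive_dens_cmult:
  "primitive (dens (\<lambda>t. of_real c * w t)) x = c * primitive (dens w) x"
proof -
  have "dens (\<lambda>t. of_real c * w t) u = c * dens w u" for u by (simp add: dens_def ift_cmult)
  then show ?thesis by (simp add: primitive_def mult.left_commute)
qed

lemma regular_transform_zero: "regular_transform (\<lambda>t. 0)"
  unfolding regular_transform_def ift_def by (auto intro!: exI[of _ 0])

lemma regular_transform_sum:
  assumes "finite A" "\<And>j. j \<in> A \<Longrightarrow> regular_transform (w j)"
  shows "regular_transform (\<lambda>t. \<Sum>j\<in>A. of_real (c j) * w j t)"
    "primitive (dens (\<lambda>t. \<Sum>j\<in>A. of_real (c j) * w j t)) x = (\<Sum>j\<in>A. c j * primitive (dens (w j)) x)"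
proof -
  have "regular_transform (\<lambda>t. \<Sum>j\<in>A. of_real (c j) * w j t) \<and>
    primitive (dens (\<lambda>t. \<Sum>j\<in>A. of_real (c j) * w j t)) x = (\<Sum>j\<in>A. c j * primitive (dens (w j)) x)"
    using assms
  proof (induction A rule: finite_induct)
    case empty
    have "primitive (dens (\<lambda>t. 0)) x = 0" by (simp add: primitive_def dens_def ift_def)
    then show ?case using regular_transform_zero by simp
  next
    case (insert j A)
    have r: "regular_transform (\<lambda>t. of_real (c j) * w j t)" using insert by (intro regular_transform_cmult) auto
    from insert have IH: "regular_transform (\<lambda>t. \<Sum>j\<in>A. of_real (c j) * w j t)"
      "primitive (dens (\<lambda>t. \<Sum>j\<in>A. of_real (c j) * w j t)) x = (\<Sum>j\<in>A. c j * primitive (dens (w j)) x)" by auto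
    show ?case
      using regular_transform_add[OF r IH(1)] primitive_dens_add[OF r IH(1), of x] IH(2) insert(1,2)
      by (simp add: primitive_dens_cmult)
  qed
  then show "regular_transform (\<lambda>t. \<Sum>j\<in>A. of_real (c j) * w j t)"
    "primitive (dens (\<lambda>t. \<Sum>j\<in>A. of_real (c j) * w j t)) x = (\<Sum>j\<in>A. c j * primitive (dens (w j)) x)" by auto
qed

context petersburg
begin

definition eps :: "nat \<Rightarrow> real" where "eps n = 1 / real n powr (1 / \<alpha>)"
definition aa :: "nat \<Rightarrow> real" where "aa n = A2 * (real n * (eps n)\<^sup>2)"
definition Y :: "nat \<Rightarrow> real \<Rightarrow> complex" where "Y n t = of_nat n * y1 (eps n * t)"

lemma eps: "n \<ge> 1 \<Longrightarrow> 0 < eps n" "n \<ge> 1 \<Longrightarrow> eps n \<le> 1"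
  using \<alpha> by (auto simp: eps_def ge_one_powr_ge_zero)

lemma yfun_eq_Y: "n \<ge> 1 \<Longrightarrow> yfun \<alpha> p (gam p n) t = Y n t"
  by (simp add: yfun_gam Y_def eps_def)

end

context petersburg_sample
begin

lemma regular_power_exp:
  assumes n: "n \<ge> 1"
  shows "regular_transform (\<lambda>t. (- \<i> * of_real t) ^ m * exp (Y n t))"
proof -
  have "regular_transform (\<lambda>t. (- \<i> * of_real t) ^ m * \<phi> (eps n * t) ^ 0 * exp (of_real (real n) * y1 (eps n * t)))"
  proof (rule regular_product)
    show "(\<lambda>z. (- \<i> * z) ^ m) holomorphic_on UNIV" by (intro holomorphic_intros)
    show "cmod ((- \<i> * z) ^ m) \<le> 1 * (1 + \<bar>Re z\<bar>) ^ m" if "\<bar>Im z\<bar> \<le> 1" for z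
      using cmod_le[of z] that by (simp add: norm_mult norm_power power_mono)
    show "(- \<i> * complex_of_real (- t)) ^ m = cnj ((- \<i> * complex_of_real t) ^ m)" for t by simp
  qed (use n eps in auto)
  then show ?thesis by (simp add: Y_def)
qed

lemma regular_one_one:
  assumes n: "n \<ge> 1"
  shows "regular_transform (\<lambda>t. (- \<i> * of_real t) * Y n t * exp (Y n t))"
proof -
  let ?e = "eps n" and ?n = "real n"
  let ?P1 = "\<lambda>z. (- \<i> * z) * (of_real ?n * ys (of_real ?e * z) - of_real ?n - of_real (?n * ?e * \<mu>) * (\<i> * z))"
  let ?P2 = "\<lambda>z. (- \<i> * z) * of_real ?n"
  have n0: "?n > 0" using n by simp
  have zb: "cmod z \<le> 1 + \<bar>Re z\<bar>" if "\<bar>Im z\<bar> \<le> 1" for z using cmod_le[of z] that by simp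
  have hys: "(\<lambda>z. ys (of_real ?e * z)) holomorphic_on UNIV"
  proof -
    have "ys holomorphic_on UNIV" using ys_series(2) by (auto simp: holomorphic_on_open)
    then have "(ys \<circ> (\<lambda>z. of_real ?e * z)) holomorphic_on UNIV"
      by (intro holomorphic_on_compose_gen[of _ UNIV ys UNIV] holomorphic_intros) auto
    then show ?thesis by (simp add: comp_def)
  qed
  have r1: "regular_transform (\<lambda>t. ?P1 (of_real t) * \<phi> (?e * t) ^ 0 * exp (of_real ?n * y1 (?e * t)))"
  proof (rule regular_product[OF _ _ _ n0 eps[OF n]])
    show "?P1 holomorphic_on UNIV" by (intro holomorphic_intros hys)
    define C where "C = ?n * (exp 1 * (- \<mu>2)) + ?n + ?n * \<mu>"
    fix z assume z: "\<bar>Im z\<bar> \<le> 1"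
    let ?x = "1 + \<bar>Re z\<bar>"
    have x1: "1 \<le> ?x" by simp
    have "\<bar>Im (of_real ?e * z)\<bar> \<le> 1" using mult_mono[of ?e 1 "\<bar>Im z\<bar>" 1] z eps[OF n] by (simp add: abs_mult)
    then have "cmod (ys (of_real ?e * z)) \<le> exp 1 * (- \<mu>2) * (cmod (of_real ?e * z))\<^sup>2" by (rule ys_strip_bound)
    also have "\<dots> \<le> exp 1 * (- \<mu>2) * ?x\<^sup>2"
    proof (intro mult_left_mono power_mono)
      show "cmod (of_real ?e * z) \<le> ?x"
        using mult_mono[of ?e 1 "cmod z" ?x] zb[OF z] eps[OF n] by (simp add: norm_mult)
      show "0 \<le> exp 1 * (- \<mu>2)" by (intro mult_nonneg_nonneg \<mu>2_nonpos) simp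
    qed auto
    finally have "?n * cmod (ys (of_real ?e * z)) \<le> ?n * (exp 1 * (- \<mu>2) * ?x\<^sup>2)"
      by (rule mult_left_mono) simp
    then have 1: "cmod (of_real ?n * ys (of_real ?e * z)) \<le> ?n * (exp 1 * (- \<mu>2) * ?x\<^sup>2)"
      by (simp add: norm_mult)
    have 2: "cmod (complex_of_real ?n) \<le> ?n * ?x\<^sup>2" using n0 one_le_power[OF x1, of 2] by simp
    have 3: "cmod (of_real (?n * ?e * \<mu>) * (\<i> * z)) \<le> ?n * \<mu> * ?x\<^sup>2"
    proof -
      have "cmod (of_real (?n * ?e * \<mu>) * (\<i> * z)) = (?n * \<mu>) * (?e * cmod z)"
        using n0 \<mu>_pos eps[OF n] by (simp add: norm_mult)
      also have "\<dots> \<le> (?n * \<mu>) * (1 * (?x * ?x))"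
        using n0 \<mu>_pos eps[OF n] zb[OF z] x1 mult_mono[of 1 ?x "cmod z" ?x] by (intro mult_left_mono mult_mono) auto
      finally show ?thesis by (simp add: power2_eq_square)
    qed
    have "cmod (of_real ?n * ys (of_real ?e * z) - of_real ?n - of_real (?n * ?e * \<mu>) * (\<i> * z)) \<le>
      (?n * (exp 1 * (- \<mu>2) * ?x\<^sup>2) + ?n * ?x\<^sup>2) + ?n * \<mu> * ?x\<^sup>2"
      by (rule norm_triangle_le_diff[OF add_mono[OF norm_triangle_le_diff[OF add_mono[OF 1 2]] 3]])
    also have "\<dots> = C * ?x\<^sup>2" unfolding C_def by (simp only: distrib_right mult.assoc)
    finally have 4: "cmod (of_real ?n * ys (of_real ?e * z) - of_real ?n - of_real (?n * ?e * \<mu>) * (\<i> * z)) \<le> C * ?x\<^sup>2" .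
    have "cmod (?P1 z) \<le> ?x * (C * ?x\<^sup>2)"
      unfolding norm_mult[of "- \<i> * z"] using zb[OF z] x1 by (intro mult_mono 4) (auto simp: norm_mult)
    then show "cmod (?P1 z) \<le> C * ?x ^ 3" by (simp add: power2_eq_square power3_eq_cube mult_ac)
  next
    fix t
    have "ys (of_real ?e * - of_real t) = cnj (ys (of_real ?e * of_real t))"
      using ys_minus[of "?e * t"] by simp
    then show "?P1 (complex_of_real (- t)) = cnj (?P1 (complex_of_real t))" by simp
  qed
  have r2: "regular_transform (\<lambda>t. ?P2 (of_real t) * \<phi> (?e * t) ^ 1 * exp (of_real ?n * y1 (?e * t)))"
  proof (rule regular_product[OF _ _ _ n0 eps[OF n]])
    show "?P2 holomorphic_on UNIV" by (intro holomorphic_intros)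
    show "cmod (?P2 z) \<le> ?n * (1 + \<bar>Re z\<bar>) ^ 1" if "\<bar>Im z\<bar> \<le> 1" for z
      using zb[OF that] n0 by (simp add: norm_mult mult.commute)
  qed simp
  have "(\<lambda>t. ?P1 (of_real t) * \<phi> (?e * t) ^ 0 * exp (of_real ?n * y1 (?e * t))
      + ?P2 (of_real t) * \<phi> (?e * t) ^ 1 * exp (of_real ?n * y1 (?e * t))) = (\<lambda>t. (- \<i> * of_real t) * Y n t * exp (Y n t))"
  proof (rule ext)
    fix t
    have y: "Y n t = (of_real ?n * ys (of_real ?e * of_real t) - of_real ?n - of_real (?n * ?e * \<mu>) * (\<i> * of_real t)) + of_real ?n * \<phi> (?e * t)"
      by (simp add: Y_def y1_def algebra_simps)
    have e: "exp (of_real ?n * y1 (?e * t)) = exp (Y n t)" by (simp add: Y_def)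
    show "?P1 (of_real t) * \<phi> (?e * t) ^ 0 * exp (of_real ?n * y1 (?e * t))
      + ?P2 (of_real t) * \<phi> (?e * t) ^ 1 * exp (of_real ?n * y1 (?e * t)) = (- \<i> * of_real t) * Y n t * exp (Y n t)"
      unfolding e by (subst (2) y) (simp only: power_0 power_one_right mult_1_right distrib_left distrib_right mult.assoc)
  qed
  with regular_transform_add[OF r1 r2] show ?thesis by simp
qed

lemma dens_exp_nonneg:
  assumes n: "n \<ge> 1"
  shows "dens (\<lambda>t. exp (Y n t)) x \<ge> 0"
proof -
  have reg: "regular_transform (\<lambda>t. exp (Y n t))" using regular_power_exp[OF n, of 0] by simp
  let ?\<nu> = "\<lambda>j. real n * r ^ j" and ?e = "\<lambda>j. eps n * b ^ j"
  have "ift (\<lambda>t. exp (Y n t)) x \<in> \<real>\<^sub>\<ge>\<^sub>0"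
  proof (rule ift_limit_char_nonneg[OF regular_transform_integrable[OF reg], where N = "\<lambda>j. CP (?\<nu> j)" and U = "\<lambda>j. cp (?\<nu> j) (?e j) 0"])
    show "prob_space (CP (?\<nu> j))" for j by (rule prob_space_CP)
    show "cp (?\<nu> j) (?e j) 0 \<in> borel_measurable (CP (?\<nu> j))" for j by measurable
    fix t
    let ?u = "eps n * t"
    have \<nu>: "?\<nu> j > 0" for j using n r by simp
    have eq: "(\<integral>z. iexp (t * cp (?\<nu> j) (?e j) 0 z) \<partial>CP (?\<nu> j)) = exp (Y n t - of_real (?\<nu> j) * ys (of_real (b ^ j * ?u)))" for j
    proof -
      have u: "?e j * t = b ^ j * ?u" by simp
      have sc: "y1 (b ^ j * ?u) = of_real (1 / r ^ j) * y1 ?u"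
      proof -
        have "r powr real_of_int (- int j) = 1 / r ^ j" using r by (simp add: powr_minus_divide powr_realpow)
        moreover have "real_of_int (- int j) = - real j" by simp
        ultimately show ?thesis using y1_scale[of "- int j" ?u] by (simp only: r_powr_root(2))
      qed
      have "\<phi> (b ^ j * ?u) - 1 - \<i> * of_real (b ^ j * ?u) * \<mu> = y1 (b ^ j * ?u) - ys (of_real (b ^ j * ?u))"
        by (simp add: y1_def)
      then have "of_real (?\<nu> j) * (\<phi> (b ^ j * ?u) - 1 - \<i> * of_real (b ^ j * ?u) * \<mu>) = of_real (?\<nu> j * (1 / r ^ j)) * y1 ?u - of_real (?\<nu> j) * ys (of_real (b ^ j * ?u))"
        unfolding sc by (simp only: right_diff_distrib of_real_mult mult.assoc)
      also have "?\<nu> j * (1 / r ^ j) = real n" using r by simp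
      finally have "of_real (?\<nu> j) * (\<phi> (?e j * t) - 1 - \<i> * of_real (?e j * t) * \<mu>) = Y n t - of_real (?\<nu> j) * ys (of_real (b ^ j * ?u))"
        unfolding u by (simp add: Y_def)
      then show ?thesis unfolding char_cp[OF \<nu>] by simp
    qed
    have "(\<lambda>j. of_real (?\<nu> j) * ys (of_real (b ^ j * ?u))) \<longlonglongrightarrow> 0"
    proof (rule Lim_null_comparison)
      have "cmod (of_real (?\<nu> j) * ys (of_real (b ^ j * ?u))) \<le> real n * (exp 1 * (- \<mu>2)) * ?u\<^sup>2 * (r * b\<^sup>2) ^ j" for j
      proof -
        have "cmod (ys (of_real (b ^ j * ?u))) \<le> exp 1 * (- \<mu>2) * (cmod (of_real (b ^ j * ?u)))\<^sup>2" by (rule ys_strip_bound) simp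
        also have "(cmod (complex_of_real (b ^ j * ?u)))\<^sup>2 = (b ^ j * ?u)\<^sup>2" by (simp only: norm_of_real power2_abs)
        finally have "?\<nu> j * cmod (ys (of_real (b ^ j * ?u))) \<le> ?\<nu> j * (exp 1 * (- \<mu>2) * (b ^ j * ?u)\<^sup>2)"
          using \<nu>[of j] by (intro mult_left_mono) auto
        also have "\<dots> = real n * (exp 1 * (- \<mu>2)) * ?u\<^sup>2 * (r * b\<^sup>2) ^ j"
          by (simp add: power_mult_distrib power_mult[symmetric] mult_ac)
        finally show ?thesis using \<nu>[of j] by (simp only: norm_mult[of "complex_of_real _"] norm_of_real abs_of_pos)
      qed
      then show "\<forall>\<^sub>F j in sequentially. cmod (of_real (?\<nu> j) * ys (of_real (b ^ j * ?u))) \<le> real n * (exp 1 * (- \<mu>2)) * ?u\<^sup>2 * (r * b\<^sup>2) ^ j"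
        by (intro always_eventually allI)
      have "(\<lambda>j. real n * (exp 1 * (- \<mu>2)) * ?u\<^sup>2 * (r * b\<^sup>2) ^ j) \<longlonglongrightarrow> real n * (exp 1 * (- \<mu>2)) * ?u\<^sup>2 * 0"
        using rb2 by (intro tendsto_mult_left LIMSEQ_realpow_zero) auto
      then show "(\<lambda>j. real n * (exp 1 * (- \<mu>2)) * ?u\<^sup>2 * (r * b\<^sup>2) ^ j) \<longlonglongrightarrow> 0" by simp
    qed
    then have "(\<lambda>j. exp (Y n t - of_real (?\<nu> j) * ys (of_real (b ^ j * ?u)))) \<longlonglongrightarrow> exp (Y n t - 0)"
      by (intro tendsto_exp tendsto_diff tendsto_const)
    then show "(\<lambda>j. \<integral>z. iexp (t * cp (?\<nu> j) (?e j) 0 z) \<partial>CP (?\<nu> j)) \<longlonglongrightarrow> exp (Y n t)"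
      unfolding eq by simp
  qed
  then show ?thesis by (simp add: dens_def complex_nonneg_Reals_iff)
qed

lemma Gdf_eq:
  assumes n: "n \<ge> 1"
  shows "Gdf \<alpha> p (gam p n) = primitive (dens (\<lambda>t. exp (Y n t)))"
proof -
  have reg: "regular_transform (\<lambda>t. exp (Y n t))" using regular_power_exp[OF n, of 0] by simp
  have "y1 0 = 0" by (simp add: y1_def \<phi>_series(6) ys_def)
  then have Y0: "exp (Y n 0) = 1" by (simp add: Y_def)
  show ?thesis unfolding Gdf_def yfun_eq_Y[OF n]
    by (rule the_cdf[where h = "\<lambda>t. exp (Y n t)", OF dens_facts(3)[OF reg] dens_exp_nonneg[OF n] dens_facts(4)[OF reg] Y0])
qed

lemma Gkj_eq:
  assumes n: "n \<ge> 1"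
    and reg: "regular_transform (\<lambda>t. (- \<i> * of_real t) ^ k * Y n t ^ j * exp (Y n t))"
  shows "Gkj k j \<alpha> p (gam p n) = primitive (dens (\<lambda>t. (- \<i> * of_real t) ^ k * Y n t ^ j * exp (Y n t)))"
  unfolding Gkj_def yfun_eq_Y[OF n]
  by (rule the_signed_cdf[OF dens_facts(3,4)[OF reg]])

definition hT :: "nat \<Rightarrow> nat \<Rightarrow> real \<Rightarrow> complex" where
  "hT l n t = (\<Sum>j<l. of_real ((aa n * t\<^sup>2) ^ j / fact j)) * exp (Y n t)"

definition hTT :: "nat \<Rightarrow> nat \<Rightarrow> real \<Rightarrow> complex" where
  "hTT l n t = hT l n t + of_real (\<mu> * eps n) * ((- \<i> * of_real t) * Y n t * exp (Y n t))"

lemma Gtilde_eq: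
  assumes n: "n \<ge> 1" and l: "l \<ge> 1"
  shows "regular_transform (hT l n)" "Gtilde \<alpha> p l n = primitive (dens (hT l n))"
proof -
  define c where "c j = (- 1) ^ j * (aa n ^ j / fact j)" for j :: nat
  let ?w = "\<lambda>j t. (- \<i> * of_real t) ^ (2 * j) * exp (Y n t)"
  have reg: "regular_transform (?w j)" for j by (rule regular_power_exp[OF n])
  have hT: "hT l n = (\<lambda>t. \<Sum>j<l. of_real (c j) * ?w j t)"
  proof (rule ext)
    fix t
    have "(- \<i> * complex_of_real t) ^ (2 * j) = of_real ((- 1) ^ j * (t\<^sup>2) ^ j)" for j
      by (simp add: power_mult power_mult_distrib power_minus[of "(complex_of_real t)\<^sup>2"])
    then have "of_real (c j) * (- \<i> * complex_of_real t) ^ (2 * j) = of_real (c j * ((- 1) ^ j * (t\<^sup>2) ^ j))" for j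
      by (simp only: of_real_mult)
    moreover have "c j * ((- 1) ^ j * (t\<^sup>2) ^ j) = (aa n * t\<^sup>2) ^ j / fact j" for j
    proof -
      have "(- 1 :: real) ^ j * (- 1) ^ j = 1" by (simp flip: power_mult_distrib)
      then show ?thesis by (simp add: c_def power_mult_distrib mult_ac)
    qed
    ultimately show "hT l n t = (\<Sum>j<l. of_real (c j) * ?w j t)"
      by (simp only: hT_def sum_distrib_right mult.assoc[symmetric])
  qed
  show "regular_transform (hT l n)" unfolding hT by (rule regular_transform_sum(1)[OF finite_lessThan reg])
  have coeff: "(-1) ^ j * ((mu \<alpha> p 1)\<^sup>2 - mu \<alpha> p 2) ^ j * g / (fact j * 2 ^ j * real n powr (real j * (2 - \<alpha>) / \<alpha>)) = c j * g" for j g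
  proof -
    have "real n * (eps n)\<^sup>2 = 1 / real n powr ((2 - \<alpha>) / \<alpha>)"
    proof -
      have "(eps n)\<^sup>2 = 1 / real n powr (2 / \<alpha>)"
        using n by (simp add: eps_def power2_eq_square powr_add[symmetric])
      moreover have "real n powr (2 / \<alpha>) = real n powr 1 * real n powr ((2 - \<alpha>) / \<alpha>)"
        using \<alpha> by (simp only: powr_add[symmetric]) (simp add: field_simps)
      ultimately show ?thesis using n by simp
    qed
    then have aa: "aa n = (\<mu>\<^sup>2 - \<mu>2) / (2 * real n powr ((2 - \<alpha>) / \<alpha>))" by (simp add: aa_def A2_def)
    have "real n powr (real j * (2 - \<alpha>) / \<alpha>) = (real n powr ((2 - \<alpha>) / \<alpha>)) ^ j"
      using n by (simp add: powr_realpow[symmetric] powr_powr mult.commute)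
    then show ?thesis unfolding c_def aa \<mu>_def \<mu>2_def by (simp add: power_divide power_mult_distrib mult_ac)
  qed
  have G: "Gkj (2 * j) 0 \<alpha> p (gam p n) = primitive (dens (?w j))" for j
    using Gkj_eq[OF n, of "2 * j" 0] reg[of j] by simp
  show "Gtilde \<alpha> p l n = primitive (dens (hT l n))"
  proof (rule ext)
    fix x
    have "{..<l} = insert 0 {1..l - 1}" using l by auto
    then have "primitive (dens (hT l n)) x = c 0 * primitive (dens (?w 0)) x + (\<Sum>j\<in>{1..l - 1}. c j * primitive (dens (?w j)) x)"
      unfolding hT regular_transform_sum(2)[OF finite_lessThan reg] by simp
    also have "c 0 * primitive (dens (?w 0)) x = Gdf \<alpha> p (gam p n) x" unfolding Gdf_eq[OF n] by (simp add: c_def)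
    finally show "Gtilde \<alpha> p l n x = primitive (dens (hT l n)) x" unfolding Gtilde_def coeff G by simp
  qed
qed

lemma Gtt_eq:
  assumes n: "n \<ge> 1" and l: "l \<ge> 1"
  shows "regular_transform (hTT l n)" "Gtt \<alpha> p l n = primitive (dens (hTT l n))"
proof -
  let ?w = "\<lambda>t. (- \<i> * of_real t) * Y n t * exp (Y n t)"
  note r1 = Gtilde_eq(1)[OF n l] and r2 = regular_transform_cmult[OF regular_one_one[OF n], of "\<mu> * eps n"]
  have hTT: "hTT l n = (\<lambda>t. hT l n t + of_real (\<mu> * eps n) * ?w t)" by (rule ext) (simp only: hTT_def)
  show "regular_transform (hTT l n)" unfolding hTT by (rule regular_transform_add[OF r1 r2])
  have G: "Gkj 1 1 \<alpha> p (gam p n) = primitive (dens ?w)"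
    using Gkj_eq[OF n, of 1 1] regular_one_one[OF n] by simp
  show "Gtt \<alpha> p l n = primitive (dens (hTT l n))"
  proof (rule ext)
    fix x
    have "primitive (dens (hTT l n)) x = primitive (dens (hT l n)) x + (\<mu> * eps n) * primitive (dens ?w) x"
      unfolding hTT primitive_dens_add[OF r1 r2] primitive_dens_cmult ..
    then show "Gtt \<alpha> p l n x = primitive (dens (hTT l n)) x"
      unfolding Gtt_def G Gtilde_eq(2)[OF n l] by (simp add: \<mu>_def eps_def)
  qed
qed

end

section \<open>Expansion of the characteristic function\<close>

lemma exp_taylor_remainder:
  fixes s :: complex
  shows "cmod (exp s - (\<Sum>j<l. s ^ j / fact j)) \<le> cmod s ^ l * exp (cmod s)"
proof -
  have ex: "(\<lambda>j. s ^ j / fact j) sums exp s"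
    using exp_converges[of s] by (simp add: scaleR_conv_of_real divide_inverse mult.commute)
  have S: "(\<lambda>j. s ^ (j + l) / fact (j + l)) sums (exp s - (\<Sum>j<l. s ^ j / fact j))"
    using sums_split_initial_segment[OF ex, of l] .
  have E: "(\<lambda>j. cmod s ^ l * (cmod s ^ j / fact j)) sums (cmod s ^ l * exp (cmod s))"
    using sums_mult[OF exp_converges[of "cmod s"], of "cmod s ^ l"] by (simp add: divide_inverse mult_ac)
  have "cmod (\<Sum>j. s ^ (j + l) / fact (j + l)) \<le> (\<Sum>j. cmod s ^ l * (cmod s ^ j / fact j))"
  proof (rule norm_suminf_le_suminf[OF _ sums_summable[OF E]])
    fix j
    have "cmod (s ^ (j + l) / fact (j + l)) = cmod s ^ l * cmod s ^ j / fact (j + l)"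
      by (simp add: norm_divide norm_mult norm_power power_add mult.commute)
    also have "\<dots> \<le> cmod s ^ l * cmod s ^ j / fact j"
      by (intro divide_left_mono fact_mono) auto
    finally show "cmod (s ^ (j + l) / fact (j + l)) \<le> cmod s ^ l * (cmod s ^ j / fact j)" by simp
  qed
  then show ?thesis unfolding sums_unique[OF S, symmetric] sums_unique[OF E, symmetric] .
qed

lemma power_prod_le: "0 \<le> x \<Longrightarrow> i + j \<le> k \<Longrightarrow> x ^ i * (1 + x) ^ j \<le> (1 + x :: real) ^ k"
proof -
  assume x: "0 \<le> x" and k: "i + j \<le> k"
  have "x ^ i * (1 + x) ^ j \<le> (1 + x) ^ i * (1 + x) ^ j" using x by (intro mult_right_mono power_mono) auto
  also have "\<dots> \<le> (1 + x) ^ k" unfolding power_add[symmetric] using x k by (intro power_increasing) auto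
  finally show ?thesis .
qed

lemma exp_expansion_estimate:
  fixes t a b0 b1 C :: real and Y Y' v0 v0' v1 v1' :: complex
  assumes l: "l \<ge> 1" and a: "\<bar>a\<bar> \<le> 1" and b0: "0 \<le> b0" and b1: "0 \<le> b1" and C: "0 \<le> C"
    and Y': "cmod Y' \<le> C * (1 + \<bar>t\<bar>)"
    and v0: "cmod v0 \<le> b0 * (\<bar>t\<bar>\<^sup>2 * (1 + \<bar>t\<bar>))" "cmod v0' \<le> b0 * (\<bar>t\<bar> * (1 + \<bar>t\<bar>))"
    and v1: "cmod v1 \<le> b1 * (\<bar>t\<bar>\<^sup>2 * (1 + \<bar>t\<bar>))" "cmod v1' \<le> b1 * (\<bar>t\<bar> * (1 + \<bar>t\<bar>))"
  defines "s \<equiv> of_real (a * t\<^sup>2) :: complex"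
  defines "E \<equiv> \<lambda>k. (\<Sum>j<k. s ^ j / fact j)"
  defines "f \<equiv> exp (Y + s + v0 + v1)" and "h \<equiv> (E l + v0) * exp Y"
  defines "f' \<equiv> f * (Y' + of_real (2 * a * t) + v0' + v1')"
    and "h' \<equiv> Y' * h + (of_real (2 * a * t) * E (l - 1) + v0') * exp Y"
  defines "G \<equiv> exp (Re Y + (\<bar>a\<bar> * t\<^sup>2 + cmod v0 + cmod v1))"
    and "\<eta> \<equiv> \<bar>a\<bar> ^ l + (b0 + b1)\<^sup>2 + b1 + \<bar>a\<bar> * b0"
  shows "cmod (f - h) \<le> \<eta> * \<bar>t\<bar>\<^sup>2 * (1 + \<bar>t\<bar>) ^ (2 * l + 4) * G"
    and "cmod (f' - h') \<le> (C + 3) * \<eta> * \<bar>t\<bar> * (1 + \<bar>t\<bar>) ^ (2 * l + 6) * G"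
proof -
  define x where "x = \<bar>t\<bar>"
  define A where "A = \<bar>a\<bar>"
  define P where "P = (1 + x) ^ (2 * l + 4)"
  define v where "v = v0 + v1"
  define U where "U = A * x\<^sup>2 + cmod v0 + cmod v1"
  have x: "0 \<le> x" and A: "0 \<le> A" "A \<le> 1" using a by (auto simp: x_def A_def)
  have t2: "t\<^sup>2 = x\<^sup>2" by (simp add: x_def)
  have ns: "cmod s = A * x\<^sup>2" unfolding s_def A_def by (simp only: norm_of_real abs_mult abs_power2 t2)
  have P1: "1 \<le> P" unfolding P_def using x by (intro one_le_power) auto
  have \<eta>0: "0 \<le> \<eta>" using b0 b1 by (auto simp: \<eta>_def intro!: add_nonneg_nonneg)
  have e1: "cmod (exp s) \<le> exp (A * x\<^sup>2)" using norm_exp[of s] by (simp add: ns)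
  have vb: "cmod v \<le> cmod v0 + cmod v1" unfolding v_def by (rule norm_triangle_ineq)
  have vb2: "cmod v \<le> (b0 + b1) * (x\<^sup>2 * (1 + x))"
    using vb v0(1) v1(1) by (simp add: x_def distrib_right)
  have eU1: "exp (A * x\<^sup>2) \<le> exp U" "exp (A * x\<^sup>2) * exp (cmod v) \<le> exp U" "exp (cmod v) \<le> exp U"
  proof -
    have Ax: "0 \<le> A * x\<^sup>2" using A by simp
    show "exp (A * x\<^sup>2) \<le> exp U" by (simp add: U_def)
    show "exp (A * x\<^sup>2) * exp (cmod v) \<le> exp U" using vb by (simp add: U_def exp_add[symmetric])
    show "exp (cmod v) \<le> exp U" using vb Ax by (simp add: U_def)
  qed
  have sj: "cmod (exp s - E k) \<le> (A * x\<^sup>2) ^ k * exp U" for k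
  proof -
    have "cmod (exp s - E k) \<le> cmod s ^ k * exp (cmod s)" unfolding E_def by (rule exp_taylor_remainder)
    also have "\<dots> \<le> (A * x\<^sup>2) ^ k * exp U" unfolding ns using eU1(1) A x by (intro mult_left_mono) auto
    finally show ?thesis .
  qed
  have s1: "cmod (exp s - 1) \<le> A * x\<^sup>2 * exp U" using sj[of 1] by (simp add: E_def)
  have ev1: "cmod (exp v - 1) \<le> cmod v * exp (cmod v)" by (rule norm_exp_minus_1_le)
  have ev2: "cmod (exp v - 1 - v) \<le> (cmod v)\<^sup>2 * exp (cmod v)" by (rule norm_exp_minus_1_minus_le)
  have xx: "x\<^sup>2 * (1 + x) \<le> P" "x * (1 + x) \<le> P" "1 + x \<le> P" "(1 + x)\<^sup>2 * x\<^sup>2 \<le> P" "x\<^sup>2 * (1+x)\<^sup>2 \<le> P"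
    using power_prod_le[OF x, of 2 1 "2 * l + 4"] power_prod_le[OF x, of 1 1 "2 * l + 4"]
      power_prod_le[OF x, of 0 1 "2 * l + 4"] power_prod_le[OF x, of 2 2 "2 * l + 4"]
    by (simp_all add: P_def mult.commute)
  have xl: "x ^ (2 * (l - 1)) \<le> P" using power_prod_le[OF x, of "2 * (l - 1)" 0 "2 * l + 4"] l by (simp add: P_def)
  have lpow: "(A * x\<^sup>2) ^ l = A ^ l * (x\<^sup>2 * x ^ (2 * (l - 1)))" "A * (A * x\<^sup>2) ^ (l - 1) = A ^ l * x ^ (2 * (l - 1))"
  proof -
    obtain k where k: "l = Suc k" using l by (cases l) auto
    show "(A * x\<^sup>2) ^ l = A ^ l * (x\<^sup>2 * x ^ (2 * (l - 1)))" "A * (A * x\<^sup>2) ^ (l - 1) = A ^ l * x ^ (2 * (l - 1))"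
      unfolding k by (simp_all add: power_mult_distrib power_mult)
  qed
  define D where "D = exp (s + v) - E l - v0"
  have Dsplit: "D = (exp s - E l) + exp s * (exp v - 1 - v) + exp s * v1 + (exp s - 1) * v0"
    unfolding D_def exp_add v_def by (simp add: algebra_simps)
  have Db: "cmod D \<le> \<eta> * x\<^sup>2 * P * exp U"
  proof -
    have 1: "cmod (exp s - E l) \<le> A ^ l * (x\<^sup>2 * P) * exp U"
    proof -
      have "A ^ l * (x\<^sup>2 * x ^ (2 * (l - 1))) * exp U \<le> A ^ l * (x\<^sup>2 * P) * exp U"
        using A x xl by (intro mult_right_mono mult_left_mono) auto
      with sj[of l] show ?thesis unfolding lpow by linarith
    qed
    have 2: "cmod (exp s * (exp v - 1 - v)) \<le> (b0 + b1)\<^sup>2 * (x\<^sup>2 * P) * exp U"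
    proof -
      have "cmod (exp s * (exp v - 1 - v)) \<le> exp (A * x\<^sup>2) * ((cmod v)\<^sup>2 * exp (cmod v))"
        unfolding norm_mult using e1 ev2 by (intro mult_mono) auto
      also have "\<dots> = (cmod v)\<^sup>2 * (exp (A * x\<^sup>2) * exp (cmod v))" by simp
      also have "\<dots> \<le> ((b0 + b1) * (x\<^sup>2 * (1 + x)))\<^sup>2 * exp U"
        using vb2 eU1(2) by (intro mult_mono power_mono) auto
      also have "((b0 + b1) * (x\<^sup>2 * (1 + x)))\<^sup>2 = (b0 + b1)\<^sup>2 * (x\<^sup>2 * (x\<^sup>2 * (1 + x)\<^sup>2))"
        by (simp add: power_mult_distrib power2_eq_square mult_ac)
      also have "\<dots> * exp U \<le> (b0 + b1)\<^sup>2 * (x\<^sup>2 * P) * exp U"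
        using xx(5) by (intro mult_right_mono mult_left_mono) auto
      finally show ?thesis .
    qed
    have 3: "cmod (exp s * v1) \<le> b1 * (x\<^sup>2 * P) * exp U"
    proof -
      have "cmod (exp s * v1) \<le> exp U * (b1 * (x\<^sup>2 * (1 + x)))"
        unfolding norm_mult using e1 eU1(1) v1(1) by (intro mult_mono) (auto simp: x_def)
      also have "\<dots> \<le> exp U * (b1 * (x\<^sup>2 * P))" using b1 x xx(3) by (intro mult_left_mono) auto
      finally show ?thesis by (simp add: mult_ac)
    qed
    have 4: "cmod ((exp s - 1) * v0) \<le> A * b0 * (x\<^sup>2 * P) * exp U"
    proof -
      have "cmod ((exp s - 1) * v0) \<le> (A * x\<^sup>2 * exp U) * (b0 * (x\<^sup>2 * (1 + x)))"
        unfolding norm_mult using s1 v0(1) A by (intro mult_mono) (auto simp: x_def)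
      also have "\<dots> = A * b0 * (x\<^sup>2 * (x\<^sup>2 * (1 + x))) * exp U" by (simp only: mult_ac)
      also have "\<dots> \<le> A * b0 * (x\<^sup>2 * P) * exp U" using A b0 xx(1) by (intro mult_right_mono mult_left_mono) auto
      finally show ?thesis .
    qed
    have "cmod D \<le> A ^ l * (x\<^sup>2 * P) * exp U + (b0 + b1)\<^sup>2 * (x\<^sup>2 * P) * exp U + b1 * (x\<^sup>2 * P) * exp U + A * b0 * (x\<^sup>2 * P) * exp U"
      unfolding Dsplit
      by (rule norm_triangle_le[OF add_mono[OF norm_triangle_le[OF add_mono[OF norm_triangle_le[OF add_mono[OF 1 2]] 3]] 4]])
    also have "\<dots> = \<eta> * x\<^sup>2 * P * exp U" unfolding \<eta>_def A_def[symmetric] by (simp only: distrib_right mult.assoc)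
    finally show ?thesis .
  qed
  have G: "cmod (exp Y) * exp U = G" unfolding G_def U_def t2 A_def by (simp add: exp_add)
  have fh: "f - h = exp Y * D" unfolding f_def h_def D_def v_def by (simp add: exp_add algebra_simps)
  have fhb: "cmod (f - h) \<le> \<eta> * x\<^sup>2 * P * G"
  proof -
    have "cmod (f - h) \<le> cmod (exp Y) * (\<eta> * x\<^sup>2 * P * exp U)"
      unfolding fh norm_mult by (rule mult_left_mono[OF Db norm_ge_zero])
    also have "\<dots> = \<eta> * x\<^sup>2 * P * (cmod (exp Y) * exp U)" by (simp only: mult_ac)
    finally show ?thesis unfolding G .
  qed
  then show "cmod (f - h) \<le> \<eta> * \<bar>t\<bar>\<^sup>2 * (1 + \<bar>t\<bar>) ^ (2 * l + 4) * G" unfolding x_def P_def .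
  define W where "W = of_real (2 * a * t) * (exp (s + v) - E (l - 1)) + v0' * (exp (s + v) - 1) + v1' * exp (s + v)"
  have f'h': "f' - h' = Y' * (f - h) + exp Y * W"
    unfolding f'_def h'_def W_def f_def h_def v_def by (simp add: exp_add algebra_simps)
  have evU: "cmod (exp (s + v)) \<le> exp U"
  proof -
    have "cmod (exp (s + v)) \<le> exp (A * x\<^sup>2) * exp (cmod v)"
      unfolding exp_add norm_mult by (intro mult_mono e1 norm_exp) auto
    with eU1(2) show ?thesis by linarith
  qed
  have esv: "cmod (exp s * (exp v - 1)) \<le> (b0 + b1) * (x\<^sup>2 * (1 + x)) * exp U"
  proof -
    have "cmod (exp s * (exp v - 1)) \<le> exp (A * x\<^sup>2) * (cmod v * exp (cmod v))"
      unfolding norm_mult using e1 ev1 by (intro mult_mono) auto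
    also have "\<dots> = cmod v * (exp (A * x\<^sup>2) * exp (cmod v))" by simp
    also have "\<dots> \<le> (b0 + b1) * (x\<^sup>2 * (1 + x)) * exp U"
      using vb2 eU1(2) b0 b1 x by (intro mult_mono) auto
    finally show ?thesis .
  qed
  have Wb: "cmod W \<le> 3 * \<eta> * x * P * exp U"
  proof -
    have n2: "cmod (complex_of_real (2 * a * t)) = 2 * A * x" by (simp only: norm_of_real abs_mult A_def x_def abs_numeral)
    have d1: "exp (s + v) - E (l - 1) = (exp s - E (l - 1)) + exp s * (exp v - 1)" by (simp add: exp_add algebra_simps)
    have "cmod (exp (s + v) - E (l - 1)) \<le> (A * x\<^sup>2) ^ (l - 1) * exp U + (b0 + b1) * (x\<^sup>2 * (1 + x)) * exp U"
      unfolding d1 by (rule norm_triangle_le[OF add_mono[OF sj esv]])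
    then have "cmod (of_real (2 * a * t) * (exp (s + v) - E (l - 1))) \<le> 2 * A * x * ((A * x\<^sup>2) ^ (l - 1) * exp U + (b0 + b1) * (x\<^sup>2 * (1 + x)) * exp U)"
      unfolding norm_mult n2 using A x by (intro mult_left_mono) auto
    also have "\<dots> = (2 * (A * (A * x\<^sup>2) ^ (l - 1)) + 2 * A * (b0 + b1) * (x\<^sup>2 * (1 + x))) * x * exp U" by (simp add: algebra_simps)
    also have "\<dots> \<le> (2 * (A ^ l * P) + 2 * A * (b0 + b1) * P) * x * exp U"
      unfolding lpow(2) using A x b0 b1 xl xx(1) by (intro mult_right_mono add_mono mult_left_mono) auto
    also have "\<dots> = (2 * A ^ l + 2 * A * (b0 + b1)) * x * P * exp U" by (simp add: algebra_simps)
    finally have 1: "cmod (of_real (2 * a * t) * (exp (s + v) - E (l - 1))) \<le> (2 * A ^ l + 2 * A * (b0 + b1)) * x * P * exp U" .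
    have d2: "exp (s + v) - 1 = (exp s - 1) + exp s * (exp v - 1)" by (simp add: exp_add algebra_simps)
    have "cmod (exp (s + v) - 1) \<le> A * x\<^sup>2 * exp U + (b0 + b1) * (x\<^sup>2 * (1 + x)) * exp U"
      unfolding d2 by (rule norm_triangle_le[OF add_mono[OF s1 esv]])
    also have "\<dots> \<le> A * (x\<^sup>2 * (1 + x)) * exp U + (b0 + b1) * (x\<^sup>2 * (1 + x)) * exp U"
      using A x mult_left_mono[of 1 "1 + x" "x\<^sup>2"] by (intro add_right_mono mult_right_mono mult_left_mono) auto
    finally have d2b: "cmod (exp (s + v) - 1) \<le> A * (x\<^sup>2 * (1 + x)) * exp U + (b0 + b1) * (x\<^sup>2 * (1 + x)) * exp U" .
    have "cmod (v0' * (exp (s + v) - 1)) \<le> (b0 * (x * (1 + x))) * (A * (x\<^sup>2 * (1 + x)) * exp U + (b0 + b1) * (x\<^sup>2 * (1 + x)) * exp U)"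
      unfolding norm_mult using v0(2) d2b b0 x by (intro mult_mono) (auto simp: x_def)
    also have "\<dots> = (A * b0 + b0 * (b0 + b1)) * x * (x\<^sup>2 * (1 + x)\<^sup>2) * exp U" by (simp add: algebra_simps power2_eq_square)
    also have "\<dots> \<le> (A * b0 + b0 * (b0 + b1)) * x * P * exp U"
      using A x b0 b1 xx(5) by (intro mult_right_mono mult_left_mono mult_nonneg_nonneg add_nonneg_nonneg) auto
    finally have 2: "cmod (v0' * (exp (s + v) - 1)) \<le> (A * b0 + b0 * (b0 + b1)) * x * P * exp U" .
    have "cmod (v1' * exp (s + v)) \<le> (b1 * (x * (1 + x))) * exp U"
      unfolding norm_mult using v1(2) evU b1 x by (intro mult_mono) (auto simp: x_def)
    also have "\<dots> \<le> (b1 * (x * P)) * exp U" using b1 x xx(3) by (intro mult_right_mono mult_left_mono) auto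
    finally have 3: "cmod (v1' * exp (s + v)) \<le> b1 * x * P * exp U" by (simp only: mult.assoc)
    have "cmod W \<le> (2 * A ^ l + 2 * A * (b0 + b1)) * x * P * exp U + (A * b0 + b0 * (b0 + b1)) * x * P * exp U + b1 * x * P * exp U"
      unfolding W_def by (rule norm_triangle_le[OF add_mono[OF norm_triangle_le[OF add_mono[OF 1 2]] 3]])
    also have "\<dots> = (2 * A ^ l + 2 * A * (b0 + b1) + (A * b0 + b0 * (b0 + b1)) + b1) * (x * P * exp U)" by (simp only: distrib_right mult.assoc)
    also have "\<dots> \<le> (3 * \<eta>) * (x * P * exp U)"
    proof (rule mult_right_mono)
      have 1: "A * b1 \<le> b1" using A b1 mult_right_mono[of A 1 b1] by simp
      have 2: "b0 * (b0 + b1) \<le> (b0 + b1)\<^sup>2" unfolding power2_eq_square using b0 b1 by (intro mult_right_mono) auto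
      have "0 \<le> A ^ l" "0 \<le> A * b0" "0 \<le> (b0 + b1)\<^sup>2" using A b0 by auto
      then show "2 * A ^ l + 2 * A * (b0 + b1) + (A * b0 + b0 * (b0 + b1)) + b1 \<le> 3 * \<eta>"
      proof -
        assume nn: "0 \<le> A ^ l" "0 \<le> A * b0" "0 \<le> (b0 + b1)\<^sup>2"
        define Q where "Q = (b0 + b1)\<^sup>2"
        define R where "R = b0 * (b0 + b1)"
        define B0 where "B0 = A * b0"
        define B1 where "B1 = A * b1"
        have e: "2 * A * (b0 + b1) = 2 * B0 + 2 * B1" by (simp add: B0_def B1_def algebra_simps)
        have "B1 \<le> b1" "R \<le> Q" "0 \<le> B0" "0 \<le> Q" using 1 2 nn by (simp_all add: B0_def B1_def Q_def R_def)
        then have "2 * A ^ l + (2 * B0 + 2 * B1) + (B0 + R) + b1 \<le> 3 * (A ^ l + Q + b1 + B0)"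
          using nn(1) b1 by (simp add: distrib_left)
        then show ?thesis unfolding e \<eta>_def A_def[symmetric] B0_def Q_def R_def by simp
      qed
      show "0 \<le> x * P * exp U" using x P1 by auto
    qed
    finally show ?thesis by (simp only: mult.assoc)
  qed
  have PP: "P \<le> (1 + x) ^ (2 * l + 6)" "(1 + x) * x * P \<le> (1 + x) ^ (2 * l + 6)"
  proof -
    show "P \<le> (1 + x) ^ (2 * l + 6)" unfolding P_def using x by (intro power_increasing) auto
    have "(1 + x) * x * P \<le> (1 + x) * (1 + x) * P" using x P1 by (intro mult_right_mono mult_left_mono) auto
    also have "\<dots> = (1 + x) ^ (2 * l + 6)" by (simp add: P_def power_add numeral_eq_Suc mult_ac)
    finally show "(1 + x) * x * P \<le> (1 + x) ^ (2 * l + 6)" .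
  qed
  have G0: "G > 0" by (simp add: G_def)
  have "cmod (f' - h') \<le> cmod Y' * cmod (f - h) + cmod (exp Y) * cmod W"
    unfolding f'h' using norm_triangle_ineq[of "Y' * (f - h)" "exp Y * W"] by (simp only: norm_mult)
  also have "\<dots> \<le> (C * (1 + x)) * (\<eta> * x\<^sup>2 * P * G) + cmod (exp Y) * (3 * \<eta> * x * P * exp U)"
    using Y' fhb Wb C x by (intro add_mono mult_mono mult_left_mono) (auto simp: x_def)
  also have "\<dots> = C * \<eta> * x * ((1 + x) * x * P) * G + 3 * \<eta> * x * P * (cmod (exp Y) * exp U)"
    by (simp only: power2_eq_square mult_ac)
  also have "\<dots> \<le> C * \<eta> * x * (1 + x) ^ (2 * l + 6) * G + 3 * \<eta> * x * (1 + x) ^ (2 * l + 6) * G"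
    unfolding G using C \<eta>0 x PP G0 by (intro add_mono mult_right_mono mult_left_mono) auto
  also have "\<dots> = (C + 3) * \<eta> * x * (1 + x) ^ (2 * l + 6) * G" by (simp only: distrib_right)
  finally show "cmod (f' - h') \<le> (C + 3) * \<eta> * \<bar>t\<bar> * (1 + \<bar>t\<bar>) ^ (2 * l + 6) * G" unfolding x_def .
qed

lemma powr_le_power_interp:
  assumes "0 \<le> x" "real k \<le> e" "e \<le> real k + 1"
  shows "x powr e \<le> x ^ k * (1 + x)"
proof (cases "x = 0")
  case False
  then have x: "x > 0" using assms by simp
  show ?thesis
  proof (cases "x \<le> 1")
    case True
    have "x powr e \<le> x powr real k" using x True assms by (intro powr_mono') auto
    also have "\<dots> = x ^ k * 1" using x by (simp add: powr_realpow)
    also have "\<dots> \<le> x ^ k * (1 + x)" using x by (intro mult_left_mono) auto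
    finally show ?thesis .
  next
    case False
    have "x powr e \<le> x powr real (k + 1)" using False assms by (intro powr_mono) auto
    also have "\<dots> = x ^ k * x" using x by (simp only: powr_realpow power_add power_one_right)
    also have "\<dots> \<le> x ^ k * (1 + x)" using x by (intro mult_left_mono) auto
    finally show ?thesis .
  qed
qed (use assms in auto)

lemma small_powr:
  assumes "e > 0" "A \<ge> 0" "\<tau> > 0"
  obtains d :: real where "d > 0" "\<And>x. 0 \<le> x \<Longrightarrow> x \<le> d \<Longrightarrow> A * x powr e \<le> \<tau>"
proof (rule that[of "(\<tau> / (A + 1)) powr (1 / e)"])
  show "(\<tau> / (A + 1)) powr (1 / e) > 0" using assms by simp
  fix x assume x: "0 \<le> x" "x \<le> (\<tau> / (A + 1)) powr (1 / e)"
  have "x powr e \<le> ((\<tau> / (A + 1)) powr (1 / e)) powr e" using x assms by (intro powr_mono2) auto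
  also have "\<dots> = \<tau> / (A + 1)" using assms by (simp add: powr_powr)
  finally have "A * x powr e \<le> A * (\<tau> / (A + 1))" using assms by (intro mult_left_mono) auto
  also have "\<dots> \<le> (A + 1) * (\<tau> / (A + 1))" using assms by (intro mult_right_mono) auto
  finally show "A * x powr e \<le> \<tau>" using assms by simp
qed

context petersburg
begin

definition Yd :: "nat \<Rightarrow> real \<Rightarrow> complex" where "Yd n t = of_nat n * (of_real (eps n) * y1' (eps n * t))"
definition vv :: "nat \<Rightarrow> real \<Rightarrow> complex" where "vv n t = (- \<i> * of_real (\<mu> * eps n)) * (of_real t * Y n t)"
definition vd :: "nat \<Rightarrow> real \<Rightarrow> complex" where "vd n t = (- \<i> * of_real (\<mu> * eps n)) * (Y n t + of_real t * Yd n t)"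
definition EE :: "nat \<Rightarrow> nat \<Rightarrow> real \<Rightarrow> complex" where "EE l n t = (\<Sum>j<l. of_real (aa n * t\<^sup>2) ^ j / fact j)"
text \<open>\<open>hh l n 0\<close> and \<open>hh l n 1\<close> are the transforms of \<open>Gtilde\<close> and \<open>Gtt\<close>; \<open>ff n\<close> is the transform of the normalised sum.\<close>
definition hh :: "nat \<Rightarrow> nat \<Rightarrow> real \<Rightarrow> real \<Rightarrow> complex" where
  "hh l n z t = (EE l n t + of_real z * vv n t) * exp (Y n t)"
definition hd :: "nat \<Rightarrow> nat \<Rightarrow> real \<Rightarrow> real \<Rightarrow> complex" where
  "hd l n z t = Yd n t * hh l n z t + (of_real (2 * aa n * t) * EE (l - 1) n t + of_real z * vd n t) * exp (Y n t)"
definition ff :: "nat \<Rightarrow> real \<Rightarrow> complex" where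
  "ff n t = (\<phi> (eps n * t) * iexp (- (t * (eps n * \<mu>)))) ^ n"
definition fd :: "nat \<Rightarrow> real \<Rightarrow> complex" where
  "fd n t = of_nat n * (\<phi> (eps n * t) * iexp (- (t * (eps n * \<mu>)))) ^ (n - 1)
     * (of_real (eps n) * ((\<phi>' (eps n * t) - \<i> * \<mu> * \<phi> (eps n * t)) * iexp (- (t * (eps n * \<mu>)))))"

lemma scaled_vector_derivative:
  fixes g :: "real \<Rightarrow> complex"
  assumes "\<And>s. (g has_vector_derivative g' s) (at s)"
  shows "((\<lambda>t. g (c * t)) has_vector_derivative of_real c * g' (c * t)) (at t)"
proof -
  have "((\<lambda>t. c * t) has_vector_derivative c) (at t)"
    by (auto intro!: derivative_eq_intros simp: has_real_derivative_iff_has_vector_derivative[symmetric])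
  from vector_diff_chain_at[OF this assms] show ?thesis by (simp add: comp_def scaleR_conv_of_real)
qed

lemma Y_deriv: "(Y n has_vector_derivative Yd n t) (at t)"
  unfolding Y_def[abs_def] Yd_def by (rule has_vector_derivative_mult_right[OF scaled_vector_derivative[OF y1_deriv(1)]])

lemma of_real_vector_derivative: "((\<lambda>t. complex_of_real t) has_vector_derivative 1) (at t)"
  using has_vector_derivative_of_real[OF DERIV_ident[of "at t"]] by simp

lemma exp_Y_deriv: "((\<lambda>t. exp (Y n t)) has_vector_derivative Yd n t * exp (Y n t)) (at t)"
  using field_vector_diff_chain_at[OF Y_deriv DERIV_exp[of "Y n t"]] by (simp add: comp_def)

lemma vv_deriv: "(vv n has_vector_derivative vd n t) (at t)"
proof -
  have "((\<lambda>t. of_real t * Y n t) has_vector_derivative of_real t * Yd n t + 1 * Y n t) (at t)"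
    by (rule has_vector_derivative_mult[OF of_real_vector_derivative Y_deriv])
  from has_vector_derivative_mult_right[OF this, of "- \<i> * of_real (\<mu> * eps n)"]
  show ?thesis unfolding vv_def[abs_def] vd_def by (simp only: mult_1 add.commute)
qed

lemma EE_deriv:
  assumes l: "l \<ge> 1"
  shows "(EE l n has_vector_derivative of_real (2 * aa n * t) * EE (l - 1) n t) (at t)"
proof -
  have s: "((\<lambda>t. complex_of_real (aa n * t\<^sup>2)) has_vector_derivative of_real (2 * aa n * t)) (at t)"
  proof -
    have "((\<lambda>t. aa n * t\<^sup>2) has_real_derivative 2 * aa n * t) (at t)" by (auto intro!: derivative_eq_intros)
    then show ?thesis by (rule has_vector_derivative_of_real[unfolded has_real_derivative_iff_has_vector_derivative[symmetric]])
  qed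
  obtain k where k: "l = Suc k" using l by (cases l) auto
  have fld: "((\<lambda>w::complex. \<Sum>j<Suc k. w ^ j / fact j) has_field_derivative (\<Sum>j<k. w ^ j / fact j)) (at w)" for w
  proof -
    have "((\<lambda>w::complex. \<Sum>j<Suc k. w ^ j / fact j) has_field_derivative (\<Sum>j<Suc k. of_nat j * w ^ (j - 1) / fact j)) (at w)"
      by (auto intro!: derivative_eq_intros)
    moreover have "(\<Sum>j<Suc k. of_nat j * w ^ (j - 1) / fact j) = (\<Sum>j<k. w ^ j / fact j)"
      unfolding sum.lessThan_Suc_shift by (simp add: comp_def fact_Suc divide_simps del: of_nat_Suc)
    ultimately show ?thesis by simp
  qed
  from field_vector_diff_chain_at[OF s fld] show ?thesis unfolding EE_def[abs_def] k by (simp add: comp_def)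
qed

lemma hh_deriv:
  assumes l: "l \<ge> 1"
  shows "(hh l n z has_vector_derivative hd l n z t) (at t)"
proof -
  have 1: "((\<lambda>t. EE l n t + of_real z * vv n t) has_vector_derivative of_real (2 * aa n * t) * EE (l - 1) n t + of_real z * vd n t) (at t)"
    by (rule has_vector_derivative_add[OF EE_deriv[OF l] has_vector_derivative_mult_right[OF vv_deriv]])
  show ?thesis unfolding hh_def[abs_def] hd_def
    by (rule has_vector_derivative_eq_rhs[OF has_vector_derivative_mult[OF 1 exp_Y_deriv]]) (simp only: mult_ac)
qed

lemma continuous_Y: "continuous_on UNIV (Y n)" "continuous_on UNIV (Yd n)" "continuous_on UNIV (\<lambda>t. \<phi> (c * t))" "continuous_on UNIV (\<lambda>t. \<phi>' (c * t))"
proof -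
  have c: "continuous_on UNIV (\<lambda>t. c * t)" for c :: real by (intro continuous_intros)
  have cphi: "continuous_on UNIV \<phi>"
    by (rule continuous_at_imp_continuous_on) (use has_vector_derivative_continuous[OF \<phi>_series(2)] in simp)
  show "continuous_on UNIV (Y n)" unfolding Y_def[abs_def]
    by (intro continuous_on_mult_left continuous_on_compose2[OF y1_deriv(3) c]) auto
  show "continuous_on UNIV (Yd n)" unfolding Yd_def[abs_def]
    by (intro continuous_on_mult_left continuous_on_compose2[OF y1_deriv(2) c]) auto
  show "continuous_on UNIV (\<lambda>t. \<phi> (c * t))" by (intro continuous_on_compose2[OF cphi c]) auto
  show "continuous_on UNIV (\<lambda>t. \<phi>' (c * t))" by (intro continuous_on_compose2[OF \<phi>_series(3) c]) auto
qed

lemma continuous_EE: "continuous_on UNIV (EE l n)"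
  unfolding EE_def[abs_def] by (intro continuous_intros) auto

lemma continuous_hd: "continuous_on UNIV (hd l n z)" "continuous_on UNIV (hh l n z)"
proof -
  have v: "continuous_on UNIV (vv n)" "continuous_on UNIV (vd n)"
    unfolding vv_def[abs_def] vd_def[abs_def]
    by (intro continuous_on_mult_left continuous_on_mult continuous_on_add continuous_Y continuous_on_of_real continuous_on_id)+
  show h: "continuous_on UNIV (hh l n z)" unfolding hh_def[abs_def]
    by (intro continuous_on_mult continuous_on_add continuous_on_exp continuous_on_const v continuous_Y continuous_EE)
  have t: "continuous_on UNIV (\<lambda>t. complex_of_real (2 * aa n * t))" by (intro continuous_intros)
  show "continuous_on UNIV (hd l n z)" unfolding hd_def[abs_def]
    by (intro continuous_on_mult continuous_on_add continuous_on_exp continuous_on_const v h t continuous_Y continuous_EE)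
qed

lemma ff_deriv: "(ff n has_vector_derivative fd n t) (at t)" "continuous_on UNIV (fd n)" "continuous_on UNIV (ff n)"
proof -
  let ?e = "\<lambda>t. iexp (- (t * (eps n * \<mu>)))"
  have 1: "((\<lambda>t. \<phi> (eps n * t) * ?e t) has_vector_derivative of_real (eps n) * ((\<phi>' (eps n * t) - \<i> * \<mu> * \<phi> (eps n * t)) * ?e t)) (at t)"
    by (rule has_vector_derivative_eq_rhs[OF has_vector_derivative_mult[OF scaled_vector_derivative[OF \<phi>_series(2)] has_vector_derivative_iexp_minus]])
      (simp add: algebra_simps)
  have 2: "((\<lambda>w::complex. w ^ n) has_field_derivative of_nat n * w ^ (n - 1)) (at w)" for w
    by (auto intro!: derivative_eq_intros)
  from field_vector_diff_chain_at[OF 1 2] show "(ff n has_vector_derivative fd n t) (at t)"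
    unfolding ff_def[abs_def] fd_def by (simp add: comp_def mult_ac)
  have e: "continuous_on UNIV ?e" by (intro continuous_intros)
  show "continuous_on UNIV (fd n)" unfolding fd_def[abs_def]
    by (intro continuous_on_mult continuous_on_power continuous_on_diff continuous_on_const continuous_Y e)
  show "continuous_on UNIV (ff n)" unfolding ff_def[abs_def]
    by (intro continuous_on_mult continuous_on_power continuous_Y e)
qed

lemma ff_bounds:
  assumes n: "n \<ge> 1" and \<theta>: "cmod (\<phi> (eps n * t)) \<le> \<theta>"
  shows "cmod (ff n t) \<le> \<theta> ^ n" "cmod (fd n t) \<le> 2 * \<mu> * real n * \<theta> ^ (n - 1)"
proof -
  have e: "cmod (iexp (- (t * (eps n * \<mu>)))) = 1" by (rule norm_exp_i_times)
  have b: "cmod (\<phi> (eps n * t) * iexp (- (t * (eps n * \<mu>)))) \<le> \<theta>" unfolding norm_mult e using \<theta> by simp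
  show "cmod (ff n t) \<le> \<theta> ^ n" unfolding ff_def norm_power by (rule power_mono[OF b]) simp
  have 1: "cmod (\<phi>' (eps n * t) - \<i> * \<mu> * \<phi> (eps n * t)) \<le> 2 * \<mu>"
  proof -
    have "cmod (\<i> * \<mu> * \<phi> (eps n * t)) \<le> \<mu> * 1" unfolding norm_mult using \<mu>_pos \<phi>_series(5) by (intro mult_mono) auto
    then show ?thesis using norm_triangle_ineq4[of "\<phi>' (eps n * t)" "\<i> * \<mu> * \<phi> (eps n * t)"] \<phi>_series(4)[of "eps n * t"] by linarith
  qed
  have 2: "cmod ((\<phi> (eps n * t) * iexp (- (t * (eps n * \<mu>)))) ^ (n - 1)) \<le> \<theta> ^ (n - 1)"
    unfolding norm_power by (rule power_mono[OF b]) simp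
  have \<theta>0: "0 \<le> \<theta>" using \<theta> norm_ge_zero order_trans by blast
  have 3: "cmod (of_real (eps n) * ((\<phi>' (eps n * t) - \<i> * \<mu> * \<phi> (eps n * t)) * iexp (- (t * (eps n * \<mu>))))) \<le> 1 * (2 * \<mu> * 1)"
    unfolding norm_mult[of "complex_of_real (eps n)"] norm_mult[of _ "iexp (- (t * (eps n * \<mu>)))"] e using 1 eps[OF n] \<mu>_pos
    by (intro mult_mono) auto
  have "cmod (fd n t) \<le> real n * \<theta> ^ (n - 1) * (1 * (2 * \<mu> * 1))"
    unfolding fd_def norm_mult[of "of_nat n * _"] norm_mult[of "of_nat n"] using 2 3 \<theta>0 by (intro mult_mono) auto
  then show "cmod (fd n t) \<le> 2 * \<mu> * real n * \<theta> ^ (n - 1)" by (simp add: mult_ac)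
qed

lemma n_eps_powr:
  assumes "n \<ge> 1" "0 \<le> x"
  shows "real n * (eps n * x) powr e = (eps n * x) powr (e - \<alpha>) * x powr \<alpha>"
proof (cases "x = 0")
  case False
  then have x: "x > 0" using assms by simp
  have e0: "eps n > 0" using eps assms by simp
  have "real n * eps n powr \<alpha> = 1"
    using assms \<alpha> by (simp add: eps_def powr_divide powr_powr)
  then have "real n * (eps n * x) powr \<alpha> = x powr \<alpha>"
    using x e0 by (simp add: powr_mult mult.assoc[symmetric])
  moreover have "(eps n * x) powr e = (eps n * x) powr (e - \<alpha>) * (eps n * x) powr \<alpha>"
    by (simp add: powr_add[symmetric])
  ultimately show ?thesis by (simp add: mult_ac)
qed simp

lemma Y_bounds:
  obtains C where "C > 0"
    "\<And>n t. n \<ge> 1 \<Longrightarrow> cmod (Y n t) \<le> C * \<bar>t\<bar> powr \<alpha>" "\<And>n t. n \<ge> 1 \<Longrightarrow> cmod (Yd n t) \<le> C * \<bar>t\<bar> powr (\<alpha> - 1)"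
    "\<And>n t. n \<ge> 1 \<Longrightarrow> Re (Y n t) \<le> - (cy / r) * \<bar>t\<bar> powr \<alpha>"
proof -
  obtain C where C: "C > 0" "\<And>s. cmod (y1 s) \<le> C * \<bar>s\<bar> powr \<alpha>" "\<And>s. cmod (y1' s) \<le> C * \<bar>s\<bar> powr (\<alpha> - 1)"
      "\<And>s. Re (y1 s) \<le> - (cy / r) * \<bar>s\<bar> powr \<alpha>"
    by (rule y1_bounds, rule that, assumption+)
  show thesis
  proof (rule that[OF C(1)])
    fix n :: nat and t :: real assume n: "n \<ge> 1"
    have e0: "eps n > 0" using eps n by simp
    have ab: "\<bar>eps n * t\<bar> = eps n * \<bar>t\<bar>" using e0 by (simp add: abs_mult)
    have n1: "real n * (eps n * \<bar>t\<bar>) powr \<alpha> = \<bar>t\<bar> powr \<alpha>"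
      using n_eps_powr[OF n abs_ge_zero[of t], of \<alpha>] e0 by (cases "t = 0") auto
    have "cmod (Y n t) = real n * cmod (y1 (eps n * t))" by (simp add: Y_def norm_mult)
    also have "\<dots> \<le> real n * (C * (eps n * \<bar>t\<bar>) powr \<alpha>)" using C(2)[of "eps n * t"] unfolding ab by (intro mult_left_mono) auto
    also have "\<dots> = C * \<bar>t\<bar> powr \<alpha>" using n1 by (simp add: mult.left_commute)
    finally show "cmod (Y n t) \<le> C * \<bar>t\<bar> powr \<alpha>" .
    have "Re (Y n t) = real n * Re (y1 (eps n * t))" by (simp add: Y_def)
    also have "\<dots> \<le> real n * (- (cy / r) * (eps n * \<bar>t\<bar>) powr \<alpha>)" using C(4)[of "eps n * t"] unfolding ab by (intro mult_left_mono) auto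
    also have "\<dots> = - (cy / r) * (real n * (eps n * \<bar>t\<bar>) powr \<alpha>)" by (simp only: mult.left_commute)
    finally show "Re (Y n t) \<le> - (cy / r) * \<bar>t\<bar> powr \<alpha>" unfolding n1 .
    show "cmod (Yd n t) \<le> C * \<bar>t\<bar> powr (\<alpha> - 1)"
    proof (cases "t = 0")
      case True
      have "cmod (y1' 0) \<le> 0" using C(3)[of 0] by simp
      then show ?thesis using True by (simp add: Yd_def)
    next
      case False
      have n2: "real n * (eps n * (eps n * \<bar>t\<bar>) powr (\<alpha> - 1)) = \<bar>t\<bar> powr (\<alpha> - 1)"
      proof -
        have "\<bar>t\<bar> * (real n * (eps n * (eps n * \<bar>t\<bar>) powr (\<alpha> - 1))) = real n * ((eps n * \<bar>t\<bar>) * (eps n * \<bar>t\<bar>) powr (\<alpha> - 1))" by simp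
        also have "(eps n * \<bar>t\<bar>) * (eps n * \<bar>t\<bar>) powr (\<alpha> - 1) = (eps n * \<bar>t\<bar>) powr \<alpha>"
          using e0 False by (simp add: powr_diff)
        also have "real n * (eps n * \<bar>t\<bar>) powr \<alpha> = \<bar>t\<bar> * \<bar>t\<bar> powr (\<alpha> - 1)" unfolding n1 using False by (simp add: powr_diff)
        finally show ?thesis using False by simp
      qed
      have "cmod (Yd n t) = real n * (eps n * cmod (y1' (eps n * t)))" using e0 by (simp add: Yd_def norm_mult)
      also have "\<dots> \<le> real n * (eps n * (C * (eps n * \<bar>t\<bar>) powr (\<alpha> - 1)))"
        using C(3)[of "eps n * t"] e0 unfolding ab by (intro mult_left_mono) auto
      also have "\<dots> = C * (real n * (eps n * (eps n * \<bar>t\<bar>) powr (\<alpha> - 1)))" by (simp only: mult.left_commute)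
      finally show ?thesis unfolding n2 .
    qed
  qed
qed

lemma ff_expansion:
  assumes n: "n \<ge> 1" and \<delta>: "\<delta> * \<mu> \<le> 1/2" and t: "eps n * \<bar>t\<bar> < \<delta>"
  shows "ff n t = exp (Y n t + of_real (aa n * t\<^sup>2) + vv n t + of_nat n * RR (eps n * t))"
    and "fd n t = ff n t * (Yd n t + of_real (2 * aa n * t) + vd n t + of_nat n * (of_real (eps n) * RR' (eps n * t)))"
proof -
  have e0: "eps n > 0" using eps n by simp
  let ?I = "{- (\<delta> / eps n)<..<\<delta> / eps n}"
  let ?g = "\<lambda>t. exp (Y n t + of_real (aa n * t\<^sup>2) + vv n t + of_nat n * RR (eps n * t))"
  have "\<bar>t\<bar> < \<delta> / eps n" using t e0 by (simp add: field_simps)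
  then have tI: "t \<in> ?I" by auto
  have eq: "ff n u = ?g u" if u: "u \<in> ?I" for u
  proof -
    have "\<bar>u\<bar> < \<delta> / eps n" using u by auto
    then have "eps n * \<bar>u\<bar> < \<delta>" using e0 by (simp add: field_simps)
    then have "\<bar>eps n * u\<bar> * \<mu> \<le> \<delta> * \<mu>" using \<mu>_pos e0 by (intro mult_right_mono) (auto simp: abs_mult)
    then have "\<bar>eps n * u\<bar> * \<mu> \<le> 1/2" using \<delta> by linarith
    from \<phi>_expansion(1)[OF this] have "\<phi> (eps n * u) = exp (\<i> * of_real (eps n * u) * \<mu> + (y1 (eps n * u) + of_real (A2 * (eps n * u)\<^sup>2) - \<i> * \<mu> * of_real (eps n * u) * y1 (eps n * u) + RR (eps n * u)))" .
    then have "\<phi> (eps n * u) * iexp (- (u * (eps n * \<mu>))) = exp (y1 (eps n * u) + of_real (A2 * (eps n * u)\<^sup>2) - \<i> * \<mu> * of_real (eps n * u) * y1 (eps n * u) + RR (eps n * u))"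
      by (simp add: exp_add[symmetric] algebra_simps)
    then have "ff n u = exp (of_nat n * (y1 (eps n * u) + of_real (A2 * (eps n * u)\<^sup>2) - \<i> * \<mu> * of_real (eps n * u) * y1 (eps n * u) + RR (eps n * u)))"
      by (simp only: ff_def exp_of_nat_mult)
    also have "of_nat n * (y1 (eps n * u) + of_real (A2 * (eps n * u)\<^sup>2) - \<i> * \<mu> * of_real (eps n * u) * y1 (eps n * u) + RR (eps n * u))
       = Y n u + of_real (aa n * u\<^sup>2) + vv n u + of_nat n * RR (eps n * u)"
      by (simp add: Y_def aa_def vv_def power_mult_distrib algebra_simps)
    finally show ?thesis .
  qed
  show f: "ff n t = ?g t" by (rule eq[OF tI])
  have t\<mu>: "\<bar>eps n * t\<bar> * \<mu> \<le> 1/2"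
  proof -
    have "\<bar>eps n * t\<bar> * \<mu> \<le> \<delta> * \<mu>" using t \<mu>_pos e0 by (intro mult_right_mono) (auto simp: abs_mult)
    then show ?thesis using \<delta> by linarith
  qed
  have dR: "((\<lambda>t. RR (eps n * t)) has_vector_derivative of_real (eps n) * RR' (eps n * t)) (at t)"
  proof -
    have "((\<lambda>t. eps n * t) has_vector_derivative eps n) (at t)"
      by (auto intro!: derivative_eq_intros simp: has_real_derivative_iff_has_vector_derivative[symmetric])
    from vector_diff_chain_at[OF this \<phi>_expansion(2)[OF t\<mu>]] show ?thesis by (simp add: comp_def scaleR_conv_of_real)
  qed
  have dA: "((\<lambda>t. complex_of_real (aa n * t\<^sup>2)) has_vector_derivative of_real (2 * aa n * t)) (at t)"
  proof -
    have "((\<lambda>t. aa n * t\<^sup>2) has_real_derivative 2 * aa n * t) (at t)" by (auto intro!: derivative_eq_intros)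
    then show ?thesis by (rule has_vector_derivative_of_real[unfolded has_real_derivative_iff_has_vector_derivative[symmetric]])
  qed
  have inner: "((\<lambda>t. Y n t + of_real (aa n * t\<^sup>2) + vv n t + of_nat n * RR (eps n * t)) has_vector_derivative
      Yd n t + of_real (2 * aa n * t) + vd n t + of_nat n * (of_real (eps n) * RR' (eps n * t))) (at t)"
    by (rule has_vector_derivative_add[OF has_vector_derivative_add[OF has_vector_derivative_add[OF Y_deriv dA] vv_deriv] has_vector_derivative_mult_right[OF dR]])
  have dg: "(?g has_vector_derivative (Yd n t + of_real (2 * aa n * t) + vd n t + of_nat n * (of_real (eps n) * RR' (eps n * t))) * ?g t) (at t)"
    using field_vector_diff_chain_at[OF inner DERIV_exp] by (simp add: comp_def)
  have "(ff n has_vector_derivative (Yd n t + of_real (2 * aa n * t) + vd n t + of_nat n * (of_real (eps n) * RR' (eps n * t))) * ?g t) (at t)"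
    by (rule has_vector_derivative_transform_within_open[OF dg open_greaterThanLessThan tI]) (simp only: eq)
  from vector_derivative_unique_at[OF ff_deriv(1) this]
  show "fd n t = ff n t * (Yd n t + of_real (2 * aa n * t) + vd n t + of_nat n * (of_real (eps n) * RR' (eps n * t)))"
    unfolding f by (simp only: mult.commute)
qed

end

lemma powr_ge_minus_one:
  assumes "1 < e" "0 \<le> (x::real)"
  shows "x - 1 \<le> x powr e"
proof (cases "x \<le> 1")
  case True
  have "0 \<le> x powr e" by simp
  with True show ?thesis by linarith
next
  case False
  then have "x powr 1 \<le> x powr e" using assms by (intro powr_mono) auto
  then show ?thesis using False by simp
qed

context petersburg
begin

lemma correction_bounds:
  obtains B where "B > 0"
    "\<And>n t. n \<ge> 1 \<Longrightarrow> cmod (vv n t) \<le> B * (eps n * \<bar>t\<bar>) * \<bar>t\<bar> powr \<alpha>"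
    "\<And>n t. n \<ge> 1 \<Longrightarrow> cmod (vv n t) \<le> B * eps n * (\<bar>t\<bar>\<^sup>2 * (1 + \<bar>t\<bar>))"
    "\<And>n t. n \<ge> 1 \<Longrightarrow> cmod (vd n t) \<le> B * eps n * (\<bar>t\<bar> * (1 + \<bar>t\<bar>))"
    "\<And>n t. n \<ge> 1 \<Longrightarrow> cmod (Yd n t) \<le> B * (1 + \<bar>t\<bar>)"
proof -
  obtain C where C: "C > 0"
    "\<And>n t. n \<ge> 1 \<Longrightarrow> cmod (Y n t) \<le> C * \<bar>t\<bar> powr \<alpha>" "\<And>n t. n \<ge> 1 \<Longrightarrow> cmod (Yd n t) \<le> C * \<bar>t\<bar> powr (\<alpha> - 1)"
    "\<And>n t. n \<ge> 1 \<Longrightarrow> Re (Y n t) \<le> - (cy / r) * \<bar>t\<bar> powr \<alpha>"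
    by (rule Y_bounds) blast
  define B where "B = 2 * \<mu> * C + C"
  have B: "B > 0" "\<mu> * C \<le> B" "2 * \<mu> * C \<le> B" "C \<le> B" using C(1) \<mu>_pos by (auto simp: B_def intro!: add_pos_pos)
  show thesis
  proof (rule that[OF B(1)])
    fix n :: nat and t :: real assume n: "n \<ge> 1"
    define x where "x = \<bar>t\<bar>"
    have x: "0 \<le> x" by (simp add: x_def)
    have e0: "eps n > 0" using eps n by simp
    have pa: "x powr \<alpha> \<le> x * (1 + x)" using powr_le_power_interp[OF x, of 1 \<alpha>] \<alpha> by simp
    have pa1: "x powr (\<alpha> - 1) \<le> 1 + x" using powr_le_power_interp[OF x, of 0 "\<alpha> - 1"] \<alpha> by simp
    have xp: "x * x powr (\<alpha> - 1) = x powr \<alpha>" using x by (cases "x = 0") (auto simp: powr_diff)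
    have "cmod (vv n t) = \<mu> * eps n * (x * cmod (Y n t))"
      using \<mu>_pos e0 by (simp add: vv_def norm_mult x_def abs_mult)
    also have "\<dots> \<le> \<mu> * eps n * (x * (C * x powr \<alpha>))"
      using C(2)[OF n, of t] \<mu>_pos e0 x by (intro mult_left_mono) (auto simp: x_def)
    finally have v: "cmod (vv n t) \<le> (\<mu> * C) * (eps n * x * x powr \<alpha>)" by (simp add: mult_ac)
    also have "\<dots> \<le> B * (eps n * x * x powr \<alpha>)" using B(2) e0 x by (intro mult_right_mono) auto
    finally show "cmod (vv n t) \<le> B * (eps n * \<bar>t\<bar>) * \<bar>t\<bar> powr \<alpha>" by (simp add: x_def mult_ac)
    have "(\<mu> * C) * (eps n * x * x powr \<alpha>) \<le> B * (eps n * x * (x * (1 + x)))"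
      using B e0 x pa \<mu>_pos C(1) by (intro mult_mono) auto
    with v show "cmod (vv n t) \<le> B * eps n * (\<bar>t\<bar>\<^sup>2 * (1 + \<bar>t\<bar>))" by (simp add: x_def power2_eq_square mult_ac)
    have "cmod (vd n t) = \<mu> * eps n * cmod (Y n t + of_real t * Yd n t)"
      unfolding vd_def norm_mult using \<mu>_pos e0 by (simp only: norm_minus_cancel norm_ii norm_of_real mult_1 abs_of_pos mult_pos_pos)
    also have "\<dots> \<le> \<mu> * eps n * (C * x powr \<alpha> + x * (C * x powr (\<alpha> - 1)))"
    proof (rule mult_left_mono)
      have "cmod (of_real t * Yd n t) \<le> x * (C * x powr (\<alpha> - 1))"
        unfolding norm_mult using C(3)[OF n, of t] x by (auto simp: x_def intro!: mult_left_mono)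
      then show "cmod (Y n t + of_real t * Yd n t) \<le> C * x powr \<alpha> + x * (C * x powr (\<alpha> - 1))"
        using C(2)[OF n, of t] by (intro norm_triangle_le add_mono) (auto simp: x_def)
    qed (use \<mu>_pos e0 in auto)
    also have "\<dots> = (2 * \<mu> * C) * (eps n * x powr \<alpha>)" using xp by (simp add: algebra_simps)
    also have "\<dots> \<le> B * (eps n * (x * (1 + x)))" using B e0 x pa C(1) \<mu>_pos by (intro mult_mono) auto
    finally show "cmod (vd n t) \<le> B * eps n * (\<bar>t\<bar> * (1 + \<bar>t\<bar>))" by (simp add: x_def mult_ac)
    have "cmod (Yd n t) \<le> C * x powr (\<alpha> - 1)" using C(3)[OF n, of t] by (simp add: x_def)
    also have "\<dots> \<le> B * (1 + x)" using B C(1) pa1 x by (intro mult_mono) auto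
    finally show "cmod (Yd n t) \<le> B * (1 + \<bar>t\<bar>)" by (simp add: x_def)
  qed
qed

definition \<eta> :: "nat \<Rightarrow> real \<Rightarrow> real \<Rightarrow> nat \<Rightarrow> real" where
  "\<eta> l z B n = (let b0 = z * (B * eps n); b1 = (1 - z) * (B * eps n) + B * (real n * eps n powr \<kappa>)
     in \<bar>aa n\<bar> ^ l + (b0 + b1)\<^sup>2 + b1 + \<bar>aa n\<bar> * b0)"

lemma local_estimate:
  assumes l: "l \<ge> 1"
  obtains \<delta> B K c where "\<delta> > 0" "\<delta> \<le> 1" "B > 0" "K > 0" "c > 0"
    "\<And>n t z. \<lbrakk>n \<ge> 1; \<bar>aa n\<bar> \<le> 1; 0 \<le> z; z \<le> 1; eps n * \<bar>t\<bar> < \<delta>\<rbrakk> \<Longrightarrow>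
       cmod (ff n t - hh l n z t) \<le> K * \<eta> l z B n * t\<^sup>2 * exp (- c * \<bar>t\<bar>) \<and>
       cmod (fd n t - hd l n z t) \<le> K * \<eta> l z B n * \<bar>t\<bar> * exp (- c * \<bar>t\<bar>)"
proof -
  obtain B1 where B1: "B1 > 0"
    "\<And>n t. n \<ge> 1 \<Longrightarrow> cmod (vv n t) \<le> B1 * (eps n * \<bar>t\<bar>) * \<bar>t\<bar> powr \<alpha>"
    "\<And>n t. n \<ge> 1 \<Longrightarrow> cmod (vv n t) \<le> B1 * eps n * (\<bar>t\<bar>\<^sup>2 * (1 + \<bar>t\<bar>))"
    "\<And>n t. n \<ge> 1 \<Longrightarrow> cmod (vd n t) \<le> B1 * eps n * (\<bar>t\<bar> * (1 + \<bar>t\<bar>))"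
    "\<And>n t. n \<ge> 1 \<Longrightarrow> cmod (Yd n t) \<le> B1 * (1 + \<bar>t\<bar>)"
    by (rule correction_bounds) blast
  have ReY: "\<And>n t. n \<ge> 1 \<Longrightarrow> Re (Y n t) \<le> - (cy / r) * \<bar>t\<bar> powr \<alpha>"
    by (rule Y_bounds) blast
  obtain \<delta>1 CR where R: "0 < \<delta>1" "\<delta>1 \<le> 1" "\<delta>1 * \<mu> \<le> 1/2" "CR > 0"
    "\<And>s. \<bar>s\<bar> \<le> \<delta>1 \<Longrightarrow> cmod (RR s) \<le> CR * \<bar>s\<bar> powr \<kappa>" "\<And>s. \<bar>s\<bar> \<le> \<delta>1 \<Longrightarrow> cmod (RR' s) \<le> CR * \<bar>s\<bar> powr (\<kappa> - 1)"
    by (rule RR_bounds) blast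
  define c0 where "c0 = cy / r"
  have c0: "c0 > 0" using cy r by (simp add: c0_def)
  have c6: "c0 / 6 > 0" using c0 by simp
  obtain d1 :: real where d1: "d1 > 0" "\<And>x. 0 \<le> x \<Longrightarrow> x \<le> d1 \<Longrightarrow> \<bar>A2\<bar> * x powr (2 - \<alpha>) \<le> c0 / 6"
    using small_powr[of "2 - \<alpha>" "\<bar>A2\<bar>" "c0 / 6"] \<alpha> c6 by auto
  obtain d2 :: real where d2: "d2 > 0" "\<And>x. 0 \<le> x \<Longrightarrow> x \<le> d2 \<Longrightarrow> B1 * x powr 1 \<le> c0 / 6"
    using small_powr[of 1 B1 "c0 / 6"] B1(1) c6 by auto
  obtain d3 :: real where d3: "d3 > 0" "\<And>x. 0 \<le> x \<Longrightarrow> x \<le> d3 \<Longrightarrow> CR * x powr (\<kappa> - \<alpha>) \<le> c0 / 6"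
    using small_powr[of "\<kappa> - \<alpha>" CR "c0 / 6"] R(4) c6 \<kappa> by auto
  define \<delta> where "\<delta> = min \<delta>1 (min d1 (min d2 d3))"
  have \<delta>: "\<delta> > 0" "\<delta> \<le> \<delta>1" "\<delta> \<le> d1" "\<delta> \<le> d2" "\<delta> \<le> d3" using R(1) d1(1) d2(1) d3(1) by (auto simp: \<delta>_def)
  have \<delta>\<mu>: "\<delta> * \<mu> \<le> 1/2" using mult_right_mono[OF \<delta>(2), of \<mu>] \<mu>_pos R(3) by linarith
  define B where "B = B1 + CR"
  have B: "B > 0" "B1 \<le> B" "CR \<le> B" using B1(1) R(4) by (auto simp: B_def)
  define c where "c = c0 / 2"
  have c: "c > 0" using c0 by (simp add: c_def)
  obtain K1 :: real where K1: "K1 > 0" "\<And>x. x \<ge> 0 \<Longrightarrow> (1 + x) ^ (2 * l + 6) * exp (- c * x) \<le> K1 * exp (- (c / 2) * x)"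
    using polynomial_exp_le_exp[OF c, of "2 * l + 6"] by auto
  define K where "K = (B + 4) * exp c * K1"
  have K: "K > 0" using B K1 by (simp add: K_def)
  show thesis
  proof (rule that[of \<delta> B K "c / 2"])
    show "\<delta> > 0" "\<delta> \<le> 1" "B > 0" "K > 0" "c / 2 > 0" using \<delta> R B K c by auto
    fix n :: nat and t z :: real
    assume n: "n \<ge> 1" and a1: "\<bar>aa n\<bar> \<le> 1" and z: "0 \<le> z" "z \<le> 1" and t: "eps n * \<bar>t\<bar> < \<delta>"
    define x where "x = \<bar>t\<bar>"
    have x: "0 \<le> x" by (simp add: x_def)
    have e0: "eps n > 0" using eps n by simp
    have ex: "0 \<le> eps n * x" "eps n * x \<le> \<delta>" using e0 x t by (auto simp: x_def)
    have abx: "\<bar>eps n * t\<bar> = eps n * x" using e0 by (simp add: abs_mult x_def)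
    let ?R = "of_nat n * RR (eps n * t)" and ?R' = "of_nat n * (of_real (eps n) * RR' (eps n * t))"
    let ?v0 = "of_real z * vv n t" and ?v0' = "of_real z * vd n t"
    let ?v1 = "of_real (1 - z) * vv n t + ?R" and ?v1' = "of_real (1 - z) * vd n t + ?R'"
    define b0 where "b0 = z * (B * eps n)"
    define b1 where "b1 = (1 - z) * (B * eps n) + B * (real n * eps n powr \<kappa>)"
    have b: "0 \<le> b0" "0 \<le> b1" using z B e0 by (auto simp: b0_def b1_def)
    have Rb: "cmod ?R \<le> CR * (real n * (eps n * x) powr \<kappa>)"
    proof -
      have "cmod ?R = real n * cmod (RR (eps n * t))" by (simp add: norm_mult)
      also have "\<dots> \<le> real n * (CR * (eps n * x) powr \<kappa>)"
        using R(5)[of "eps n * t"] ex \<delta>(2) unfolding abx by (intro mult_left_mono) auto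
      finally show ?thesis by (simp only: mult.left_commute)
    qed
    have Rb1: "cmod ?R \<le> B * (real n * eps n powr \<kappa>) * (x\<^sup>2 * (1 + x))"
    proof -
      have "x powr \<kappa> \<le> x\<^sup>2 * (1 + x)" using powr_le_power_interp[OF x, of 2 \<kappa>] \<kappa> by simp
      then have "CR * (real n * (eps n powr \<kappa> * x powr \<kappa>)) \<le> B * (real n * (eps n powr \<kappa> * (x\<^sup>2 * (1 + x))))"
        using B R(4) by (intro mult_mono) auto
      then show ?thesis using Rb e0 x by (simp add: powr_mult mult.assoc)
    qed
    have Rb2: "cmod ?R' \<le> B * (real n * eps n powr \<kappa>) * (x * (1 + x))"
    proof -
      have "x powr (\<kappa> - 1) \<le> x * (1 + x)" using powr_le_power_interp[OF x, of 1 "\<kappa> - 1"] \<kappa> by simp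
      have "cmod ?R' = real n * (eps n * cmod (RR' (eps n * t)))" using e0 by (simp add: norm_mult)
      also have "\<dots> \<le> real n * (eps n * (CR * (eps n * x) powr (\<kappa> - 1)))"
        using R(6)[of "eps n * t"] ex \<delta>(2) e0 unfolding abx by (intro mult_left_mono) auto
      also have "\<dots> = CR * (real n * (eps n powr \<kappa> * x powr (\<kappa> - 1)))"
        using e0 x by (simp add: powr_mult powr_diff)
      also have "\<dots> \<le> B * (real n * (eps n powr \<kappa> * (x * (1 + x))))"
        using B R(4) \<open>x powr (\<kappa> - 1) \<le> x * (1 + x)\<close> by (intro mult_mono) auto
      finally show ?thesis by (simp add: mult.assoc)
    qed
    have vB: "cmod (vv n t) \<le> B * eps n * (x\<^sup>2 * (1 + x))" "cmod (vd n t) \<le> B * eps n * (x * (1 + x))"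
    proof -
      have "B1 * eps n * (x\<^sup>2 * (1 + x)) \<le> B * eps n * (x\<^sup>2 * (1 + x))" "B1 * eps n * (x * (1 + x)) \<le> B * eps n * (x * (1 + x))"
        using B e0 x by (auto intro!: mult_right_mono)
      with B1(3,4)[OF n, of t] show "cmod (vv n t) \<le> B * eps n * (x\<^sup>2 * (1 + x))" "cmod (vd n t) \<le> B * eps n * (x * (1 + x))"
        unfolding x_def by linarith+
    qed
    have nz: "cmod (of_real z * w) = z * cmod w" "cmod (of_real (1 - z) * w) = (1 - z) * cmod w" for w
      using z by (simp_all add: norm_mult del: of_real_diff)
    have v0: "cmod ?v0 \<le> b0 * (\<bar>t\<bar>\<^sup>2 * (1 + \<bar>t\<bar>))" "cmod ?v0' \<le> b0 * (\<bar>t\<bar> * (1 + \<bar>t\<bar>))"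
      using mult_left_mono[OF vB(1) z(1)] mult_left_mono[OF vB(2) z(1)] unfolding nz b0_def x_def by (simp_all only: mult.assoc)
    have z1: "0 \<le> 1 - z" using z by simp
    have v1: "cmod ?v1 \<le> b1 * (\<bar>t\<bar>\<^sup>2 * (1 + \<bar>t\<bar>))" "cmod ?v1' \<le> b1 * (\<bar>t\<bar> * (1 + \<bar>t\<bar>))"
    proof -
      have 1: "cmod (of_real (1 - z) * vv n t) \<le> (1 - z) * (B * eps n * (x\<^sup>2 * (1 + x)))" unfolding nz by (rule mult_left_mono[OF vB(1) z1])
      have 2: "cmod (of_real (1 - z) * vd n t) \<le> (1 - z) * (B * eps n * (x * (1 + x)))" unfolding nz by (rule mult_left_mono[OF vB(2) z1])
      show "cmod ?v1 \<le> b1 * (\<bar>t\<bar>\<^sup>2 * (1 + \<bar>t\<bar>))"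
        using norm_triangle_le[OF add_mono[OF 1 Rb1]] unfolding b1_def x_def by (simp only: distrib_right mult.assoc)
      show "cmod ?v1' \<le> b1 * (\<bar>t\<bar> * (1 + \<bar>t\<bar>))"
        using norm_triangle_le[OF add_mono[OF 2 Rb2]] unfolding b1_def x_def by (simp only: distrib_right mult.assoc)
    qed
    have Yd: "cmod (Yd n t) \<le> B * (1 + \<bar>t\<bar>)"
    proof -
      have "B1 * (1 + \<bar>t\<bar>) \<le> B * (1 + \<bar>t\<bar>)" using B by (intro mult_right_mono) auto
      with B1(5)[OF n, of t] show ?thesis by linarith
    qed
    let ?G = "exp (Re (Y n t) + (\<bar>aa n\<bar> * t\<^sup>2 + cmod ?v0 + cmod ?v1))"
    have G: "?G \<le> exp c * exp (- c * x)"
    proof -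
      have 1: "\<bar>aa n\<bar> * t\<^sup>2 \<le> c0 / 6 * x powr \<alpha>"
      proof -
        have "\<bar>aa n\<bar> * t\<^sup>2 = \<bar>A2\<bar> * (real n * (eps n * x) powr 2)"
          using ex(1) e0 x by (cases "x = 0") (auto simp: aa_def abs_mult power_mult_distrib x_def mult_ac)
        also have "real n * (eps n * x) powr 2 = (eps n * x) powr (2 - \<alpha>) * x powr \<alpha>" by (rule n_eps_powr[OF n x])
        also have "\<bar>A2\<bar> * \<dots> = \<bar>A2\<bar> * (eps n * x) powr (2 - \<alpha>) * x powr \<alpha>" by (simp only: mult.assoc)
        also have "\<dots> \<le> c0 / 6 * x powr \<alpha>" using ex \<delta>(3) by (intro mult_right_mono d1(2)) auto
        finally show ?thesis .
      qed
      have 2: "cmod (vv n t) \<le> c0 / 6 * x powr \<alpha>"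
      proof -
        have "cmod (vv n t) \<le> B1 * (eps n * x) powr 1 * x powr \<alpha>" using B1(2)[OF n, of t] ex(1) by (simp add: x_def)
        also have "\<dots> \<le> c0 / 6 * x powr \<alpha>" using ex \<delta>(4) by (intro mult_right_mono d2(2)) auto
        finally show ?thesis .
      qed
      have 3: "cmod ?R \<le> c0 / 6 * x powr \<alpha>"
      proof -
        have "cmod ?R \<le> CR * (eps n * x) powr (\<kappa> - \<alpha>) * x powr \<alpha>" using Rb unfolding n_eps_powr[OF n x] by (simp only: mult.assoc)
        also have "\<dots> \<le> c0 / 6 * x powr \<alpha>" using ex \<delta>(5) by (intro mult_right_mono d3(2)) auto
        finally show ?thesis .
      qed
      have "cmod ?v0 + cmod ?v1 \<le> z * cmod (vv n t) + ((1 - z) * cmod (vv n t) + cmod ?R)"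
        using norm_triangle_ineq[of "of_real (1 - z) * vv n t" ?R] unfolding nz by linarith
      also have "\<dots> = cmod (vv n t) + cmod ?R" by (simp add: algebra_simps)
      finally have "Re (Y n t) + (\<bar>aa n\<bar> * t\<^sup>2 + cmod ?v0 + cmod ?v1) \<le> - c0 * x powr \<alpha> + 3 * (c0 / 6 * x powr \<alpha>)"
        using 1 2 3 ReY[OF n, of t] unfolding c0_def[symmetric] x_def by linarith
      also have "\<dots> = - c * x powr \<alpha>" by (simp add: c_def)
      also have "\<dots> \<le> - c * (x - 1)" using powr_ge_minus_one[OF \<alpha>(1) x] c by (intro mult_left_mono_neg) auto
      also have "\<dots> = c + - c * x" by (simp add: algebra_simps)
      finally show ?thesis by (simp only: exp_add[symmetric] exp_le_cancel_iff)
    qed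
    have \<eta>: "\<bar>aa n\<bar> ^ l + (b0 + b1)\<^sup>2 + b1 + \<bar>aa n\<bar> * b0 = \<eta> l z B n" by (simp add: \<eta>_def b0_def b1_def Let_def)
    have \<eta>0: "0 \<le> \<eta> l z B n" unfolding \<eta>[symmetric] using b by (intro add_nonneg_nonneg) auto
    note est = exp_expansion_estimate[where t = t and a = "aa n" and Y = "Y n t" and Y' = "Yd n t",
        OF l a1 b less_imp_le[OF B(1)] Yd v0 v1, unfolded \<eta>]
    have fe: "ff n t = exp (Y n t + of_real (aa n * t\<^sup>2) + ?v0 + ?v1)"
      unfolding ff_expansion(1)[OF n \<delta>\<mu> t] by (simp add: algebra_simps)
    have fde: "fd n t = ff n t * (Yd n t + of_real (2 * aa n * t) + ?v0' + ?v1')"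
      unfolding ff_expansion(2)[OF n \<delta>\<mu> t] by (simp add: algebra_simps)
    have P: "(1 + x) ^ (2 * l + 4) \<le> (1 + x) ^ (2 * l + 6)" using x by (intro power_increasing) auto
    have PG: "(1 + x) ^ (2 * l + 6) * ?G \<le> exp c * (K1 * exp (- (c / 2) * x))"
    proof -
      have "(1 + x) ^ (2 * l + 6) * ?G \<le> (1 + x) ^ (2 * l + 6) * (exp c * exp (- c * x))" using x by (intro mult_left_mono G) auto
      also have "\<dots> = exp c * ((1 + x) ^ (2 * l + 6) * exp (- c * x))" by (simp only: mult.left_commute)
      also have "\<dots> \<le> exp c * (K1 * exp (- (c / 2) * x))" by (intro mult_left_mono K1(2) x) auto
      finally show ?thesis .
    qed
    have "cmod (ff n t - hh l n z t) \<le> \<eta> l z B n * x\<^sup>2 * (1 + x) ^ (2 * l + 4) * ?G"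
      using est(1) unfolding fe[symmetric] hh_def EE_def x_def by simp
    also have "\<dots> \<le> \<eta> l z B n * x\<^sup>2 * ((1 + x) ^ (2 * l + 6) * ?G)"
      unfolding mult.assoc using \<eta>0 x P by (intro mult_left_mono mult_right_mono) auto
    also have "\<dots> \<le> \<eta> l z B n * x\<^sup>2 * (exp c * (K1 * exp (- (c / 2) * x)))"
      using \<eta>0 x by (intro mult_left_mono PG) auto
    also have "\<dots> = (1 * exp c * K1) * \<eta> l z B n * x\<^sup>2 * exp (- (c / 2) * x)" by (simp only: mult_ac mult_1)
    also have "\<dots> \<le> K * \<eta> l z B n * x\<^sup>2 * exp (- (c / 2) * x)"
      unfolding K_def using \<eta>0 x K1(1) B by (intro mult_right_mono) auto
    finally have 1: "cmod (ff n t - hh l n z t) \<le> K * \<eta> l z B n * t\<^sup>2 * exp (- (c / 2) * \<bar>t\<bar>)" by (simp add: x_def)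
    have "cmod (fd n t - hd l n z t) \<le> (B + 3) * \<eta> l z B n * x * (1 + x) ^ (2 * l + 6) * ?G"
      using est(2) unfolding fe[symmetric] fde[symmetric] hd_def hh_def EE_def x_def by simp
    also have "\<dots> = (B + 3) * \<eta> l z B n * x * ((1 + x) ^ (2 * l + 6) * ?G)" by (simp only: mult.assoc)
    also have "\<dots> \<le> (B + 3) * \<eta> l z B n * x * (exp c * (K1 * exp (- (c / 2) * x)))"
      using \<eta>0 x B by (intro mult_left_mono PG) auto
    also have "\<dots> = ((B + 3) * exp c * K1) * \<eta> l z B n * x * exp (- (c / 2) * x)" by (simp only: mult_ac)
    also have "\<dots> \<le> K * \<eta> l z B n * x * exp (- (c / 2) * x)"
      unfolding K_def using \<eta>0 x K1(1) B by (intro mult_right_mono) auto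
    finally have 2: "cmod (fd n t - hd l n z t) \<le> K * \<eta> l z B n * \<bar>t\<bar> * exp (- (c / 2) * \<bar>t\<bar>)" by (simp add: x_def)
    show "cmod (ff n t - hh l n z t) \<le> K * \<eta> l z B n * t\<^sup>2 * exp (- (c / 2) * \<bar>t\<bar>) \<and>
       cmod (fd n t - hd l n z t) \<le> K * \<eta> l z B n * \<bar>t\<bar> * exp (- (c / 2) * \<bar>t\<bar>)" using 1 2 by blast
  qed
qed

lemma approximant_decay:
  obtains K c where "K > 0" "c > 0"
    "\<And>n t z. \<lbrakk>n \<ge> 1; \<bar>aa n\<bar> \<le> 1; 0 \<le> z; z \<le> 1\<rbrakk> \<Longrightarrow>
       cmod (hh l n z t) \<le> K * exp (- c * \<bar>t\<bar>) \<and> cmod (hd l n z t) \<le> K * exp (- c * \<bar>t\<bar>)"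
proof -
  obtain B where B: "B > 0"
    "\<And>n t. n \<ge> 1 \<Longrightarrow> cmod (vv n t) \<le> B * (eps n * \<bar>t\<bar>) * \<bar>t\<bar> powr \<alpha>"
    "\<And>n t. n \<ge> 1 \<Longrightarrow> cmod (vv n t) \<le> B * eps n * (\<bar>t\<bar>\<^sup>2 * (1 + \<bar>t\<bar>))"
    "\<And>n t. n \<ge> 1 \<Longrightarrow> cmod (vd n t) \<le> B * eps n * (\<bar>t\<bar> * (1 + \<bar>t\<bar>))"
    "\<And>n t. n \<ge> 1 \<Longrightarrow> cmod (Yd n t) \<le> B * (1 + \<bar>t\<bar>)"
    by (rule correction_bounds) blast
  have ReY: "\<And>n t. n \<ge> 1 \<Longrightarrow> Re (Y n t) \<le> - (cy / r) * \<bar>t\<bar> powr \<alpha>"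
    by (rule Y_bounds) blast
  define c where "c = cy / r"
  have c: "c > 0" using cy r by (simp add: c_def)
  define m where "m = 2 * l + 4"
  define L where "L = real l + 1 + B"
  have L: "L \<ge> 1" "B \<le> L" using B(1) by (auto simp: L_def)
  obtain K1 :: real where K1: "K1 > 0" "\<And>x. x \<ge> 0 \<Longrightarrow> (1 + x) ^ (m + 1) * exp (- c * x) \<le> K1 * exp (- (c / 2) * x)"
    using polynomial_exp_le_exp[OF c, of "m + 1"] by auto
  define K where "K = (B * (L + B) + 2 * L + B + L + B) * exp c * K1"
  have K: "K > 0" unfolding K_def using B L K1(1) by (intro mult_pos_pos add_pos_pos) auto
  show thesis
  proof (rule that[of K "c / 2"])
    show "K > 0" "c / 2 > 0" using K c by auto
    fix n :: nat and t z :: real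
    assume n: "n \<ge> 1" and a1: "\<bar>aa n\<bar> \<le> 1" and z: "0 \<le> z" "z \<le> 1"
    define x where "x = \<bar>t\<bar>"
    have x: "0 \<le> x" by (simp add: x_def)
    have e0: "eps n > 0" "eps n \<le> 1" using eps n by auto
    have EEb: "cmod (EE k n t) \<le> L * (1 + x) ^ (2 * l)" if k: "k \<le> l" for k
    proof -
      have "cmod (EE k n t) \<le> (\<Sum>j<k. (1 + x) ^ (2 * l))" unfolding EE_def
      proof (rule sum_norm_le)
        fix j assume j: "j \<in> {..<k}"
        have "\<bar>aa n * t\<^sup>2\<bar> \<le> 1 * x\<^sup>2" unfolding abs_mult using a1 by (intro mult_mono) (auto simp: x_def)
        also have "\<dots> \<le> (1 + x)\<^sup>2" using x by (simp add: power_mono)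
        finally have "\<bar>aa n * t\<^sup>2\<bar> ^ j \<le> ((1 + x)\<^sup>2) ^ j" by (rule power_mono) simp
        also have "\<dots> = (1 + x) ^ (2 * j)" by (simp only: power_mult)
        also have "\<dots> \<le> (1 + x) ^ (2 * l)" using j k x by (intro power_increasing) auto
        finally have 1: "\<bar>aa n * t\<^sup>2\<bar> ^ j \<le> (1 + x) ^ (2 * l)" .
        have "cmod (of_real (aa n * t\<^sup>2) ^ j / fact j) = \<bar>aa n * t\<^sup>2\<bar> ^ j / fact j"
          unfolding norm_divide norm_power norm_of_real by simp
        also have "\<dots> \<le> \<bar>aa n * t\<^sup>2\<bar> ^ j / 1" by (intro divide_left_mono) auto
        finally show "cmod (of_real (aa n * t\<^sup>2) ^ j / fact j) \<le> (1 + x) ^ (2 * l)" using 1 by simp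
      qed
      also have "\<dots> = real k * (1 + x) ^ (2 * l)" by simp
      also have "\<dots> \<le> L * (1 + x) ^ (2 * l)" using k B(1) x by (intro mult_right_mono) (auto simp: L_def)
      finally show ?thesis .
    qed
    have pm: "(1 + x) ^ (2 * l) \<le> (1 + x) ^ m" using x by (intro power_increasing) (auto simp: m_def)
    have pm1: "(1 + x) ^ m \<le> (1 + x) ^ (m + 1)" using x by (intro power_increasing) auto
    have x2: "x\<^sup>2 * (1 + x) \<le> (1 + x) ^ m" "x * (1 + x) \<le> (1 + x) ^ m" "x * (1 + x) ^ (2 * l) \<le> (1 + x) ^ m"
      using power_prod_le[OF x, of 2 1 m] power_prod_le[OF x, of 1 1 m] power_prod_le[OF x, of 1 "2 * l" m] by (auto simp: m_def)
    have be: "B * eps n \<le> B" using e0 B(1) by simp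
    have vvb: "cmod (of_real z * vv n t) \<le> B * (1 + x) ^ m"
    proof -
      have "cmod (of_real z * vv n t) \<le> 1 * (B * eps n * (x\<^sup>2 * (1 + x)))"
        unfolding norm_mult using z B(3)[OF n, of t] by (intro mult_mono) (auto simp: x_def)
      also have "\<dots> \<le> B * (1 + x) ^ m" unfolding mult_1 using be x2(1) x B(1) by (intro mult_mono) auto
      finally show ?thesis .
    qed
    have vdb: "cmod (of_real z * vd n t) \<le> B * (1 + x) ^ m"
    proof -
      have "cmod (of_real z * vd n t) \<le> 1 * (B * eps n * (x * (1 + x)))"
        unfolding norm_mult using z B(4)[OF n, of t] by (intro mult_mono) (auto simp: x_def)
      also have "\<dots> \<le> B * (1 + x) ^ m" unfolding mult_1 using be x2(2) x B(1) by (intro mult_mono) auto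
      finally show ?thesis .
    qed
    have eY: "cmod (exp (Y n t)) \<le> exp c * exp (- c * x)"
    proof -
      have "Re (Y n t) \<le> - c * x powr \<alpha>" using ReY[OF n, of t] by (simp add: c_def x_def)
      also have "\<dots> \<le> - c * (x - 1)" using powr_ge_minus_one[OF \<alpha>(1) x] c by (intro mult_left_mono_neg) auto
      also have "\<dots> = c + - c * x" by (simp add: algebra_simps)
      finally show ?thesis by (simp only: norm_exp_eq_Re exp_add[symmetric] exp_le_cancel_iff)
    qed
    have EEl: "cmod (EE l n t) \<le> L * (1 + x) ^ m" 
    proof -
      have "L * (1 + x) ^ (2 * l) \<le> L * (1 + x) ^ m" using L pm by (intro mult_left_mono) auto
      with EEb[of l] show ?thesis by simp
    qed
    have hhb: "cmod (hh l n z t) \<le> (L + B) * (1 + x) ^ m * (exp c * exp (- c * x))"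
    proof -
      have "cmod (EE l n t + of_real z * vv n t) \<le> (L + B) * (1 + x) ^ m"
        using norm_triangle_le[OF add_mono[OF EEl vvb]] by (simp only: distrib_right)
      then show ?thesis unfolding hh_def norm_mult[of "EE l n t + _"] using eY L B(1) x by (intro mult_mono) auto
    qed
    have e2: "cmod (of_real (2 * aa n * t) * EE (l - 1) n t) \<le> 2 * L * (1 + x) ^ m"
    proof -
      have "cmod (complex_of_real (2 * aa n * t)) \<le> 2 * x"
        using mult_right_mono[OF a1, of x] x unfolding norm_of_real by (simp add: abs_mult x_def)
      then have "cmod (of_real (2 * aa n * t) * EE (l - 1) n t) \<le> (2 * x) * (L * (1 + x) ^ (2 * l))"
        unfolding norm_mult[of "complex_of_real (2 * aa n * t)"] using EEb[of "l - 1"] x by (intro mult_mono) auto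
      also have "\<dots> = 2 * L * (x * (1 + x) ^ (2 * l))" by simp
      also have "\<dots> \<le> 2 * L * (1 + x) ^ m" using x2(3) L by (intro mult_left_mono) auto
      finally show ?thesis .
    qed
    have hdb: "cmod (hd l n z t) \<le> (B * (L + B) + 2 * L + B) * (1 + x) ^ (m + 1) * (exp c * exp (- c * x))"
    proof -
      have 1: "cmod (Yd n t * hh l n z t) \<le> (B * (1 + x)) * ((L + B) * (1 + x) ^ m * (exp c * exp (- c * x)))"
        unfolding norm_mult using B(5)[OF n, of t] hhb B(1) x by (intro mult_mono) (auto simp: x_def)
      have 2: "cmod ((of_real (2 * aa n * t) * EE (l - 1) n t + of_real z * vd n t) * exp (Y n t)) \<le> ((2 * L + B) * (1 + x) ^ (m + 1)) * (exp c * exp (- c * x))"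
      proof -
        have "cmod (of_real (2 * aa n * t) * EE (l - 1) n t + of_real z * vd n t) \<le> (2 * L + B) * (1 + x) ^ m"
          using norm_triangle_le[OF add_mono[OF e2 vdb]] by (simp only: distrib_right)
        also have "\<dots> \<le> (2 * L + B) * (1 + x) ^ (m + 1)" using pm1 L B(1) by (intro mult_left_mono) auto
        finally show ?thesis unfolding norm_mult[of "of_real (2 * aa n * t) * EE (l - 1) n t + _"]
          using eY L B(1) x by (intro mult_mono) auto
      qed
      have "cmod (hd l n z t) \<le> (B * (1 + x)) * ((L + B) * (1 + x) ^ m * (exp c * exp (- c * x))) + ((2 * L + B) * (1 + x) ^ (m + 1)) * (exp c * exp (- c * x))"
        unfolding hd_def by (rule norm_triangle_le[OF add_mono[OF 1 2]])
      also have "\<dots> = (B * (L + B) + 2 * L + B) * (1 + x) ^ (m + 1) * (exp c * exp (- c * x))"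
        by (simp add: algebra_simps)
      finally show ?thesis .
    qed
    have fin: "D * (1 + x) ^ (m + 1) * (exp c * exp (- c * x)) \<le> K * exp (- (c / 2) * x)" if D: "0 \<le> D" "D \<le> B * (L + B) + 2 * L + B + L + B" for D
    proof -
      have "D * (1 + x) ^ (m + 1) * (exp c * exp (- c * x)) = D * exp c * ((1 + x) ^ (m + 1) * exp (- c * x))" by (simp only: mult_ac)
      also have "\<dots> \<le> D * exp c * (K1 * exp (- (c / 2) * x))" using D(1) by (intro mult_left_mono K1(2) x) auto
      also have "\<dots> = (D * exp c * K1) * exp (- (c / 2) * x)" by (simp only: mult.assoc)
      also have "\<dots> \<le> K * exp (- (c / 2) * x)" unfolding K_def using D(2) K1(1) by (intro mult_right_mono) auto
      finally show ?thesis .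
    qed
    have "cmod (hh l n z t) \<le> (L + B) * (1 + x) ^ (m + 1) * (exp c * exp (- c * x))"
    proof -
      have "(L + B) * (1 + x) ^ m * (exp c * exp (- c * x)) \<le> (L + B) * (1 + x) ^ (m + 1) * (exp c * exp (- c * x))"
        using pm1 L B(1) by (intro mult_right_mono mult_left_mono) auto
      with hhb show ?thesis by linarith
    qed
    also have "\<dots> \<le> K * exp (- (c / 2) * x)" using L B(1) by (intro fin) auto
    finally have A: "cmod (hh l n z t) \<le> K * exp (- (c / 2) * x)" .
    have "(B * (L + B) + 2 * L + B) * (1 + x) ^ (m + 1) * (exp c * exp (- c * x)) \<le> K * exp (- (c / 2) * x)"
      using L B(1) by (intro fin) auto
    with hdb A show "cmod (hh l n z t) \<le> K * exp (- (c / 2) * \<bar>t\<bar>) \<and> cmod (hd l n z t) \<le> K * exp (- (c / 2) * \<bar>t\<bar>)"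
      unfolding x_def by linarith
  qed
qed

end

section \<open>Rates of convergence\<close>

lemma primitive_has_derivative:
  fixes g :: "real \<Rightarrow> real"
  assumes g: "integrable lborel g" and c: "continuous_on UNIV g"
  shows "(primitive g has_real_derivative g x) (at x)"
proof -
  define a where "a = x - 1"
  define c0 where "c0 = (\<integral>u. indicator {..<a} u * g u \<partial>lborel)"
  have eq: "primitive g y = c0 + integral {a..y} g" if "a \<le> y" for y
  proof -
    have i: "integrable lborel (\<lambda>u. indicator A u * g u)" if "A \<in> sets borel" for A
      using integrable_mult_indicator[OF _ g, of A] that by simp
    have "primitive g y = (\<integral>u. indicator {..<a} u * g u + indicator {a..y} u * g u \<partial>lborel)"
      unfolding primitive_def using that by (intro Bochner_Integration.integral_cong refl) (auto simp: indicator_def)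
    also have "\<dots> = c0 + (\<integral>u. indicator {a..y} u * g u \<partial>lborel)"
      unfolding c0_def by (rule Bochner_Integration.integral_add) (auto intro!: i)
    also have "(\<integral>u. indicator {a..y} u * g u \<partial>lborel) = integral {a..y} g"
      using set_borel_integral_eq_integral(2)[of "{a..y}" g] i[of "{a..y}"]
      unfolding set_lebesgue_integral_def set_integrable_def real_scaleR_def by simp
    finally show ?thesis .
  qed
  have ca: "continuous_on {a..x + 1} g" by (rule continuous_on_subset[OF c]) simp
  have xa: "x \<in> {a..x + 1}" and xi: "x \<in> interior {a..x + 1}" by (simp_all add: a_def)
  have "((\<lambda>y. integral {a..y} g) has_real_derivative g x) (at x within {a..x + 1})"
    by (rule integral_has_real_derivative[OF ca xa])
  then have "((\<lambda>y. integral {a..y} g) has_real_derivative g x) (at x)"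
    unfolding at_within_interior[OF xi] .
  from DERIV_add[OF DERIV_const[of c0] this] have "((\<lambda>y. c0 + integral {a..y} g) has_real_derivative g x) (at x)"
    by (simp only: add_0)
  then show ?thesis
  proof (rule has_field_derivative_transform_within)
    show "(0::real) < 1" by simp
    fix y assume "dist y x < 1"
    then have "a \<le> y" unfolding a_def dist_real_def by linarith
    then show "c0 + integral {a..y} g = primitive g y" by (rule eq[symmetric])
  qed (rule UNIV_I)
qed

lemma cdf_minus_primitive_transform:
  fixes N :: "real measure" and g :: "real \<Rightarrow> real"
  assumes N: "finite_measure N" and sets: "sets N = sets borel" and first: "integrable N (\<lambda>u. u)"
    and g: "integrable lborel g" "integrable lborel (\<lambda>x. (1 + \<bar>x\<bar>) * \<bar>g x\<bar>)"
    and h: "\<And>t. (\<integral>x. iexp (t * x) * of_real (g x) \<partial>lborel) = h t" "h 0 = char N 0"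
  defines "D \<equiv> \<lambda>x. measure N {..x} - primitive g x"
  shows "integrable lborel D"
    and "t \<noteq> 0 \<Longrightarrow> (\<integral>x. iexp (t * x) * of_real (D x) \<partial>lborel) = - (char N t - h t) / (\<i> * t)"
    and "\<exists>B. \<forall>x. (1 + \<bar>x\<bar>) * \<bar>D x\<bar> \<le> B"
proof -
  have [measurable]: "g \<in> borel_measurable borel" using g by simp
  have i: "integrable lborel (\<lambda>x. max 0 (g x))" "integrable lborel (\<lambda>x. max 0 (- g x))" using g by auto
  define K1 where "K1 = density lborel (\<lambda>x. max 0 (g x))"
  define K2 where "K2 = density lborel (\<lambda>x. max 0 (- g x))"
  note K1 = density_measure_facts[OF i(1) max.cobounded1, folded K1_def] and K2 = density_measure_facts[OF i(2) max.cobounded1, folded K2_def]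
  note parts = density_parts[OF g(1), folded K1_def K2_def]
  have fm: "integrable lborel (\<lambda>x. max 0 (s * g x) * x)" if "s = 1 \<or> s = -1" for s :: real
  proof (rule Bochner_Integration.integrable_bound[OF g(2)])
    show "AE x in lborel. norm (max 0 (s * g x) * x) \<le> norm ((1 + \<bar>x\<bar>) * \<bar>g x\<bar>)"
    proof (rule AE_I2)
      fix x :: real
      have "\<bar>max 0 (s * g x)\<bar> * \<bar>x\<bar> \<le> \<bar>g x\<bar> * (1 + \<bar>x\<bar>)" using that by (intro mult_mono) auto
      then show "norm (max 0 (s * g x) * x) \<le> norm ((1 + \<bar>x\<bar>) * \<bar>g x\<bar>)" by (simp add: abs_mult mult.commute)
    qed
  qed simp
  have first1: "integrable K1 (\<lambda>u. u)" unfolding K1_def using fm[of 1] by (subst integrable_density) auto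
  have first2: "integrable K2 (\<lambda>u. u)" unfolding K2_def using fm[of "-1"] by (subst integrable_density) auto
  note tN = centred_cdf_transform[OF N sets first] and t1 = centred_cdf_transform[OF K1(1,2) first1] and t2 = centred_cdf_transform[OF K2(1,2) first2]
  define JN where "JN x = measure N {..x} - measure N UNIV * indicator {0..} x" for x
  define J1 where "J1 x = measure K1 {..x} - measure K1 UNIV * indicator {0..} x" for x
  define J2 where "J2 x = measure K2 {..x} - measure K2 UNIV * indicator {0..} x" for x
  note tN = tN[folded JN_def] and t1 = t1[folded J1_def] and t2 = t2[folded J2_def]
  have sp: "space N = UNIV" "space K1 = UNIV" "space K2 = UNIV"
    using sets_eq_imp_space_eq[OF sets] sets_eq_imp_space_eq[OF K1(2)] sets_eq_imp_space_eq[OF K2(2)] by auto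
  have "complex_of_real (measure K1 UNIV - measure K2 UNIV) = of_real (measure N UNIV)"
    using parts(1)[of 0] h(1)[of 0] h(2) by (simp add: char_at_zero sp)
  then have mass: "measure K1 UNIV - measure K2 UNIV = measure N UNIV" by (simp only: of_real_eq_iff)
  have De: "D x = JN x - (J1 x - J2 x)" for x
    unfolding D_def JN_def J1_def J2_def parts(2)[symmetric] mass[symmetric] by (simp add: algebra_simps)
  show iD: "integrable lborel D" unfolding De[abs_def] using tN(1) t1(1) t2(1) by (intro Bochner_Integration.integrable_diff)
  show "(\<integral>x. iexp (t * x) * of_real (D x) \<partial>lborel) = - (char N t - h t) / (\<i> * t)" if t: "t \<noteq> 0"
  proof -
    have int: "integrable lborel (\<lambda>x. iexp (t * x) * complex_of_real (f x))" if "integrable lborel f" for f :: "real \<Rightarrow> real"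
      by (rule Bochner_Integration.integrable_bound[OF that]) (use that in auto)
    have "(\<integral>x. iexp (t * x) * of_real (D x) \<partial>lborel) =
        (\<integral>x. iexp (t * x) * of_real (JN x) - (iexp (t * x) * of_real (J1 x) - iexp (t * x) * of_real (J2 x)) \<partial>lborel)"
      unfolding De by (intro Bochner_Integration.integral_cong refl) (simp add: algebra_simps)
    also have "\<dots> = (\<integral>x. iexp (t * x) * of_real (JN x) \<partial>lborel) - ((\<integral>x. iexp (t * x) * of_real (J1 x) \<partial>lborel) - (\<integral>x. iexp (t * x) * of_real (J2 x) \<partial>lborel))"
      using int[OF tN(1)] int[OF t1(1)] int[OF t2(1)]
      by (simp only: Bochner_Integration.integral_diff Bochner_Integration.integrable_diff)
    also have "\<dots> = - (char N t - char N 0) / (\<i> * t) - (- (char K1 t - char K1 0) / (\<i> * t) - - (char K2 t - char K2 0) / (\<i> * t))"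
      by (simp only: tN(2)[OF t] t1(2)[OF t] t2(2)[OF t])
    also have "\<dots> = - (char N t - char N 0 - ((char K1 t - char K2 t) - (char K1 0 - char K2 0))) / (\<i> * t)"
    proof -
      have "- u / c - (- (v - v') / c - - (w - w') / c) = - (u - ((v - w) - (v' - w'))) / c" for u v v' w w' c :: complex
        by (simp add: diff_divide_distrib)
      then show ?thesis .
    qed
    also have "(char N t - char N 0 - ((char K1 t - char K2 t) - (char K1 0 - char K2 0))) = char N t - h t"
      unfolding parts(1) h(1) h(2) by simp
    finally show ?thesis .
  qed
  show "\<exists>B. \<forall>x. (1 + \<bar>x\<bar>) * \<bar>D x\<bar> \<le> B"
  proof (intro exI allI)
    fix x
    have "\<bar>D x\<bar> \<le> \<bar>JN x\<bar> + (\<bar>J1 x\<bar> + \<bar>J2 x\<bar>)" unfolding De by linarith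
    then have "(1 + \<bar>x\<bar>) * \<bar>D x\<bar> \<le> (1 + \<bar>x\<bar>) * (\<bar>JN x\<bar> + (\<bar>J1 x\<bar> + \<bar>J2 x\<bar>))" by (intro mult_left_mono) auto
    also have "\<dots> = (1 + \<bar>x\<bar>) * \<bar>JN x\<bar> + ((1 + \<bar>x\<bar>) * \<bar>J1 x\<bar> + (1 + \<bar>x\<bar>) * \<bar>J2 x\<bar>)" by (simp only: distrib_left)
    also have "\<dots> \<le> (measure N UNIV + (\<integral>u. \<bar>u\<bar> \<partial>N)) + ((measure K1 UNIV + (\<integral>u. \<bar>u\<bar> \<partial>K1)) + (measure K2 UNIV + (\<integral>u. \<bar>u\<bar> \<partial>K2)))"
      by (intro add_mono tN(3) t1(3) t2(3))
    finally show "(1 + \<bar>x\<bar>) * \<bar>D x\<bar> \<le> (measure N UNIV + (\<integral>u. \<bar>u\<bar> \<partial>N)) + ((measure K1 UNIV + (\<integral>u. \<bar>u\<bar> \<partial>K1)) + (measure K2 UNIV + (\<integral>u. \<bar>u\<bar> \<partial>K2)))" .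
  qed
qed

lemma integer_multiples_of_powers:
  fixes \<rho> :: real and d :: "nat \<Rightarrow> int"
  assumes \<rho>: "\<rho> > 0" and d0: "d 0 \<noteq> 0" and d: "\<And>j. of_int (d j) = \<rho> ^ j * of_int (d 0)"
  shows "\<rho> \<in> \<nat>"
proof -
  have "\<rho> = of_int (d 1) / of_int (d 0)" using d[of 1] d0 by simp
  then have "\<rho> \<in> \<rat>" by simp
  then obtain u v :: nat where uv: "v \<noteq> 0" "\<bar>\<rho>\<bar> = real u / real v" "coprime u v" by (rule Rats_abs_nat_div_natE)
  define D where "D j = nat \<bar>d j\<bar>" for j
  have D: "real (D j) = \<rho> ^ j * real (D 0)" for j
  proof -
    have "real (D i) = \<bar>of_int (d i)\<bar>" for i by (simp add: D_def)
    then show ?thesis using d[of j] \<rho> by (simp add: abs_mult)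
  qed
  have dv: "v ^ j dvd D 0" for j
  proof -
    have "real (D j * v ^ j) = real (u ^ j * D 0)" using D[of j] uv \<rho> by (simp add: power_divide)
    then have "D j * v ^ j = u ^ j * D 0" by (simp only: of_nat_eq_iff)
    then have "v ^ j dvd u ^ j * D 0" using dvd_triv_right[of "v ^ j" "D j"] by (simp only:)
    moreover have "coprime (v ^ j) (u ^ j)" using uv(3) by (simp add: coprime_commute)
    ultimately show ?thesis by (simp add: coprime_dvd_mult_right_iff)
  qed
  have D0: "D 0 > 0" using d0 by (simp add: D_def)
  have "v = 1"
  proof (rule ccontr)
    assume "v \<noteq> 1"
    then have "2 \<le> v" using uv(1) by simp
    then have "2 ^ D 0 \<le> v ^ D 0" by (rule power_mono) simp
    also have "\<dots> \<le> D 0" using dv D0 by (rule dvd_imp_le)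
    finally show False using less_exp[of "D 0"] by simp
  qed
  with uv(2) \<rho> have "\<rho> = real u" by simp
  then show ?thesis by simp
qed

context petersburg
begin

lemma norm_\<phi>_less_1:
  assumes nl: "\<rho> \<notin> \<nat>" and s: "s \<noteq> 0"
  shows "cmod (\<phi> s) < 1"
proof (rule ccontr)
  assume "\<not> cmod (\<phi> s) < 1"
  then have m1: "cmod (\<phi> s) = 1" using \<phi>_series(5)[of s] by linarith
  define a where "a = Arg (\<phi> s)"
  have a: "\<phi> s = iexp a" using Arg_eq[of "\<phi> s"] norm_eq_zero[of "\<phi> s"] unfolding m1 a_def by simp
  define f where "f j = (1 - cos (s * \<rho> ^ (j + 1) - a)) * (p * q ^ j)" for j
  have f0: "0 \<le> f j" for j using p q by (auto simp: f_def)
  have "(\<lambda>j. iexp (- a) * (iexp (s * \<rho> ^ (j + 1)) * of_real (p * q ^ j))) sums (iexp (- a) * \<phi> s)"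
    unfolding \<phi>_def by (intro sums_mult summable_sums \<phi>_series(1))
  also have "iexp (- a) * \<phi> s = 1" unfolding a by (simp add: exp_add[symmetric])
  finally have "(\<lambda>j. Re (iexp (- a) * (iexp (s * \<rho> ^ (j + 1)) * of_real (p * q ^ j)))) sums Re 1" by (rule sums_Re)
  moreover have "Re (iexp (- a) * (iexp (s * \<rho> ^ (j + 1)) * of_real (p * q ^ j))) = cos (s * \<rho> ^ (j + 1) - a) * (p * q ^ j)" for j
  proof -
    have "- a + s * \<rho> ^ (j + 1) = s * \<rho> ^ (j + 1) - a" by simp
    moreover have "iexp (- a) * (iexp (s * \<rho> ^ (j + 1)) * of_real (p * q ^ j)) = iexp (- a + s * \<rho> ^ (j + 1)) * of_real (p * q ^ j)"
      unfolding mult.assoc[symmetric] exp_add[symmetric] of_real_add distrib_left ..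
    moreover have "Re (iexp x * of_real y) = cos x * y" for x y by (simp add: Re_exp)
    ultimately show ?thesis by (simp only:)
  qed
  ultimately have "(\<lambda>j. cos (s * \<rho> ^ (j + 1) - a) * (p * q ^ j)) sums 1" by (simp only: one_complex.sel)
  from sums_diff[OF sums_weights this] have fs: "f sums 0"
    by (simp only: f_def[abs_def] left_diff_distrib mult_1 diff_self)
  have fz: "f j = 0" for j
    using suminf_eq_zero_iff[OF sums_summable[OF fs] f0] sums_unique[OF fs] by simp
  have ex: "\<exists>m::int. s * \<rho> ^ (j + 1) - a = of_int m * (2 * pi)" for j
  proof -
    have "p * q ^ j \<noteq> 0" using p q by simp
    then have "cos (s * \<rho> ^ (j + 1) - a) = 1" using fz[of j] by (simp only: f_def mult_eq_0_iff) simp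
    then show ?thesis unfolding cos_one_2pi_int by (simp only: mult.assoc)
  qed
  define m where "m j = (SOME m::int. s * \<rho> ^ (j + 1) - a = of_int m * (2 * pi))" for j
  have m: "s * \<rho> ^ (j + 1) - a = of_int (m j) * (2 * pi)" for j unfolding m_def by (rule someI_ex[OF ex])
  define d where "d j = m (j + 1) - m j" for j
  have d: "of_int (d j) * (2 * pi) = s * \<rho> ^ (j + 1) * (\<rho> - 1)" for j
  proof -
    have "of_int (d j) * (2 * pi) = (s * \<rho> ^ (j + 1 + 1) - a) - (s * \<rho> ^ (j + 1) - a)"
      unfolding m d_def by (simp add: algebra_simps)
    then show ?thesis by (simp add: algebra_simps)
  qed
  have dj: "of_int (d j) = \<rho> ^ j * of_int (d 0)" for j
  proof -
    have "of_int (d j) * (2 * pi) = \<rho> ^ j * of_int (d 0) * (2 * pi)"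
      unfolding d mult.assoc using d[of 0] by (simp add: algebra_simps)
    then show ?thesis by simp
  qed
  have "of_int (d 0) * (2 * pi) \<noteq> 0" unfolding d using s \<rho> by simp
  then have "d 0 \<noteq> 0" by auto
  from integer_multiples_of_powers[OF _ this dj] have "\<rho> \<in> \<nat>" using \<rho> by linarith
  with nl show False ..
qed

lemma norm_\<phi>_uniformly_less_1:
  assumes nl: "\<rho> \<notin> \<nat>" and \<delta>: "0 < \<delta>"
  obtains \<theta> where "0 < \<theta>" "\<theta> < 1" "\<And>s. \<delta> \<le> \<bar>s\<bar> \<Longrightarrow> \<bar>s\<bar> \<le> K0 \<Longrightarrow> cmod (\<phi> s) \<le> \<theta>"
proof -
  have even: "cmod (\<phi> \<bar>s\<bar>) = cmod (\<phi> s)" for s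
  proof (cases "s \<ge> 0")
    case False
    show ?thesis unfolding abs_of_neg[OF False[unfolded not_le]] \<phi>_minus by (rule complex_mod_cnj)
  qed simp
  have cphi: "continuous_on {\<delta>..K0} (\<lambda>s. cmod (\<phi> s))"
    using continuous_on_subset[OF continuous_Y(3)[of 1]] by (intro continuous_on_norm) simp
  show thesis
  proof (cases "\<delta> \<le> K0")
    case True
    then have "{\<delta>..K0} \<noteq> {}" by simp
    from continuous_attains_sup[OF compact_Icc this cphi]
    obtain s0 where s0: "s0 \<in> {\<delta>..K0}" "\<And>s. s \<in> {\<delta>..K0} \<Longrightarrow> cmod (\<phi> s) \<le> cmod (\<phi> s0)"
      by blast
    have "cmod (\<phi> s0) < 1" using s0(1) \<delta> by (intro norm_\<phi>_less_1 nl) auto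
    show ?thesis
    proof (rule that[of "max (1/2) (cmod (\<phi> s0))"])
      show "0 < max (1/2) (cmod (\<phi> s0))" "max (1/2) (cmod (\<phi> s0)) < 1" using \<open>cmod (\<phi> s0) < 1\<close> by auto
      fix s :: real assume "\<delta> \<le> \<bar>s\<bar>" "\<bar>s\<bar> \<le> K0"
      then have "cmod (\<phi> \<bar>s\<bar>) \<le> cmod (\<phi> s0)" by (intro s0(2)) simp
      then show "cmod (\<phi> s) \<le> max (1/2) (cmod (\<phi> s0))" unfolding even by simp
    qed
  next
    case False
    show ?thesis
    proof (rule that[of "1/2"])
      fix s :: real assume "\<delta> \<le> \<bar>s\<bar>" "\<bar>s\<bar> \<le> K0"
      with False have False by linarith
      then show "cmod (\<phi> s) \<le> 1/2" ..
    qed simp_all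
  qed
qed

lemma density_bound:
  assumes l: "l \<ge> 1"
  obtains m where "m > 0"
    "\<And>n z x. \<lbrakk>n \<ge> 1; \<bar>aa n\<bar> \<le> 1; 0 \<le> z; z \<le> 1\<rbrakk> \<Longrightarrow> (1 + \<bar>x\<bar>) * \<bar>dens (hh l n z) x\<bar> \<le> m"
proof -
  obtain K c where K: "K > 0" and c: "c > 0" and
    bd: "\<And>n t z. \<lbrakk>n \<ge> 1; \<bar>aa n\<bar> \<le> 1; 0 \<le> z; z \<le> 1\<rbrakk> \<Longrightarrow>
       cmod (hh l n z t) \<le> K * exp (- c * \<bar>t\<bar>) \<and> cmod (hd l n z t) \<le> K * exp (- c * \<bar>t\<bar>)"
    by (rule approximant_decay) blast
  obtain C where C: "C > 0" "\<And>x. exp (- c * \<bar>x\<bar>) \<le> C / (1 + x\<^sup>2)"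
    using exp_le_inv_square[OF c] by blast
  define I where "I = (\<integral>x. K * C * (1 / (1 + x\<^sup>2)) \<partial>lborel)"
  have I0: "I \<ge> 0" unfolding I_def using K C(1) by (intro integral_nonneg_AE AE_I2) auto
  have iI: "integrable lborel (\<lambda>x::real. K * C * (1 / (1 + x\<^sup>2)))"
    by (rule integrable_mult_right) (rule integrable_inverse_one_plus_square)
  show thesis
  proof (rule that[of "2 * I + 1"])
    show "2 * I + 1 > 0" using I0 by simp
    fix n :: nat and z x :: real
    assume n: "n \<ge> 1" and a: "\<bar>aa n\<bar> \<le> 1" and z: "0 \<le> z" "z \<le> 1"
    have KC: "K * exp (- c * \<bar>t\<bar>) \<le> K * C / (1 + t\<^sup>2)" for t
      using mult_left_mono[OF C(2)[of t] less_imp_le[OF K]] by simp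
    have b: "cmod (hh l n z t) \<le> K * C / (1 + t\<^sup>2)" "cmod (hd l n z t) \<le> K * C / (1 + t\<^sup>2)" for t
      using bd[OF n a z, of t] KC[of t] by linarith+
    have ib: "cmod (ift w y) \<le> I" if "continuous_on UNIV w" "\<And>t. cmod (w t) \<le> K * C / (1 + t\<^sup>2)" for w y
    proof -
      have iw: "integrable lborel w" by (rule integrable_bounded_transform[OF that])
      have "cmod (ift w y) \<le> (\<integral>t. cmod (w t) \<partial>lborel)" by (rule norm_ift_le[OF iw])
      also have "\<dots> \<le> I" unfolding I_def using that(2) by (intro integral_mono integrable_norm iw iI) simp
      finally show ?thesis .
    qed
    have 1: "cmod (ift (hh l n z) x) \<le> I" by (rule ib[OF continuous_hd(2) b(1)])
    have "cmod (ift (hd l n z) x) \<le> I" by (rule ib[OF continuous_hd(1) b(2)])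
    then have 2: "\<bar>x\<bar> * cmod (ift (hh l n z) x) \<le> I"
      unfolding ift_derivative[OF hh_deriv[OF l] continuous_hd(1) b] norm_mult by simp
    have "(1 + \<bar>x\<bar>) * \<bar>dens (hh l n z) x\<bar> \<le> (1 + \<bar>x\<bar>) * cmod (ift (hh l n z) x)"
      unfolding dens_def by (intro mult_left_mono abs_Re_le_cmod) simp
    also have "\<dots> \<le> 2 * I + 1" using 1 2 unfolding distrib_right by linarith
    finally show "(1 + \<bar>x\<bar>) * \<bar>dens (hh l n z) x\<bar> \<le> 2 * I + 1" .
  qed
qed

definition gap :: "nat \<Rightarrow> real \<Rightarrow> nat \<Rightarrow> real \<Rightarrow> real" where
  "gap l z n t = cmod (ff n t - hh l n z t) / \<bar>t\<bar> + cmod (ff n t - hh l n z t) / t\<^sup>2 + cmod (fd n t - hd l n z t) / \<bar>t\<bar>"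

lemma gap_local_bound:
  assumes l: "l \<ge> 1"
  obtains \<delta> B A where "\<delta> > 0" "\<delta> \<le> 1" "B > 0" "A > 0"
    "\<And>n t z. \<lbrakk>n \<ge> 1; \<bar>aa n\<bar> \<le> 1; 0 \<le> z; z \<le> 1; t \<noteq> 0; eps n * \<bar>t\<bar> < \<delta>\<rbrakk> \<Longrightarrow>
       gap l z n t \<le> A * \<eta> l z B n / (1 + t\<^sup>2)"
proof -
  obtain \<delta> B K c where d: "\<delta> > 0" "\<delta> \<le> 1" "B > 0" "K > 0" "c > 0" and
    est: "\<And>n t z. \<lbrakk>n \<ge> 1; \<bar>aa n\<bar> \<le> 1; 0 \<le> z; z \<le> 1; eps n * \<bar>t\<bar> < \<delta>\<rbrakk> \<Longrightarrow>
       cmod (ff n t - hh l n z t) \<le> K * \<eta> l z B n * t\<^sup>2 * exp (- c * \<bar>t\<bar>) \<and>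
       cmod (fd n t - hd l n z t) \<le> K * \<eta> l z B n * \<bar>t\<bar> * exp (- c * \<bar>t\<bar>)"
    using local_estimate[OF l] by blast
  obtain K1 :: real where K1: "K1 > 0" "\<And>x. x \<ge> 0 \<Longrightarrow> (1 + x) ^ 1 * exp (- c * x) \<le> K1 * exp (- (c / 2) * x)"
    using polynomial_exp_le_exp[OF d(5), of 1] by blast
  have c2: "c / 2 > 0" using d by simp
  obtain C where C: "C > 0" "\<And>x. exp (- (c / 2) * \<bar>x\<bar>) \<le> C / (1 + x\<^sup>2)"
    using exp_le_inv_square[OF c2] by blast
  show thesis
  proof (rule that[of \<delta> B "2 * K * (K1 * C)"])
    show "2 * K * (K1 * C) > 0" using d K1 C by simp
    fix n :: nat and t z :: real
    assume h: "n \<ge> 1" "\<bar>aa n\<bar> \<le> 1" "0 \<le> z" "z \<le> 1" "t \<noteq> 0" "eps n * \<bar>t\<bar> < \<delta>"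
    define E where "E = exp (- c * \<bar>t\<bar>)"
    define x where "x = \<bar>t\<bar>"
    define L where "L = K * \<eta> l z B n"
    have x: "x > 0" "t\<^sup>2 = x\<^sup>2" using h by (auto simp: x_def)
    have e: "cmod (ff n t - hh l n z t) \<le> L * x\<^sup>2 * E" "cmod (fd n t - hd l n z t) \<le> L * x * E"
      using est[OF h(1-4,6)] unfolding L_def E_def x_def by auto
    have E: "E > 0" by (simp add: E_def)
    have "0 \<le> L * x * E" by (rule order_trans[OF norm_ge_zero e(2)])
    then have L0: "0 \<le> L" using x E by (simp add: zero_le_mult_iff)
    have 1: "cmod (ff n t - hh l n z t) / x \<le> L * x * E"
      using e(1) x by (simp add: divide_le_eq power2_eq_square mult_ac)
    have 2: "cmod (ff n t - hh l n z t) / x\<^sup>2 \<le> L * E"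
      using e(1) x by (simp add: divide_le_eq mult_ac)
    have 3: "cmod (fd n t - hd l n z t) / x \<le> L * E"
      using e(2) x by (simp add: divide_le_eq mult_ac)
    have "gap l z n t \<le> L * x * E + L * E + L * E"
      unfolding gap_def x(2) x_def[symmetric] using 1 2 3 by linarith
    also have "\<dots> \<le> 2 * L * ((1 + x) ^ 1 * E)" using L0 x E by (simp add: algebra_simps)
    also have "\<dots> \<le> 2 * L * (K1 * exp (- (c / 2) * x))"
      using K1(2)[of x] x L0 unfolding E_def x_def by (intro mult_left_mono) auto
    also have "\<dots> \<le> 2 * L * (K1 * (C / (1 + t\<^sup>2)))"
      using C(2)[of t] K1 L0 unfolding x_def by (intro mult_left_mono) auto
    also have "\<dots> = 2 * K * (K1 * C) * \<eta> l z B n / (1 + t\<^sup>2)" by (simp add: L_def)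
    finally show "gap l z n t \<le> 2 * K * (K1 * C) * \<eta> l z B n / (1 + t\<^sup>2)" .
  qed (use d in auto)
qed

lemma gap_global_bound:
  assumes l: "l \<ge> 1" and nl: "\<rho> \<notin> \<nat>" and K0: "K0 > 0"
  obtains B A d \<theta> where "B > 0" "A > 0" "d > 0" "0 < \<theta>" "\<theta> < 1"
    "\<And>n t z. \<lbrakk>n \<ge> 1; \<bar>aa n\<bar> \<le> 1; 0 \<le> z; z \<le> 1; eps n \<le> d; t \<noteq> 0; eps n * \<bar>t\<bar> < K0\<rbrakk> \<Longrightarrow>
       gap l z n t \<le> A * (\<bar>\<eta> l z B n\<bar> + exp (- d / eps n) + real n * \<theta> ^ (n - 1) / (eps n)\<^sup>2) / (1 + t\<^sup>2)"
proof -
  obtain \<delta> B A where d: "\<delta> > 0" "\<delta> \<le> 1" "B > 0" "A > 0" and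
    loc: "\<And>n t z. \<lbrakk>n \<ge> 1; \<bar>aa n\<bar> \<le> 1; 0 \<le> z; z \<le> 1; t \<noteq> 0; eps n * \<bar>t\<bar> < \<delta>\<rbrakk> \<Longrightarrow>
       gap l z n t \<le> A * \<eta> l z B n / (1 + t\<^sup>2)"
    using gap_local_bound[OF l] by blast
  obtain K c where K: "K > 0" and c: "c > 0" and
    bd: "\<And>n t z. \<lbrakk>n \<ge> 1; \<bar>aa n\<bar> \<le> 1; 0 \<le> z; z \<le> 1\<rbrakk> \<Longrightarrow>
       cmod (hh l n z t) \<le> K * exp (- c * \<bar>t\<bar>) \<and> cmod (hd l n z t) \<le> K * exp (- c * \<bar>t\<bar>)"
    by (rule approximant_decay) blast
  have c2: "c / 2 > 0" using c by simp
  obtain C where C: "C > 0" "\<And>x. exp (- (c / 2) * \<bar>x\<bar>) \<le> C / (1 + x\<^sup>2)"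
    using exp_le_inv_square[OF c2] by blast
  obtain \<theta> where \<theta>: "0 < \<theta>" "\<theta> < 1" "\<And>s. \<delta> \<le> \<bar>s\<bar> \<Longrightarrow> \<bar>s\<bar> \<le> K0 \<Longrightarrow> cmod (\<phi> s) \<le> \<theta>"
    using norm_\<phi>_uniformly_less_1[OF nl d(1), of K0] by blast
  define A' where "A' = A + 3 * K * C + (2 + 2 * \<mu>) * (1 + K0\<^sup>2)"
  have parts: "0 \<le> 3 * K * C" "0 \<le> (2 + 2 * \<mu>) * (1 + K0\<^sup>2)" using K C \<mu>_pos by auto
  have A': "A' > 0" "A \<le> A'" "3 * K * C \<le> A'" "(2 + 2 * \<mu>) * (1 + K0\<^sup>2) \<le> A'" using parts d(4) unfolding A'_def by linarith+
  define d' where "d' = min \<delta> (c / 2 * \<delta>)"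
  have d': "d' > 0" "d' \<le> \<delta>" "d' \<le> c / 2 * \<delta>" using d c by (auto simp: d'_def)
  show thesis
  proof (rule that[of B A' d' \<theta>])
    show "B > 0" "A' > 0" "d' > 0" "0 < \<theta>" "\<theta> < 1" using d A' d' \<theta> by auto
    fix n :: nat and t z :: real
    assume h: "n \<ge> 1" "\<bar>aa n\<bar> \<le> 1" "0 \<le> z" "z \<le> 1" and en: "eps n \<le> d'" and t: "t \<noteq> 0" "eps n * \<bar>t\<bar> < K0"
    have e0: "eps n > 0" "eps n \<le> 1" using eps h(1) by auto
    let ?a = "\<bar>\<eta> l z B n\<bar>" and ?b = "exp (- d' / eps n)" and ?c = "real n * \<theta> ^ (n - 1) / (eps n)\<^sup>2"
    have nn: "0 \<le> ?a" "0 \<le> ?b" "0 \<le> ?c" using \<theta> by auto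
    have t1: "1 + t\<^sup>2 > 0" by (rule add_pos_nonneg) auto
    show "gap l z n t \<le> A' * (?a + ?b + ?c) / (1 + t\<^sup>2)"
    proof (cases "eps n * \<bar>t\<bar> < \<delta>")
      case True
      have "gap l z n t \<le> A * \<eta> l z B n / (1 + t\<^sup>2)" by (rule loc[OF h t(1) True])
      also have "\<dots> \<le> A' * (?a + ?b + ?c) / (1 + t\<^sup>2)"
      proof (rule divide_right_mono)
        have "A * \<eta> l z B n \<le> A * ?a" using d by (intro mult_left_mono) auto
        also have "\<dots> \<le> A' * (?a + ?b + ?c)" using A' d nn by (intro mult_mono) auto
        finally show "A * \<eta> l z B n \<le> A' * (?a + ?b + ?c)" .
      qed (use t1 in simp)
      finally show ?thesis .
    next
      case False
      then have te: "\<delta> \<le> eps n * \<bar>t\<bar>" by simp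
      have "eps n * 1 \<le> eps n * \<bar>t\<bar>" using en d'(2) te by linarith
      then have tl: "1 \<le> \<bar>t\<bar>" using e0 by simp
      have at: "\<bar>eps n * t\<bar> = eps n * \<bar>t\<bar>" using e0 by (simp add: abs_mult)
      have \<phi>b: "cmod (\<phi> (eps n * t)) \<le> \<theta>" by (rule \<theta>(3)) (use te t(2) in \<open>simp_all only: at less_imp_le\<close>)
      have f: "cmod (ff n t) \<le> \<theta> ^ (n - 1)" "cmod (fd n t) \<le> 2 * \<mu> * real n * \<theta> ^ (n - 1)"
      proof -
        have "\<theta> ^ n \<le> \<theta> ^ (n - 1)" using \<theta> by (intro power_decreasing) auto
        with ff_bounds[OF h(1) \<phi>b] show "cmod (ff n t) \<le> \<theta> ^ (n - 1)" "cmod (fd n t) \<le> 2 * \<mu> * real n * \<theta> ^ (n - 1)"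
          by linarith+
      qed
      have tt: "1 \<le> t\<^sup>2" using power_mono[OF tl, of 2] by simp
      have red: "w / y \<le> w" if "1 \<le> y" "0 \<le> w" for w y :: real
        using that by (simp add: divide_le_eq mult_le_cancel_left1)
      have tri: "cmod (ff n t - hh l n z t) \<le> cmod (ff n t) + cmod (hh l n z t)" "cmod (fd n t - hd l n z t) \<le> cmod (fd n t) + cmod (hd l n z t)"
        by (rule norm_triangle_ineq4)+
      have "gap l z n t \<le> cmod (ff n t - hh l n z t) + cmod (ff n t - hh l n z t) + cmod (fd n t - hd l n z t)"
        unfolding gap_def by (intro add_mono red tl tt norm_ge_zero)
      also have "\<dots> \<le> 2 * \<theta> ^ (n - 1) + 2 * \<mu> * real n * \<theta> ^ (n - 1) + 3 * (K * exp (- c * \<bar>t\<bar>))"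
        using tri f bd[OF h, of t] by linarith
      also have "\<dots> \<le> (2 + 2 * \<mu>) * (1 + K0\<^sup>2) * ?c / (1 + t\<^sup>2) + 3 * K * C * ?b / (1 + t\<^sup>2)"
      proof (rule add_mono)
        have "t\<^sup>2 * (eps n)\<^sup>2 \<le> K0\<^sup>2"
        proof -
          have "(eps n * \<bar>t\<bar>)\<^sup>2 \<le> K0\<^sup>2" using t(2) e0 by (intro power_mono) auto
          then show ?thesis by (simp add: power_mult_distrib mult.commute)
        qed
        moreover have "(eps n)\<^sup>2 \<le> 1" using e0 by (simp add: power_le_one)
        ultimately have "(1 + t\<^sup>2) * (eps n)\<^sup>2 \<le> 1 + K0\<^sup>2" unfolding distrib_right mult_1 by linarith
        then have r1: "1 \<le> (1 + K0\<^sup>2) / ((1 + t\<^sup>2) * (eps n)\<^sup>2)"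
          using t1 e0 by (simp add: le_divide_eq)
        have n1: "1 * \<theta> ^ (n - 1) \<le> real n * \<theta> ^ (n - 1)" using h(1) \<theta> by (intro mult_right_mono) auto
        have "2 * \<theta> ^ (n - 1) + 2 * \<mu> * real n * \<theta> ^ (n - 1) \<le> (2 + 2 * \<mu>) * (real n * \<theta> ^ (n - 1))"
          using n1 by (simp add: algebra_simps)
        also have "\<dots> = (2 + 2 * \<mu>) * (real n * \<theta> ^ (n - 1)) * 1" by simp
        also have "\<dots> \<le> (2 + 2 * \<mu>) * (real n * \<theta> ^ (n - 1)) * ((1 + K0\<^sup>2) / ((1 + t\<^sup>2) * (eps n)\<^sup>2))"
          by (rule mult_left_mono[OF r1]) (use \<mu>_pos \<theta> in auto)
        also have "\<dots> = (2 + 2 * \<mu>) * (1 + K0\<^sup>2) * ?c / (1 + t\<^sup>2)"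
          by (simp only: times_divide_eq_left times_divide_eq_right divide_divide_eq_left mult_ac)
        finally show "2 * \<theta> ^ (n - 1) + 2 * \<mu> * real n * \<theta> ^ (n - 1) \<le> (2 + 2 * \<mu>) * (1 + K0\<^sup>2) * ?c / (1 + t\<^sup>2)" .
        have "- c * \<bar>t\<bar> \<le> - d' / eps n + - (c / 2) * \<bar>t\<bar>"
        proof -
          have "d' \<le> (c / 2 * \<bar>t\<bar>) * eps n" using order_trans[OF d'(3) mult_left_mono[OF te, of "c / 2"]] c by (simp add: mult_ac)
          then have "d' / eps n \<le> c / 2 * \<bar>t\<bar>" using e0 by (simp add: divide_le_eq)
          then show ?thesis by (simp add: field_simps)
        qed
        then have "exp (- c * \<bar>t\<bar>) \<le> ?b * exp (- (c / 2) * \<bar>t\<bar>)" by (simp only: exp_add[symmetric] exp_le_cancel_iff)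
        also have "\<dots> \<le> ?b * (C / (1 + t\<^sup>2))" by (intro mult_left_mono C(2)) simp
        finally have "3 * K * exp (- c * \<bar>t\<bar>) \<le> 3 * K * (?b * (C / (1 + t\<^sup>2)))" using K by (intro mult_left_mono) auto
        also have "\<dots> = 3 * K * C * ?b / (1 + t\<^sup>2)"
          by (simp only: times_divide_eq_left times_divide_eq_right mult_ac)
        finally show "3 * (K * exp (- c * \<bar>t\<bar>)) \<le> 3 * K * C * ?b / (1 + t\<^sup>2)" by (simp only: mult.assoc)
      qed
      also have "\<dots> = ((2 + 2 * \<mu>) * (1 + K0\<^sup>2) * ?c + 3 * K * C * ?b) / (1 + t\<^sup>2)" by (simp only: add_divide_distrib)
      also have "\<dots> \<le> A' * (?a + ?b + ?c) / (1 + t\<^sup>2)"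
      proof (rule divide_right_mono)
        have "(2 + 2 * \<mu>) * (1 + K0\<^sup>2) * ?c \<le> A' * ?c" "3 * K * C * ?b \<le> A' * ?b" "0 \<le> A' * ?a"
          by (rule mult_right_mono[OF A'(4) nn(3)], rule mult_right_mono[OF A'(3) nn(2)], rule mult_nonneg_nonneg[OF less_imp_le[OF A'(1)] nn(1)])
        then show "(2 + 2 * \<mu>) * (1 + K0\<^sup>2) * ?c + 3 * K * C * ?b \<le> A' * (?a + ?b + ?c)"
          unfolding distrib_left by linarith
      qed (use t1 in simp)
      finally show ?thesis .
    qed
  qed
qed

end

context petersburg_sample
begin

lemma regular_hh:
  assumes "n \<ge> 1" "l \<ge> 1"
  shows "hh l n 0 = hT l n" "hh l n 1 = hTT l n"
    "regular_transform (hh l n 0)" "regular_transform (hh l n 1)"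
proof -
  have e: "EE l n t = (\<Sum>j<l. of_real ((aa n * t\<^sup>2) ^ j / fact j))" for t by (simp add: EE_def)
  show 0: "hh l n 0 = hT l n" by (rule ext) (simp add: hh_def hT_def e)
  show 1: "hh l n 1 = hTT l n" by (rule ext) (simp add: hh_def hTT_def hT_def e vv_def algebra_simps)
  show "regular_transform (hh l n 0)" "regular_transform (hh l n 1)"
    unfolding 0 1 using Gtilde_eq(1) Gtt_eq(1) assms by blast+
qed

definition N :: "nat \<Rightarrow> real measure" where
  "N n = distr M borel (\<lambda>\<omega>. (S n \<omega> - \<mu> * real n) * eps n)"

lemma N_facts: "prob_space (N n)" "sets (N n) = sets borel" "integrable (N n) (\<lambda>u. u)" "char (N n) t = ff n t"
proof -
  show "prob_space (N n)" unfolding N_def by (rule M.prob_space_distr) measurable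
  show "sets (N n) = sets borel" by (simp add: N_def)
  show "integrable (N n) (\<lambda>u. u)" unfolding N_def
    by (subst integrable_distr_eq) (use integrable_S(1)[of n] in simp_all)
  have "char (N n) t = (\<integral>\<omega>. iexp (t * ((S n \<omega> - \<mu> * real n) * eps n)) \<partial>M)"
    unfolding char_def N_def by (rule integral_distr) measurable
  also have "\<dots> = (\<integral>\<omega>. iexp (- (t * (\<mu> * real n * eps n))) * iexp ((eps n * t) * S n \<omega>) \<partial>M)"
    by (intro Bochner_Integration.integral_cong refl) (simp add: exp_add[symmetric] algebra_simps)
  also have "\<dots> = iexp (- (t * (\<mu> * real n * eps n))) * \<phi> (eps n * t) ^ n"
    unfolding char_S[symmetric] by (rule integral_mult_right_zero)
  also have "iexp (- (t * (\<mu> * real n * eps n))) = iexp (- (t * (eps n * \<mu>))) ^ n"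
    unfolding exp_of_nat_mult[symmetric] by (simp add: mult_ac)
  finally show "char (N n) t = ff n t" unfolding ff_def power_mult_distrib by (simp only: mult.commute)
qed

lemma smoothing_bound:
  assumes l: "l \<ge> 1"
  obtains C1 where "C1 > 0"
    "\<And>n z \<Lambda> T x. \<lbrakk>n \<ge> 1; \<bar>aa n\<bar> \<le> 1; z = 0 \<or> z = 1; 0 \<le> \<Lambda>; C1 \<le> T;
       \<And>t. t \<noteq> 0 \<Longrightarrow> \<bar>t\<bar> < T \<Longrightarrow> gap l z n t \<le> \<Lambda> / (1 + t\<^sup>2)\<rbrakk> \<Longrightarrow>
       (1 + \<bar>x\<bar>) * \<bar>measure (N n) {..x} - primitive (dens (hh l n z)) x\<bar> \<le> C1 * (\<Lambda> + 1 / T)"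
proof -
  obtain C0 where C0: "C0 > 0" and esseen:
    "\<And>F H g D Z Z' \<beta> m J T. \<lbrakk>mono F; \<And>x. (H has_real_derivative g x) (at x); \<And>x. (1 + \<bar>x\<bar>) * \<bar>g x\<bar> \<le> m; m > 0;
      D = (\<lambda>x. F x - H x); \<exists>B. \<forall>x. (1 + \<bar>x\<bar>) * \<bar>D x\<bar> \<le> B; integrable lborel D;
      Z = (\<lambda>t. \<integral>y. iexp (t * y) * complex_of_real (D y) \<partial>lborel);
      \<And>t. t \<noteq> 0 \<Longrightarrow> \<bar>t\<bar> < T \<Longrightarrow> (Z has_vector_derivative Z' t) (at t);
      Z' \<in> borel_measurable borel; integrable lborel \<beta>; \<And>t. 0 \<le> \<beta> t; (\<integral>t. \<beta> t \<partial>lborel) \<le> J;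
      \<And>t. t \<noteq> 0 \<Longrightarrow> \<bar>t\<bar> < T \<Longrightarrow> cmod (Z t) + cmod (Z' t) \<le> \<beta> t; C0 \<le> T\<rbrakk>
      \<Longrightarrow> (\<forall>x::real. (1 + \<bar>x\<bar>) * \<bar>D x\<bar> \<le> C0 * (J + m / T))"
    by (rule weighted_esseen) blast
  obtain m where m: "m > 0"
    "\<And>n z x. \<lbrakk>n \<ge> 1; \<bar>aa n\<bar> \<le> 1; 0 \<le> z; z \<le> 1\<rbrakk> \<Longrightarrow> (1 + \<bar>x\<bar>) * \<bar>dens (hh l n z) x\<bar> \<le> m"
    by (rule density_bound[OF l]) blast
  define I where "I = (\<integral>x. 1 / (1 + (x::real)\<^sup>2) \<partial>lborel)"
  have I0: "I \<ge> 0" unfolding I_def by (intro integral_nonneg_AE AE_I2) auto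
  define C1 where "C1 = C0 * (1 + I + m)"
  have C1: "C1 > 0" "C0 \<le> C1" "C0 * I \<le> C1" "C0 * m \<le> C1"
    using C0 I0 m(1) by (auto simp: C1_def distrib_left intro!: add_nonneg_nonneg add_pos_nonneg)
  show thesis
  proof (rule that[OF C1(1)])
    fix n :: nat and z \<Lambda> T x :: real
    assume n: "n \<ge> 1" and a: "\<bar>aa n\<bar> \<le> 1" and z: "z = 0 \<or> z = 1" and \<Lambda>: "0 \<le> \<Lambda>" and T: "C1 \<le> T"
      and g: "\<And>t. t \<noteq> 0 \<Longrightarrow> \<bar>t\<bar> < T \<Longrightarrow> gap l z n t \<le> \<Lambda> / (1 + t\<^sup>2)"
    have z01: "0 \<le> z" "z \<le> 1" using z by auto
    have reg: "regular_transform (hh l n z)" using z regular_hh(3,4)[OF n l] by auto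
    note df = dens_facts[OF reg]
    interpret Nn: prob_space "N n" by (rule N_facts(1))
    have fin: "finite_measure (N n)" by unfold_locales
    have hz: "hh l n z 0 = char (N n) 0"
    proof -
      have "Y n 0 = 0" "vv n 0 = 0" by (simp_all add: Y_def y1_def vv_def \<phi>_series(6) ys_def)
      moreover have "EE l n 0 = 1"
      proof -
        obtain k where "l = Suc k" using l by (cases l) auto
        then show ?thesis by (simp add: EE_def sum.lessThan_Suc_shift del: sum.lessThan_Suc)
      qed
      ultimately show ?thesis by (simp add: hh_def N_facts(4) ff_def \<phi>_series(6))
    qed
    define D where "D = (\<lambda>x. measure (N n) {..x} - primitive (dens (hh l n z)) x)"
    note tr = cdf_minus_primitive_transform[OF fin N_facts(2,3) df(3) df(2) df(4) hz, folded D_def]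
    define Z where "Z = (\<lambda>t. \<integral>y. iexp (t * y) * complex_of_real (D y) \<partial>lborel)"
    define w where "w t = ff n t - hh l n z t" for t
    define wd where "wd t = fd n t - hd l n z t" for t
    define Z' where "Z' t = \<i> * (wd t / of_real t - w t / (of_real t)\<^sup>2)" for t
    have Zt: "Z t = \<i> * (w t / of_real t)" if "t \<noteq> 0" for t
    proof -
      have "Z t = - (char (N n) t - hh l n z t) / (\<i> * t)" unfolding Z_def D_def by (rule tr(2)[OF that])
      also have "\<dots> = \<i> * (w t / of_real t)" unfolding N_facts(4) w_def[symmetric] by (simp add: divide_inverse)
      finally show ?thesis .
    qed
    have wder: "(w has_vector_derivative wd t) (at t)" for t
      unfolding w_def[abs_def] wd_def by (rule has_vector_derivative_diff[OF ff_deriv(1) hh_deriv[OF l]])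
    have Zder: "(Z has_vector_derivative Z' t) (at t)" if t: "t \<noteq> 0" for t
    proof -
      have inv: "((\<lambda>t. complex_of_real (1 / t)) has_vector_derivative of_real (- (1 / t\<^sup>2))) (at t)"
      proof -
        have "((\<lambda>t. 1 / t) has_real_derivative (- (1 / t\<^sup>2))) (at t)"
          using t by (auto intro!: derivative_eq_intros simp: power2_eq_square)
        then show ?thesis by (rule has_vector_derivative_of_real)
      qed
      have "((\<lambda>t. \<i> * (w t * of_real (1 / t))) has_vector_derivative \<i> * (w t * of_real (- (1 / t\<^sup>2)) + wd t * of_real (1 / t))) (at t)"
        by (rule has_vector_derivative_mult_right[OF has_vector_derivative_mult[OF wder inv]])
      moreover have "\<i> * (w t * of_real (- (1 / t\<^sup>2)) + wd t * of_real (1 / t)) = Z' t"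
        unfolding Z'_def using t by (simp add: field_simps)
      ultimately have "((\<lambda>t. \<i> * (w t * of_real (1 / t))) has_vector_derivative Z' t) (at t)" by simp
      then show ?thesis
      proof (rule has_vector_derivative_transform_within_open[where S = "- {0}"])
        fix s :: real assume "s \<in> - {0}"
        then show "\<i> * (w s * of_real (1 / s)) = Z s" by (subst Zt) auto
      qed (use t in auto)
    qed
    have mZ': "Z' \<in> borel_measurable borel"
    proof -
      have [measurable]: "ff n \<in> borel_measurable borel" "fd n \<in> borel_measurable borel"
          "hh l n z \<in> borel_measurable borel" "hd l n z \<in> borel_measurable borel"
        by (intro borel_measurable_continuous_onI ff_deriv continuous_hd)+
      show ?thesis unfolding Z'_def[abs_def] w_def wd_def by measurable
    qed
    have bd: "cmod (Z t) + cmod (Z' t) \<le> \<Lambda> * (1 / (1 + t\<^sup>2))" if t: "t \<noteq> 0" "\<bar>t\<bar> < T" for t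
    proof -
      have 1: "cmod (Z t) = cmod (w t) / \<bar>t\<bar>" unfolding Zt[OF t(1)] norm_mult norm_divide by simp
      have "cmod (Z' t) = cmod (wd t / of_real t - w t / (of_real t)\<^sup>2)" unfolding Z'_def norm_mult by simp
      also have "\<dots> \<le> cmod (wd t / of_real t) + cmod (w t / (of_real t)\<^sup>2)" by (rule norm_triangle_ineq4)
      also have "\<dots> = cmod (wd t) / \<bar>t\<bar> + cmod (w t) / t\<^sup>2" unfolding norm_divide norm_power by simp
      finally have "cmod (Z t) + cmod (Z' t) \<le> gap l z n t"
        unfolding 1 gap_def w_def wd_def by linarith
      also have "\<dots> \<le> \<Lambda> / (1 + t\<^sup>2)" by (rule g[OF t])
      finally show ?thesis by simp
    qed
    have mono: "mono (\<lambda>x. measure (N n) {..x})"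
      by (intro monoI Nn.finite_measure_mono) (auto simp: N_facts(2))
    have i\<beta>: "integrable lborel (\<lambda>t::real. \<Lambda> * (1 / (1 + t\<^sup>2)))"
      by (rule integrable_mult_right[OF integrable_inverse_one_plus_square])
    have J: "(\<integral>t. \<Lambda> * (1 / (1 + (t::real)\<^sup>2)) \<partial>lborel) \<le> \<Lambda> * I"
      unfolding I_def by (subst integral_mult_right_zero) simp
    have D_bounded: "\<exists>B. \<forall>x. (1 + \<bar>x\<bar>) * \<bar>D x\<bar> \<le> B" unfolding D_def by (rule tr(3))
    have ZderT: "(Z has_vector_derivative Z' t) (at t)" if "t \<noteq> 0" "\<bar>t\<bar> < T" for t by (rule Zder[OF that(1)])
    have \<beta>0: "0 \<le> \<Lambda> * (1 / (1 + t\<^sup>2))" for t :: real using \<Lambda> by simp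
    have "\<forall>x. (1 + \<bar>x\<bar>) * \<bar>D x\<bar> \<le> C0 * (\<Lambda> * I + m / T)"
      by (rule esseen[OF mono primitive_has_derivative[OF df(3,1)] m(2)[OF n a z01] m(1) D_def D_bounded tr(1) Z_def ZderT mZ' i\<beta> \<beta>0 J bd order_trans[OF C1(2) T]])
    then have "(1 + \<bar>x\<bar>) * \<bar>D x\<bar> \<le> C0 * (\<Lambda> * I + m / T)" by blast
    also have "\<dots> = (C0 * I) * \<Lambda> + (C0 * m) * (1 / T)" by (simp add: algebra_simps)
    also have "\<dots> \<le> C1 * \<Lambda> + C1 * (1 / T)" using C1 \<Lambda> T by (intro add_mono mult_right_mono) auto
    also have "\<dots> = C1 * (\<Lambda> + 1 / T)" by (simp only: distrib_left)
    finally show "(1 + \<bar>x\<bar>) * \<bar>measure (N n) {..x} - primitive (dens (hh l n z)) x\<bar> \<le> C1 * (\<Lambda> + 1 / T)"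
      by (simp only: D_def)
  qed
qed

end

lemma power_times_geometric_tendsto_zero:
  fixes \<theta> :: real
  assumes "0 < \<theta>" "\<theta> < 1"
  shows "(\<lambda>n. real n ^ k * \<theta> ^ (n - 1)) \<longlonglongrightarrow> 0"
proof -
  define d where "d = - ln \<theta>"
  have d: "d > 0" using assms by (simp add: d_def)
  have th: "\<theta> ^ (n - 1) = exp d * exp (- d * real n)" if "n \<ge> 1" for n
  proof -
    have "\<theta> ^ (n - 1) = exp (real (n - 1) * ln \<theta>)" using assms by (simp add: exp_of_nat_mult)
    also have "real (n - 1) * ln \<theta> = d + - d * real n" using that by (simp add: d_def of_nat_diff algebra_simps)
    finally show ?thesis by (simp only: exp_add)
  qed
  have "((\<lambda>x::real. x ^ k * (exp d * exp (- d * x))) \<longlongrightarrow> 0) at_top" using d by real_asymp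
  from filterlim_compose[OF this filterlim_real_sequentially]
  have "(\<lambda>n. real n ^ k * (exp d * exp (- d * real n))) \<longlonglongrightarrow> 0" .
  then show ?thesis
  proof (rule Lim_transform_eventually)
    show "\<forall>\<^sub>F n in sequentially. real n ^ k * (exp d * exp (- d * real n)) = real n ^ k * \<theta> ^ (n - 1)"
      using eventually_ge_at_top[of 1] by eventually_elim (simp only: th)
  qed
qed

context petersburg
begin

lemma eps_eq: "eps n = real n powr (- 1 / \<alpha>)"
  by (simp add: eps_def powr_minus_divide)

lemma aa_eq: "n \<ge> 1 \<Longrightarrow> aa n = A2 * real n powr (1 - 2 / \<alpha>)"
  by (simp add: aa_def eps_eq power2_eq_square powr_add[symmetric] powr_diff powr_mult_base powr_minus_divide)

lemma n_eps_\<kappa>: "n \<ge> 1 \<Longrightarrow> real n * eps n powr \<kappa> = real n powr (1 + 1 / \<alpha> - \<kappa> / \<alpha>) * eps n"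
  by (simp add: eps_eq powr_powr powr_mult_base powr_add[symmetric])

lemma exponent_negative: "1 + 1 / \<alpha> - \<kappa> / \<alpha> < 0" "1 - 2 / \<alpha> < 0"
proof -
  have "1 + 1 / \<alpha> - \<kappa> / \<alpha> = (1 + \<alpha> - \<kappa>) / \<alpha>" "1 - 2 / \<alpha> = (\<alpha> - 2) / \<alpha>" using \<alpha> by (simp_all add: field_simps)
  then show "1 + 1 / \<alpha> - \<kappa> / \<alpha> < 0" "1 - 2 / \<alpha> < 0" using \<kappa> \<alpha> by (simp_all add: divide_less_0_iff)
qed

lemma powr_tendsto_zero: "e < 0 \<Longrightarrow> (\<lambda>n. real n powr e) \<longlonglongrightarrow> 0"
  by (rule tendsto_neg_powr[OF _ filterlim_real_sequentially])

lemma eps_tendsto: "eps \<longlonglongrightarrow> 0"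
  unfolding eps_eq[abs_def] by (rule powr_tendsto_zero) (use \<alpha> in simp)

lemma aa_tendsto: "aa \<longlonglongrightarrow> 0"
proof (rule Lim_transform_eventually)
  show "(\<lambda>n. A2 * real n powr (1 - 2 / \<alpha>)) \<longlonglongrightarrow> 0"
    by (rule tendsto_mult_right_zero[OF powr_tendsto_zero[OF exponent_negative(2)]])
  show "\<forall>\<^sub>F n in sequentially. A2 * real n powr (1 - 2 / \<alpha>) = aa n"
    using eventually_ge_at_top[of 1] by eventually_elim (simp only: aa_eq)
qed

lemma eventually_aa_le_1: "\<forall>\<^sub>F n in sequentially. \<bar>aa n\<bar> \<le> 1"
proof -
  have "\<forall>\<^sub>F n in sequentially. dist (aa n) 0 < 1" by (rule tendstoD[OF aa_tendsto]) simp
  then show ?thesis by eventually_elim simp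
qed

lemma eventually_eps_le: "d > 0 \<Longrightarrow> \<forall>\<^sub>F n in sequentially. eps n \<le> d"
  using order_tendstoD(2)[OF eps_tendsto, of d] by (auto elim: eventually_mono)

lemma abs_aa_power:
  assumes n: "n \<ge> 1"
  shows "\<bar>aa n\<bar> ^ l = \<bar>A2\<bar> ^ l * real n powr (real l * (1 - 2 / \<alpha>))"
  using n by (simp add: aa_eq abs_mult power_mult_distrib powr_realpow[symmetric] powr_powr mult.commute)

lemma \<eta>_0_le:
  assumes n: "n \<ge> 1" and l: "1 \<le> real l * (2 - \<alpha>)" and B: "B > 0"
  shows "\<bar>\<eta> l 0 B n\<bar> \<le> (\<bar>A2\<bar> ^ l + (2 * B)\<^sup>2 + 2 * B) * eps n"
proof -
  have e0: "eps n > 0" "eps n \<le> 1" using eps n by auto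
  have n1: "1 \<le> real n" using n by simp
  have "real n powr (1 + 1 / \<alpha> - \<kappa> / \<alpha>) \<le> real n powr 0"
    using n1 exponent_negative(1) by (intro powr_mono) auto
  then have "real n powr (1 + 1 / \<alpha> - \<kappa> / \<alpha>) \<le> 1" using n1 by simp
  then have u: "real n * eps n powr \<kappa> \<le> eps n" unfolding n_eps_\<kappa>[OF n] using e0 by simp
  define b1 where "b1 = B * eps n + B * (real n * eps n powr \<kappa>)"
  have b1: "0 \<le> b1" "b1 \<le> 2 * B * eps n"
    using B e0 mult_left_mono[OF u, of B] by (auto simp: b1_def)
  have "b1\<^sup>2 \<le> (2 * B * eps n)\<^sup>2" using b1 by (intro power_mono) auto
  also have "\<dots> = (2 * B)\<^sup>2 * (eps n * eps n)" by (simp only: power_mult_distrib power2_eq_square mult_ac)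
  also have "\<dots> \<le> (2 * B)\<^sup>2 * (eps n * 1)" using e0 by (intro mult_left_mono) auto
  finally have 1: "b1\<^sup>2 \<le> (2 * B)\<^sup>2 * eps n" by simp
  have "real l * (1 - 2 / \<alpha>) = - (real l * (2 - \<alpha>)) / \<alpha>" using \<alpha> by (simp add: field_simps)
  also have "\<dots> \<le> - 1 / \<alpha>" using l \<alpha> by (intro divide_right_mono) auto
  finally have "real l * (1 - 2 / \<alpha>) \<le> - 1 / \<alpha>" .
  then have "real n powr (real l * (1 - 2 / \<alpha>)) \<le> eps n" unfolding eps_eq using n1 by (intro powr_mono) auto
  then have 2: "\<bar>aa n\<bar> ^ l \<le> \<bar>A2\<bar> ^ l * eps n" unfolding abs_aa_power[OF n] by (intro mult_left_mono) auto
  have e: "\<eta> l 0 B n = \<bar>aa n\<bar> ^ l + b1\<^sup>2 + b1" by (simp add: \<eta>_def b1_def Let_def)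
  have "0 \<le> \<eta> l 0 B n" unfolding e using b1 by (intro add_nonneg_nonneg) auto
  moreover have "\<eta> l 0 B n \<le> (\<bar>A2\<bar> ^ l + (2 * B)\<^sup>2 + 2 * B) * eps n"
    unfolding e distrib_right using 1 2 b1 by linarith
  ultimately show ?thesis by simp
qed

lemma \<eta>_1_tendsto:
  assumes l: "1 < real l * (2 - \<alpha>)"
  shows "(\<lambda>n. \<eta> l 1 B n / eps n) \<longlonglongrightarrow> 0"
proof (rule Lim_transform_eventually)
  let ?u = "\<lambda>n. real n powr (1 + 1 / \<alpha> - \<kappa> / \<alpha>)"
  let ?v = "\<lambda>n. real n powr (real l * (1 - 2 / \<alpha>) + 1 / \<alpha>)"
  have "real l * (1 - 2 / \<alpha>) + 1 / \<alpha> = (1 - real l * (2 - \<alpha>)) / \<alpha>" using \<alpha> by (simp add: field_simps)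
  also have "\<dots> < 0" using l \<alpha> by (simp add: divide_less_0_iff)
  finally have v: "?v \<longlonglongrightarrow> 0" by (rule powr_tendsto_zero)
  have u: "?u \<longlonglongrightarrow> 0" by (rule powr_tendsto_zero[OF exponent_negative(1)])
  have a: "(\<lambda>n. \<bar>aa n\<bar>) \<longlonglongrightarrow> 0" by (rule tendsto_rabs_zero[OF aa_tendsto])
  have "(\<lambda>n. \<bar>A2\<bar> ^ l * ?v n + (B * (1 + ?u n))\<^sup>2 * eps n + B * ?u n + \<bar>aa n\<bar> * B) \<longlonglongrightarrow>
      \<bar>A2\<bar> ^ l * 0 + (B * (1 + 0))\<^sup>2 * 0 + B * 0 + 0 * B"
    by (intro tendsto_add tendsto_mult tendsto_power tendsto_const v u a eps_tendsto)
  then show "(\<lambda>n. \<bar>A2\<bar> ^ l * ?v n + (B * (1 + ?u n))\<^sup>2 * eps n + B * ?u n + \<bar>aa n\<bar> * B) \<longlonglongrightarrow> 0"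
    by (simp only: mult_zero_left mult_zero_right add_0)
  show "\<forall>\<^sub>F n in sequentially. \<bar>A2\<bar> ^ l * ?v n + (B * (1 + ?u n))\<^sup>2 * eps n + B * ?u n + \<bar>aa n\<bar> * B = \<eta> l 1 B n / eps n"
    using eventually_ge_at_top[of 1]
  proof eventually_elim
    case (elim n)
    have e0: "eps n > 0" using eps elim by simp
    have "?v n = real n powr (real l * (1 - 2 / \<alpha>)) / eps n"
      using elim by (simp add: eps_eq powr_add powr_minus_divide)
    then have A: "\<bar>A2\<bar> ^ l * ?v n = \<bar>aa n\<bar> ^ l / eps n" unfolding abs_aa_power[OF elim] by simp
    have "B * eps n + B * (?u n * eps n) = (B * (1 + ?u n)) * eps n" by (simp only: distrib_left distrib_right mult_1_right mult.assoc)
    then have "(B * eps n + B * (?u n * eps n))\<^sup>2 / eps n = (B * (1 + ?u n))\<^sup>2 * eps n"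
      using e0 by (simp only: power_mult_distrib) (simp add: power2_eq_square)
    moreover have "B * (?u n * eps n) / eps n = B * ?u n" "\<bar>aa n\<bar> * (B * eps n) / eps n = \<bar>aa n\<bar> * B" using e0 by simp_all
    moreover have "\<eta> l 1 B n = \<bar>aa n\<bar> ^ l + (B * eps n + B * (?u n * eps n))\<^sup>2 + B * (?u n * eps n) + \<bar>aa n\<bar> * (B * eps n)"
      unfolding \<eta>_def Let_def n_eps_\<kappa>[OF elim] diff_self mult_zero_left add_0 mult_1 ..
    ultimately show ?case unfolding A by (simp only: add_divide_distrib)
  qed
qed

lemma exp_eps_tendsto:
  assumes d: "d > 0"
  shows "(\<lambda>n. exp (- d / eps n) / eps n) \<longlonglongrightarrow> 0"
proof -
  have 1: "((\<lambda>x::real. exp (- d * x) * x) \<longlongrightarrow> 0) at_top" using d by real_asymp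
  have "filterlim (\<lambda>x::real. x powr (1 / \<alpha>)) at_top at_top"
  proof -
    define e where "e = 1 / \<alpha>"
    have "e > 0" using \<alpha> by (simp add: e_def)
    then have "filterlim (\<lambda>x::real. x powr e) at_top at_top" by real_asymp
    then show ?thesis by (simp only: e_def)
  qed
  from filterlim_compose[OF 1 filterlim_compose[OF this filterlim_real_sequentially]]
  show ?thesis by (simp add: eps_def)
qed

lemma geometric_eps_tendsto:
  assumes \<theta>: "0 < \<theta>" "\<theta> < 1"
  shows "(\<lambda>n. real n * \<theta> ^ (n - 1) / (eps n)\<^sup>2 / eps n) \<longlonglongrightarrow> 0"
proof (rule tendsto_sandwich[OF _ _ tendsto_const power_times_geometric_tendsto_zero[OF \<theta>, of 4]])
  show "\<forall>\<^sub>F n in sequentially. 0 \<le> real n * \<theta> ^ (n - 1) / (eps n)\<^sup>2 / eps n"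
    using eventually_ge_at_top[of 1]
  proof eventually_elim
    case (elim n)
    then show ?case using eps(1)[of n] \<theta> by simp
  qed
  show "\<forall>\<^sub>F n in sequentially. real n * \<theta> ^ (n - 1) / (eps n)\<^sup>2 / eps n \<le> real n ^ 4 * \<theta> ^ (n - 1)"
    using eventually_ge_at_top[of 1]
  proof eventually_elim
    case (elim n)
    have n1: "1 \<le> real n" using elim by simp
    have "real n powr (1 / \<alpha>) \<le> real n powr 1" using n1 \<alpha> by (intro powr_mono) auto
    then have "real n powr (1 / \<alpha>) \<le> real n" using n1 by simp
    then have 3: "(real n powr (1 / \<alpha>)) ^ 3 \<le> real n ^ 3" by (rule power_mono) simp
    have "real n * \<theta> ^ (n - 1) / (eps n)\<^sup>2 / eps n = real n * \<theta> ^ (n - 1) * (real n powr (1 / \<alpha>)) ^ 3"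
      by (simp add: eps_def power2_eq_square power3_eq_cube)
    also have "\<dots> \<le> real n * \<theta> ^ (n - 1) * real n ^ 3" using \<theta> by (intro mult_left_mono 3) auto
    also have "\<dots> = real n ^ 4 * \<theta> ^ (n - 1)" by (simp add: eval_nat_numeral mult_ac)
    finally show ?case .
  qed
qed

end

context petersburg_sample
begin

lemma expansion_O:
  assumes l: "l \<ge> 1" "1 \<le> real l * (2 - \<alpha>)"
  shows "\<exists>C. \<forall>\<^sub>F n in sequentially. \<forall>x. (1 + \<bar>x\<bar>) * \<bar>measure (N n) {..x} - Gtilde \<alpha> p l n x\<bar> \<le> C * eps n"
proof -
  obtain C1 where C1: "C1 > 0" and sm:
    "\<And>n z \<Lambda> T x. \<lbrakk>n \<ge> 1; \<bar>aa n\<bar> \<le> 1; z = 0 \<or> z = 1; 0 \<le> \<Lambda>; C1 \<le> T;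
       \<And>t. t \<noteq> 0 \<Longrightarrow> \<bar>t\<bar> < T \<Longrightarrow> gap l z n t \<le> \<Lambda> / (1 + t\<^sup>2)\<rbrakk> \<Longrightarrow>
       (1 + \<bar>x\<bar>) * \<bar>measure (N n) {..x} - primitive (dens (hh l n z)) x\<bar> \<le> C1 * (\<Lambda> + 1 / T)"
    using smoothing_bound[OF l(1)] by blast
  obtain \<delta> B A where d: "\<delta> > 0" "\<delta> \<le> 1" "B > 0" "A > 0" and
    loc: "\<And>n t z. \<lbrakk>n \<ge> 1; \<bar>aa n\<bar> \<le> 1; 0 \<le> z; z \<le> 1; t \<noteq> 0; eps n * \<bar>t\<bar> < \<delta>\<rbrakk> \<Longrightarrow>
       gap l z n t \<le> A * \<eta> l z B n / (1 + t\<^sup>2)"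
    using gap_local_bound[OF l(1)] by blast
  define C where "C = \<bar>A2\<bar> ^ l + (2 * B)\<^sup>2 + 2 * B"
  have dC: "\<delta> / C1 > 0" using d C1 by simp
  have "\<forall>\<^sub>F n in sequentially. \<forall>x. (1 + \<bar>x\<bar>) * \<bar>measure (N n) {..x} - Gtilde \<alpha> p l n x\<bar> \<le> C1 * (A * C + 1 / \<delta>) * eps n"
    using eventually_ge_at_top[of 1] eventually_aa_le_1 eventually_eps_le[OF dC]
  proof eventually_elim
    case (elim n)
    have e0: "eps n > 0" using eps elim(1) by simp
    have T: "C1 \<le> \<delta> / eps n" using elim(3) e0 C1 by (simp add: field_simps)
    have \<eta>: "\<bar>\<eta> l 0 B n\<bar> \<le> C * eps n" unfolding C_def by (rule \<eta>_0_le[OF elim(1) l(2) d(3)])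
    have \<Lambda>: "0 \<le> A * \<bar>\<eta> l 0 B n\<bar>" using d by simp
    have gp: "gap l 0 n t \<le> A * \<bar>\<eta> l 0 B n\<bar> / (1 + t\<^sup>2)" if t: "t \<noteq> 0" "\<bar>t\<bar> < \<delta> / eps n" for t
    proof -
      have "eps n * \<bar>t\<bar> < \<delta>" using t(2) e0 by (simp add: field_simps)
      then have "gap l 0 n t \<le> A * \<eta> l 0 B n / (1 + t\<^sup>2)" using loc[OF elim(1,2) order_refl zero_le_one t(1)] by blast
      also have "\<dots> \<le> A * \<bar>\<eta> l 0 B n\<bar> / (1 + t\<^sup>2)"
        using d by (intro divide_right_mono mult_left_mono) auto
      finally show ?thesis .
    qed
    have G: "Gtilde \<alpha> p l n = primitive (dens (hh l n 0))"
      using Gtilde_eq(2)[OF elim(1) l(1)] unfolding regular_hh(1)[OF elim(1) l(1)] .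
    show ?case
    proof
      fix x
      have "(1 + \<bar>x\<bar>) * \<bar>measure (N n) {..x} - Gtilde \<alpha> p l n x\<bar> \<le> C1 * (A * \<bar>\<eta> l 0 B n\<bar> + 1 / (\<delta> / eps n))"
        unfolding G by (rule sm[OF elim(1,2) _ \<Lambda> T gp]) auto
      also have "\<dots> \<le> C1 * (A * (C * eps n) + 1 / (\<delta> / eps n))"
        using \<eta> d C1 by (intro mult_left_mono add_right_mono) auto
      also have "\<dots> = C1 * (A * C + 1 / \<delta>) * eps n" by (simp add: algebra_simps)
      finally show "(1 + \<bar>x\<bar>) * \<bar>measure (N n) {..x} - Gtilde \<alpha> p l n x\<bar> \<le> C1 * (A * C + 1 / \<delta>) * eps n" .
    qed
  qed
  then show ?thesis ..
qed

lemma expansion_o: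
  assumes l: "l \<ge> 1" "1 < real l * (2 - \<alpha>)" and nl: "\<rho> \<notin> \<nat>" and \<epsilon>: "\<epsilon> > 0"
  shows "\<forall>\<^sub>F n in sequentially. \<forall>x. (1 + \<bar>x\<bar>) * \<bar>measure (N n) {..x} - Gtt \<alpha> p l n x\<bar> \<le> \<epsilon> * eps n"
proof -
  obtain C1 where C1: "C1 > 0" and sm:
    "\<And>n z \<Lambda> T x. \<lbrakk>n \<ge> 1; \<bar>aa n\<bar> \<le> 1; z = 0 \<or> z = 1; 0 \<le> \<Lambda>; C1 \<le> T;
       \<And>t. t \<noteq> 0 \<Longrightarrow> \<bar>t\<bar> < T \<Longrightarrow> gap l z n t \<le> \<Lambda> / (1 + t\<^sup>2)\<rbrakk> \<Longrightarrow>
       (1 + \<bar>x\<bar>) * \<bar>measure (N n) {..x} - primitive (dens (hh l n z)) x\<bar> \<le> C1 * (\<Lambda> + 1 / T)"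
    using smoothing_bound[OF l(1)] by blast
  define K0 where "K0 = 2 * C1 / \<epsilon>"
  have K0: "K0 > 0" using C1 \<epsilon> by (simp add: K0_def)
  obtain B A d \<theta> where b: "B > 0" "A > 0" "d > 0" and \<theta>: "0 < \<theta>" "\<theta> < 1" and
    glob: "\<And>n t z. \<lbrakk>n \<ge> 1; \<bar>aa n\<bar> \<le> 1; 0 \<le> z; z \<le> 1; eps n \<le> d; t \<noteq> 0; eps n * \<bar>t\<bar> < K0\<rbrakk> \<Longrightarrow>
       gap l z n t \<le> A * (\<bar>\<eta> l z B n\<bar> + exp (- d / eps n) + real n * \<theta> ^ (n - 1) / (eps n)\<^sup>2) / (1 + t\<^sup>2)"
    using gap_global_bound[OF l(1) nl K0] by blast
  define \<Lambda> where "\<Lambda> n = A * (\<bar>\<eta> l 1 B n\<bar> + exp (- d / eps n) + real n * \<theta> ^ (n - 1) / (eps n)\<^sup>2)" for n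
  have "(\<lambda>n. A * (\<bar>\<eta> l 1 B n / eps n\<bar> + exp (- d / eps n) / eps n + real n * \<theta> ^ (n - 1) / (eps n)\<^sup>2 / eps n)) \<longlonglongrightarrow> A * (0 + 0 + 0)"
    by (intro tendsto_mult tendsto_const tendsto_add tendsto_rabs_zero \<eta>_1_tendsto[OF l(2)] exp_eps_tendsto[OF b(3)] geometric_eps_tendsto[OF \<theta>])
  then have "(\<lambda>n. A * (\<bar>\<eta> l 1 B n / eps n\<bar> + exp (- d / eps n) / eps n + real n * \<theta> ^ (n - 1) / (eps n)\<^sup>2 / eps n)) \<longlonglongrightarrow> 0"
    by simp
  moreover have "0 < \<epsilon> / (2 * C1)" using \<epsilon> C1 by simp
  ultimately have small: "\<forall>\<^sub>F n in sequentially. A * (\<bar>\<eta> l 1 B n / eps n\<bar> + exp (- d / eps n) / eps n + real n * \<theta> ^ (n - 1) / (eps n)\<^sup>2 / eps n) < \<epsilon> / (2 * C1)"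
    by (rule order_tendstoD(2))
  have dC: "K0 / C1 > 0" using K0 C1 by simp
  show ?thesis
    using eventually_ge_at_top[of 1] eventually_aa_le_1 eventually_eps_le[OF dC] eventually_eps_le[OF b(3)] small
  proof eventually_elim
    case (elim n)
    have e0: "eps n > 0" using eps elim(1) by simp
    have T: "C1 \<le> K0 / eps n" using elim(3) e0 C1 by (simp add: field_simps)
    have \<Lambda>0: "0 \<le> \<Lambda> n" unfolding \<Lambda>_def using b \<theta> by (intro mult_nonneg_nonneg add_nonneg_nonneg divide_nonneg_nonneg) auto
    have "\<bar>\<eta> l 1 B n / eps n\<bar> = \<bar>\<eta> l 1 B n\<bar> / eps n" using e0 by (simp only: abs_divide abs_of_pos)
    then have "\<Lambda> n / eps n < \<epsilon> / (2 * C1)"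
      using elim(5) unfolding \<Lambda>_def by (simp only: add_divide_distrib[symmetric] times_divide_eq_right)
    then have \<Lambda>1: "C1 * \<Lambda> n \<le> \<epsilon> / 2 * eps n" using e0 C1 by (simp add: field_simps)
    have gp: "gap l 1 n t \<le> \<Lambda> n / (1 + t\<^sup>2)" if t: "t \<noteq> 0" "\<bar>t\<bar> < K0 / eps n" for t
    proof -
      have "eps n * \<bar>t\<bar> < K0" using t(2) e0 by (simp add: field_simps)
      then show ?thesis unfolding \<Lambda>_def by (rule glob[OF elim(1,2) zero_le_one order_refl elim(4) t(1)])
    qed
    have G: "Gtt \<alpha> p l n = primitive (dens (hh l n 1))"
      using Gtt_eq(2)[OF elim(1) l(1)] unfolding regular_hh(2)[OF elim(1) l(1)] .
    show ?case
    proof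
      fix x
      have "(1 + \<bar>x\<bar>) * \<bar>measure (N n) {..x} - Gtt \<alpha> p l n x\<bar> \<le> C1 * (\<Lambda> n + 1 / (K0 / eps n))"
        unfolding G by (rule sm[OF elim(1,2) _ \<Lambda>0 T gp]) auto
      also have "\<dots> = C1 * \<Lambda> n + \<epsilon> / 2 * eps n" using C1 \<epsilon> by (simp add: K0_def distrib_left)
      also have "\<dots> \<le> \<epsilon> * eps n" using \<Lambda>1 by simp
      finally show "(1 + \<bar>x\<bar>) * \<bar>measure (N n) {..x} - Gtt \<alpha> p l n x\<bar> \<le> \<epsilon> * eps n" .
    qed
  qed
qed

lemma measure_N: "measure (N n) {..x} = measure M {\<omega> \<in> space M. ((\<Sum>i<n. X i \<omega>) - mu \<alpha> p 1 * real n) / real n powr (1 / \<alpha>) \<le> x}"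
proof -
  have "measure (N n) {..x} = measure M ((\<lambda>\<omega>. (S n \<omega> - \<mu> * real n) * eps n) -` {..x} \<inter> space M)"
    unfolding N_def by (rule measure_distr; measurable)
  also have "(\<lambda>\<omega>. (S n \<omega> - \<mu> * real n) * eps n) -` {..x} \<inter> space M =
      {\<omega> \<in> space M. ((\<Sum>i<n. X i \<omega>) - mu \<alpha> p 1 * real n) / real n powr (1 / \<alpha>) \<le> x}"
    by (auto simp: S_def eps_def \<mu>_def)
  finally show ?thesis .
qed

end

theorem theorem2:
  fixes p \<alpha> :: real and l :: nat and M :: "'a measure" and X :: "nat \<Rightarrow> 'a \<Rightarrow> real"
  assumes p: "0 < p" "p < 1"
    and \<alpha>: "1 < \<alpha>" "\<alpha> < 2"
    and M: "prob_space M"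
    and rv: "\<And>i. X i \<in> borel_measurable M"
    and indep: "prob_space.indep_vars M (\<lambda>_. borel) X UNIV"
    and distr: "\<And>i k. k \<ge> 1 \<Longrightarrow>
        measure M {\<omega> \<in> space M. X i \<omega> = rr p powr (real k / \<alpha>)} = qq p ^ (k - 1) * p"
  shows
    "(l \<ge> 2 \<and> 2 - 1 / (real l - 1) < \<alpha> \<and> \<alpha> \<le> 2 - 1 / real l \<longrightarrow>
       (\<exists>C. \<forall>\<^sub>F n in at_top. \<forall>x::real.
          (1 + \<bar>x\<bar>) * \<bar>measure M {\<omega> \<in> space M.
              ((\<Sum>i<n. X i \<omega>) - mu \<alpha> p 1 * real n) / real n powr (1 / \<alpha>) \<le> x}
            - Gtilde \<alpha> p l n x\<bar> \<le> C * real n powr (- 1 / \<alpha>)))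
   \<and>
    ((l = 2 \<and> \<alpha> < 3 / 2 \<or> l \<ge> 3 \<and> 2 - 1 / (real l - 1) \<le> \<alpha> \<and> \<alpha> < 2 - 1 / real l) \<and>
      rr p powr (1 / \<alpha>) \<notin> \<nat> \<longrightarrow>
       (\<forall>\<epsilon>>0. \<forall>\<^sub>F n in at_top. \<forall>x::real.
          (1 + \<bar>x\<bar>) * \<bar>measure M {\<omega> \<in> space M.
              ((\<Sum>i<n. X i \<omega>) - mu \<alpha> p 1 * real n) / real n powr (1 / \<alpha>) \<le> x}
            - Gtt \<alpha> p l n x\<bar> \<le> \<epsilon> * real n powr (- 1 / \<alpha>)))"
proof -
  interpret petersburg_sample p \<alpha> M X
    by (intro petersburg_sample.intro petersburg.intro petersburg_sample_axioms.intro p \<alpha> M rv indep distr)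
  have \<rho>: "\<rho> = rr p powr (1 / \<alpha>)" by (simp add: \<rho>_def qq_rr)
  have le: "1 \<le> real l * (2 - \<alpha>)" if "l \<ge> 2" "\<alpha> \<le> 2 - 1 / real l"
  proof -
    have "1 = real l * (1 / real l)" using that by simp
    also have "\<dots> \<le> real l * (2 - \<alpha>)" using that by (intro mult_left_mono) auto
    finally show ?thesis .
  qed
  have lt: "1 < real l * (2 - \<alpha>)" if "l \<ge> 2" "\<alpha> < 2 - 1 / real l"
  proof -
    have "1 = real l * (1 / real l)" using that by simp
    also have "\<dots> < real l * (2 - \<alpha>)" using that by (intro mult_strict_left_mono) auto
    finally show ?thesis .
  qed
  show ?thesis
    unfolding measure_N[symmetric] eps_eq[symmetric] \<rho>[symmetric]
  proof (intro conjI impI allI)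
    assume "l \<ge> 2 \<and> 2 - 1 / (real l - 1) < \<alpha> \<and> \<alpha> \<le> 2 - 1 / real l"
    then have "l \<ge> 1" "1 \<le> real l * (2 - \<alpha>)" using le by simp_all
    then show "\<exists>C. \<forall>\<^sub>F n in sequentially. \<forall>x. (1 + \<bar>x\<bar>) * \<bar>measure (N n) {..x} - Gtilde \<alpha> p l n x\<bar> \<le> C * eps n"
      by (rule expansion_O)
  next
    fix \<epsilon> :: real
    assume A: "(l = 2 \<and> \<alpha> < 3 / 2 \<or> l \<ge> 3 \<and> 2 - 1 / (real l - 1) \<le> \<alpha> \<and> \<alpha> < 2 - 1 / real l) \<and> \<rho> \<notin> \<nat>"
      and \<epsilon>: "\<epsilon> > 0"
    have l2: "l \<ge> 2" "\<alpha> < 2 - 1 / real l" using A by auto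
    then have "l \<ge> 1" by simp
    moreover have "\<rho> \<notin> \<nat>" using A by blast
    ultimately show "\<forall>\<^sub>F n in sequentially. \<forall>x. (1 + \<bar>x\<bar>) * \<bar>measure (N n) {..x} - Gtt \<alpha> p l n x\<bar> \<le> \<epsilon> * eps n"
      using lt[OF l2] \<epsilon> by (intro expansion_o)
  qed
qed

end
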